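(* Let $d\geq1$, $k\geq1$, $0<\rho_\star<1$, and let $\boldsymbol X_1,\dots,\boldsymbol X_n$ be iid $\mathrm{C}_k(\boldsymbol\mu,\rho)$ with $(\boldsymbol\mu,\rho)\in\Theta^\star_{k,d}$, where $\Theta^\star_{k,1}=\{(\cos\theta,\sin\theta)^\top:\theta\in(0,2\pi/k)\}\times(0,\rho_\star)$; for $d\geq2$ and $k$ odd, $\Theta^\star_{k,d}=\mathbb{S}^d\times(0,\rho_\star)$; for $d\geq2$ and $k$ even, $\Theta^\star_{k,d}=\mathbb{S}^d_+\times(0,\rho_\star)$ with $\mathbb{S}^d_+=\{\boldsymbol\mu\in\mathbb{S}^d:\mu_1>0\}$. Let $\ell_n(\boldsymbol\mu,\rho)=\sum_{i=1}^n\log f_{\mathrm{C}_k}(\boldsymbol X_i;\boldsymbol\mu,\rho)$. Then: (i) the probability that $\ell_n$ has at least one local maximum tends to one as $n\to\infty$; (ii) there is a sequence of local maxima $(\hat{\boldsymbol\mu}_n,\hat\rho_n)$ with $(\hat{\boldsymbol\mu}_n,\hat\rho_n)\to(\boldsymbol\mu,\rho)$ in probability; (iii) $$\sqrt n\begin{pmatrix}\hat{\boldsymbol\mu}_n-\boldsymbol\mu\\ \hat\rho_n-\rho\end{pmatrix}\rightsquigarrow\mathcal N_{d+2}\left(\boldsymbol0,\begin{pmatrix}\sigma^2_{\mathrm{ML}}(\boldsymbol\mu)(\boldsymbol I_{d+1}-\boldsymbol\mu\boldsymbol\mu^\top)&\boldsymbol0\\ \boldsymbol0^\top&\sigma^2_{\mathrm{ML}}(\rho)\end{pmatrix}\right),$$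 where for $d=1$: $\sigma^2_{\mathrm{ML}}(\rho)=\frac{\rho^2\sqrt{1-\rho^2}}{1-\sqrt{1-\rho^2}}$, $\sigma^2_{\mathrm{ML}}(\boldsymbol\mu)=\frac{1}{k^2(1-\sqrt{1-\rho^2})}$; and for $d\geq2$: $$[\sigma^2_{\mathrm{ML}}(\rho)]^{-1}=\frac{\omega_{d-1}}{\omega_dC_k^{(d-1)/2}(1)}\int_{-1}^1\frac{C_k^{(d-1)/2}(t)^2(1-t^2)^{d/2-1}}{C_k^{(d-1)/2}(1)+\rho\,C_k^{(d-1)/2}(t)}\,\mathrm dt,$$ $$[\sigma^2_{\mathrm{ML}}(\boldsymbol\mu)]^{-1}=\rho^2\frac{\omega_{d-1}}{\omega_dC_k^{(d-1)/2}(1)}\frac{(d-1)^2}{d}\int_{-1}^1\frac{C_{k-1}^{(d+1)/2}(t)^2(1-t^2)^{d/2}}{C_k^{(d-1)/2}(1)+\rho\,C_k^{(d-1)/2}(t)}\,\mathrm dt.$$ When $d=2$ and $k=1$: $\sigma^2_{\mathrm{ML}}(\rho)=\frac{\rho^3}{\tanh^{-1}(\rho)-\rho}$ and $\sigma^2_{\mathrm{ML}}(\boldsymbol\mu)=\frac{2\rho}{\rho-(1-\rho^2)\tanh^{-1}(\rho)}$.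
   Context: For $d\geq1$, $\mathbb{S}^d$ is the unit sphere of $\mathbb{R}^{d+1}$ with surface area measure $\sigma_d$ and total area $\omega_d=2\pi^{(d+1)/2}/\Gamma((d+1)/2)$ (with $\omega_0=2$). For $\lambda>0$, $C_k^{\lambda}$ is the standard Gegenbauer polynomial of degree $k$ and index $\lambda$ (generating function $(1-2xt+t^2)^{-\lambda}$); for $d=1$, $C_k^0:=T_k$, $T_k(x)=\cos(k\cos^{-1}x)$. $\tilde C_k^{(d-1)/2}=C_k^{(d-1)/2}/C_k^{(d-1)/2}(1)$. $\mathrm{C}_k(\boldsymbol\mu,\rho)$ is the distribution on $\mathbb{S}^d$ with density $f_{\mathrm{C}_k}(\boldsymbol x;\boldsymbol\mu,\rho)=\omega_d^{-1}\{1+\rho\,\tilde C_k^{(d-1)/2}(\boldsymbol x^\top\boldsymbol\mu)\}$ w.r.t. $\sigma_d$. *)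

theory Defs
  imports "HOL-Probability.Probability"
begin

text \<open>Total surface area of the unit sphere S^d in R^(d+1).\<close>
definition omega :: "nat \<Rightarrow> real" where
  "omega d = 2 * pi powr ((real d + 1) / 2) / Gamma ((real d + 1) / 2)"

text \<open>Gegenbauer polynomial C_n^lam (lam > 0), explicit expansion of the
  generating function (1 - 2xt + t^2)^(-lam).\<close>
definition gegen :: "real \<Rightarrow> nat \<Rightarrow> real \<Rightarrow> real" where
  "gegen lam n x = (\<Sum>j\<le>n div 2. (-1) ^ j * pochhammer lam (n - j)
       / (fact j * fact (n - 2 * j)) * (2 * x) ^ (n - 2 * j))"

text \<open>Normalised Gegenbauer polynomial tilde C_k^((d-1)/2); for d = 1 the Chebyshev
  polynomial T_k (which satisfies T_k(1) = 1).\<close>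
definition gegen_tilde :: "nat \<Rightarrow> nat \<Rightarrow> real \<Rightarrow> real" where
  "gegen_tilde d k t = (if d = 1 then cos (real k * arccos t)
     else gegen ((real d - 1) / 2) k t / gegen ((real d - 1) / 2) k 1)"

definition fC :: "nat \<Rightarrow> nat \<Rightarrow> 'a::real_inner \<Rightarrow> real \<Rightarrow> 'a \<Rightarrow> real" where
  "fC d k mu rho x = (1 + rho * gegen_tilde d k (x \<bullet> mu)) / omega d"

text \<open>Surface area measure on the unit sphere of a Euclidean space (as a measure
  on the Borel sets of the whole space): sigma(A) = DIM * vol{t x : x in A, 0 < t <= 1}.\<close>
definition sphere_surface :: "'a::euclidean_space measure" where
  "sphere_surface = scale_measure (ennreal (real DIM('a)))
     (distr (restrict_space lborel (cball 0 1 - {0})) borel (\<lambda>x. x /\<^sub>R norm x))"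

definition Ck_distr :: "nat \<Rightarrow> nat \<Rightarrow> 'a::euclidean_space \<Rightarrow> real \<Rightarrow> 'a measure" where
  "Ck_distr d k mu rho = density sphere_surface (\<lambda>x. ennreal (fC d k mu rho x))"

definition idx1 :: "'n::{finite,wellorder}" where "idx1 = (LEAST i. True)"
definition idx2 :: "'n::{finite,wellorder}" where "idx2 = (LEAST i. i \<noteq> idx1)"

text \<open>Parameter space Theta*_{k,d}, with d = CARD('n) - 1.\<close>
definition theta_star :: "nat \<Rightarrow> real \<Rightarrow> ((real ^ 'n::{finite,wellorder}) \<times> real) set" where
  "theta_star k rs =
     (if CARD('n) = 2 then
        {v. \<exists>\<theta>. 0 < \<theta> \<and> \<theta> < 2 * pi / real k \<and>
              v = cos \<theta> *\<^sub>R axis idx1 1 + sin \<theta> *\<^sub>R axis idx2 1} \<times> {0<..<rs}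
      else if odd k then sphere 0 1 \<times> {0<..<rs}
      else {v \<in> sphere 0 1. v $ idx1 > 0} \<times> {0<..<rs})"

definition is_local_max_on :: "'a::metric_space set \<Rightarrow> ('a \<Rightarrow> real) \<Rightarrow> 'a \<Rightarrow> bool" where
  "is_local_max_on S f p \<longleftrightarrow> p \<in> S \<and> (\<exists>e>0. \<forall>q\<in>S. dist q p < e \<longrightarrow> f q \<le> f p)"

definition sigma2_rho :: "nat \<Rightarrow> nat \<Rightarrow> real \<Rightarrow> real" where
  "sigma2_rho d k rho =
     (if d = 1 then rho\<^sup>2 * sqrt (1 - rho\<^sup>2) / (1 - sqrt (1 - rho\<^sup>2))
      else 1 / (omega (d - 1) / (omega d * gegen ((real d - 1) / 2) k 1) *
        integral {-1..1} (\<lambda>t. (gegen ((real d - 1) / 2) k t)\<^sup>2 * (1 - t\<^sup>2) powr (real d / 2 - 1)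
          / (gegen ((real d - 1) / 2) k 1 + rho * gegen ((real d - 1) / 2) k t))))"

definition sigma2_mu :: "nat \<Rightarrow> nat \<Rightarrow> real \<Rightarrow> real" where
  "sigma2_mu d k rho =
     (if d = 1 then 1 / ((real k)\<^sup>2 * (1 - sqrt (1 - rho\<^sup>2)))
      else 1 / (rho\<^sup>2 * (omega (d - 1) / (omega d * gegen ((real d - 1) / 2) k 1)) *
        ((real d - 1)\<^sup>2 / real d) *
        integral {-1..1} (\<lambda>t. (gegen ((real d + 1) / 2) (k - 1) t)\<^sup>2 * (1 - t\<^sup>2) powr (real d / 2)
          / (gegen ((real d - 1) / 2) k 1 + rho * gegen ((real d - 1) / 2) k t))))"

definition std_gauss :: "'a::euclidean_space measure" where
  "std_gauss = density lborel
     (\<lambda>x. ennreal ((2 * pi) powr (- real DIM('a) / 2) * exp (- (norm x)\<^sup>2 / 2)))"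

definition gaussian :: "('a::euclidean_space \<Rightarrow> 'a) \<Rightarrow> 'a measure" where
  "gaussian Cov = distr (std_gauss :: 'a measure) borel (SOME L. linear L \<and> L \<circ> adjoint L = Cov)"

definition conv_distr :: "'w measure \<Rightarrow> (nat \<Rightarrow> 'w \<Rightarrow> 'a::euclidean_space) \<Rightarrow> 'a measure \<Rightarrow> bool" where
  "conv_distr M Z N \<longleftrightarrow> (\<forall>g::'a \<Rightarrow> real. continuous_on UNIV g \<and> bounded (range g) \<longrightarrow>
     (\<lambda>n. integral\<^sup>L M (\<lambda>w. g (Z n w))) \<longlonglongrightarrow> integral\<^sup>L N g)"

end

theory Submission
  imports Defs "HOL-Probability.Hoeffding"
begin

text \<open>
  On a compact cap \<open>K\<close> of the parameter manifold around the true parameter, the log-likelihood has, by a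
  third-order Taylor expansion with uniformly bounded remainder, the form
  \<open>n (S . H - J(H) / 2)\<close> up to an error \<open>n (\<epsilon> |H|\<^sup>2 + C |H|\<^sup>3)\<close>. Here \<open>H\<close> is the increment of the parameter in
  the ambient space, \<open>S\<close> the mean score (tangential to the manifold), \<open>J\<close> the Fisher information, and \<open>\<epsilon>\<close> tends to
  zero by the law of large numbers. A measurably selected maximiser over \<open>K\<close> is therefore interior with probability
  tending to one, and it agrees with \<open>J\<^sup>-\<^sup>1 S\<close> up to \<open>o(n powr (-1/2))\<close>; the central limit theorem for
  the bounded scores concludes.

  Invariance of the surface measure under reflections makes \<open>J\<close> block diagonal and isotropic on the tangent space, and
  the differential equation of the Gegenbauer polynomials gives the information identity
  \<open>E (Hessian) = - J\<close> as well as the bound \<open>\<bar>C\<bar> \<le> C(1)\<close> on \<open>[-1, 1]\<close>.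
\<close>

text \<open>No chart of the sphere is used. For unit vectors the increment h = v - mu satisfies mu .
  h = -|h|^2 / 2, so its normal part is of second order: it turns the normal part of the gradient
  into a curvature term of the Hessian and leaves a quadratic model in ambient coordinates that
  degenerates exactly in the direction mu. The limit law is therefore singular, and convergence in
  distribution is obtained from characteristic functions, which need no density and allow variance
  zero. All error constants are uniform because |p| <= 1 and r <= rs < 1 keep 1 + r p(t) above 1 -
  rs. That the zonal function has mean zero on the sphere is read off from the total mass one of the
  sampling distribution. Spherical integrals of zonal functions are reduced to one dimension by
  comparing moments, which come from integrating a Gaussian in Cartesian and in polar coordinates.
  Since the parameter set is relatively open in the product of sphere and line, a maximiser in the
  interior of a small cap is a local maximum on it.\<close>

section \<open>Gegenbauer polynomials\<close>

text \<open>Indexed by the exponent m instead of the summation index j = (n - m) / 2 of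
  \<open>gegen\<close>, so that the differential equation becomes a relation between the
  coefficients of x^m and x^(m+2).\<close>

definition gegen_coeff :: "real \<Rightarrow> nat \<Rightarrow> nat \<Rightarrow> real" where
  "gegen_coeff lam n m = (if m \<le> n \<and> even (n - m)
     then (-1) ^ ((n - m) div 2) * pochhammer lam (n - (n - m) div 2)
       / (fact ((n - m) div 2) * fact m) * 2 ^ m else 0)"

definition gegen_poly :: "real \<Rightarrow> nat \<Rightarrow> real poly" where
  "gegen_poly lam n = Abs_poly (gegen_coeff lam n)"

lemma coeff_gegen_poly: "coeff (gegen_poly lam n) m = gegen_coeff lam n m"
proof -
  have "eventually (\<lambda>m. gegen_coeff lam n m = 0) cofinite"
    unfolding MOST_nat by (rule exI[of _ n]) (auto simp: gegen_coeff_def)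
  thus ?thesis by (simp add: gegen_poly_def Abs_poly_inverse)
qed

lemma degree_gegen_poly_le: "degree (gegen_poly lam n) \<le> n"
  by (rule degree_le) (auto simp: coeff_gegen_poly gegen_coeff_def)

lemma poly_gegen_poly: "poly (gegen_poly lam n) x = gegen lam n x"
proof -
  have "poly (gegen_poly lam n) x = (\<Sum>i\<le>n. gegen_coeff lam n i * x ^ i)"
  proof -
    have "(\<Sum>i\<le>n. gegen_coeff lam n i * x ^ i) = (\<Sum>i\<le>degree (gegen_poly lam n). gegen_coeff lam n i * x ^ i)"
      by (rule sum.mono_neutral_right)
         (use degree_gegen_poly_le[of lam n] in \<open>auto simp flip: coeff_gegen_poly intro!: coeff_eq_0\<close>)
    thus ?thesis by (simp add: poly_altdef coeff_gegen_poly)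
  qed
  also have "\<dots> = (\<Sum>i\<in>(\<lambda>j. n - 2 * j) ` {..n div 2}. gegen_coeff lam n i * x ^ i)"
  proof (rule sum.mono_neutral_right)
    show "\<forall>i\<in>{..n} - (\<lambda>j. n - 2 * j) ` {..n div 2}. gegen_coeff lam n i * x ^ i = 0"
    proof
      fix i assume i: "i \<in> {..n} - (\<lambda>j. n - 2 * j) ` {..n div 2}"
      have "odd (n - i)"
      proof
        assume "even (n - i)"
        then obtain j where "n - i = 2 * j" by (elim evenE)
        hence "i = n - 2 * j" "j \<le> n div 2" using i by auto
        with i show False by blast
      qed
      thus "gegen_coeff lam n i * x ^ i = 0" by (simp add: gegen_coeff_def)
    qed
  qed auto
  also have "\<dots> = (\<Sum>j\<le>n div 2. gegen_coeff lam n (n - 2 * j) * x ^ (n - 2 * j))"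
    by (subst sum.reindex) (auto simp: inj_on_def)
  also have "\<dots> = gegen lam n x"
    unfolding gegen_def
  proof (rule sum.cong[OF refl])
    fix j assume "j \<in> {..n div 2}"
    hence "n - (n - 2 * j) = 2 * j" by auto
    thus "gegen_coeff lam n (n - 2 * j) * x ^ (n - 2 * j) =
      (- 1) ^ j * pochhammer lam (n - j) / (fact j * fact (n - 2 * j)) * (2 * x) ^ (n - 2 * j)"
      by (simp add: gegen_coeff_def power_mult_distrib)
  qed
  finally show ?thesis .
qed

text \<open>Raising m by two lowers j = (n - m) / 2 by one: the Pochhammer symbol gains one factor
  and both factorials change by explicit ratios. At m = n both sides vanish.\<close>

lemma gegen_coeff_rec:
  "real (Suc (Suc m)) * real (Suc m) * gegen_coeff lam n (Suc (Suc m)) =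
     - (real n - real m) * (real n + real m + 2 * lam) * gegen_coeff lam n m"
proof (cases "m < n \<and> even (n - m)")
  case False
  thus ?thesis by (cases "m = n") (auto simp: gegen_coeff_def)
next
  case True
  then obtain j' where "n - m = 2 * j'" by (meson evenE)
  with True have "n = m + 2 * Suc (j' - 1)" by auto
  then obtain j where j: "n = m + 2 * Suc j" ..
  have 1: "n - m = 2 * Suc j" "n - Suc (Suc m) = 2 * j" "n - Suc j = Suc (m + j)" "n - j = Suc (Suc (m + j))"
    using j by auto
  have c1: "gegen_coeff lam n m = (-1) ^ Suc j * pochhammer lam (Suc (m + j)) / (fact (Suc j) * fact m) * 2 ^ m"
    using j by (simp only: gegen_coeff_def 1) (simp add: add_ac)
  have c2: "gegen_coeff lam n (Suc (Suc m)) = (-1) ^ j * pochhammer lam (Suc (Suc (m + j))) / (fact j * fact (Suc (Suc m))) * 2 ^ Suc (Suc m)"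
    using j by (simp only: gegen_coeff_def 1) (simp add: add_ac)
  have p: "pochhammer lam (Suc (Suc (m + j))) = pochhammer lam (Suc (m + j)) * (lam + real (Suc (m + j)))"
    by (rule pochhammer_Suc)
  have "real n = real m + 2 * real (Suc j)" using j by simp
  thus ?thesis unfolding c1 c2 p
    by (simp add: divide_simps del: pochhammer_Suc of_nat_Suc) (simp add: algebra_simps)
qed

text \<open>Multiplication by x after one derivative, and by x^2 after two, acts diagonally on
  monomials. The Gegenbauer equation is therefore \<open>gegen_coeff_rec\<close> read
  coefficientwise.\<close>

lemma gegen_poly_ode:
  "(1 - x\<^sup>2) * poly (pderiv (pderiv (gegen_poly lam n))) x =
     (2 * lam + 1) * x * poly (pderiv (gegen_poly lam n)) x - real n * (real n + 2 * lam) * gegen lam n x"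
proof -
  let ?y = "gegen_poly lam n"
  have "pderiv (pderiv ?y) - pCons 0 (pCons 0 (pderiv (pderiv ?y))) =
        smult (2 * lam + 1) (pCons 0 (pderiv ?y)) - smult (real n * (real n + 2 * lam)) ?y" (is "?l = ?r")
  proof (rule poly_eqI)
    fix m
    have "coeff (pCons 0 (pCons 0 (pderiv (pderiv ?y)))) m = real m * (real m - 1) * gegen_coeff lam n m"
      by (cases m; cases "m - 1") (auto simp: coeff_pderiv coeff_gegen_poly)
    moreover have "coeff (pCons 0 (pderiv ?y)) m = real m * gegen_coeff lam n m"
      by (cases m) (auto simp: coeff_pderiv coeff_gegen_poly)
    moreover have "coeff (pderiv (pderiv ?y)) m = real (Suc (Suc m)) * real (Suc m) * gegen_coeff lam n (Suc (Suc m))"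
      by (simp add: coeff_pderiv coeff_gegen_poly)
    ultimately show "coeff ?l m = coeff ?r m"
      by (simp only: coeff_diff coeff_smult coeff_gegen_poly gegen_coeff_rec) (simp add: algebra_simps)
  qed
  hence "poly ?l x = poly ?r x" by simp
  thus ?thesis by (simp add: poly_gegen_poly algebra_simps power2_eq_square)
qed

lemma pderiv_gegen_poly: "pderiv (gegen_poly lam (Suc n)) = smult (2 * lam) (gegen_poly (lam + 1) n)"
proof (rule poly_eqI)
  fix m
  show "coeff (pderiv (gegen_poly lam (Suc n))) m = coeff (smult (2 * lam) (gegen_poly (lam + 1) n)) m"
  proof (cases "m \<le> n \<and> even (n - m)")
    case False
    thus ?thesis by (auto simp: coeff_pderiv coeff_gegen_poly gegen_coeff_def)
  next
    case True
    define j where "j = (n - m) div 2"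
    have "Suc n - j = Suc (n - j)" using True by (auto simp: j_def)
    hence "pochhammer lam (Suc n - j) = lam * pochhammer (lam + 1) (n - j)" by (simp add: pochhammer_rec)
    thus ?thesis using True
      by (auto simp: coeff_pderiv coeff_gegen_poly gegen_coeff_def simp flip: j_def)
  qed
qed

text \<open>At x = 1 the leading term of the differential equation drops out, and the value becomes
  a positive multiple of the derivative, that is, of the polynomial of degree n - 1 and index lam +
  1. Hence the induction lets \<open>lam\<close> vary.\<close>

lemma gegen_1_pos: "lam > 0 \<Longrightarrow> gegen lam n 1 > 0"
proof (induction n arbitrary: lam)
  case 0
  show ?case by (simp add: gegen_def)
next
  case (Suc n)
  have "(2 * lam + 1) * (2 * lam * gegen (lam + 1) n 1) = real (Suc n) * (real (Suc n) + 2 * lam) * gegen lam (Suc n) 1"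
    using gegen_poly_ode[of 1 lam "Suc n"] by (simp add: pderiv_gegen_poly poly_gegen_poly)
  moreover have "(2 * lam + 1) * (2 * lam * gegen (lam + 1) n 1) > 0"
    using Suc.IH[of "lam + 1"] Suc.prems by simp
  ultimately have *: "real (Suc n) * (real (Suc n) + 2 * lam) * gegen lam (Suc n) 1 > 0" by simp
  have "real (Suc n) * (real (Suc n) + 2 * lam) > 0" using Suc.prems by simp
  with * show ?case by (rule zero_less_mult_pos)
qed

lemma gegen_minus: "gegen lam n (-x) = (-1) ^ n * gegen lam n x"
  unfolding gegen_def sum_distrib_left
proof (rule sum.cong[OF refl])
  fix j assume "j \<in> {..n div 2}"
  hence "even n \<longleftrightarrow> even (n - 2 * j)" by auto
  hence "(2 * - x) ^ (n - 2 * j) = (-1) ^ n * (2 * x) ^ (n - 2 * j)"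
    by (cases "even n") (simp_all add: power_minus_even power_minus_odd)
  thus "(- 1) ^ j * pochhammer lam (n - j) / (fact j * fact (n - 2 * j)) * (2 * - x) ^ (n - 2 * j) =
     (- 1) ^ n * ((- 1) ^ j * pochhammer lam (n - j) / (fact j * fact (n - 2 * j)) * (2 * x) ^ (n - 2 * j))"
    by simp
qed

text \<open>Sonin's argument: \<open>N y\<^sup>2 + (1 - x\<^sup>2) y'\<^sup>2\<close> with \<open>N = n (n + 2 lam)\<close> has
  derivative \<open>4 lam x y'\<^sup>2\<close> by the differential equation.\<close>
lemma abs_gegen_le:
  assumes lam: "lam > 0" and x: "\<bar>x\<bar> \<le> 1"
  shows "\<bar>gegen lam n x\<bar> \<le> gegen lam n 1"
proof (cases "n = 0")
  case True
  thus ?thesis by (simp add: gegen_def)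
next
  case False
  let ?y = "gegen_poly lam n"
  define N where "N = real n * (real n + 2 * lam)"
  define g where "g = (\<lambda>x. N * (poly ?y x)\<^sup>2 + (1 - x\<^sup>2) * (poly (pderiv ?y) x)\<^sup>2)"
  have N: "N > 0" using False lam by (simp add: N_def)
  have g': "(g has_real_derivative 4 * lam * t * (poly (pderiv ?y) t)\<^sup>2) (at t)" for t
  proof -
    have "(g has_real_derivative N * (2 * poly ?y t * poly (pderiv ?y) t) +
       ((1 - t\<^sup>2) * (2 * poly (pderiv ?y) t * poly (pderiv (pderiv ?y)) t) - 2 * t * (poly (pderiv ?y) t)\<^sup>2)) (at t)"
      unfolding g_def by (auto intro!: derivative_eq_intros simp: power2_eq_square algebra_simps)
    also have "(1 - t\<^sup>2) * (2 * poly (pderiv ?y) t * poly (pderiv (pderiv ?y)) t) =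
       2 * poly (pderiv ?y) t * ((2 * lam + 1) * t * poly (pderiv ?y) t - N * poly ?y t)"
      unfolding poly_gegen_poly N_def gegen_poly_ode[symmetric] by simp
    finally show ?thesis by (simp add: algebra_simps power2_eq_square)
  qed
  \<comment> \<open>The derivative has the sign of t, so monotonicity is used on [|x|, 1]; parity
    returns to x at the end.\<close>
  have "g \<bar>x\<bar> \<le> g 1"
    by (rule DERIV_nonneg_imp_nondecreasing[OF x]) (use g' lam in \<open>auto intro!: exI mult_nonneg_nonneg\<close>)
  moreover have "N * (poly ?y \<bar>x\<bar>)\<^sup>2 \<le> g \<bar>x\<bar>"
    using x by (simp add: g_def power_le_one_iff abs_square_le_1)
  ultimately have "N * (gegen lam n \<bar>x\<bar>)\<^sup>2 \<le> N * (gegen lam n 1)\<^sup>2" by (simp add: g_def poly_gegen_poly)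
  hence "(gegen lam n \<bar>x\<bar>)\<^sup>2 \<le> (gegen lam n 1)\<^sup>2" using N by simp
  hence "\<bar>gegen lam n \<bar>x\<bar>\<bar> \<le> gegen lam n 1"
    using gegen_1_pos[OF lam, of n] by (simp add: abs_le_square_iff[symmetric])
  moreover have "\<bar>gegen lam n \<bar>x\<bar>\<bar> = \<bar>gegen lam n x\<bar>"
    by (cases "x \<ge> 0") (auto simp: gegen_minus abs_mult)
  ultimately show ?thesis by simp
qed

text \<open>The two polynomials are T_k and U_(k-1); the addition theorems for cos and sin close up
  only as a simultaneous recursion. The polynomial \<open>[:1, 0, -1:]\<close> is sin^2 expressed in
  cos.\<close>

lemma chebyshev_poly_exists:
  "\<exists>p q :: real poly. \<forall>\<theta>. poly p (cos \<theta>) = cos (real k * \<theta>) \<and> poly q (cos \<theta>) * sin \<theta> = sin (real k * \<theta>)"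
proof (induction k)
  case 0
  show ?case by (rule exI[of _ 1], rule exI[of _ 0]) simp
next
  case (Suc k)
  then obtain p q where pq: "\<And>\<theta>. poly p (cos \<theta>) = cos (real k * \<theta>)" "\<And>\<theta>. poly q (cos \<theta>) * sin \<theta> = sin (real k * \<theta>)"
    by blast
  have "poly ([:0, 1:] * p - [:1, 0, -1:] * q) (cos \<theta>) = cos (real (Suc k) * \<theta>)" for \<theta>
  proof -
    have "cos (real (Suc k) * \<theta>) = cos (real k * \<theta>) * cos \<theta> - sin (real k * \<theta>) * sin \<theta>"
      by (simp add: cos_add[symmetric] del: of_nat_Suc) (simp add: algebra_simps)
    also have "sin (real k * \<theta>) * sin \<theta> = (sin \<theta>)\<^sup>2 * poly q (cos \<theta>)"
      by (simp add: power2_eq_square flip: pq(2))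
    also have "\<dots> = (1 - (cos \<theta>)\<^sup>2) * poly q (cos \<theta>)" by (simp add: sin_squared_eq)
    finally show ?thesis by (simp add: pq algebra_simps power2_eq_square)
  qed
  moreover have "poly (p + [:0, 1:] * q) (cos \<theta>) * sin \<theta> = sin (real (Suc k) * \<theta>)" for \<theta>
  proof -
    have "sin (real (Suc k) * \<theta>) = sin (real k * \<theta>) * cos \<theta> + cos (real k * \<theta>) * sin \<theta>"
      by (simp add: sin_add[symmetric] del: of_nat_Suc) (simp add: algebra_simps)
    also have "sin (real k * \<theta>) * cos \<theta> = cos \<theta> * poly q (cos \<theta>) * sin \<theta>"
      by (simp flip: pq(2))
    finally show ?thesis by (simp add: algebra_simps pq(1))
  qed
  ultimately show ?case by blast
qed

text \<open>The likelihood analysis sees the special functions only through this polynomial, with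
  the circle and the higher spheres treated alike. For lam = (d - 1) / 2 the coefficient 2 lam + 1
  is d, and k (k + d - 1) is the eigenvalue of degree k of the spherical Laplacian.\<close>

lemma gegen_tilde_poly:
  assumes "d \<ge> 1" "k \<ge> 1"
  obtains p :: "real poly" where
    "\<And>t. t \<in> {-1..1} \<Longrightarrow> gegen_tilde d k t = poly p t"
    "\<And>t. t \<in> {-1..1} \<Longrightarrow> \<bar>poly p t\<bar> \<le> 1"
    "poly p 1 = 1"
    "poly (pderiv p) 1 \<noteq> 0"
    "\<And>t. t \<in> {-1..1} \<Longrightarrow> (1 - t\<^sup>2) * poly (pderiv (pderiv p)) t =
         real d * t * poly (pderiv p) t - real k * (real k + real d - 1) * poly p t"
    "d = 1 \<Longrightarrow> (\<forall>\<theta>. poly p (cos \<theta>) = cos (real k * \<theta>) \<and> poly (pderiv p) (cos \<theta>) * sin \<theta> = real k * sin (real k * \<theta>))"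
    "d \<ge> 2 \<Longrightarrow> (\<forall>t. poly p t = gegen ((real d - 1) / 2) k t / gegen ((real d - 1) / 2) k 1 \<and>
       poly (pderiv p) t = (real d - 1) * gegen ((real d + 1) / 2) (k - 1) t / gegen ((real d - 1) / 2) k 1)"
proof (cases "d = 1")
  case True
  obtain p where p: "\<And>\<theta>. poly p (cos \<theta>) = cos (real k * \<theta>)" using chebyshev_poly_exists[of k] by blast
  \<comment> \<open>Obtained by differentiating p(cos theta) in two ways; differentiating the result
    once more gives the equation \<open>ode\<close>.\<close>
  have p1: "poly (pderiv p) (cos \<theta>) * sin \<theta> = real k * sin (real k * \<theta>)" for \<theta>
  proof -
    have "((\<lambda>\<theta>. poly p (cos \<theta>)) has_real_derivative - (poly (pderiv p) (cos \<theta>) * sin \<theta>)) (at \<theta>)"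
      by (auto intro!: derivative_eq_intros)
    moreover have "((\<lambda>\<theta>. poly p (cos \<theta>)) has_real_derivative - (real k * sin (real k * \<theta>))) (at \<theta>)"
      unfolding p by (auto intro!: derivative_eq_intros)
    ultimately show ?thesis using DERIV_unique by fastforce
  qed
  have ode: "(1 - t\<^sup>2) * poly (pderiv (pderiv p)) t =
         real d * t * poly (pderiv p) t - real k * (real k + real d - 1) * poly p t" if t: "t \<in> {-1..1}" for t
  proof -
    define \<theta> where "\<theta> = arccos t"
    have th: "cos \<theta> = t" using t by (simp add: \<theta>_def)
    have "((\<lambda>\<theta>. poly (pderiv p) (cos \<theta>) * sin \<theta>) has_real_derivative
       (poly (pderiv p) (cos \<theta>) * cos \<theta> - poly (pderiv (pderiv p)) (cos \<theta>) * (sin \<theta>)\<^sup>2)) (at \<theta>)"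
      by (auto intro!: derivative_eq_intros simp: power2_eq_square)
    moreover have "((\<lambda>\<theta>. poly (pderiv p) (cos \<theta>) * sin \<theta>) has_real_derivative (real k * real k * cos (real k * \<theta>))) (at \<theta>)"
      unfolding p1 by (auto intro!: derivative_eq_intros)
    ultimately have "poly (pderiv p) (cos \<theta>) * cos \<theta> - poly (pderiv (pderiv p)) (cos \<theta>) * (sin \<theta>)\<^sup>2 = real k * real k * cos (real k * \<theta>)"
      using DERIV_unique by blast
    thus ?thesis unfolding p[symmetric] th sin_squared_eq using True by (simp add: algebra_simps)
  qed
  have pp1: "poly p 1 = 1" using p[of 0] by simp
  show ?thesis
  proof (rule that[of p])
    fix t :: real assume t: "t \<in> {-1..1}"
    show "gegen_tilde d k t = poly p t" using t p[of "arccos t"] True by (simp add: gegen_tilde_def)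
    show "\<bar>poly p t\<bar> \<le> 1" using t p[of "arccos t"] True by simp
  next
    show "poly (pderiv p) 1 \<noteq> 0" using ode[of 1] pp1 True assms by auto
  qed (use p p1 ode pp1 True in auto)
next
  case False
  hence d: "d \<ge> 2" using assms by simp
  define lam where "lam = (real d - 1) / 2"
  have lam: "lam > 0" "2 * lam + 1 = real d" "lam + 1 = (real d + 1) / 2" "2 * lam = real d - 1"
    using d by (auto simp: lam_def field_simps)
  define c where "c = gegen lam k 1"
  have c: "c > 0" using gegen_1_pos[OF lam(1)] by (simp add: c_def)
  define p where "p = smult (1 / c) (gegen_poly lam k)"
  have pp: "poly p t = gegen lam k t / c" for t by (simp add: p_def poly_gegen_poly)
  obtain k' where k': "k = Suc k'" using assms by (cases k) auto
  have dp: "poly (pderiv p) t = (real d - 1) * gegen ((real d + 1) / 2) (k - 1) t / c" for t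
    by (simp add: p_def pderiv_smult k' pderiv_gegen_poly poly_gegen_poly lam flip: lam(3))
  show ?thesis
  proof (rule that[of p])
    fix t :: real assume t: "t \<in> {-1..1}"
    show "gegen_tilde d k t = poly p t" using False by (simp add: gegen_tilde_def pp c_def flip: lam_def)
    have "\<bar>t\<bar> \<le> 1" using t by auto
    thus "\<bar>poly p t\<bar> \<le> 1" using abs_gegen_le[OF lam(1), of t k] c by (simp add: pp c_def)
    show "(1 - t\<^sup>2) * poly (pderiv (pderiv p)) t =
         real d * t * poly (pderiv p) t - real k * (real k + real d - 1) * poly p t"
    proof -
      have "real k + real d - 1 = real k + 2 * lam" using lam(2) by simp
      thus ?thesis using gegen_poly_ode[of t lam k] c unfolding lam(2)
        by (simp add: p_def pderiv_smult poly_gegen_poly divide_simps)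
    qed
  next
    show "poly p 1 = 1" using c by (simp add: pp c_def)
    have "gegen ((real d + 1) / 2) (k - 1) 1 > 0" by (rule gegen_1_pos) simp
    thus "poly (pderiv p) 1 \<noteq> 0" using d c by (simp add: dp)
  qed (use False dp pp in \<open>auto simp: c_def lam_def\<close>)
qed

section \<open>The surface measure of the sphere\<close>

lemma sets_sphere_surface [simp, measurable_cong]: "sets sphere_surface = sets borel"
  by (simp add: sphere_surface_def)

lemma space_sphere_surface [simp]: "space sphere_surface = UNIV"
  by (simp add: sphere_surface_def space_scale_measure)

lemma nn_integral_sphere_surface:
  fixes f :: "'a::euclidean_space \<Rightarrow> ennreal"
  assumes [measurable]: "f \<in> borel_measurable borel"
  shows "(\<integral>\<^sup>+x. f x \<partial>sphere_surface) =
     ennreal (real DIM('a)) * (\<integral>\<^sup>+x. f (x /\<^sub>R norm x) * indicator (cball 0 1 - {0}) x \<partial>lborel)"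
proof -
  have "(\<integral>\<^sup>+x. f x \<partial>sphere_surface) = ennreal (real DIM('a)) *
      (\<integral>\<^sup>+x. f x \<partial>distr (restrict_space lborel (cball 0 1 - {0})) borel (\<lambda>x. x /\<^sub>R norm x))"
    unfolding sphere_surface_def by (subst nn_integral_scale_measure) auto
  also have "(\<integral>\<^sup>+x. f x \<partial>distr (restrict_space lborel (cball 0 1 - {0})) borel (\<lambda>x. x /\<^sub>R norm x)) =
      (\<integral>\<^sup>+x. f (x /\<^sub>R norm x) \<partial>restrict_space lborel (cball 0 1 - {0}))"
    by (subst nn_integral_distr) (auto intro!: measurable_restrict_space1)
  also have "\<dots> = (\<integral>\<^sup>+x. f (x /\<^sub>R norm x) * indicator (cball 0 1 - {0}) x \<partial>lborel)"
    by (subst nn_integral_restrict_space) auto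
  finally show ?thesis .
qed

lemma AE_sphere_surface_norm: "AE x in sphere_surface. norm x = 1"
proof -
  have "(\<integral>\<^sup>+x. indicator {x::'a. norm x \<noteq> 1} x \<partial>sphere_surface) = 0"
    by (subst nn_integral_sphere_surface) (auto simp: nn_integral_0_iff_AE indicator_def)
  hence "{x::'a. norm x \<noteq> 1} \<in> null_sets sphere_surface"
    by (auto simp: null_sets_def)
  thus ?thesis by (simp add: eventually_ae_filter) auto
qed

lemma omega_eq: "omega d = real (d + 1) * unit_ball_vol (real (d + 1))"
proof -
  have "Gamma ((real d + 1) / 2 + 1) = (real d + 1) / 2 * Gamma ((real d + 1) / 2)"
    by (subst Gamma_plus1) (auto simp: nonpos_Ints_def)
  moreover have "Gamma ((real d + 1) / 2) > 0" by (intro Gamma_real_pos) simp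
  ultimately show ?thesis
    unfolding omega_def unit_ball_vol_def by (simp only: of_nat_add of_nat_1) simp
qed

lemma omega_pos: "omega d > 0"
  by (simp add: omega_eq del: of_nat_add)

lemma emeasure_sphere_surface_UNIV:
  "emeasure (sphere_surface :: 'a::euclidean_space measure) UNIV = ennreal (omega (DIM('a) - 1))"
proof -
  have "emeasure (sphere_surface :: 'a measure) UNIV = (\<integral>\<^sup>+x. 1 \<partial>(sphere_surface :: 'a measure))" by simp
  also have "\<dots> = ennreal (real DIM('a)) * (\<integral>\<^sup>+x. indicator (cball 0 1 - {0}) (x::'a) \<partial>lborel)"
    by (subst nn_integral_sphere_surface) auto
  also have "(\<integral>\<^sup>+x. indicator (cball 0 1 - {0}) (x::'a) \<partial>lborel) = emeasure lborel (cball 0 1 - {0::'a})"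
    by simp
  also have "\<dots> = emeasure lborel (cball (0::'a) 1)"
    by (rule emeasure_Diff_null_set) auto
  also have "\<dots> = ennreal (unit_ball_vol (real DIM('a)))"
    by (simp add: emeasure_cball)
  also have "ennreal (real DIM('a)) * \<dots> = ennreal (omega (DIM('a) - 1))"
    by (simp add: omega_eq ennreal_mult DIM_positive)
  finally show ?thesis .
qed

lemma finite_measure_sphere_surface: "finite_measure sphere_surface"
  by (rule finite_measureI) (simp add: emeasure_sphere_surface_UNIV)

section \<open>Invariance of the surface measure under orthogonal transformations\<close>

lemma distr_lborel_orthogonal:
  fixes T :: "real ^ 'n::{finite,wellorder} \<Rightarrow> real ^ 'n::_"
  assumes T: "orthogonal_transformation T"
  shows "distr lborel borel T = lborel"
proof (rule lborel_eqI[symmetric])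
  have lin: "linear T" using T by (simp add: orthogonal_transformation)
  have [measurable]: "T \<in> borel_measurable borel"
    using lin by (intro borel_measurable_continuous_onI linear_continuous_on linear_conv_bounded_linear[THEN iffD1])
  have inv: "orthogonal_transformation (inv T)" using T by (rule orthogonal_transformation_inv)
  fix l u :: "(real, 'n) vec" assume le: "\<And>b. b \<in> Basis \<Longrightarrow> l \<bullet> b \<le> u \<bullet> b"
  have em: "emeasure lborel V = ennreal (measure lebesgue V)" if "V \<in> sets borel" "V \<in> lmeasurable" for V :: "(real, 'n) vec set"
  proof -
    have "emeasure lborel V = emeasure lebesgue V" using that(1) by simp
    also have "\<dots> = ennreal (measure lebesgue V)" by (rule emeasure_eq_measure2[OF that(2)])
    finally show ?thesis .
  qed
  have 1: "T -` box l u = inv T ` box l u"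
    using T by (simp add: bij_vimage_eq_inv_image orthogonal_transformation_bij)
  have 2: "T -` box l u \<in> sets borel" using measurable_sets[of T borel borel "box l u"] by simp
  have "emeasure lborel (T -` box l u) = ennreal (measure lebesgue (inv T ` box l u))"
    unfolding 1[symmetric] by (rule em[OF 2]) (unfold 1, rule measurable_orthogonal_image[OF inv], simp)
  also have "measure lebesgue (inv T ` box l u) = measure lebesgue (box l u)"
    by (rule measure_orthogonal_image[OF inv]) simp
  also have "ennreal \<dots> = emeasure lborel (box l u)" by (rule em[symmetric]) auto
  finally have "emeasure lborel (T -` box l u) = emeasure lborel (box l u)" .
  thus "emeasure (distr lborel borel T) (box l u) = (\<Prod>b\<in>Basis. (u - l) \<bullet> b)"
    using le by (simp add: emeasure_distr emeasure_lborel_box)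
qed simp

text \<open>The radial projection commutes with \<open>T\<close> and the punctured ball is
  preserved, so the invariance of Lebesgue measure passes to the surface measure.\<close>

lemma distr_sphere_surface_orthogonal:
  fixes T :: "real ^ 'n::{finite,wellorder} \<Rightarrow> real ^ 'n::_"
  assumes T: "orthogonal_transformation T"
  shows "distr sphere_surface borel T = sphere_surface"
proof (rule measure_eqI)
  have lin: "linear T" using T by (simp add: orthogonal_transformation)
  have Tm [measurable]: "T \<in> borel_measurable borel"
    using lin by (intro borel_measurable_continuous_onI linear_continuous_on linear_conv_bounded_linear[THEN iffD1])
  have nT: "norm (T x) = norm x" for x using T by (rule orthogonal_transformation_norm)
  have T0: "T x = 0 \<longleftrightarrow> x = 0" for x using nT[of x] by auto
  fix A assume "A \<in> sets (distr sphere_surface borel T)"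
  hence A [measurable]: "A \<in> sets borel" by simp
  have "emeasure (distr sphere_surface borel T) A = (\<integral>\<^sup>+x. indicator A (T x) \<partial>sphere_surface)"
    by (subst nn_integral_distr[symmetric, of T sphere_surface borel]) (auto simp: measurable_def[symmetric])
  also have "\<dots> = ennreal (real DIM((real, 'n) vec)) *
       (\<integral>\<^sup>+x. (\<lambda>y. indicator A (y /\<^sub>R norm y) * indicator (cball 0 1 - {0}) y) (T x) \<partial>lborel)"
    by (subst nn_integral_sphere_surface)
       (auto simp: linear_scale[OF lin] nT T0 indicator_def intro!: arg_cong2[where f="(*)"] nn_integral_cong)
  also have "(\<integral>\<^sup>+x. (\<lambda>y. indicator A (y /\<^sub>R norm y) * indicator (cball 0 1 - {0}) y) (T x) \<partial>lborel) =
      (\<integral>\<^sup>+y. indicator A (y /\<^sub>R norm y) * indicator (cball 0 1 - {0}) y \<partial>distr lborel borel T)"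
    by (subst nn_integral_distr) (auto intro!: borel_measurable_times_ennreal borel_measurable_indicator)
  also have "ennreal (real DIM((real, 'n) vec)) * \<dots> = (\<integral>\<^sup>+x. indicator A x \<partial>sphere_surface)"
    unfolding distr_lborel_orthogonal[OF T] by (subst nn_integral_sphere_surface) auto
  also have "\<dots> = emeasure sphere_surface A" by simp
  finally show "emeasure (distr sphere_surface borel T) A = emeasure sphere_surface A" .
qed simp

lemma integral_sphere_surface_orthogonal:
  fixes T :: "real ^ 'n::{finite,wellorder} \<Rightarrow> real ^ 'n::_" and f :: "real ^ 'n::{finite,wellorder} \<Rightarrow> real"
  assumes T: "orthogonal_transformation T" and [measurable]: "f \<in> borel_measurable borel"
  shows "(\<integral>x. f (T x) \<partial>sphere_surface) = (\<integral>x. f x \<partial>sphere_surface)"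
proof -
  have "linear T" using T by (simp add: orthogonal_transformation)
  hence Tm [measurable]: "T \<in> borel_measurable borel"
    by (intro borel_measurable_continuous_onI linear_continuous_on linear_conv_bounded_linear[THEN iffD1])
  have "(\<integral>x. f x \<partial>sphere_surface) = (\<integral>x. f x \<partial>distr sphere_surface borel T)"
    by (simp add: distr_sphere_surface_orthogonal[OF T])
  also have "\<dots> = (\<integral>x. f (T x) \<partial>sphere_surface)"
    by (rule integral_distr) auto
  finally show ?thesis ..
qed

section \<open>Dilations, polar coordinates and spherical moments\<close>

lemma punctured_cball_borel [measurable]: "cball (a::'a::euclidean_space) r - {b} \<in> sets borel"
  by (rule sets.Diff) simp_all

text \<open>The integrand is homogeneous of degree zero, so a dilation only contributes its
  Jacobian. This supplies the distribution function of the radial part in the polar coordinates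
  below.\<close>

lemma nn_integral_sphere_scale:
  fixes f :: "'a::euclidean_space \<Rightarrow> ennreal"
  assumes [measurable]: "f \<in> borel_measurable borel" and r: "r \<ge> 0"
  shows "ennreal (real DIM('a)) * (\<integral>\<^sup>+x. f (x /\<^sub>R norm x) * indicator (cball 0 r - {0}) x \<partial>lborel) =
     ennreal (r ^ DIM('a)) * (\<integral>\<^sup>+x. f x \<partial>sphere_surface)"
proof (cases "r = 0")
  case True
  thus ?thesis by (simp add: zero_power)
next
  case False
  hence r: "r > 0" using r by simp
  define h :: "'a \<Rightarrow> ennreal" where "h = (\<lambda>x. f (x /\<^sub>R norm x) * indicator (cball 0 r - {0}) x)"
  have [measurable]: "h \<in> borel_measurable borel" unfolding h_def by measurable
  have "(\<integral>\<^sup>+x. h x \<partial>lborel) =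
     (\<integral>\<^sup>+x. h x \<partial>density (distr lborel borel (\<lambda>x::'a. 0 + r *\<^sub>R x)) (\<lambda>_. ennreal (\<bar>r\<bar> ^ DIM('a))))"
    using r by (subst lborel_affine[of r 0]) auto
  also have "\<dots> = (\<integral>\<^sup>+x. ennreal (\<bar>r\<bar> ^ DIM('a)) * h x \<partial>distr lborel borel (\<lambda>x::'a. 0 + r *\<^sub>R x))"
    by (rule nn_integral_density) measurable
  also have "\<dots> = (\<integral>\<^sup>+x. ennreal (\<bar>r\<bar> ^ DIM('a)) * h (0 + r *\<^sub>R x) \<partial>lborel)"
    by (rule nn_integral_distr) measurable
  also have "\<dots> = (\<integral>\<^sup>+x. ennreal (r ^ DIM('a)) * (f (x /\<^sub>R norm x) * indicator (cball 0 1 - {0}) x) \<partial>lborel)"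
  proof (rule nn_integral_cong)
    fix x :: 'a
    have "(r *\<^sub>R x) /\<^sub>R norm (r *\<^sub>R x) = x /\<^sub>R norm x" using r by simp
    moreover have "r *\<^sub>R x \<in> cball 0 r - {0} \<longleftrightarrow> x \<in> cball 0 1 - {0}" using r by auto
    ultimately show "ennreal (\<bar>r\<bar> ^ DIM('a)) * h (0 + r *\<^sub>R x) =
       ennreal (r ^ DIM('a)) * (f (x /\<^sub>R norm x) * indicator (cball 0 1 - {0}) x)"
      using r unfolding h_def by (simp only: add_0 abs_of_pos indicator_def)
  qed
  also have "\<dots> = ennreal (r ^ DIM('a)) * (\<integral>\<^sup>+x. f (x /\<^sub>R norm x) * indicator (cball 0 1 - {0}) x \<partial>lborel)"
    by (rule nn_integral_cmult) measurable
  finally show ?thesis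
    unfolding h_def by (simp only: nn_integral_sphere_surface[OF assms(1)] mult_ac)
qed

lemma nn_integral_power_Ioc:
  fixes r :: real
  assumes "r \<ge> 0" "n > 0"
  shows "(\<integral>\<^sup>+s. ennreal (s ^ (n - 1)) * indicator {0<..r} s \<partial>lborel) = ennreal (r ^ n / n)"
proof -
  have "(\<integral>\<^sup>+s. ennreal (s ^ (n - 1)) * indicator {0<..r} s \<partial>lborel) =
        (\<integral>\<^sup>+s. ennreal (s ^ (n - 1)) * indicator {0..r} s \<partial>lborel)"
    by (rule nn_integral_cong_AE, rule AE_mp[OF AE_lborel_singleton[of 0]])
       (auto simp: indicator_def)
  also have "\<dots> = ennreal (r ^ n / n - 0 ^ n / n)"
    by (rule nn_integral_FTC_Icc[where F="\<lambda>s. s ^ n / n"])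
       (use assms in \<open>auto intro!: derivative_eq_intros\<close>)
  finally show ?thesis using assms by (simp add: zero_power)
qed

text \<open>Polar coordinates for functions of the form \<open>f (x / |x|) w(|x|)\<close>: both sides are measures in \<open>w\<close>,
  so it suffices to compare them on the intervals \<open>{..r}\<close>.\<close>
lemma nn_integral_lborel_polar:
  fixes f :: "'a::euclidean_space \<Rightarrow> ennreal" and w :: "real \<Rightarrow> ennreal"
  assumes [measurable]: "f \<in> borel_measurable borel" "w \<in> borel_measurable borel"
    and fin: "(\<integral>\<^sup>+x. f x \<partial>sphere_surface) < \<infinity>"
  shows "(\<integral>\<^sup>+x. f (x /\<^sub>R norm x) * w (norm x) \<partial>lborel) =
     (\<integral>\<^sup>+x. f x \<partial>sphere_surface) * (\<integral>\<^sup>+s. w s * ennreal (s ^ (DIM('a) - 1)) * indicator {0<..} s \<partial>lborel)"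
proof -
  let ?D = "DIM('a)"
  define C where "C = (\<integral>\<^sup>+x. f x \<partial>sphere_surface)"
  define g :: "'a \<Rightarrow> ennreal" where "g = (\<lambda>x. f (x /\<^sub>R norm x) * indicator (- {0}) x)"
  have [measurable]: "g \<in> borel_measurable borel" unfolding g_def by measurable
  define N where "N = distr (density lborel g) borel norm"
  define N' where "N' = density lborel (\<lambda>s::real. C * (ennreal (s ^ (?D - 1)) * indicator {0<..} s))"
  have N1: "emeasure N {..r} = (\<integral>\<^sup>+x. f (x /\<^sub>R norm x) * indicator (cball 0 r - {0}) x \<partial>lborel)" for r
  proof -
    have "emeasure N {..r} = emeasure (density lborel g) (norm -` {..r} \<inter> space (density lborel g))"
      unfolding N_def by (rule emeasure_distr) measurable
    also have "norm -` {..r} \<inter> space (density lborel g) = cball 0 r" by auto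
    also have "emeasure (density lborel g) (cball 0 r) = (\<integral>\<^sup>+x. g x * indicator (cball 0 r) x \<partial>lborel)"
      by (rule emeasure_density) auto
    also have "\<dots> = (\<integral>\<^sup>+x. f (x /\<^sub>R norm x) * indicator (cball 0 r - {0}) x \<partial>lborel)"
      by (rule nn_integral_cong) (auto simp: g_def split: split_indicator)
    finally show ?thesis .
  qed
  have N1': "emeasure N' {..r} = C * (\<integral>\<^sup>+s. ennreal (s ^ (?D - 1)) * indicator {0<..r} s \<partial>lborel)" for r
  proof -
    have "emeasure N' {..r} = (\<integral>\<^sup>+s. C * (ennreal (s ^ (?D - 1)) * indicator {0<..} s) * indicator {..r} s \<partial>lborel)"
      unfolding N'_def by (rule emeasure_density) auto
    also have "\<dots> = (\<integral>\<^sup>+s. C * (ennreal (s ^ (?D - 1)) * indicator {0<..r} s) \<partial>lborel)"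
      by (rule nn_integral_cong) (auto split: split_indicator)
    also have "\<dots> = C * (\<integral>\<^sup>+s. ennreal (s ^ (?D - 1)) * indicator {0<..r} s \<partial>lborel)"
      by (rule nn_integral_cmult) auto
    finally show ?thesis .
  qed
  have D: "ennreal (real ?D) \<noteq> 0" "ennreal (real ?D) \<noteq> \<infinity>" by auto
  have eq: "emeasure N {..r} = emeasure N' {..r}" for r
  proof (cases "r < 0")
    case True
    have "cball 0 r - {0::'a} = {}" "{0<..r} = {}" using True by auto
    note e = this
    show ?thesis unfolding N1 N1' e by simp
  next
    case False
    have "ennreal (real ?D) * emeasure N {..r} = ennreal (r ^ ?D) * C"
      unfolding N1 C_def using False by (intro nn_integral_sphere_scale) auto
    also have "\<dots> = ennreal (real ?D) * emeasure N' {..r}"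
    proof -
      have "ennreal (r ^ ?D) = ennreal (real ?D) * ennreal (r ^ ?D / real ?D)"
        using False by (subst ennreal_mult[symmetric]) auto
      thus ?thesis unfolding N1' using False by (subst nn_integral_power_Ioc) (auto simp: mult_ac)
    qed
    finally show ?thesis using D by (simp add: ennreal_mult_cancel_left)
  qed
  \<comment> \<open>Two measures agreeing on a generator are equal only under finiteness on an
    exhausting sequence; this is where \<open>fin\<close> enters.\<close>
  have fin': "emeasure N {..r} \<noteq> \<infinity>" for r
  proof (cases "r < 0")
    case True
    hence "{0<..r} = {}" by auto
    thus ?thesis unfolding eq N1' by simp
  next
    case False
    thus ?thesis unfolding eq N1' using fin
      by (subst nn_integral_power_Ioc) (auto simp: ennreal_mult_eq_top_iff C_def)
  qed
  have "N = N'"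
  proof (rule measure_eqI_generator_eq[where E="range atMost" and A="\<lambda>i::nat. {..real i}" and \<Omega>=UNIV])
    show "Int_stable (range atMost :: real set set)" by (auto simp: Int_stable_def)
    show "sets N = sigma_sets UNIV (range atMost)" "sets N' = sigma_sets UNIV (range atMost)"
      by (simp_all add: N_def N'_def borel_eq_atMost)
    show "(\<Union>i::nat. {..real i}) = UNIV"
      using real_arch_simple by auto
  qed (use eq fin' in auto)
  have "(\<integral>\<^sup>+x. f (x /\<^sub>R norm x) * w (norm x) \<partial>lborel) = (\<integral>\<^sup>+x. g x * w (norm x) \<partial>lborel)"
    by (rule nn_integral_cong_AE, rule AE_mp[OF AE_lborel_singleton[of 0]]) (auto simp: g_def)
  also have "\<dots> = (\<integral>\<^sup>+s. w s \<partial>N)"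
    unfolding N_def by (simp add: nn_integral_distr nn_integral_density)
  also have "\<dots> = (\<integral>\<^sup>+s. C * (ennreal (s ^ (?D - 1)) * indicator {0<..} s) * w s \<partial>lborel)"
    unfolding \<open>N = N'\<close> N'_def by (rule nn_integral_density) auto
  also have "\<dots> = C * (\<integral>\<^sup>+s. w s * ennreal (s ^ (?D - 1)) * indicator {0<..} s \<partial>lborel)"
    by (subst nn_integral_cmult[symmetric]) (auto simp: mult_ac intro!: nn_integral_cong)
  finally show ?thesis by (simp add: C_def)
qed

text \<open>Absolute moments, because polar coordinates bring in odd exponents as well: in dimension
  D the radial integral has exponent 2 j + D - 1.\<close>

definition gauss_moment :: "nat \<Rightarrow> real" where
  "gauss_moment n = (\<integral>x. std_normal_density x * \<bar>x\<bar> ^ n \<partial>lborel)"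

lemma gauss_moment_pos: "gauss_moment n > 0"
  and gauss_moment_rec: "gauss_moment (n + 2) = (real n + 1) * gauss_moment n"
proof -
  have e: "gauss_moment (2 * k) = fact (2 * k) / (2 ^ k * fact k)" for k
    using integral_std_normal_moment_even[of k] by (simp add: gauss_moment_def power_even_abs)
  have o: "gauss_moment (2 * k + 1) = sqrt (2 / pi) * 2 ^ k * fact k" for k
    unfolding gauss_moment_def by (rule integral_std_normal_moment_abs_odd)
  show "gauss_moment n > 0"
  proof (cases "even n")
    case True
    then obtain k where "n = 2 * k" by (elim evenE)
    thus ?thesis by (simp add: e)
  next
    case False
    then obtain k where n: "n = 2 * k + 1" by (elim oddE)
    show ?thesis unfolding n o by simp
  qed
  show "gauss_moment (n + 2) = (real n + 1) * gauss_moment n"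
  proof (cases "even n")
    case True
    then obtain k where n: "n = 2 * k" by (elim evenE)
    have 2: "n + 2 = 2 * Suc k" using n by simp
    have "(fact (2 * Suc k) :: real) = 2 * real (Suc k) * ((2 * real k + 1) * fact (2 * k))"
      by (simp add: algebra_simps)
    thus ?thesis unfolding 2 unfolding n e by (simp add: divide_simps)
  next
    case False
    then obtain k where n: "n = 2 * k + 1" by (elim oddE)
    have 2: "n + 2 = 2 * Suc k + 1" using n by simp
    show ?thesis unfolding 2 unfolding n o by (simp add: algebra_simps)
  qed
qed

lemma nn_integral_gauss_moment:
  "(\<integral>\<^sup>+x. ennreal (std_normal_density x * \<bar>x\<bar> ^ n) \<partial>lborel) = ennreal (gauss_moment n)"
  unfolding gauss_moment_def
  by (rule nn_integral_eq_integral[OF integrable_std_normal_moment_abs]) auto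

lemma nn_integral_gauss_moment_half:
  "(\<integral>\<^sup>+x. ennreal (std_normal_density x * x ^ n) * indicator {0<..} x \<partial>lborel) = ennreal (gauss_moment n / 2)"
proof -
  let ?f = "\<lambda>x. ennreal (std_normal_density x * \<bar>x\<bar> ^ n)"
  have "(\<integral>\<^sup>+x. ?f x \<partial>lborel) = (\<integral>\<^sup>+x. ?f x * indicator {0<..} x + ?f x * indicator {..<0} x \<partial>lborel)"
    by (rule nn_integral_cong_AE, rule AE_mp[OF AE_lborel_singleton[of 0]]) (auto simp: indicator_def)
  also have "\<dots> = (\<integral>\<^sup>+x. ?f x * indicator {0<..} x \<partial>lborel) + (\<integral>\<^sup>+x. ?f x * indicator {..<0} x \<partial>lborel)"
    by (rule nn_integral_add) auto
  also have "(\<integral>\<^sup>+x. ?f x * indicator {..<0} x \<partial>lborel) = (\<integral>\<^sup>+x. ?f (- x) * indicator {..<0} (- x) \<partial>lborel)"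
    by (subst nn_integral_real_affine[where c="-1" and t=0]) auto
  also have "\<dots> = (\<integral>\<^sup>+x. ?f x * indicator {0<..} x \<partial>lborel)"
    by (rule nn_integral_cong) (auto simp: indicator_def std_normal_density_def)
  finally have "2 * (\<integral>\<^sup>+x. ?f x * indicator {0<..} x \<partial>lborel) = ennreal (gauss_moment n)"
    by (simp add: nn_integral_gauss_moment mult_2)
  also have "\<dots> = 2 * ennreal (gauss_moment n / 2)"
    using gauss_moment_pos[of n] by (subst ennreal_numeral[symmetric], subst ennreal_mult[symmetric]) auto
  finally have "(\<integral>\<^sup>+x. ?f x * indicator {0<..} x \<partial>lborel) = ennreal (gauss_moment n / 2)"
    by (simp add: ennreal_mult_cancel_left)
  thus ?thesis by (subst (asm) nn_integral_cong[where v="\<lambda>x. ennreal (std_normal_density x * x ^ n) * indicator {0<..} x"])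
       (auto simp: indicator_def)
qed

lemma prod_std_normal_density:
  fixes x :: "'a::euclidean_space"
  shows "(\<Prod>b\<in>Basis. std_normal_density (x \<bullet> b)) = (1 / sqrt (2 * pi)) ^ DIM('a) * exp (- (norm x)\<^sup>2 / 2)"
proof -
  have "(\<Prod>b\<in>Basis. std_normal_density (x \<bullet> b)) = (1 / sqrt (2 * pi)) ^ DIM('a) * exp (\<Sum>b\<in>Basis. - (x \<bullet> b)\<^sup>2 / 2)"
    unfolding std_normal_density_def prod.distrib by (simp add: exp_sum power_divide)
  also have "(\<Sum>b\<in>Basis. - (x \<bullet> b)\<^sup>2 / 2) = - (norm x)\<^sup>2 / 2"
    unfolding power2_norm_eq_inner euclidean_inner[of x x] by (simp add: sum_divide_distrib[symmetric] sum_negf power2_eq_square)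
  finally show ?thesis .
qed

lemma integrable_sphere_surface_power:
  fixes e :: "'a::euclidean_space"
  shows "integrable sphere_surface (\<lambda>x. (x \<bullet> e) ^ m)"
proof -
  interpret finite_measure "sphere_surface :: 'a measure" by (rule finite_measure_sphere_surface)
  show ?thesis
  proof (rule integrable_const_bound[of _ "norm e ^ m"])
    show "AE x in sphere_surface. norm ((x \<bullet> e) ^ m) \<le> norm e ^ m"
      using AE_sphere_surface_norm
    proof eventually_elim
      case (elim x)
      have "\<bar>x \<bullet> e\<bar> \<le> norm e" using Cauchy_Schwarz_ineq2[of x e] elim by simp
      thus ?case by (simp add: power_abs power_mono)
    qed
  qed simp
qed

text \<open>The function (x . e)^(2j) is integrated against the standard Gaussian in two ways. Polar
  coordinates separate the spherical moment from a radial integral over a half-line, hence the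
  factor 2; the product structure leaves a one-dimensional moment. One of the D factors 1 / sqrt (2
  pi) belongs to the radial density, which explains the power D - 1.\<close>

lemma sphere_even_moment:
  fixes e :: "'a::euclidean_space"
  assumes e: "e \<in> Basis"
  shows "(\<integral>x. (x \<bullet> e) ^ (2 * j) \<partial>sphere_surface) * ((1 / sqrt (2 * pi)) ^ (DIM('a) - 1) * gauss_moment (2 * j + DIM('a) - 1)) =
     2 * gauss_moment (2 * j)"
proof -
  let ?D = "DIM('a)" and ?c = "1 / sqrt (2 * pi)"
  define M where "M = (\<integral>x. (x \<bullet> e) ^ (2 * j) \<partial>sphere_surface)"
  have M0: "M \<ge> 0" unfolding M_def by (rule integral_nonneg_AE) (auto simp: power_mult)
  have nM: "(\<integral>\<^sup>+x. ennreal ((x \<bullet> e) ^ (2 * j)) \<partial>sphere_surface) = ennreal M"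
    unfolding M_def by (rule nn_integral_eq_integral[OF integrable_sphere_surface_power]) (auto simp: power_mult)
  \<comment> \<open>The factor s^(2j) undoes the normalisation x / |x| in the monomial.\<close>
  define w where "w = (\<lambda>s::real. ennreal (?c ^ ?D * exp (- s\<^sup>2 / 2) * s ^ (2 * j)))"
  have "ennreal M * (\<integral>\<^sup>+s. w s * ennreal (s ^ (?D - 1)) * indicator {0<..} s \<partial>lborel) =
     (\<integral>\<^sup>+x. ennreal (((x /\<^sub>R norm x) \<bullet> e) ^ (2 * j)) * w (norm (x::'a)) \<partial>lborel)"
    unfolding nM[symmetric] by (rule nn_integral_lborel_polar[symmetric]) (simp_all add: nM w_def)
  also have "\<dots> = (\<integral>\<^sup>+x. ennreal (\<Prod>b\<in>Basis. std_normal_density (x \<bullet> b) * (if b = e then \<bar>x \<bullet> b\<bar> ^ (2 * j) else 1)) \<partial>lborel)"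
  proof (rule nn_integral_cong_AE, rule AE_mp[OF AE_lborel_singleton[of 0]], rule AE_I2, rule impI)
    fix x :: 'a assume x: "x \<noteq> 0"
    have "((x /\<^sub>R norm x) \<bullet> e) ^ (2 * j) * norm x ^ (2 * j) = (x \<bullet> e) ^ (2 * j)"
    proof -
      have "((x /\<^sub>R norm x) \<bullet> e) * norm x = x \<bullet> e" using x by simp
      thus ?thesis by (simp only: power_mult_distrib[symmetric])
    qed
    hence "((x /\<^sub>R norm x) \<bullet> e) ^ (2 * j) * (?c ^ ?D * exp (- (norm x)\<^sup>2 / 2) * norm x ^ (2 * j)) =
       (\<Prod>b\<in>Basis. std_normal_density (x \<bullet> b)) * (x \<bullet> e) ^ (2 * j)"
      unfolding prod_std_normal_density by (simp only: mult.left_commute mult.assoc)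
    also have "(x \<bullet> e) ^ (2 * j) = (\<Prod>b\<in>Basis. if b = e then \<bar>x \<bullet> b\<bar> ^ (2 * j) else 1)"
      using e by (simp add: prod.delta power_even_abs)
    finally show "ennreal (((x /\<^sub>R norm x) \<bullet> e) ^ (2 * j)) * w (norm x) =
        ennreal (\<Prod>b\<in>Basis. std_normal_density (x \<bullet> b) * (if b = e then \<bar>x \<bullet> b\<bar> ^ (2 * j) else 1))"
      unfolding w_def prod.distrib by (subst ennreal_mult[symmetric]) (auto simp: power_mult)
  qed
  also have "\<dots> = (\<integral>\<^sup>+x. (\<Prod>b\<in>Basis. ennreal (std_normal_density (x \<bullet> b) * (if b = e then \<bar>x \<bullet> b\<bar> ^ (2 * j) else 1))) \<partial>(lborel :: 'a measure))"
    by (subst prod_ennreal) auto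
  also have "\<dots> = (\<Prod>b\<in>(Basis::'a set). \<integral>\<^sup>+y. ennreal (std_normal_density y * (if b = e then \<bar>y\<bar> ^ (2 * j) else 1)) \<partial>lborel)"
    by (rule nn_integral_lborel_prod) auto
  also have "\<dots> = (\<Prod>b\<in>(Basis::'a set). if b = e then ennreal (gauss_moment (2 * j)) else 1)"
  proof (rule prod.cong[OF refl])
    fix b :: 'a
    show "(\<integral>\<^sup>+y. ennreal (std_normal_density y * (if b = e then \<bar>y\<bar> ^ (2 * j) else 1)) \<partial>lborel) =
       (if b = e then ennreal (gauss_moment (2 * j)) else 1)"
      using nn_integral_gauss_moment[of "2 * j"] nn_integral_gauss_moment[of 0] integral_std_normal_moment_even[of 0]
      by (auto simp: gauss_moment_def)
  qed
  also have "\<dots> = ennreal (gauss_moment (2 * j))" using e by (simp add: prod.delta)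
  also have "(\<integral>\<^sup>+s. w s * ennreal (s ^ (?D - 1)) * indicator {0<..} s \<partial>lborel) =
     (\<integral>\<^sup>+s. ennreal (?c ^ (?D - 1)) * (ennreal (std_normal_density s * s ^ (2 * j + ?D - 1)) * indicator {0<..} s) \<partial>lborel)"
  proof (rule nn_integral_cong)
    fix s :: real
    have "?c ^ ?D = ?c ^ (?D - 1) * ?c" using DIM_positive[where 'a='a] by (metis power_minus_mult)
    moreover have A: "2 * j + ?D - 1 = 2 * j + (?D - 1)" using DIM_positive[where 'a='a] by linarith
    ultimately show "w s * ennreal (s ^ (?D - 1)) * indicator {0<..} s =
       ennreal (?c ^ (?D - 1)) * (ennreal (std_normal_density s * s ^ (2 * j + ?D - 1)) * indicator {0<..} s)"
      unfolding A power_add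
      by (auto simp: w_def indicator_def std_normal_density_def ennreal_mult[symmetric] mult_ac)
  qed
  also have "\<dots> = ennreal (?c ^ (?D - 1)) * ennreal (gauss_moment (2 * j + ?D - 1) / 2)"
    by (subst nn_integral_cmult) (auto simp: nn_integral_gauss_moment_half)
  finally have eq: "ennreal M * (ennreal (?c ^ (?D - 1)) * ennreal (gauss_moment (2 * j + ?D - 1) / 2)) = ennreal (gauss_moment (2 * j))" .
  have "ennreal (M * (?c ^ (?D - 1) * (gauss_moment (2 * j + ?D - 1) / 2))) = ennreal (gauss_moment (2 * j))"
    unfolding eq[symmetric] using M0 gauss_moment_pos[of "2 * j + ?D - 1"]
    by (subst ennreal_mult, simp, simp, subst ennreal_mult, simp_all)
  hence "M * (?c ^ (?D - 1) * (gauss_moment (2 * j + ?D - 1) / 2)) = gauss_moment (2 * j)"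
    using M0 gauss_moment_pos[of "2 * j"] gauss_moment_pos[of "2 * j + ?D - 1"] by (subst (asm) ennreal_inj) auto
  thus ?thesis unfolding M_def by simp
qed

section \<open>Reflections and the isotropy of zonal integrals\<close>

lemma integrable_sphere_surface:
  fixes f :: "'a::euclidean_space \<Rightarrow> real"
  assumes [measurable]: "f \<in> borel_measurable borel" and B: "\<And>x. norm x = 1 \<Longrightarrow> \<bar>f x\<bar> \<le> B"
  shows "integrable sphere_surface f"
proof -
  interpret finite_measure "sphere_surface :: 'a measure" by (rule finite_measure_sphere_surface)
  have "AE x in sphere_surface. norm (f x) \<le> B"
    using AE_sphere_surface_norm by eventually_elim (use B in auto)
  thus ?thesis by (intro integrable_const_bound[of _ B]) auto
qed

lemma integral_sphere_surface_const:
  "(\<integral>x. c \<partial>(sphere_surface :: 'a::euclidean_space measure)) = omega (DIM('a) - 1) * (c::real)"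
  using omega_pos[of "DIM('a) - 1"] by (simp add: measure_def emeasure_sphere_surface_UNIV)

lemma abs_inner_le_1: "norm x = 1 \<Longrightarrow> norm e = 1 \<Longrightarrow> \<bar>x \<bullet> e\<bar> \<le> (1::real)"
  using Cauchy_Schwarz_ineq2[of x e] by simp

text \<open>Householder reflection in the hyperplane orthogonal to \<open>a\<close>; for
  \<open>a = 0\<close> division by zero makes it the identity.\<close>

definition reflect :: "'a::real_inner \<Rightarrow> 'a \<Rightarrow> 'a" where
  "reflect a x = x - (2 * (x \<bullet> a) / (a \<bullet> a)) *\<^sub>R a"

lemma orthogonal_transformation_reflect: "orthogonal_transformation (reflect a)"
proof (cases "a = 0")
  case True
  hence "reflect a = (\<lambda>x. x)" by (auto simp: reflect_def)
  thus ?thesis by (simp add: orthogonal_transformation_def linear_iff)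
next
  case False
  thus ?thesis unfolding orthogonal_transformation_def
    by (auto simp: reflect_def linear_iff algebra_simps inner_commute add_divide_distrib diff_divide_distrib)
qed

lemma inner_reflect: "reflect a x \<bullet> y = x \<bullet> reflect a y"
  by (simp add: reflect_def algebra_simps inner_commute)

lemma reflect_orthogonal: "y \<bullet> a = 0 \<Longrightarrow> reflect a y = y"
  by (simp add: reflect_def)

lemma reflect_self: "reflect a a = - a"
  by (cases "a = 0") (simp_all add: reflect_def scaleR_2)

text \<open>Since |u| = |v|, the vector u - v has squared length 2 u . (u - v), so the reflection
  subtracts it exactly once from u. Such reflections exchange tangent directions while fixing the
  pole.\<close>

lemma reflect_diff:
  assumes "norm u = norm v"
  shows "reflect (u - v) u = v"
proof (cases "u = v")
  case False
  have n: "u \<bullet> u = v \<bullet> v" using assms by (simp add: norm_eq)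
  have "(u - v) \<bullet> (u - v) = 2 * (u \<bullet> (u - v))" using n by (simp add: algebra_simps inner_commute)
  moreover have "(u - v) \<bullet> (u - v) \<noteq> 0" using False by simp
  ultimately show ?thesis by (simp add: reflect_def)
qed (simp add: reflect_def)

text \<open>The reflection in \<open>u\<close> fixes \<open>mu\<close> and changes the sign of x .
  u.\<close>

lemma sphere_odd_moment_orthogonal:
  fixes mu u :: "real ^ 'n::{finite,wellorder}" and F :: "real \<Rightarrow> real"
  assumes "u \<bullet> mu = 0" and [measurable]: "F \<in> borel_measurable borel"
  shows "(\<integral>x. F (x \<bullet> mu) * (x \<bullet> u) \<partial>sphere_surface) = 0"
proof -
  have "(\<integral>x. F (x \<bullet> mu) * (x \<bullet> u) \<partial>sphere_surface) =
      (\<integral>x. F (reflect u x \<bullet> mu) * (reflect u x \<bullet> u) \<partial>sphere_surface)"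
    by (rule integral_sphere_surface_orthogonal[OF orthogonal_transformation_reflect, symmetric]) measurable
  also have "\<dots> = (\<integral>x. - (F (x \<bullet> mu) * (x \<bullet> u)) \<partial>sphere_surface)"
  proof -
    have "reflect u x \<bullet> mu = x \<bullet> mu" "reflect u x \<bullet> u = - (x \<bullet> u)" for x
      using assms(1) by (simp_all only: inner_reflect reflect_self inner_minus_right)
        (simp add: reflect_orthogonal inner_commute)
    thus ?thesis by simp
  qed
  also have "\<dots> = - (\<integral>x. F (x \<bullet> mu) * (x \<bullet> u) \<partial>sphere_surface)" by simp
  finally show ?thesis by simp
qed

text \<open>Reflections carry any unit tangent vector to any other without moving \<open>mu\<close>,
  so the quadratic moment depends on |u| only. Its value comes from the trace: over an orthonormal
  basis of the complement of \<open>mu\<close>, which has \<open>CARD('n) - 1\<close> elements, the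
  squares add up to 1 - (x . mu)^2 on the sphere.\<close>

lemma sphere_isotropic:
  fixes mu u :: "real ^ 'n::{finite,wellorder}" and F :: "real \<Rightarrow> real"
  assumes mu: "norm mu = 1" and u: "u \<bullet> mu = 0" and F [measurable]: "F \<in> borel_measurable borel"
    and B: "\<And>t. t \<in> {-1..1} \<Longrightarrow> \<bar>F t\<bar> \<le> B"
  shows "real (CARD('n) - 1) * (\<integral>x. F (x \<bullet> mu) * (x \<bullet> u)\<^sup>2 \<partial>sphere_surface) =
     (norm u)\<^sup>2 * (\<integral>x. F (x \<bullet> mu) * (1 - (x \<bullet> mu)\<^sup>2) \<partial>sphere_surface)"
proof -
  define I where "I = (\<lambda>u. \<integral>x. F (x \<bullet> mu) * (x \<bullet> u)\<^sup>2 \<partial>sphere_surface)"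
  have int: "integrable sphere_surface (\<lambda>x. F (x \<bullet> mu) * (x \<bullet> v)\<^sup>2)" if "norm v = 1" for v
  proof (rule integrable_sphere_surface)
    fix x :: "(real, 'n) vec" assume x: "norm x = 1"
    have "\<bar>F (x \<bullet> mu)\<bar> \<le> B" using abs_inner_le_1[OF x mu] by (intro B) auto
    moreover have "(x \<bullet> v)\<^sup>2 \<le> 1" using abs_inner_le_1[OF x that] by (simp add: abs_square_le_1)
    ultimately show "\<bar>F (x \<bullet> mu) * (x \<bullet> v)\<^sup>2\<bar> \<le> B * 1"
      unfolding abs_mult by (intro mult_mono) auto
  qed measurable
  have I_eq: "I v = I w" if "norm v = norm w" "v \<bullet> mu = 0" "w \<bullet> mu = 0" for v w
  proof -
    let ?T = "reflect (v - w)"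
    have "I v = (\<integral>x. F (?T x \<bullet> mu) * (?T x \<bullet> v)\<^sup>2 \<partial>sphere_surface)"
      unfolding I_def
      by (rule integral_sphere_surface_orthogonal[OF orthogonal_transformation_reflect, symmetric]) measurable
    also have "\<dots> = I w"
      unfolding I_def inner_reflect reflect_diff[OF that(1)] using that
      by (subst reflect_orthogonal) (simp_all add: inner_diff_right inner_commute)
    finally show ?thesis .
  qed
  obtain S where S: "mu \<in> S" "pairwise orthogonal S" "\<And>x. x \<in> S \<Longrightarrow> norm x = 1"
      "independent S" "card S = DIM((real, 'n) vec)" "span S = UNIV"
    using vector_in_orthonormal_basis[OF mu] by metis
  have fS: "finite S" using S(4) by (simp add: independent_imp_finite)
  have perp: "v \<bullet> mu = 0" if "v \<in> S - {mu}" for v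
    using S(1,2) that by (auto simp: pairwise_def orthogonal_def)
  have expand: "(\<Sum>v\<in>S. (x \<bullet> v)\<^sup>2) = (norm x)\<^sup>2" for x
  proof -
    have "x = (\<Sum>v\<in>S. (x \<bullet> v) *\<^sub>R v)"
      using orthonormal_basis_expand[OF S(2,3) _ fS, of x] S(6) by simp
    hence "x \<bullet> x = (\<Sum>v\<in>S. (x \<bullet> v) *\<^sub>R v) \<bullet> x" by (rule arg_cong[where f="\<lambda>y. y \<bullet> x"])
    also have "\<dots> = (\<Sum>v\<in>S. (x \<bullet> v)\<^sup>2)"
      unfolding inner_sum_left inner_scaleR_left power2_eq_square by (simp only: inner_commute)
    finally show ?thesis by (simp add: power2_norm_eq_inner)
  qed
  have J: "(\<Sum>v\<in>S - {mu}. I v) = (\<integral>x. F (x \<bullet> mu) * (1 - (x \<bullet> mu)\<^sup>2) \<partial>sphere_surface)"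
  proof -
    have "(\<Sum>v\<in>S - {mu}. I v) = (\<integral>x. (\<Sum>v\<in>S - {mu}. F (x \<bullet> mu) * (x \<bullet> v)\<^sup>2) \<partial>sphere_surface)"
      unfolding I_def by (subst Bochner_Integration.integral_sum) (use S(3) int in auto)
    also have "\<dots> = (\<integral>x. F (x \<bullet> mu) * (1 - (x \<bullet> mu)\<^sup>2) \<partial>sphere_surface)"
    proof (rule integral_cong_AE)
      show "AE x in sphere_surface. (\<Sum>v\<in>S - {mu}. F (x \<bullet> mu) * (x \<bullet> v)\<^sup>2) = F (x \<bullet> mu) * (1 - (x \<bullet> mu)\<^sup>2)"
        using AE_sphere_surface_norm
      proof eventually_elim
        case (elim x)
        have "(\<Sum>v\<in>S - {mu}. (x \<bullet> v)\<^sup>2) = 1 - (x \<bullet> mu)\<^sup>2"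
          using expand[of x] elim S(1) fS by (simp add: sum_diff1)
        thus ?case by (simp flip: sum_distrib_left)
      qed
    qed measurable
    finally show ?thesis .
  qed
  show ?thesis
  proof (cases "u = 0")
    case False
    define u0 where "u0 = u /\<^sub>R norm u"
    have u0: "norm u0 = 1" "u0 \<bullet> mu = 0" "u = norm u *\<^sub>R u0" using False u by (simp_all add: u0_def)
    have "(\<Sum>v\<in>S - {mu}. I v) = (\<Sum>v\<in>S - {mu}. I u0)"
      by (rule sum.cong[OF refl], rule I_eq) (use S(3) u0 perp in auto)
    also have "\<dots> = real (CARD('n) - 1) * I u0" using S(1,5) fS by simp
    finally have "real (CARD('n) - 1) * I u0 = (\<integral>x. F (x \<bullet> mu) * (1 - (x \<bullet> mu)\<^sup>2) \<partial>sphere_surface)"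
      unfolding J by simp
    moreover have "I u = (norm u)\<^sup>2 * I u0"
    proof -
      have "F (x \<bullet> mu) * (x \<bullet> u)\<^sup>2 = (norm u)\<^sup>2 * (F (x \<bullet> mu) * (x \<bullet> u0)\<^sup>2)" for x
        by (subst u0(3)) (simp add: power_mult_distrib)
      hence "I u = (\<integral>x. (norm u)\<^sup>2 * (F (x \<bullet> mu) * (x \<bullet> u0)\<^sup>2) \<partial>sphere_surface)"
        unfolding I_def by (intro Bochner_Integration.integral_cong refl)
      thus ?thesis unfolding I_def by simp
    qed
    ultimately have "real (CARD('n) - 1) * I u = (norm u)\<^sup>2 * (\<integral>x. F (x \<bullet> mu) * (1 - (x \<bullet> mu)\<^sup>2) \<partial>sphere_surface)"
      by (metis mult.left_commute)
    thus ?thesis unfolding I_def .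
  qed simp
qed

section \<open>One-dimensional form of zonal integrals\<close>

definition zonal_moment :: "nat \<Rightarrow> nat \<Rightarrow> real" where
  "zonal_moment d m = integral {0..pi} (\<lambda>\<theta>. cos \<theta> ^ m * sin \<theta> ^ (d - 1))"

text \<open>Integrate the derivative of cos^(m+1) sin^d over [0, pi]; its boundary values vanish for
  d >= 1. The moments of x . e over the sphere will be shown to obey the same recursion.\<close>

lemma zonal_moment_rec:
  assumes "d \<ge> 1"
  shows "(real m + 1 + real d) * zonal_moment d (m + 2) = (real m + 1) * zonal_moment d m"
proof -
  obtain d' where d: "d = Suc d'" using assms by (cases d) auto
  have "((\<lambda>\<theta>. (real m + 1 + real d) * (cos \<theta> ^ (m + 2) * sin \<theta> ^ (d - 1)) - (real m + 1) * (cos \<theta> ^ m * sin \<theta> ^ (d - 1)))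
     has_integral (cos pi ^ (m + 1) * sin pi ^ d - cos 0 ^ (m + 1) * sin 0 ^ d)) {0..pi}"
  proof (rule fundamental_theorem_of_calculus)
    fix \<theta> :: real
    have "((\<lambda>\<theta>. cos \<theta> ^ (m + 1) * sin \<theta> ^ d) has_real_derivative
       (cos \<theta> ^ (m + 1) * (real d * sin \<theta> ^ d' * cos \<theta>) - real (m + 1) * cos \<theta> ^ m * sin \<theta> * sin \<theta> ^ d)) (at \<theta> within {0..pi})"
    proof -
      have 1: "((\<lambda>\<theta>. cos \<theta> ^ Suc m) has_real_derivative (1 + real m) * (- sin \<theta> * cos \<theta> ^ m)) (at \<theta> within {0..pi})"
        by (rule DERIV_power_Suc) (rule has_field_derivative_at_within[OF DERIV_cos])
      have 2: "((\<lambda>\<theta>. sin \<theta> ^ Suc d') has_real_derivative (1 + real d') * (cos \<theta> * sin \<theta> ^ d')) (at \<theta> within {0..pi})"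
        by (rule DERIV_power_Suc) (rule has_field_derivative_at_within[OF DERIV_sin])
      show ?thesis using DERIV_mult[OF 1 2] unfolding d by (simp add: algebra_simps)
    qed
    also have "real (m + 1) * cos \<theta> ^ m * sin \<theta> * sin \<theta> ^ d = (real m + 1) * cos \<theta> ^ m * (1 - (cos \<theta>)\<^sup>2) * sin \<theta> ^ d'"
      by (simp add: d flip: sin_squared_eq) (simp add: power2_eq_square)
    finally show "((\<lambda>\<theta>. cos \<theta> ^ (m + 1) * sin \<theta> ^ d) has_vector_derivative
       (real m + 1 + real d) * (cos \<theta> ^ (m + 2) * sin \<theta> ^ (d - 1)) - (real m + 1) * (cos \<theta> ^ m * sin \<theta> ^ (d - 1))) (at \<theta> within {0..pi})"
      unfolding has_real_derivative_iff_has_vector_derivative[symmetric]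
      by (simp add: d algebra_simps power2_eq_square power_add)
  qed simp
  hence "integral {0..pi} (\<lambda>\<theta>. (real m + 1 + real d) * (cos \<theta> ^ (m + 2) * sin \<theta> ^ (d - 1)) - (real m + 1) * (cos \<theta> ^ m * sin \<theta> ^ (d - 1))) = 0"
    using assms by (simp add: integral_unique zero_power)
  also have "integral {0..pi} (\<lambda>\<theta>. (real m + 1 + real d) * (cos \<theta> ^ (m + 2) * sin \<theta> ^ (d - 1)) - (real m + 1) * (cos \<theta> ^ m * sin \<theta> ^ (d - 1))) =
     (real m + 1 + real d) * zonal_moment d (m + 2) - (real m + 1) * zonal_moment d m"
    unfolding zonal_moment_def
    by (subst integral_diff) (auto intro!: integrable_continuous_real continuous_intros)
  finally show ?thesis by simp
qed

lemma zonal_moment_1: "d \<ge> 1 \<Longrightarrow> zonal_moment d 1 = 0"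
proof -
  assume "d \<ge> 1"
  then obtain d' where d: "d = Suc d'" by (cases d) auto
  have "((\<lambda>\<theta>. cos \<theta> * sin \<theta> ^ d') has_integral (sin pi ^ d / real d - sin 0 ^ d / real d)) {0..pi}"
  proof (rule fundamental_theorem_of_calculus)
    fix \<theta> :: real
    have "((\<lambda>\<theta>. sin \<theta> ^ Suc d') has_real_derivative (1 + real d') * (cos \<theta> * sin \<theta> ^ d')) (at \<theta> within {0..pi})"
      by (rule DERIV_power_Suc) (rule has_field_derivative_at_within[OF DERIV_sin])
    from DERIV_cdivide[OF this, of "real d"]
    show "((\<lambda>\<theta>. sin \<theta> ^ d / real d) has_vector_derivative cos \<theta> * sin \<theta> ^ d') (at \<theta> within {0..pi})"
      unfolding has_real_derivative_iff_has_vector_derivative[symmetric] d by simp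
  qed simp
  thus ?thesis by (simp add: zonal_moment_def d integral_unique)
qed

lemma omega_add_2: "omega (d + 2) = omega d * (2 * pi) / (real d + 1)"
proof -
  define a where "a = (real d + 1) / 2"
  have a: "a > 0" "real d + 1 = 2 * a" "(real (d + 2) + 1) / 2 = a + 1" by (simp_all add: a_def)
  have "Gamma (a + 1) = a * Gamma a" using a(1) by (intro Gamma_plus1) (auto simp: nonpos_Ints_def)
  moreover have "Gamma a > 0" using a(1) by (rule Gamma_real_pos)
  ultimately show ?thesis
    using a(1) unfolding omega_def a(3) a_def[symmetric] unfolding a(2) by (simp add: powr_add field_simps)
qed

lemma omega_0: "omega 0 = 2" and omega_1: "omega 1 = 2 * pi"
  by (simp_all add: omega_def powr_half_sqrt Gamma_one_half_real)

text \<open>Writing sin^2 as 1 - cos^2 relates the zeroth moments for d' + 2 and d'. Together with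
  \<open>omega_add_2\<close> this gives an induction in steps of two from d = 1 and d = 2.\<close>

lemma omega_zonal_moment: "d \<ge> 1 \<Longrightarrow> omega d = omega (d - 1) * zonal_moment d 0"
proof (induction d rule: less_induct)
  case (less d)
  consider "d = 1" | "d = 2" | d' where "d = d' + 2" "d' \<ge> 1"
    using less.prems by (metis add.commute add_diff_inverse_nat le_neq_implies_less less_2_cases less_one not_le zero_neq_one diff_is_0_eq' nat_le_linear linorder_not_less zero_less_diff less_eq_Suc_le One_nat_def)
  thus ?case
  proof cases
    case 1
    have "zonal_moment 1 0 = pi" by (simp add: zonal_moment_def)
    thus ?thesis using 1 omega_0 omega_1 by simp
  next
    case 2
    have "((\<lambda>\<theta>. sin \<theta>) has_integral (- cos pi - (- cos 0))) {0..pi}"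
      by (rule fundamental_theorem_of_calculus)
         (auto simp: has_real_derivative_iff_has_vector_derivative[symmetric] intro!: derivative_eq_intros)
    hence "zonal_moment 2 0 = 2" by (simp add: zonal_moment_def integral_unique)
    thus ?thesis using 2 omega_0 omega_1 omega_add_2[of 0] by (simp add: numeral_2_eq_2)
  next
    case 3
    have "zonal_moment (d' + 2) 0 = zonal_moment d' 0 - zonal_moment d' 2"
    proof -
      have "zonal_moment (d' + 2) 0 = integral {0..pi} (\<lambda>\<theta>. cos \<theta> ^ 0 * sin \<theta> ^ (d' - 1) - cos \<theta> ^ 2 * sin \<theta> ^ (d' - 1))"
      proof -
        have "sin \<theta> ^ (d' + 1) = sin \<theta> ^ (d' - 1) * (1 - (cos \<theta>)\<^sup>2)" for \<theta> :: real
        proof -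
          have "d' + 1 = (d' - 1) + 2" using 3 by simp
          thus ?thesis by (simp only: power_add sin_squared_eq)
        qed
        hence "(\<lambda>\<theta>::real. cos \<theta> ^ 0 * sin \<theta> ^ (d' + 1)) =
            (\<lambda>\<theta>. cos \<theta> ^ 0 * sin \<theta> ^ (d' - 1) - cos \<theta> ^ 2 * sin \<theta> ^ (d' - 1))"
          by (simp only: power_0 mult_1 right_diff_distrib mult_1_right) (simp add: mult.commute)
        thus ?thesis by (simp add: zonal_moment_def)
      qed
      also have "\<dots> = zonal_moment d' 0 - zonal_moment d' 2"
        unfolding zonal_moment_def
        by (rule integral_diff) (auto intro!: integrable_continuous_real continuous_intros)
      finally show ?thesis .
    qed
    moreover have "(1 + real d') * zonal_moment d' 2 = zonal_moment d' 0"
      using zonal_moment_rec[OF 3(2), of 0] by (simp add: numeral_2_eq_2)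
    ultimately have z: "(1 + real d') * zonal_moment (d' + 2) 0 = real d' * zonal_moment d' 0"
      by (simp only: right_diff_distrib) (simp add: algebra_simps)
    have o: "omega d' = omega (d' - 1) * zonal_moment d' 0" using less.IH[of d'] 3 by simp
    have "d - 1 = (d' - 1) + 2" using 3 by simp
    hence o2: "omega (d - 1) * real d' = omega (d' - 1) * (2 * pi)" using omega_add_2[of "d' - 1"] 3 by (simp add: of_nat_diff)
    have "(1 + real d') * real d' * omega d = real d' * omega (d' - 1) * zonal_moment d' 0 * (2 * pi)"
      using 3(2) unfolding 3(1) omega_add_2 o by (simp add: field_simps)
    also have "\<dots> = (omega (d' - 1) * (2 * pi)) * (real d' * zonal_moment d' 0)" by simp
    also have "\<dots> = (omega (d - 1) * real d') * ((1 + real d') * zonal_moment (d' + 2) 0)" unfolding o2 z ..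
    finally have "(1 + real d') * real d' * omega d = (1 + real d') * real d' * (omega (d - 1) * zonal_moment d 0)"
      using 3 by (simp add: mult_ac)
    thus ?thesis using 3 by simp
  qed
qed

text \<open>Both sides satisfy the same two-step recursion in m and agree for m = 0 and m = 1. On
  the sphere, even m follow from ratios of Gaussian moments, and odd ones vanish under x ->
  -x.\<close>

lemma sphere_zonal_moment:
  fixes e :: "real ^ 'n::{finite,wellorder}"
  assumes e: "norm e = 1" and n: "CARD('n) \<ge> 2"
  defines "d \<equiv> CARD('n) - 1"
  shows "(\<integral>x. (x \<bullet> e) ^ m \<partial>sphere_surface) = omega (d - 1) * zonal_moment d m"
proof -
  have d: "d \<ge> 1" "CARD('n) = d + 1" using n by (auto simp: d_def)
  define M where "M = (\<lambda>m. \<integral>x. (x \<bullet> e) ^ m \<partial>(sphere_surface :: (real, 'n) vec measure))"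
  have rec: "(real m + 1 + real d) * M (m + 2) = (real m + 1) * M m" for m
  proof (cases "even m")
    case True
    then obtain j where j: "m = 2 * j" by (elim evenE)
    obtain b :: "(real, 'n) vec" where b: "b \<in> Basis" using nonempty_Basis by blast
    \<comment> \<open>The Gaussian computation concerns coordinate directions; an orthogonal map
      carries one of them to \<open>e\<close>.\<close>
    obtain T where T: "orthogonal_transformation T" "T b = e"
      using orthogonal_transformation_exists[of b e] e b by auto
    have Mb: "M k = (\<integral>x. (x \<bullet> b) ^ k \<partial>sphere_surface)" for k
    proof -
      have "M k = (\<integral>x. (T x \<bullet> e) ^ k \<partial>sphere_surface)" unfolding M_def
        by (rule integral_sphere_surface_orthogonal[OF T(1), symmetric]) measurable
      also have "(\<lambda>x. T x \<bullet> e) = (\<lambda>x. x \<bullet> b)"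
        using T unfolding orthogonal_transformation_def by auto
      finally show ?thesis by (simp add: fun_eq_iff)
    qed
    have s: "M (2 * j) * ((1 / sqrt (2 * pi)) ^ d * gauss_moment (2 * j + d)) = 2 * gauss_moment (2 * j)" for j
      using sphere_even_moment[OF b, of j] d by (simp add: Mb)
    have g1: "gauss_moment (2 * Suc j + d) = (real m + 1 + real d) * gauss_moment (2 * j + d)"
      using gauss_moment_rec[of "2 * j + d"] by (simp add: j add_ac)
    have g2: "gauss_moment (2 * Suc j) = (real m + 1) * gauss_moment (2 * j)"
      using gauss_moment_rec[of "2 * j"] by (simp add: j)
    define K where "K = (1 / sqrt (2 * pi)) ^ d * gauss_moment (2 * j + d)"
    have K: "K > 0" using gauss_moment_pos[of "2 * j + d"] by (simp add: K_def)
    have "(real m + 1 + real d) * M (m + 2) * K = 2 * ((real m + 1) * gauss_moment (2 * j))"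
      using s[of "Suc j"] unfolding g1 g2 K_def by (simp add: j mult_ac)
    also have "\<dots> = (real m + 1) * (2 * gauss_moment (2 * j))" by simp
    also have "\<dots> = (real m + 1) * M m * K"
      unfolding s[symmetric] K_def j by simp
    finally show ?thesis using K by simp
  next
    case False
    have z: "M k = 0" if "odd k" for k
    proof -
      have "orthogonal_transformation (\<lambda>x :: (real, 'n) vec. - x)"
        by (simp add: orthogonal_transformation_def linear_iff)
      from integral_sphere_surface_orthogonal[OF this, of "\<lambda>x. (x \<bullet> e) ^ k"]
      have "(\<integral>x. ((- x) \<bullet> e) ^ k \<partial>(sphere_surface :: (real, 'n) vec measure)) = M k" by (simp add: M_def)
      thus ?thesis using that by (simp add: M_def power_minus_odd)
    qed
    show ?thesis using z[of m] z[of "m + 2"] False by simp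
  qed
  have M0: "M 0 = omega d" unfolding M_def d_def power_0 integral_sphere_surface_const by simp
  have M1: "M 1 = 0"
  proof -
    have "(\<integral>x. (\<lambda>_. 1) (x \<bullet> 0) * (x \<bullet> e) \<partial>sphere_surface) = 0"
      by (rule sphere_odd_moment_orthogonal[where F="\<lambda>_. 1" and mu=0]) auto
    thus ?thesis by (simp add: M_def)
  qed
  have "M m = omega (d - 1) * zonal_moment d m"
  proof (induction m rule: less_induct)
    case (less m)
    consider "m = 0" | "m = 1" | m' where "m = m' + 2" by (metis One_nat_def Suc_1 add_2_eq_Suc' not0_implies_Suc)
    thus ?case
    proof cases
      case 1
      thus ?thesis using M0 omega_zonal_moment[OF d(1)] by simp
    next
      case 2
      thus ?thesis using M1 zonal_moment_1[OF d(1)] by simp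
    next
      case 3
      have "(real m' + 1 + real d) * M m = (real m' + 1 + real d) * (omega (d - 1) * zonal_moment d m)"
        using rec[of m'] zonal_moment_rec[OF d(1), of m'] less.IH[of m'] 3 by (simp add: mult_ac)
      moreover have "real m' + 1 + real d > 0" by simp
      ultimately show ?thesis by (metis less_irrefl mult_left_cancel)
    qed
  qed
  thus ?thesis by (simp add: M_def)
qed

text \<open>Both sides are linear in F and agree on monomials. By the Weierstrass theorem it remains
  to bound them by the supremum of |F| on [-1, 1]: the left side has mass omega d, the right side at
  most omega (d - 1) times pi because |sin| <= 1.\<close>

lemma integral_sphere_zonal:
  fixes e :: "real ^ 'n::{finite,wellorder}" and F :: "real \<Rightarrow> real"
  assumes e: "norm e = 1" and n: "CARD('n) \<ge> 2"
    and F [measurable]: "F \<in> borel_measurable borel" and cont: "continuous_on {-1..1} F"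
  defines "d \<equiv> CARD('n) - 1"
  shows "(\<integral>x. F (x \<bullet> e) \<partial>sphere_surface) = omega (d - 1) * integral {0..pi} (\<lambda>\<theta>. F (cos \<theta>) * sin \<theta> ^ (d - 1))"
proof -
  define L :: "(real \<Rightarrow> real) \<Rightarrow> real" where "L = (\<lambda>F. \<integral>x. F (x \<bullet> e) \<partial>sphere_surface)"
  define R :: "(real \<Rightarrow> real) \<Rightarrow> real" where "R = (\<lambda>F. omega (d - 1) * integral {0..pi} (\<lambda>\<theta>. F (cos \<theta>) * sin \<theta> ^ (d - 1)))"
  have contR: "continuous_on {0..pi} (\<lambda>\<theta>. G (cos \<theta>) * sin \<theta> ^ (d - 1))" if "continuous_on {-1..1} G" for G :: "real \<Rightarrow> real"
    by (intro continuous_intros continuous_on_compose2[OF that]) auto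
  have poly: "L p = R p" if p: "real_polynomial_function p" for p
  proof -
    obtain a N where p: "p = (\<lambda>x. \<Sum>i\<le>N. a i * x ^ i)" using p by (auto simp: real_polynomial_function_iff_sum)
    have "L p = (\<Sum>i\<le>N. a i * (\<integral>x. (x \<bullet> e) ^ i \<partial>(sphere_surface :: (real, 'n) vec measure)))"
      unfolding L_def p using integrable_sphere_surface_power[of e]
      by (subst Bochner_Integration.integral_sum) auto
    also have "\<dots> = (\<Sum>i\<le>N. a i * (omega (d - 1) * zonal_moment d i))"
      unfolding d_def by (simp only: sphere_zonal_moment[OF e n])
    also have "\<dots> = R p"
    proof -
      have "(\<lambda>\<theta>. p (cos \<theta>) * sin \<theta> ^ (d - 1)) = (\<lambda>\<theta>. \<Sum>i\<le>N. a i * (cos \<theta> ^ i * sin \<theta> ^ (d - 1)))"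
        unfolding p by (simp only: sum_distrib_right mult.assoc)
      hence "R p = omega (d - 1) * (\<Sum>i\<le>N. integral {0..pi} (\<lambda>\<theta>. a i * (cos \<theta> ^ i * sin \<theta> ^ (d - 1))))"
        unfolding R_def
        by (simp only:) (subst integral_sum, auto intro!: integrable_continuous_real continuous_intros)
      thus ?thesis by (simp add: zonal_moment_def sum_distrib_left mult_ac)
    qed
    finally show ?thesis .
  qed
  have close: "\<bar>L F - R F\<bar> \<le> \<epsilon> * (omega d + omega (d - 1) * pi)" if \<epsilon>: "\<epsilon> > 0" for \<epsilon>
  proof -
    obtain p where p: "real_polynomial_function p" "\<And>t. t \<in> {-1..1} \<Longrightarrow> \<bar>F t - p t\<bar> < \<epsilon>"
      using Stone_Weierstrass_real_polynomial_function[OF compact_Icc cont \<epsilon>] by auto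
    have pc: "continuous_on A p" for A
      using p(1) by (simp add: continuous_on_polymonial_function real_polynomial_function_eq)
    have pm [measurable]: "p \<in> borel_measurable borel" using pc by (intro borel_measurable_continuous_onI)
    have in1: "x \<bullet> e \<in> {-1..1}" if "norm x = 1" for x using abs_inner_le_1[OF that e] by auto
    have ib: "integrable sphere_surface (\<lambda>x. G (x \<bullet> e))" if "continuous_on {-1..1} G" and [measurable]: "G \<in> borel_measurable borel" for G :: "real \<Rightarrow> real"
    proof -
      have "bounded (G ` {-1..1})" using that by (intro compact_imp_bounded compact_continuous_image) auto
      then obtain B where "\<forall>y\<in>G ` {-1..1}. norm y \<le> B" unfolding bounded_iff by blast
      hence "\<And>t. t \<in> {-1..1} \<Longrightarrow> \<bar>G t\<bar> \<le> B" by auto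
      thus ?thesis using in1 by (intro integrable_sphere_surface[of _ B]) auto
    qed
    have "\<bar>L F - L p\<bar> = \<bar>\<integral>x. F (x \<bullet> e) - p (x \<bullet> e) \<partial>sphere_surface\<bar>"
      unfolding L_def using ib[OF cont F] ib[OF pc pm] by simp
    also have "\<dots> \<le> (\<integral>x. \<bar>F (x \<bullet> e) - p (x \<bullet> e)\<bar> \<partial>sphere_surface)" by (rule integral_abs_bound)
    also have "\<dots> \<le> (\<integral>x. \<epsilon> \<partial>(sphere_surface :: (real, 'n) vec measure))"
    proof (rule integral_mono_AE)
      show "integrable sphere_surface (\<lambda>x. \<bar>F (x \<bullet> e) - p (x \<bullet> e)\<bar>)"
        using ib[OF cont F] ib[OF pc pm] by auto
      show "integrable (sphere_surface :: (real, 'n) vec measure) (\<lambda>x. \<epsilon>)" by (rule integrable_sphere_surface) auto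
      show "AE x in sphere_surface. \<bar>F (x \<bullet> e) - p (x \<bullet> e)\<bar> \<le> \<epsilon>"
        using AE_sphere_surface_norm by eventually_elim (use p(2) in1 less_imp_le in blast)
    qed
    also have "\<dots> = \<epsilon> * omega d" by (simp only: integral_sphere_surface_const d_def) simp
    finally have 1: "\<bar>L F - L p\<bar> \<le> \<epsilon> * omega d" .
    have "R F - R p = omega (d - 1) * integral {0..pi} (\<lambda>\<theta>. F (cos \<theta>) * sin \<theta> ^ (d - 1) - p (cos \<theta>) * sin \<theta> ^ (d - 1))"
      unfolding R_def using contR[OF cont] contR[OF pc]
      by (subst integral_diff) (auto intro!: integrable_continuous_real simp: algebra_simps)
    moreover have "norm (integral {0..pi} (\<lambda>\<theta>. F (cos \<theta>) * sin \<theta> ^ (d - 1) - p (cos \<theta>) * sin \<theta> ^ (d - 1))) \<le> \<epsilon> * (pi - 0)"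
    proof (rule integral_bound)
      show "continuous_on {0..pi} (\<lambda>\<theta>. F (cos \<theta>) * sin \<theta> ^ (d - 1) - p (cos \<theta>) * sin \<theta> ^ (d - 1))"
        by (intro continuous_on_diff contR cont pc)
      fix \<theta> :: real
      have "\<bar>F (cos \<theta>) - p (cos \<theta>)\<bar> * \<bar>sin \<theta> ^ (d - 1)\<bar> \<le> \<epsilon> * 1"
        using p(2)[of "cos \<theta>"] by (intro mult_mono) (auto simp: power_abs power_le_one)
      thus "norm (F (cos \<theta>) * sin \<theta> ^ (d - 1) - p (cos \<theta>) * sin \<theta> ^ (d - 1)) \<le> \<epsilon>"
        by (simp add: abs_mult flip: left_diff_distrib)
    qed simp
    ultimately have 2: "\<bar>R F - R p\<bar> \<le> omega (d - 1) * (\<epsilon> * pi)"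
      using omega_pos[of "d - 1"] by (simp add: abs_mult)
    show ?thesis using 1 2 poly[OF p(1)] by (simp add: algebra_simps)
  qed
  have "\<bar>L F - R F\<bar> \<le> 0"
  proof (rule field_le_epsilon)
    fix \<epsilon> :: real assume \<epsilon>: "\<epsilon> > 0"
    define c where "c = omega d + omega (d - 1) * pi"
    have c: "c > 0" using omega_pos[of d] omega_pos[of "d - 1"] by (simp add: c_def add_pos_pos)
    from close[of "\<epsilon> / c"] show "\<bar>L F - R F\<bar> \<le> 0 + \<epsilon>"
      unfolding c_def[symmetric] using \<epsilon> c by simp
  qed
  thus ?thesis by (simp add: L_def R_def)
qed

section \<open>Characteristic functions and convergence in distribution\<close>

text \<open>The class on which convergence of characteristic functions carries over to expectations
  by linearity. It is closed under products, so polynomials in sines of linear forms belong to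
  it.\<close>

inductive trig_poly :: "('a::euclidean_space \<Rightarrow> complex) \<Rightarrow> bool" where
  trig_poly_base: "trig_poly (\<lambda>x. c * iexp (t \<bullet> x))"
| trig_poly_add: "trig_poly f \<Longrightarrow> trig_poly g \<Longrightarrow> trig_poly (\<lambda>x. f x + g x)"

lemma trig_poly_const: "trig_poly (\<lambda>x. c)"
  using trig_poly_base[of c 0] by simp

lemma trig_poly_mult:
  assumes "trig_poly f" "trig_poly g"
  shows "trig_poly (\<lambda>x. f x * g x)"
  using assms
proof (induction f)
  case (trig_poly_base c t)
  from this show ?case
  proof (induction g)
    case (trig_poly_base c' t')
    have "c * iexp (t \<bullet> x) * (c' * iexp (t' \<bullet> x)) = (c * c') * iexp ((t + t') \<bullet> x)" for x
      by (simp add: exp_add ring_distribs inner_add_left)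
    thus ?case by (simp only: trig_poly.trig_poly_base)
  qed (simp add: ring_distribs trig_poly.trig_poly_add)
qed (simp add: ring_distribs trig_poly.trig_poly_add)

lemma trig_poly_sum: "(\<And>i. i \<in> I \<Longrightarrow> trig_poly (f i)) \<Longrightarrow> trig_poly (\<lambda>x. \<Sum>i\<in>I. f i x)"
  by (induction I rule: infinite_finite_induct) (auto intro: trig_poly_const trig_poly_add)

lemma trig_poly_sin: "trig_poly (\<lambda>x. complex_of_real (sin (t \<bullet> x)))"
proof -
  have "complex_of_real (sin (t \<bullet> x)) = (1 / (2 * \<i>)) * iexp (t \<bullet> x) + (- 1 / (2 * \<i>)) * iexp ((- t) \<bullet> x)" for x
    by (simp add: sin_exp_eq sin_of_real[symmetric] field_simps)
  thus ?thesis by (simp only:) (intro trig_poly.intros)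
qed

lemma trig_poly_real_polynomial_sin:
  fixes P :: "'a::euclidean_space \<Rightarrow> real"
  assumes "real_polynomial_function P"
  shows "trig_poly (\<lambda>x. complex_of_real (P (\<Sum>b\<in>Basis. sin (s * (x \<bullet> b)) *\<^sub>R b)))"
  using assms
proof (induction P)
  case (linear f)
  interpret f: bounded_linear f by fact
  have "complex_of_real (f (\<Sum>b\<in>Basis. sin (s * (x \<bullet> b)) *\<^sub>R b)) =
     (\<Sum>b\<in>Basis. complex_of_real (sin ((s *\<^sub>R b) \<bullet> x)) * complex_of_real (f b))" for x
    by (simp add: f.sum f.scaleR inner_commute)
  thus ?case by (simp only:) (intro trig_poly_sum trig_poly_mult trig_poly_sin trig_poly_const)
qed (auto intro: trig_poly_const trig_poly_add trig_poly_mult)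

lemma trig_poly_bounded_measurable:
  assumes "trig_poly f"
  shows "(\<exists>B. \<forall>x. norm (f x) \<le> B) \<and> f \<in> borel_measurable borel"
  using assms
proof (induction f)
  case (trig_poly_base c t)
  show ?case
    by (intro conjI exI[of _ "norm c"]) (simp_all add: norm_mult)
next
  case (trig_poly_add f g)
  then obtain B C where "\<And>x. norm (f x) \<le> B" "\<And>x. norm (g x) \<le> C" by blast
  hence "norm (f x + g x) \<le> B + C" for x by (meson norm_triangle_mono)
  thus ?case using trig_poly_add by auto
qed

lemma trig_poly_integral_tendsto:
  fixes Z :: "nat \<Rightarrow> 'w \<Rightarrow> 'a::euclidean_space"
  assumes "prob_space M" "prob_space N" and [measurable_cong]: "sets N = sets borel"
    and [measurable]: "\<And>n. Z n \<in> borel_measurable M"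
    and char: "\<And>t. (\<lambda>n. \<integral>w. iexp (t \<bullet> Z n w) \<partial>M) \<longlonglongrightarrow> (\<integral>x. iexp (t \<bullet> x) \<partial>N)"
    and "trig_poly f"
  shows "(\<lambda>n. \<integral>w. f (Z n w) \<partial>M) \<longlonglongrightarrow> (\<integral>x. f x \<partial>N)"
  using \<open>trig_poly f\<close>
proof (induction f)
  case (trig_poly_base c t)
  show ?case using tendsto_mult_left[OF char[of t], of c] by simp
next
  case (trig_poly_add f g)
  interpret M: prob_space M by fact
  interpret N: prob_space N by fact
  have int: "integrable M (\<lambda>w. h (Z n w))" "integrable N h" if "trig_poly h" for h n
  proof -
    obtain B where B: "\<And>x. norm (h x) \<le> B" and [measurable]: "h \<in> borel_measurable borel"
      using trig_poly_bounded_measurable[OF \<open>trig_poly h\<close>] by blast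
    show "integrable M (\<lambda>w. h (Z n w))"
      by (rule M.integrable_const_bound[of _ B]) (use B in auto)
    show "integrable N h"
      by (rule N.integrable_const_bound[of _ B]) (use B in auto)
  qed
  show ?case
    using tendsto_add[OF trig_poly_add.IH] int trig_poly_add.hyps by simp
qed

text \<open>On the unit cube, \<open>y \<mapsto> g (arcsin (y) / s)\<close> (coordinatewise) is uniformly close to a polynomial \<open>P\<close>. Then
  \<open>x \<mapsto> P (sin (s x))\<close> is a trigonometric polynomial that is bounded everywhere and close to \<open>g\<close> on a large cube.\<close>
lemma conv_distr_charI:
  fixes Z :: "nat \<Rightarrow> 'w \<Rightarrow> 'a::euclidean_space"
  assumes pM: "prob_space M" and pN: "prob_space N" and sN [measurable_cong]: "sets N = sets borel"
    and [measurable]: "\<And>n. Z n \<in> borel_measurable M"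
    and char: "\<And>t. (\<lambda>n. \<integral>w. iexp (t \<bullet> Z n w) \<partial>M) \<longlonglongrightarrow> (\<integral>x. iexp (t \<bullet> x) \<partial>N)"
  shows "conv_distr M Z N"
  unfolding conv_distr_def
proof (intro allI impI)
  interpret M: prob_space M by fact
  interpret N: prob_space N by fact
  fix g :: "'a \<Rightarrow> real" assume g: "continuous_on UNIV g \<and> bounded (range g)"
  then obtain B where B: "B > 0" "\<And>x. \<bar>g x\<bar> \<le> B"
    unfolding bounded_pos by (auto simp: image_iff)
  have [measurable]: "g \<in> borel_measurable borel" using g by (intro borel_measurable_continuous_onI) auto
  \<comment> \<open>A continuous cutoff: 0 for |s| <= R / 2 and 1 for |s| >= R. It dominates the
    indicator of the tail, and its expectations converge by the one-dimensional Levy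
    theorem.\<close>
  define h where "h = (\<lambda>R s :: real. min 1 (max 0 (2 * \<bar>s\<bar> / R - 1)))"
  have hm [measurable]: "h R \<in> borel_measurable borel" for R unfolding h_def by measurable
  have h01: "0 \<le> h R s" "h R s \<le> 1" for R s by (auto simp: h_def)
  have h_conv: "(\<lambda>n. \<integral>w. h R (Z n w \<bullet> b) \<partial>M) \<longlonglongrightarrow> (\<integral>x. h R (x \<bullet> b) \<partial>N)" if R: "R > 0" for R b
  proof -
    have rd: "real_distribution (distr M borel (\<lambda>w. Z n w \<bullet> b))" for n
      by (rule M.real_distribution_distr) measurable
    have rdN: "real_distribution (distr N borel (\<lambda>x. x \<bullet> b))"
      by (rule N.real_distribution_distr) measurable
    have "weak_conv_m (\<lambda>n. distr M borel (\<lambda>w. Z n w \<bullet> b)) (distr N borel (\<lambda>x. x \<bullet> b))"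
    proof (rule levy_continuity[OF rd rdN])
      fix t
      have "char (distr M borel (\<lambda>w. Z n w \<bullet> b)) t = (\<integral>w. iexp ((t *\<^sub>R b) \<bullet> Z n w) \<partial>M)" for n
        by (simp add: char_def integral_distr inner_commute)
      moreover have "char (distr N borel (\<lambda>x. x \<bullet> b)) t = (\<integral>x. iexp ((t *\<^sub>R b) \<bullet> x) \<partial>N)"
        by (simp add: char_def integral_distr inner_commute)
      ultimately show "(\<lambda>n. char (distr M borel (\<lambda>w. Z n w \<bullet> b)) t) \<longlonglongrightarrow> char (distr N borel (\<lambda>x. x \<bullet> b)) t"
        using char[of "t *\<^sub>R b"] by simp
    qed
    note * = weak_conv_imp_integral_bdd_continuous_conv[OF rd rdN this, of "h R" 1]
    have "(\<lambda>n. integral\<^sup>L (distr M borel (\<lambda>w. Z n w \<bullet> b)) (h R)) \<longlonglongrightarrow> integral\<^sup>L (distr N borel (\<lambda>x. x \<bullet> b)) (h R)"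
    proof -
      have "continuous_on UNIV (h R)" unfolding h_def using R by (intro continuous_intros) auto
      hence "isCont (h R) x" for x by (simp add: continuous_on_eq_continuous_at)
      moreover have "norm (h R x) \<le> 1" for x using h01[of R x] by simp
      ultimately show ?thesis using * by blast
    qed
    thus ?thesis by (simp add: integral_distr)
  qed
  have h_lim: "(\<lambda>m. \<integral>x. h (real (Suc m)) (x \<bullet> b) \<partial>N) \<longlonglongrightarrow> 0" for b
  proof -
    have "(\<lambda>m. \<integral>x. h (real (Suc m)) (x \<bullet> b) \<partial>N) \<longlonglongrightarrow> (\<integral>x. 0 \<partial>N)"
    proof (rule integral_dominated_convergence[where w="\<lambda>_. 1"])
      show "AE x in N. (\<lambda>m. h (real (Suc m)) (x \<bullet> b)) \<longlonglongrightarrow> 0"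
      proof (rule AE_I2)
        fix x :: 'a
        obtain m0 where m0: "2 * \<bar>x \<bullet> b\<bar> \<le> real m0" using real_arch_simple by blast
        have "h (real (Suc m)) (x \<bullet> b) = 0" if "m \<ge> m0" for m
        proof -
          have "2 * \<bar>x \<bullet> b\<bar> \<le> real (Suc m)" using m0 that by simp
          thus ?thesis by (simp add: h_def divide_le_eq del: of_nat_Suc)
        qed
        thus "(\<lambda>m. h (real (Suc m)) (x \<bullet> b)) \<longlonglongrightarrow> 0"
          by (intro tendsto_eventually eventually_sequentiallyI[of m0])
      qed
    qed (use h01 in \<open>auto simp: abs_of_nonneg\<close>)
    thus ?thesis by simp
  qed
  show "(\<lambda>n. \<integral>w. g (Z n w) \<partial>M) \<longlonglongrightarrow> integral\<^sup>L N g"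
  proof (rule LIMSEQ_I)
    fix r :: real assume r: "r > 0"
    define e where "e = r / 4"
    have e: "e > 0" using r by (simp add: e_def)
    have "(\<lambda>m. \<Sum>b\<in>Basis. (\<integral>x. h (real (Suc m)) ((x::'a) \<bullet> b) \<partial>N)) \<longlonglongrightarrow> (\<Sum>b\<in>(Basis :: 'a set). 0 :: real)"
      by (intro tendsto_sum h_lim)
    \<comment> \<open>The tail enters with the factor 2 B, so this threshold limits its contribution
      to e / 2.\<close>
    hence "eventually (\<lambda>m. (\<Sum>b\<in>Basis. (\<integral>x. h (real (Suc m)) ((x::'a) \<bullet> b) \<partial>N)) < e / (4 * B)) sequentially"
      using e B(1) by (intro order_tendstoD(2)[of _ 0]) auto
    then obtain m where m: "(\<Sum>b\<in>Basis. (\<integral>x. h (real (Suc m)) ((x::'a) \<bullet> b) \<partial>N)) < e / (4 * B)"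
      by (auto simp: eventually_sequentially)
    define R where "R = real (Suc m)"
    have R: "R > 0" by (simp add: R_def)
    \<comment> \<open>This scale maps [-R, R] onto [-pi/2, pi/2], where arcsin inverts sin.\<close>
    define s where "s = pi / (2 * R)"
    have s: "s > 0" using R by (simp add: s_def)
    define \<phi> :: "'a \<Rightarrow> 'a" where "\<phi> = (\<lambda>x. \<Sum>b\<in>Basis. sin (s * (x \<bullet> b)) *\<^sub>R b)"
    define G :: "'a \<Rightarrow> real" where "G = (\<lambda>y. g (\<Sum>b\<in>Basis. (arcsin (y \<bullet> b) / s) *\<^sub>R b))"
    have \<phi>b: "\<phi> x \<bullet> b = sin (s * (x \<bullet> b))" if "b \<in> Basis" for x b
      using that by (simp add: \<phi>_def inner_sum_left inner_Basis if_distrib cong: if_cong)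
    have \<phi>box: "\<phi> x \<in> cbox (-One) One" for x by (simp add: mem_box \<phi>b)
    have Gcont: "continuous_on (cbox (-One) One) G"
      unfolding G_def
    proof (rule continuous_on_compose2[of UNIV g])
      show "continuous_on (cbox (- One) One) (\<lambda>x::'a. \<Sum>b\<in>Basis. (arcsin (x \<bullet> b) / s) *\<^sub>R b)"
        using s by (intro continuous_intros) (auto simp: mem_box)
    qed (use g in auto)
    obtain P where P: "real_polynomial_function P" "\<And>y. y \<in> cbox (-One) One \<Longrightarrow> \<bar>G y - P y\<bar> < e / 2"
      using Stone_Weierstrass_real_polynomial_function[OF compact_cbox Gcont, of "e / 2"] e by auto
    have G\<phi>: "G (\<phi> x) = g x" if bd: "\<And>b. b \<in> Basis \<Longrightarrow> \<bar>x \<bullet> b\<bar> \<le> R" for x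
    proof -
      have "arcsin (\<phi> x \<bullet> b) / s = x \<bullet> b" if b: "b \<in> Basis" for b
      proof -
        have "\<bar>s * (x \<bullet> b)\<bar> \<le> s * R" using bd[OF b] s by (simp add: abs_mult)
        hence "\<bar>s * (x \<bullet> b)\<bar> \<le> pi / 2" using R by (simp add: s_def)
        hence "arcsin (sin (s * (x \<bullet> b))) = s * (x \<bullet> b)" by (intro arcsin_sin) auto
        thus ?thesis using s b by (simp add: \<phi>b)
      qed
      hence "(\<Sum>b\<in>Basis. (arcsin (\<phi> x \<bullet> b) / s) *\<^sub>R b) = (\<Sum>b\<in>Basis. (x \<bullet> b) *\<^sub>R b)" by simp
      thus ?thesis by (simp add: G_def euclidean_representation)
    qed
    define H where "H = (\<lambda>x::'a. \<Sum>b\<in>Basis. h R (x \<bullet> b))"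
    have Hm [measurable]: "H \<in> borel_measurable borel" unfolding H_def by measurable
    have H0: "H x \<ge> 0" for x by (simp add: H_def h01 sum_nonneg)
    have HD: "\<bar>H x\<bar> \<le> real DIM('a)" for x
      using sum_bounded_above[of Basis "\<lambda>b. h R (x \<bullet> b)" 1] H0[of x] h01 by (simp add: H_def)
    \<comment> \<open>Inside the cube only the polynomial error counts. Outside it H x >= 1, and
      since G is bounded by B as well, the trivial bound 2 B is absorbed by
      \<open>2 * B * H x\<close>.\<close>
    have gP: "\<bar>g x - P (\<phi> x)\<bar> \<le> e / 2 + 2 * B * H x" for x
    proof (cases "\<forall>b\<in>Basis. \<bar>x \<bullet> b\<bar> \<le> R")
      case True
      have "2 * B * H x \<ge> 0" using B(1) H0[of x] by simp
      thus ?thesis using P(2)[OF \<phi>box[of x]] G\<phi>[of x] True by auto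
    next
      case False
      then obtain b where b: "b \<in> Basis" "\<bar>x \<bullet> b\<bar> > R" by force
      have "2 * \<bar>x \<bullet> b\<bar> / R \<ge> 2" using b R by (simp add: le_divide_eq)
      hence "h R (x \<bullet> b) = 1" by (simp add: h_def)
      hence "H x \<ge> 1" unfolding H_def using member_le_sum[of b Basis "\<lambda>b. h R (x \<bullet> b)"] b h01 by auto
      hence "2 * B * H x \<ge> 2 * B" using B(1) by simp
      moreover have "\<bar>G (\<phi> x)\<bar> \<le> B" by (simp add: G_def B)
      ultimately show ?thesis using P(2)[OF \<phi>box[of x]] B(2)[of x] by linarith
    qed
    define Q where "Q = (\<lambda>x. P (\<phi> x))"
    have tp: "trig_poly (\<lambda>x. complex_of_real (Q x))"
      unfolding Q_def \<phi>_def by (rule trig_poly_real_polynomial_sin[OF P(1)])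
    obtain BQ where BQ: "\<And>x. \<bar>Q x\<bar> \<le> BQ" and Qm': "(\<lambda>x. complex_of_real (Q x)) \<in> borel_measurable borel"
      using trig_poly_bounded_measurable[OF tp] by auto
    have Qm [measurable]: "Q \<in> borel_measurable borel" using measurable_compose[OF Qm' borel_measurable_Re] by simp
    have "(\<lambda>n. \<integral>w. complex_of_real (Q (Z n w)) \<partial>M) \<longlonglongrightarrow> (\<integral>x. complex_of_real (Q x) \<partial>N)"
      by (rule trig_poly_integral_tendsto[OF pM pN sN _ char tp]) measurable
    hence Qlim: "(\<lambda>n. \<integral>w. Q (Z n w) \<partial>M) \<longlonglongrightarrow> (\<integral>x. Q x \<partial>N)"
      unfolding integral_complex_of_real by (rule tendsto_of_real_iff[THEN iffD1])
    have intM: "integrable M (\<lambda>w. g (Z n w))" "integrable M (\<lambda>w. Q (Z n w))" "integrable M (\<lambda>w. H (Z n w))"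
         "integrable M (\<lambda>w. h R (Z n w \<bullet> b))" for n b
      by (rule M.integrable_const_bound[of _ B] M.integrable_const_bound[of _ BQ] M.integrable_const_bound[of _ "real DIM('a)"]
           M.integrable_const_bound[of _ 1], use B BQ HD h01 in \<open>auto simp: abs_of_nonneg\<close>)+
    have intN: "integrable N g" "integrable N Q" "integrable N H" "integrable N (\<lambda>x. h R (x \<bullet> b))" for b
      by (rule N.integrable_const_bound[of _ B] N.integrable_const_bound[of _ BQ] N.integrable_const_bound[of _ "real DIM('a)"]
           N.integrable_const_bound[of _ 1], use B BQ HD h01 in \<open>auto simp: abs_of_nonneg\<close>)+
    have 1: "\<bar>(\<integral>w. g (Z n w) \<partial>M) - (\<integral>w. Q (Z n w) \<partial>M)\<bar> \<le> e / 2 + 2 * B * (\<integral>w. H (Z n w) \<partial>M)" for n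
    proof -
      have "\<bar>(\<integral>w. g (Z n w) \<partial>M) - (\<integral>w. Q (Z n w) \<partial>M)\<bar> = \<bar>\<integral>w. g (Z n w) - Q (Z n w) \<partial>M\<bar>"
        using intM by simp
      also have "\<dots> \<le> (\<integral>w. \<bar>g (Z n w) - Q (Z n w)\<bar> \<partial>M)" by (rule integral_abs_bound)
      also have "\<dots> \<le> (\<integral>w. e / 2 + 2 * B * H (Z n w) \<partial>M)"
        using intM gP by (intro integral_mono) (auto simp: Q_def)
      also have "\<dots> = e / 2 + 2 * B * (\<integral>w. H (Z n w) \<partial>M)"
        using intM by (simp add: M.prob_space)
      finally show ?thesis .
    qed
    have 2: "\<bar>(\<integral>x. g x \<partial>N) - (\<integral>x. Q x \<partial>N)\<bar> \<le> e / 2 + 2 * B * (\<integral>x. H x \<partial>N)"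
    proof -
      have "\<bar>(\<integral>x. g x \<partial>N) - (\<integral>x. Q x \<partial>N)\<bar> = \<bar>\<integral>x. g x - Q x \<partial>N\<bar>"
        using intN by simp
      also have "\<dots> \<le> (\<integral>x. \<bar>g x - Q x\<bar> \<partial>N)" by (rule integral_abs_bound)
      also have "\<dots> \<le> (\<integral>x. e / 2 + 2 * B * H x \<partial>N)"
        using intN gP by (intro integral_mono) (auto simp: Q_def)
      also have "\<dots> = e / 2 + 2 * B * (\<integral>x. H x \<partial>N)"
        using intN by (simp add: N.prob_space)
      finally show ?thesis .
    qed
    have "(\<lambda>n. \<Sum>b\<in>Basis. (\<integral>w. h R (Z n w \<bullet> b) \<partial>M)) \<longlonglongrightarrow> (\<Sum>b\<in>Basis. (\<integral>x. h R (x \<bullet> b) \<partial>N))"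
      by (intro tendsto_sum h_conv R)
    hence Hlim: "(\<lambda>n. \<integral>w. H (Z n w) \<partial>M) \<longlonglongrightarrow> (\<integral>x. H x \<partial>N)"
      unfolding H_def using intM intN by simp
    have HN: "(\<integral>x. H x \<partial>N) < e / (4 * B)"
      using m intN by (simp add: H_def R_def)
    have ev1: "eventually (\<lambda>n. (\<integral>w. H (Z n w) \<partial>M) < e / (4 * B)) sequentially"
      by (rule order_tendstoD(2)[OF Hlim HN])
    have ev2: "eventually (\<lambda>n. \<bar>(\<integral>w. Q (Z n w) \<partial>M) - (\<integral>x. Q x \<partial>N)\<bar> < e) sequentially"
      using tendstoD[OF Qlim e] by (simp add: dist_real_def)
    from ev1 ev2 have "eventually (\<lambda>n. norm ((\<integral>w. g (Z n w) \<partial>M) - integral\<^sup>L N g) < r) sequentially"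
    proof eventually_elim
      case (elim n)
      have "2 * B * (\<integral>w. H (Z n w) \<partial>M) < e / 2" "2 * B * (\<integral>x. H x \<partial>N) < e / 2"
        using elim(1) HN B(1) by (simp_all add: field_simps)
      moreover have "r = 4 * e" by (simp add: e_def)
      ultimately show ?case using 1[of n] 2 elim(2) e unfolding real_norm_def by linarith
    qed
    thus "\<exists>no. \<forall>n\<ge>no. norm ((\<integral>w. g (Z n w) \<partial>M) - integral\<^sup>L N g) < r"
      by (simp add: eventually_sequentially)
  qed
qed

section \<open>Gaussian measures and their characteristic functions\<close>

lemma std_gauss_altdef:
  "(std_gauss :: 'a::euclidean_space measure) = density lborel (\<lambda>x. ennreal (\<Prod>b\<in>Basis. std_normal_density (x \<bullet> b)))"
proof -
  have "(2 * pi) powr (- real DIM('a) / 2) = (1 / sqrt (2 * pi)) ^ DIM('a)"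
  proof -
    have "(2 * pi) powr (- real DIM('a) / 2) = ((2 * pi) powr - (1 / 2)) powr real DIM('a)" by (simp add: powr_powr)
    also have "\<dots> = ((2 * pi) powr - (1 / 2)) ^ DIM('a)" by (rule powr_realpow) simp
    also have "(2 * pi) powr - (1 / 2) = 1 / sqrt (2 * pi)"
      unfolding powr_minus_divide by (subst powr_half_sqrt) simp_all
    finally show ?thesis .
  qed
  thus ?thesis unfolding std_gauss_def prod_std_normal_density by simp
qed

lemma sets_std_gauss [simp, measurable_cong]: "sets std_gauss = sets borel"
  by (simp add: std_gauss_def)

lemma space_std_gauss [simp]: "space std_gauss = UNIV"
  by (simp add: std_gauss_def)

lemma prob_space_std_gauss: "prob_space (std_gauss :: 'a::euclidean_space measure)"
proof (rule prob_spaceI)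
  have "emeasure (std_gauss :: 'a measure) UNIV = (\<integral>\<^sup>+x. ennreal (\<Prod>b\<in>Basis. std_normal_density (x \<bullet> b)) \<partial>(lborel :: 'a measure))"
    unfolding std_gauss_altdef by (subst emeasure_density) auto
  also have "\<dots> = (\<integral>\<^sup>+x. (\<Prod>b\<in>Basis. ennreal (std_normal_density (x \<bullet> b))) \<partial>(lborel :: 'a measure))"
    by (subst prod_ennreal) auto
  also have "\<dots> = (\<Prod>b\<in>(Basis::'a set). \<integral>\<^sup>+y. ennreal (std_normal_density y) \<partial>lborel)"
    by (rule nn_integral_lborel_prod) auto
  also have "(\<integral>\<^sup>+y. ennreal (std_normal_density y) \<partial>lborel) = 1"
    using nn_integral_gauss_moment[of 0] integral_std_normal_moment_even[of 0] by (simp add: gauss_moment_def)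
  finally show "emeasure (std_gauss :: 'a measure) (space std_gauss) = 1" by simp
qed

lemma char_std_gauss:
  fixes u :: "'a::euclidean_space"
  shows "(\<integral>x. iexp (u \<bullet> x) \<partial>std_gauss) = complex_of_real (exp (- (norm u)\<^sup>2 / 2))"
proof -
  interpret product_sigma_finite "\<lambda>_::'a. lborel :: real measure" by standard
  let ?f = "\<lambda>b y. complex_of_real (std_normal_density y) * iexp ((u \<bullet> b) * y)"
  have int: "integrable lborel (?f b)" for b
  proof (rule Bochner_Integration.integrable_bound)
    show "integrable lborel (\<lambda>y. std_normal_density y * y ^ 0)" by (rule integrable_std_normal_moment)
  qed (auto simp: norm_mult)
  have char1: "(\<integral>y. ?f b y \<partial>lborel) = complex_of_real (exp (- (u \<bullet> b)\<^sup>2 / 2))" for b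
  proof -
    have "(\<integral>y. ?f b y \<partial>lborel) = char std_normal_distribution (u \<bullet> b)"
      unfolding char_def by (subst integral_density) (auto simp: scaleR_conv_of_real)
    thus ?thesis by (simp add: char_std_normal_distribution)
  qed
  have "(\<integral>x. iexp (u \<bullet> x) \<partial>std_gauss) = (\<integral>x. (\<Prod>b\<in>Basis. std_normal_density (x \<bullet> b)) *\<^sub>R iexp (u \<bullet> x) \<partial>lborel)"
    unfolding std_gauss_altdef by (subst integral_density) (auto intro!: prod_nonneg)
  also have "\<dots> = (\<integral>x. (\<Prod>b\<in>Basis. ?f b (x \<bullet> b)) \<partial>lborel)"
  proof (rule Bochner_Integration.integral_cong[OF refl])
    fix x :: 'a
    have "iexp (u \<bullet> x) = (\<Prod>b\<in>Basis. iexp ((u \<bullet> b) * (x \<bullet> b)))"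
      by (subst euclidean_inner[of u x]) (simp add: exp_sum sum_distrib_left)
    thus "(\<Prod>b\<in>Basis. std_normal_density (x \<bullet> b)) *\<^sub>R iexp (u \<bullet> x) = (\<Prod>b\<in>Basis. ?f b (x \<bullet> b))"
      by (simp add: prod.distrib scaleR_conv_of_real)
  qed
  also have "\<dots> = (\<integral>g. (\<Prod>b\<in>Basis. ?f b ((\<Sum>b'\<in>Basis. g b' *\<^sub>R b') \<bullet> (b::'a))) \<partial>(\<Pi>\<^sub>M b\<in>Basis. lborel))"
    by (subst lborel_eq, subst integral_distr) auto
  also have "\<dots> = (\<integral>g. (\<Prod>b\<in>Basis. ?f b (g (b::'a))) \<partial>(\<Pi>\<^sub>M b\<in>Basis. lborel))"
    by (simp add: inner_sum_left inner_Basis if_distrib cong: if_cong)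
  also have "\<dots> = (\<Prod>b\<in>Basis. \<integral>y. ?f b y \<partial>lborel)"
    by (rule product_integral_prod) (use int in auto)
  also have "\<dots> = complex_of_real (exp (\<Sum>b\<in>Basis. - (u \<bullet> b)\<^sup>2 / 2))"
    unfolding char1 by (simp add: exp_sum)
  also have "(\<Sum>b\<in>Basis. - (u \<bullet> b)\<^sup>2 / 2) = - (norm u)\<^sup>2 / 2"
    unfolding power2_norm_eq_inner euclidean_inner[of u u]
    by (simp add: sum_divide_distrib[symmetric] sum_negf power2_eq_square)
  finally show ?thesis .
qed

lemma sets_gaussian [simp, measurable_cong]: "sets (gaussian Cov) = sets borel"
  by (simp add: gaussian_def)

text \<open>\<open>gaussian\<close> chooses some square root of the covariance. The existence of one
  root makes the choice meaningful, and the law is independent of it because the characteristic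
  function involves only the composition of L with its adjoint.\<close>

lemma
  fixes Cov L :: "'a::euclidean_space \<Rightarrow> 'a"
  assumes "linear L" "L \<circ> adjoint L = Cov"
  shows prob_space_gaussian: "prob_space (gaussian Cov)"
    and char_gaussian: "(\<integral>x. iexp (t \<bullet> x) \<partial>gaussian Cov) = complex_of_real (exp (- (t \<bullet> Cov t) / 2))"
proof -
  define L' :: "'a \<Rightarrow> 'a" where "L' = (SOME L. linear L \<and> L \<circ> adjoint L = Cov)"
  have "linear L' \<and> L' \<circ> adjoint L' = Cov"
    unfolding L'_def by (rule someI[of "\<lambda>L. linear L \<and> L \<circ> adjoint L = Cov" L]) (use assms in simp)
  hence L': "linear L'" "L' \<circ> adjoint L' = Cov" by auto
  have [measurable]: "L' \<in> borel_measurable borel"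
    using L'(1) by (intro borel_measurable_continuous_onI linear_continuous_on linear_conv_bounded_linear[THEN iffD1])
  interpret std: prob_space "std_gauss :: 'a measure" by (rule prob_space_std_gauss)
  have g: "gaussian Cov = distr std_gauss borel L'" by (simp add: gaussian_def L'_def)
  show "prob_space (gaussian Cov)" unfolding g by (rule std.prob_space_distr) simp
  have "(\<integral>x. iexp (t \<bullet> x) \<partial>gaussian Cov) = (\<integral>x. iexp (adjoint L' t \<bullet> x) \<partial>std_gauss)"
    unfolding g by (subst integral_distr) (auto simp: adjoint_works[OF L'(1)] inner_commute)
  also have "\<dots> = complex_of_real (exp (- (norm (adjoint L' t))\<^sup>2 / 2))" by (rule char_std_gauss)
  also have "(norm (adjoint L' t))\<^sup>2 = t \<bullet> Cov t"
    unfolding L'(2)[symmetric] by (simp add: power2_norm_eq_inner adjoint_works[OF L'(1)] inner_commute)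
  finally show "(\<integral>x. iexp (t \<bullet> x) \<partial>gaussian Cov) = complex_of_real (exp (- (t \<bullet> Cov t) / 2))" .
qed

text \<open>For a fixed direction t the statement is one-dimensional. The variance may be zero, as
  it will be in the normal direction of the sphere, and then the summands vanish almost surely;
  otherwise the classical theorem applies.\<close>

lemma (in prob_space) char_clt:
  fixes Y :: "nat \<Rightarrow> 'a \<Rightarrow> 'b::euclidean_space"
  assumes indep: "indep_vars (\<lambda>_. borel) Y UNIV" and distr: "\<And>i. distr M borel (Y i) = D"
    and bdd: "\<And>i w. w \<in> space M \<Longrightarrow> norm (Y i w) \<le> B"
    and mean: "\<And>i. expectation (\<lambda>w. t \<bullet> Y i w) = 0" and var: "\<And>i. expectation (\<lambda>w. (t \<bullet> Y i w)\<^sup>2) = v"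
  shows "(\<lambda>n. \<integral>w. iexp (t \<bullet> ((1 / sqrt (real n)) *\<^sub>R (\<Sum>i<n. Y i w))) \<partial>M) \<longlonglongrightarrow> complex_of_real (exp (- v / 2))"
proof -
  have Ym [measurable]: "Y i \<in> borel_measurable M" for i using indep by (auto simp: indep_vars_def)
  define X where "X = (\<lambda>i w. t \<bullet> Y i w)"
  have Xm [measurable]: "X i \<in> borel_measurable M" for i unfolding X_def by measurable
  have Xb: "\<bar>X i w\<bar> \<le> norm t * B" if "w \<in> space M" for i w
    unfolding X_def using Cauchy_Schwarz_ineq2[of t "Y i w"] bdd[OF that, of i] by (meson mult_left_mono norm_ge_zero order_trans)
  have int2: "integrable M (\<lambda>w. (X i w)\<^sup>2)" for i
  proof (rule integrable_const_bound)
    show "AE w in M. norm ((X i w)\<^sup>2) \<le> (norm t * B)\<^sup>2"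
    proof (rule AE_I2)
      fix w assume "w \<in> space M"
      from power_mono[OF Xb[OF this, of i] abs_ge_zero, of 2] show "norm ((X i w)\<^sup>2) \<le> (norm t * B)\<^sup>2" by simp
    qed
  qed simp
  have eq: "t \<bullet> ((1 / sqrt (real n)) *\<^sub>R (\<Sum>i<n. Y i w)) = (\<Sum>i<n. X i w) / sqrt (real n)" for n w
    by (simp add: X_def inner_sum_right)
  have v0: "v \<ge> 0" unfolding var[of 0, symmetric] by (rule Bochner_Integration.integral_nonneg) simp
  show ?thesis
  proof (cases "v = 0")
    case True
    have "AE w in M. \<forall>i. X i w = 0"
    proof (subst AE_all_countable, rule allI)
      fix i
      have "(\<integral>w. (X i w)\<^sup>2 \<partial>M) = 0" using var[of i] True by (simp add: X_def)
      thus "AE w in M. X i w = 0" using int2[of i] by (subst (asm) integral_nonneg_eq_0_iff_AE) auto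
    qed
    hence "(\<integral>w. iexp (t \<bullet> ((1 / sqrt (real n)) *\<^sub>R (\<Sum>i<n. Y i w))) \<partial>M) = (\<integral>w. 1 \<partial>M)" for n
      unfolding eq by (intro integral_cong_AE) auto
    thus ?thesis using True by (simp add: prob_space)
  next
    case False
    hence v: "v > 0" using v0 by simp
    have indX: "indep_vars (\<lambda>_. borel) X UNIV"
      unfolding X_def by (rule indep_vars_compose2[OF indep]) measurable
    have dX: "distr M borel (X i) = distr D borel ((\<bullet>) t)" for i
      unfolding distr[of i, symmetric] X_def by (subst distr_distr) (auto simp: comp_def)
    \<comment> \<open>The theorem divides by sqrt (n v); evaluating the characteristic function at
      sqrt v restores the scaling by sqrt n.\<close>
    have "weak_conv_m (\<lambda>n. distr M borel (\<lambda>w. (\<Sum>i<n. X i w) / sqrt (n * (sqrt v)\<^sup>2))) std_normal_distribution"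
      by (rule central_limit_theorem_zero_mean[OF indX]) (use mean var v int2 dX in \<open>auto simp: X_def\<close>)
    hence lim: "(\<lambda>n. char (distr M borel (\<lambda>w. (\<Sum>i<n. X i w) / sqrt (n * (sqrt v)\<^sup>2))) (sqrt v)) \<longlonglongrightarrow> char std_normal_distribution (sqrt v)"
      by (rule levy_continuity1[rotated 2]) (auto intro: real_dist_normal_dist real_distribution_distr)
    have "char (distr M borel (\<lambda>w. (\<Sum>i<n. X i w) / sqrt (n * (sqrt v)\<^sup>2))) (sqrt v) =
        (\<integral>w. iexp (t \<bullet> ((1 / sqrt (real n)) *\<^sub>R (\<Sum>i<n. Y i w))) \<partial>M)" for n
      unfolding char_def eq using v by (subst integral_distr) (auto simp: real_sqrt_mult)
    with lim show ?thesis using v by (simp add: char_std_normal_distribution)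
  qed
qed

lemma (in prob_space) hoeffding_sum:
  fixes Y :: "nat \<Rightarrow> 'a \<Rightarrow> real"
  assumes indep: "indep_vars (\<lambda>_. borel) Y UNIV"
    and bdd: "\<And>i w. w \<in> space M \<Longrightarrow> \<bar>Y i w\<bar> \<le> B" and B: "B > 0"
    and mean: "\<And>i. expectation (Y i) = m" and "\<epsilon> \<ge> 0" "n > 0"
  shows "prob {w \<in> space M. \<bar>(\<Sum>i<n. Y i w) - real n * m\<bar> \<ge> \<epsilon>} \<le> 2 * exp (- \<epsilon>\<^sup>2 / (2 * real n * B\<^sup>2))"
proof -
  have ind: "indep_vars (\<lambda>_. borel) Y {..<n}" by (rule indep_vars_subset[OF indep]) auto
  interpret H: Hoeffding_ineq M "{..<n}" Y "\<lambda>_. - B" "\<lambda>_. B" "\<Sum>i<n. expectation (Y i)"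
  proof unfold_locales
    show "AE w in M. Y i w \<in> {- B..B}" for i
      by (rule AE_I2) (use bdd[of _ i] in \<open>auto simp: abs_le_iff minus_le_iff\<close>)
  qed (use ind in auto)
  have "- 2 * \<epsilon>\<^sup>2 / (\<Sum>i<n. (B - - B)\<^sup>2) = - \<epsilon>\<^sup>2 / (2 * real n * B\<^sup>2)"
    using \<open>n > 0\<close> B by (simp add: power2_eq_square field_simps)
  thus ?thesis using H.Hoeffding_ineq_abs_ge[OF \<open>\<epsilon> \<ge> 0\<close>] \<open>n > 0\<close> B by (simp add: mean mult.assoc)
qed

lemma (in prob_space) weak_law_bounded:
  fixes Y :: "nat \<Rightarrow> 'a \<Rightarrow> real"
  assumes indep: "indep_vars (\<lambda>_. borel) Y UNIV"
    and bdd: "\<And>i w. w \<in> space M \<Longrightarrow> \<bar>Y i w\<bar> \<le> B"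
    and mean: "\<And>i. expectation (Y i) = m" and \<epsilon>: "\<epsilon> > 0"
  shows "(\<lambda>n. prob {w \<in> space M. \<bar>(\<Sum>i<n. Y i w) / real n - m\<bar> \<ge> \<epsilon>}) \<longlonglongrightarrow> 0"
proof (rule tendsto_sandwich[OF _ _ tendsto_const])
  \<comment> \<open>\<open>hoeffding_sum\<close> asks for a positive bound, whereas \<open>B\<close>
    may be zero.\<close>
  define C where "C = max 1 B"
  have C: "C > 0" "\<And>i w. w \<in> space M \<Longrightarrow> \<bar>Y i w\<bar> \<le> C" using bdd by (auto simp: C_def intro: max.coboundedI2)
  show "\<forall>\<^sub>F n in sequentially. prob {w \<in> space M. \<bar>(\<Sum>i<n. Y i w) / real n - m\<bar> \<ge> \<epsilon>} \<le> 2 * exp (- (real n * (\<epsilon>\<^sup>2 / (2 * C\<^sup>2))))"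
    using eventually_gt_at_top[of 0]
  proof eventually_elim
    case (elim n)
    have "{w \<in> space M. \<bar>(\<Sum>i<n. Y i w) / real n - m\<bar> \<ge> \<epsilon>} = {w \<in> space M. \<bar>(\<Sum>i<n. Y i w) - real n * m\<bar> \<ge> real n * \<epsilon>}"
    proof (intro Collect_cong conj_cong refl)
      fix w
      have "\<bar>(\<Sum>i<n. Y i w) / real n - m\<bar> = \<bar>(\<Sum>i<n. Y i w) - real n * m\<bar> / real n"
      proof -
        have "(\<Sum>i<n. Y i w) / real n - m = ((\<Sum>i<n. Y i w) - real n * m) / real n"
          using elim by (simp add: field_simps)
        thus ?thesis by simp
      qed
      thus "(\<bar>(\<Sum>i<n. Y i w) / real n - m\<bar> \<ge> \<epsilon>) = (\<bar>(\<Sum>i<n. Y i w) - real n * m\<bar> \<ge> real n * \<epsilon>)"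
        using elim by (simp add: field_simps)
    qed
    also have "prob \<dots> \<le> 2 * exp (- (real n * \<epsilon>)\<^sup>2 / (2 * real n * C\<^sup>2))"
      by (rule hoeffding_sum[OF indep C(2,1) mean]) (use \<epsilon> elim in auto)
    also have "- (real n * \<epsilon>)\<^sup>2 / (2 * real n * C\<^sup>2) = - (real n * (\<epsilon>\<^sup>2 / (2 * C\<^sup>2)))"
      using elim by (simp add: power2_eq_square)
    finally show ?case .
  qed
  have c: "\<epsilon>\<^sup>2 / (2 * C\<^sup>2) > 0" using \<epsilon> C by simp
  have "filterlim (\<lambda>n. real n * (\<epsilon>\<^sup>2 / (2 * C\<^sup>2))) at_top sequentially"
    by (rule filterlim_at_top_mult_tendsto_pos[OF tendsto_const c filterlim_real_sequentially, THEN filterlim_cong[THEN iffD1, rotated -1]]) auto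
  hence "filterlim (\<lambda>n. - (real n * (\<epsilon>\<^sup>2 / (2 * C\<^sup>2)))) at_bot sequentially"
    by (simp add: filterlim_uminus_at_bot)
  hence "(\<lambda>n. exp (- (real n * (\<epsilon>\<^sup>2 / (2 * C\<^sup>2))))) \<longlonglongrightarrow> 0" by (rule filterlim_compose[OF exp_at_bot])
  from tendsto_mult_right[OF this, of 2] tendsto_mult_left[OF this, of 2]
  show "(\<lambda>n. 2 * exp (- (real n * (\<epsilon>\<^sup>2 / (2 * C\<^sup>2))))) \<longlonglongrightarrow> 0" by simp
qed auto

section \<open>Measurable selection of maximisers\<close>

text \<open>Closed-valued random sets are treated through their hitting events
  \<open>{w. A w \<inter> F \<noteq> {}}\<close> for closed \<open>F\<close>; minimising one coordinate after the other
  selects the lexicographically least point.\<close>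

lemma hitting_minimise:
  fixes A :: "'w \<Rightarrow> 'a::euclidean_space set" and b :: 'a
  assumes comp: "\<And>w. w \<in> space M \<Longrightarrow> compact (A w) \<and> A w \<noteq> {}"
    and meas: "\<And>F. closed F \<Longrightarrow> {w \<in> space M. A w \<inter> F \<noteq> {}} \<in> sets M"
  defines "m \<equiv> (\<lambda>w. Inf ((\<lambda>x. x \<bullet> b) ` A w))"
  shows "m \<in> borel_measurable M"
    and "\<And>w. w \<in> space M \<Longrightarrow> compact {x \<in> A w. x \<bullet> b = m w} \<and> {x \<in> A w. x \<bullet> b = m w} \<noteq> {}"
    and "\<And>F. closed F \<Longrightarrow> {w \<in> space M. {x \<in> A w. x \<bullet> b = m w} \<inter> F \<noteq> {}} \<in> sets M"
proof -
  have cimg: "compact ((\<lambda>x. x \<bullet> b) ` B)" if "compact B" for B :: "'a set"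
    using that by (intro compact_continuous_image continuous_intros)
  have bdd: "bdd_below ((\<lambda>x. x \<bullet> b) ` B)" if "compact B" for B :: "'a set"
    using cimg[OF that] by (simp add: bounded_imp_bdd_below compact_imp_bounded)
  have clI: "closed {x. x \<bullet> b \<le> c}" for c :: real
    by (intro closed_Collect_le continuous_intros)
  have attain: "\<exists>x\<in>B. x \<bullet> b = Inf ((\<lambda>x. x \<bullet> b) ` B)" if "compact B" "B \<noteq> {}" for B :: "'a set"
    using closed_contains_Inf[of "(\<lambda>x. x \<bullet> b) ` B"] bdd[OF that(1)] cimg[OF that(1)] that(2)
    by (metis (no_types, lifting) compact_imp_closed imageE image_is_empty)
  have le: "Inf ((\<lambda>x. x \<bullet> b) ` B) \<le> c \<longleftrightarrow> B \<inter> {x. x \<bullet> b \<le> c} \<noteq> {}" if B: "compact B" "B \<noteq> {}" for B :: "'a set" and c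
  proof
    assume "Inf ((\<lambda>x. x \<bullet> b) ` B) \<le> c"
    with attain[OF B] show "B \<inter> {x. x \<bullet> b \<le> c} \<noteq> {}" by auto
  next
    assume "B \<inter> {x. x \<bullet> b \<le> c} \<noteq> {}"
    then obtain x where "x \<in> B" "x \<bullet> b \<le> c" by blast
    thus "Inf ((\<lambda>x. x \<bullet> b) ` B) \<le> c" using bdd[OF B(1)] by (meson cInf_lower image_eqI order_trans)
  qed
  show mm [measurable]: "m \<in> borel_measurable M"
  proof (rule borel_measurableI_le)
    fix c
    have "{w \<in> space M. m w \<le> c} = {w \<in> space M. A w \<inter> {x. x \<bullet> b \<le> c} \<noteq> {}}"
      using le comp unfolding m_def by blast
    thus "{w \<in> space M. m w \<le> c} \<in> sets M" using meas[OF clI] by simp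
  qed
  show "compact {x \<in> A w. x \<bullet> b = m w} \<and> {x \<in> A w. x \<bullet> b = m w} \<noteq> {}" if w: "w \<in> space M" for w
  proof
    have "closed {x. x \<bullet> b = m w}" by (intro closed_Collect_eq continuous_intros)
    hence "compact (A w \<inter> {x. x \<bullet> b = m w})" using comp[OF w] by (simp add: compact_Int_closed)
    thus "compact {x \<in> A w. x \<bullet> b = m w}" by (simp add: Int_def)
    show "{x \<in> A w. x \<bullet> b = m w} \<noteq> {}" using attain[of "A w"] comp[OF w] by (auto simp: m_def)
  qed
  show "{w \<in> space M. {x \<in> A w. x \<bullet> b = m w} \<inter> F \<noteq> {}} \<in> sets M" if F: "closed F" for F
  proof -
    define W where "W = {w \<in> space M. A w \<inter> F \<noteq> {}}"
    have W: "W \<in> sets M" unfolding W_def by (rule meas[OF F])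
    \<comment> \<open>Where \<open>A w\<close> misses F, the value m w + 1 makes the test
      \<open>mF w \<le> m w\<close> fail. Elsewhere the test says that the minimum over all of
      \<open>A w\<close> is attained in F.\<close>
    define mF where "mF = (\<lambda>w. if w \<in> W then Inf ((\<lambda>x. x \<bullet> b) ` (A w \<inter> F)) else m w + 1)"
    have BF: "compact (A w \<inter> F)" "A w \<inter> F \<noteq> {}" if "w \<in> W" for w
      using that comp F by (auto simp: W_def compact_Int_closed)
    have 1: "{w \<in> W. mF w \<le> c} = {w \<in> space M. A w \<inter> (F \<inter> {x. x \<bullet> b \<le> c}) \<noteq> {}}" for c
      using le[OF BF] by (auto simp: mF_def W_def)
    have mFm: "{w \<in> space M. mF w \<le> c} \<in> sets M" for c
    proof -
      have "{w \<in> space M. mF w \<le> c} = {w \<in> W. mF w \<le> c} \<union> ((space M - W) \<inter> {w \<in> space M. m w + 1 \<le> c})"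
        using sets.sets_into_space[OF W] by (auto simp: mF_def)
      moreover have "{w \<in> W. mF w \<le> c} \<in> sets M"
        unfolding 1 by (intro meas closed_Int F clI)
      ultimately show ?thesis using W by auto
    qed
    have [measurable]: "mF \<in> borel_measurable M" by (rule borel_measurableI_le) (rule mFm)
    have "{w \<in> space M. {x \<in> A w. x \<bullet> b = m w} \<inter> F \<noteq> {}} = {w \<in> space M. mF w \<le> m w}"
    proof (intro Collect_cong conj_cong refl)
      fix w assume w: "w \<in> space M"
      have *: "m w \<le> x \<bullet> b" if "x \<in> A w" for x
        unfolding m_def using that bdd comp[OF w] by (auto intro!: cInf_lower)
      show "({x \<in> A w. x \<bullet> b = m w} \<inter> F \<noteq> {}) = (mF w \<le> m w)"
      proof (cases "w \<in> W")
        case False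
        thus ?thesis using w by (auto simp: mF_def W_def)
      next
        case True
        have "(mF w \<le> m w) = (A w \<inter> F \<inter> {x. x \<bullet> b \<le> m w} \<noteq> {})"
          using le[OF BF[OF True]] True by (simp add: mF_def)
        also have "\<dots> = ({x \<in> A w. x \<bullet> b = m w} \<inter> F \<noteq> {})"
          using * by (auto intro: antisym)
        finally show ?thesis by simp
      qed
    qed
    thus ?thesis by simp
  qed
qed

lemma measurable_selection_closed_hits:
  fixes A :: "'w \<Rightarrow> 'a::euclidean_space set"
  assumes comp: "\<And>w. w \<in> space M \<Longrightarrow> compact (A w) \<and> A w \<noteq> {}"
    and meas: "\<And>F. closed F \<Longrightarrow> {w \<in> space M. A w \<inter> F \<noteq> {}} \<in> sets M"
  obtains T where "T \<in> borel_measurable M" "\<And>w. w \<in> space M \<Longrightarrow> T w \<in> A w"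
proof -
  obtain bs :: "'a list" where bs: "set bs = Basis" using finite_list[OF finite_Basis] by blast
  \<comment> \<open>Invariant along the list of coordinates: those already treated are constant on
    \<open>B w\<close>, with measurable values \<open>m\<close>. Once the list exhausts the basis,
    \<open>B w\<close> is a single point.\<close>
  have "\<exists>B m. (\<forall>w\<in>space M. compact (B w) \<and> B w \<noteq> {} \<and> B w \<subseteq> A w \<and> (\<forall>b\<in>set cs. \<forall>x\<in>B w. x \<bullet> b = m b w)) \<and>
      (\<forall>b\<in>set cs. m b \<in> borel_measurable M) \<and> (\<forall>F. closed F \<longrightarrow> {w \<in> space M. B w \<inter> F \<noteq> {}} \<in> sets M)" for cs :: "'a list"
  proof (induction cs)
    case Nil
    show ?case by (rule exI[of _ A]) (use assms in auto)
  next
    case (Cons b cs)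
    then obtain B m where B0: "(\<forall>w\<in>space M. compact (B w) \<and> B w \<noteq> {} \<and> B w \<subseteq> A w \<and> (\<forall>b\<in>set cs. \<forall>x\<in>B w. x \<bullet> b = m b w)) \<and>
      (\<forall>b\<in>set cs. m b \<in> borel_measurable M) \<and> (\<forall>F. closed F \<longrightarrow> {w \<in> space M. B w \<inter> F \<noteq> {}} \<in> sets M)"
      by (elim exE)
    have B: "\<And>w. w \<in> space M \<Longrightarrow> compact (B w) \<and> B w \<noteq> {}"
        "\<And>F. closed F \<Longrightarrow> {w \<in> space M. B w \<inter> F \<noteq> {}} \<in> sets M"
      using B0 by auto
    define m' where "m' = (\<lambda>w. Inf ((\<lambda>x. x \<bullet> b) ` B w))"
    have h1: "m' \<in> borel_measurable M"
      unfolding m'_def by (rule hitting_minimise(1)) (fact B)+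
    have h2: "compact {x \<in> B w. x \<bullet> b = m' w} \<and> {x \<in> B w. x \<bullet> b = m' w} \<noteq> {}" if "w \<in> space M" for w
      unfolding m'_def by (rule hitting_minimise(2)[where M=M and A=B and b=b, OF _ _ that]) (fact B)+
    have h3: "{w \<in> space M. {x \<in> B w. x \<bullet> b = m' w} \<inter> F \<noteq> {}} \<in> sets M" if "closed F" for F
      unfolding m'_def by (rule hitting_minimise(3)[where M=M and A=B and b=b, OF _ _ that]) (fact B)+
    define B' where "B' = (\<lambda>w. {x \<in> B w. x \<bullet> b = m' w})"
    define m2 where "m2 = m(b := m')"
    have "compact (B' w) \<and> B' w \<noteq> {} \<and> B' w \<subseteq> A w \<and> (\<forall>b\<in>set (b # cs). \<forall>x\<in>B' w. x \<bullet> b = m2 b w)"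
      if w: "w \<in> space M" for w
    proof (intro conjI ballI)
      show "compact (B' w)" "B' w \<noteq> {}" using h2[OF w] by (auto simp: B'_def)
      show "B' w \<subseteq> A w" using B0 w by (auto simp: B'_def)
      fix c x assume "c \<in> set (b # cs)" "x \<in> B' w"
      thus "x \<bullet> c = m2 c w" using B0 w by (cases "c = b") (auto simp: B'_def m2_def)
    qed
    moreover have "m2 c \<in> borel_measurable M" if "c \<in> set (b # cs)" for c
      using that h1 B0 by (cases "c = b") (simp_all add: m2_def)
    moreover have "{w \<in> space M. B' w \<inter> F \<noteq> {}} \<in> sets M" if "closed F" for F
      unfolding B'_def by (rule h3[OF that])
    ultimately show ?case by blast
  qed
  from this[of bs] obtain B m where B0: "(\<forall>w\<in>space M. compact (B w) \<and> B w \<noteq> {} \<and> B w \<subseteq> A w \<and> (\<forall>b\<in>Basis. \<forall>x\<in>B w. x \<bullet> b = m b w)) \<and>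
      (\<forall>b\<in>Basis. m b \<in> borel_measurable M) \<and> (\<forall>F. closed F \<longrightarrow> {w \<in> space M. B w \<inter> F \<noteq> {}} \<in> sets M)"
    unfolding bs by (elim exE)
  have B: "\<And>w. w \<in> space M \<Longrightarrow> B w \<noteq> {} \<and> B w \<subseteq> A w"
     "\<And>b w x. b \<in> Basis \<Longrightarrow> w \<in> space M \<Longrightarrow> x \<in> B w \<Longrightarrow> x \<bullet> b = m b w"
     "\<And>b. b \<in> Basis \<Longrightarrow> m b \<in> borel_measurable M"
    using B0 by auto
  define T where "T = (\<lambda>w. \<Sum>b\<in>Basis. m b w *\<^sub>R b)"
  show ?thesis
  proof (rule that[of T])
    show "T \<in> borel_measurable M" unfolding T_def using B(3) by measurable
    fix w assume w: "w \<in> space M"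
    then obtain x where x: "x \<in> B w" using B(1) by blast
    have "T w = (\<Sum>b\<in>Basis. (x \<bullet> b) *\<^sub>R b)" unfolding T_def using B(2)[OF _ w x] by simp
    also have "\<dots> = x" by (rule euclidean_representation)
    finally show "T w \<in> A w" using x B(1)[OF w] by blast
  qed
qed

text \<open>The set of maximisers is a compact random set. It meets a closed F with nonempty K
  \<inter> F exactly when the supremum over K \<inter> F reaches that over K. By continuity these
  suprema may be taken over countable dense subsets, hence they are measurable.\<close>

lemma measurable_argmax:
  fixes f :: "'w \<Rightarrow> 'a::euclidean_space \<Rightarrow> real"
  assumes K: "compact K" "K \<noteq> {}"
    and cont: "\<And>w. w \<in> space M \<Longrightarrow> continuous_on K (f w)"
    and meas: "\<And>x. x \<in> K \<Longrightarrow> (\<lambda>w. f w x) \<in> borel_measurable M"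
  obtains T where "T \<in> borel_measurable M" "\<And>w. w \<in> space M \<Longrightarrow> T w \<in> K \<and> (\<forall>x\<in>K. f w x \<le> f w (T w))"
proof -
  have attain: "\<exists>x\<in>C. \<forall>y\<in>C. f w y \<le> f w x" if "compact C" "C \<noteq> {}" "C \<subseteq> K" "w \<in> space M" for C w
    using continuous_attains_sup[OF that(1,2) continuous_on_subset[OF cont[OF that(4)] that(3)]] by blast
  define S where "S = (\<lambda>C w. SUP x\<in>C. f w x)"
  have S_eq: "S C w = f w x" if "x \<in> C" "\<forall>y\<in>C. f w y \<le> f w x" for C w x
    unfolding S_def by (rule cSup_eq_maximum) (use that in auto)
  have Sm: "S C \<in> borel_measurable M" if C: "compact C" "C \<noteq> {}" "C \<subseteq> K" for C
  proof -
    obtain D where D: "countable D" "D \<subseteq> C" "C \<subseteq> closure D" using separable[of C] by blast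
    hence ne: "D \<noteq> {}" using C by auto
    show ?thesis
    proof (rule borel_measurableI_le)
      fix c
      have "{w \<in> space M. S C w \<le> c} = {w \<in> space M. \<forall>x\<in>D. f w x \<le> c}"
      proof (intro Collect_cong conj_cong refl)
        fix w assume w: "w \<in> space M"
        obtain x where x: "x \<in> C" "\<forall>y\<in>C. f w y \<le> f w x" using attain[OF C w] by blast
        show "(S C w \<le> c) = (\<forall>x\<in>D. f w x \<le> c)"
        proof
          assume "S C w \<le> c" thus "\<forall>x\<in>D. f w x \<le> c" using S_eq[OF x] x D(2) by force
        next
          assume *: "\<forall>x\<in>D. f w x \<le> c"
          have "x \<in> closure D" using x D by blast
          then obtain s where s: "\<And>n. s n \<in> D" "s \<longlonglongrightarrow> x" unfolding closure_sequential by blast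
          have "(\<lambda>n. f w (s n)) \<longlonglongrightarrow> f w x"
            using cont[OF w] s x(1) D(2) C(3) unfolding continuous_on_sequentially by (auto simp: comp_def subset_iff)
          hence "f w x \<le> c" by (rule LIMSEQ_le_const2) (use * s in auto)
          thus "S C w \<le> c" using S_eq[OF x] by simp
        qed
      qed
      also have "\<dots> \<in> sets M"
      proof -
        have [measurable]: "(\<lambda>w. f w x) \<in> borel_measurable M" if "x \<in> D" for x using meas D C that by blast
        have "{w \<in> space M. \<forall>x\<in>D. f w x \<le> c} = space M \<inter> (\<Inter>x\<in>D. {w \<in> space M. f w x \<le> c})" by auto
        also have "\<dots> = (\<Inter>x\<in>D. {w \<in> space M. f w x \<le> c})" using ne by auto
        also have "\<dots> \<in> sets M" by (rule sets.countable_INT'[OF D(1) ne]) auto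
        finally show ?thesis .
      qed
      finally show "{w \<in> space M. S C w \<le> c} \<in> sets M" .
    qed
  qed
  define A where "A = (\<lambda>w. {x \<in> K. \<forall>y\<in>K. f w y \<le> f w x})"
  have A1: "compact (A w) \<and> A w \<noteq> {}" if w: "w \<in> space M" for w
  proof
    obtain x where x: "x \<in> K" "\<forall>y\<in>K. f w y \<le> f w x" using attain[OF K _ w] by blast
    thus "A w \<noteq> {}" by (auto simp: A_def)
    have "A w = K \<inter> f w -` {f w x}" using x by (auto simp: A_def intro: antisym)
    moreover have "closed (K \<inter> f w -` {f w x})"
      by (rule continuous_closed_preimage[OF cont[OF w]]) (use K compact_imp_closed in auto)
    ultimately show "compact (A w)" using K compact_Int_closed[of K "A w"] by (simp add: Int_absorb1)
  qed
  have A2: "{w \<in> space M. A w \<inter> F \<noteq> {}} \<in> sets M" if F: "closed F" for F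
  proof (cases "K \<inter> F = {}")
    case True
    hence "{w \<in> space M. A w \<inter> F \<noteq> {}} = {}" by (auto simp: A_def)
    thus ?thesis by (simp only: sets.empty_sets)
  next
    case False
    have KF: "compact (K \<inter> F)" "K \<inter> F \<subseteq> K" using K F by (auto simp: compact_Int_closed)
    have [measurable]: "S K \<in> borel_measurable M" "S (K \<inter> F) \<in> borel_measurable M"
      using Sm[OF K] Sm[OF KF(1) False KF(2)] by auto
    have "{w \<in> space M. A w \<inter> F \<noteq> {}} = {w \<in> space M. S K w \<le> S (K \<inter> F) w}"
    proof (intro Collect_cong conj_cong refl)
      fix w assume w: "w \<in> space M"
      obtain x where x: "x \<in> K" "\<forall>y\<in>K. f w y \<le> f w x" using attain[OF K _ w] by blast
      obtain z where z: "z \<in> K \<inter> F" "\<forall>y\<in>K \<inter> F. f w y \<le> f w z" using attain[OF KF(1) False KF(2) w] by blast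
      show "(A w \<inter> F \<noteq> {}) = (S K w \<le> S (K \<inter> F) w)"
      proof
        assume "A w \<inter> F \<noteq> {}"
        then obtain y where "y \<in> K \<inter> F" "f w x \<le> f w y" using x by (auto simp: A_def)
        thus "S K w \<le> S (K \<inter> F) w" using z unfolding S_eq[OF x] S_eq[OF z] by (meson order_trans)
      next
        assume "S K w \<le> S (K \<inter> F) w"
        hence "z \<in> A w \<inter> F" unfolding S_eq[OF x] S_eq[OF z] using x z by (force simp: A_def)
        thus "A w \<inter> F \<noteq> {}" by blast
      qed
    qed
    thus ?thesis by simp
  qed
  obtain T where "T \<in> borel_measurable M" "\<And>w. w \<in> space M \<Longrightarrow> T w \<in> A w"
    using measurable_selection_closed_hits[of M A, OF A1 A2] by blast
  thus ?thesis using that[of T] by (auto simp: A_def)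
qed

section \<open>Likelihood expansion\<close>

lemma poly_bounded_Icc: "\<exists>P. \<forall>t\<in>{-1..1}. \<bar>poly (p :: real poly) t\<bar> \<le> P"
proof -
  have "bounded (poly p ` {-1..1})"
    by (intro compact_imp_bounded compact_continuous_image continuous_intros) auto
  thus ?thesis unfolding bounded_iff by auto
qed

text \<open>For rs < 1 this margin keeps the logarithm of the density and its derivatives uniformly
  bounded.\<close>

lemma density_poly_lower:
  fixes rs r :: real
  assumes "\<bar>P\<bar> \<le> 1" "0 \<le> r" "r \<le> rs"
  shows "1 - rs \<le> 1 + r * P"
proof -
  have "\<bar>r * P\<bar> \<le> rs * 1" unfolding abs_mult using assms by (intro mult_mono) auto
  thus ?thesis by linarith
qed

text \<open>Taylor's formula along the segment from (t, rho) to (t', r). The argument N of the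
  logarithm stays at least 1 - rs there, so the third derivative is bounded by a multiple of h^3,
  where h is the sum of the moduli of the two increments.\<close>

lemma log_density_taylor:
  fixes p :: "real poly" and rs :: real
  assumes p1: "\<And>t. t \<in> {-1..1} \<Longrightarrow> \<bar>poly p t\<bar> \<le> 1" and rs: "0 < rs" "rs < 1"
  obtains C where "C \<ge> 0"
    "\<And>t t' rho r. t \<in> {-1..1} \<Longrightarrow> t' \<in> {-1..1} \<Longrightarrow> rho \<in> {0..rs} \<Longrightarrow> r \<in> {0..rs} \<Longrightarrow>
       \<bar>ln (1 + r * poly p t') - ln (1 + rho * poly p t)
         - ((t' - t) * (rho * poly (pderiv p) t / (1 + rho * poly p t)) + (r - rho) * (poly p t / (1 + rho * poly p t)))
         - ((t' - t)\<^sup>2 * (rho * poly (pderiv (pderiv p)) t / (1 + rho * poly p t) - (rho * poly (pderiv p) t / (1 + rho * poly p t))\<^sup>2)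
            + 2 * (t' - t) * (r - rho) * (poly (pderiv p) t / (1 + rho * poly p t)\<^sup>2)
            - (r - rho)\<^sup>2 * (poly p t / (1 + rho * poly p t))\<^sup>2) / 2\<bar>
       \<le> C * (\<bar>t' - t\<bar> + \<bar>r - rho\<bar>) ^ 3"
proof -
  let ?p1 = "pderiv p" and ?p2 = "pderiv (pderiv p)" and ?p3 = "pderiv (pderiv (pderiv p))"
  obtain P1 P2 P3 where P0: "\<And>t. t \<in> {-1..1} \<Longrightarrow> \<bar>poly ?p1 t\<bar> \<le> P1"
     "\<And>t. t \<in> {-1..1} \<Longrightarrow> \<bar>poly ?p2 t\<bar> \<le> P2" "\<And>t. t \<in> {-1..1} \<Longrightarrow> \<bar>poly ?p3 t\<bar> \<le> P3"
    using poly_bounded_Icc[of ?p1] poly_bounded_Icc[of ?p2] poly_bounded_Icc[of ?p3] by blast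
  define P where "P = Max {1, P1, P2, P3}"
  have P: "\<bar>poly p t\<bar> \<le> P" "\<bar>poly ?p1 t\<bar> \<le> P" "\<bar>poly ?p2 t\<bar> \<le> P" "\<bar>poly ?p3 t\<bar> \<le> P" if "t \<in> {-1..1}" for t
    using P0[OF that] p1[OF that] unfolding P_def by (auto intro!: order_trans[OF _ Max_ge])
  have P1: "P \<ge> 1" by (simp add: P_def)
  define c where "c = 1 - rs"
  have c: "c > 0" "c < 1" using rs by (auto simp: c_def)
  \<comment> \<open>The three summands bound the three terms of \<open>f3\<close>, by |N1| <= 2 P h,
    |N2| <= 3 P h^2, |N3| <= 4 P h^3 and N >= c.\<close>
  define C where "C = 4 * P / c + 3 * (2 * P) * (3 * P) / c\<^sup>2 + 2 * (2 * P) ^ 3 / c ^ 3"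
  have C: "C \<ge> 0" using c P1 by (simp add: C_def)
  show ?thesis
  proof (rule that[OF C])
    fix t t' rho r :: real
    assume t: "t \<in> {-1..1}" "t' \<in> {-1..1}" and r: "rho \<in> {0..rs}" "r \<in> {0..rs}"
    define \<alpha> where "\<alpha> = t' - t"
    define \<beta> where "\<beta> = r - rho"
    define h where "h = \<bar>\<alpha>\<bar> + \<bar>\<beta>\<bar>"
    have h: "\<bar>\<alpha>\<bar> \<le> h" "\<bar>\<beta>\<bar> \<le> h" "h \<ge> 0" by (auto simp: h_def)
    define T where "T = (\<lambda>s. t + s * \<alpha>)"
    define Rr where "Rr = (\<lambda>s. rho + s * \<beta>)"
    define N where "N = (\<lambda>s. 1 + Rr s * poly p (T s))"
    define N1 where "N1 = (\<lambda>s. \<beta> * poly p (T s) + Rr s * (poly ?p1 (T s) * \<alpha>))"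
    define N2 where "N2 = (\<lambda>s. 2 * \<beta> * (poly ?p1 (T s) * \<alpha>) + Rr s * (poly ?p2 (T s) * \<alpha>\<^sup>2))"
    define N3 where "N3 = (\<lambda>s. 3 * \<beta> * (poly ?p2 (T s) * \<alpha>\<^sup>2) + Rr s * (poly ?p3 (T s) * \<alpha> ^ 3))"
    have TI: "T s \<in> {-1..1}" and RI: "Rr s \<in> {0..rs}" if s: "0 \<le> s" "s \<le> 1" for s
    proof -
      have "T s = (1 - s) * t + s * t'" "Rr s = (1 - s) * rho + s * r"
        by (simp_all add: T_def Rr_def \<alpha>_def \<beta>_def algebra_simps)
      moreover have "(1 - s) *\<^sub>R t + s *\<^sub>R t' \<in> {-1..1}"
        by (rule convexD[OF convex_real_interval(5)]) (use t s in auto)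
      moreover have "(1 - s) *\<^sub>R rho + s *\<^sub>R r \<in> {0..rs}"
        by (rule convexD[OF convex_real_interval(5)]) (use r s in auto)
      ultimately show "T s \<in> {-1..1}" "Rr s \<in> {0..rs}" by auto
    qed
    have Nc: "N s \<ge> c" if "0 \<le> s" "s \<le> 1" for s
      unfolding N_def c_def using density_poly_lower[OF p1[OF TI[OF that]]] RI[OF that] by auto
    have dT: "(T has_real_derivative \<alpha>) (at s)" "(Rr has_real_derivative \<beta>) (at s)" for s
      by (auto simp: T_def Rr_def intro!: derivative_eq_intros)
    have dp: "((\<lambda>s. poly q (T s)) has_real_derivative poly (pderiv q) (T s) * \<alpha>) (at s)" for q s
      by (rule DERIV_chain2[OF poly_DERIV dT(1)])
    have dN: "(N has_real_derivative N1 s) (at s)" for s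
      unfolding N_def N1_def by (auto intro!: derivative_eq_intros dT dp simp: algebra_simps)
    have dN1: "(N1 has_real_derivative N2 s) (at s)" for s
      unfolding N1_def N2_def by (auto intro!: derivative_eq_intros dT dp simp: algebra_simps power2_eq_square)
    have dN2: "(N2 has_real_derivative N3 s) (at s)" for s
      unfolding N2_def N3_def by (auto intro!: derivative_eq_intros dT dp simp: algebra_simps power2_eq_square power3_eq_cube)
    define f where "f = (\<lambda>s. ln (N s))"
    define f1 where "f1 = (\<lambda>s. N1 s / N s)"
    define f2 where "f2 = (\<lambda>s. N2 s / N s - (N1 s)\<^sup>2 / (N s)\<^sup>2)"
    define f3 where "f3 = (\<lambda>s. N3 s / N s - 3 * N1 s * N2 s / (N s)\<^sup>2 + 2 * (N1 s) ^ 3 / (N s) ^ 3)"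
    define D where "D = (\<lambda>m::nat. if m = 0 then f else if m = 1 then f1 else if m = 2 then f2 else f3)"
    have N0: "N s > 0" if "0 \<le> s" "s \<le> 1" for s using Nc[OF that] c by simp
    have df: "(f has_real_derivative f1 s) (at s)" if "0 \<le> s" "s \<le> 1" for s
      unfolding f_def f1_def using N0[OF that] by (auto intro!: derivative_eq_intros dN)
    have df1: "(f1 has_real_derivative f2 s) (at s)" if "0 \<le> s" "s \<le> 1" for s
      unfolding f1_def f2_def using N0[OF that]
      by (auto intro!: derivative_eq_intros dN dN1 simp: field_simps power2_eq_square)
    have df2: "(f2 has_real_derivative f3 s) (at s)" if "0 \<le> s" "s \<le> 1" for s
    proof -
      have nz: "N s \<noteq> 0" using N0[OF that] by simp
      have a: "((\<lambda>s. N2 s / N s) has_real_derivative (N3 s * N s - N2 s * N1 s) / (N s * N s)) (at s)"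
        by (rule DERIV_divide[OF dN2 dN nz])
      have b1: "((\<lambda>s. N1 s / N s) has_real_derivative (N2 s * N s - N1 s * N1 s) / (N s * N s)) (at s)"
        by (rule DERIV_divide[OF dN1 dN nz])
      have b: "((\<lambda>s. (N1 s / N s)\<^sup>2) has_real_derivative 2 * ((N2 s * N s - N1 s * N1 s) / (N s * N s) * (N1 s / N s))) (at s)"
        using DERIV_power[OF b1, of 2] by simp
      have "f2 = (\<lambda>s. N2 s / N s - (N1 s / N s)\<^sup>2)" by (simp add: f2_def power_divide)
      moreover have "(N3 s * N s - N2 s * N1 s) / (N s * N s) - 2 * ((N2 s * N s - N1 s * N1 s) / (N s * N s) * (N1 s / N s)) = f3 s"
        unfolding f3_def using nz by (simp add: divide_simps power2_eq_square power3_eq_cube) (simp add: algebra_simps)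
      ultimately show ?thesis using DERIV_diff[OF a b] by simp
    qed
    have "\<exists>s>0. s < 1 \<and> f 1 = (\<Sum>m<3. D m 0 / fact m * 1 ^ m) + D 3 s / fact 3 * 1 ^ 3"
    proof (rule Maclaurin)
      show "\<forall>m s. m < 3 \<and> 0 \<le> s \<and> s \<le> 1 \<longrightarrow> DERIV (D m) s :> D (Suc m) s"
      proof (intro allI impI)
        fix m :: nat and s :: real assume *: "m < 3 \<and> 0 \<le> s \<and> s \<le> 1"
        hence "m = 0 \<or> m = 1 \<or> m = 2" by auto
        thus "DERIV (D m) s :> D (Suc m) s" using df df1 df2 * by (auto simp: D_def)
      qed
    qed (auto simp: D_def)
    then obtain s where s: "0 < s" "s < 1" "f 1 = (\<Sum>m<3. D m 0 / fact m * 1 ^ m) + D 3 s / fact 3 * 1 ^ 3" by blast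
    have f: "f 1 = f 0 + f1 0 + f2 0 / 2 + f3 s / 6"
      using s(3) by (simp add: D_def numeral_3_eq_3 eval_nat_numeral)
    have s': "0 \<le> s" "s \<le> 1" using s by auto
    note Ps = P[OF TI[OF s']]
    have Rs: "\<bar>Rr s\<bar> \<le> 1" using RI[OF s'] rs by auto
    have b1: "\<bar>N1 s\<bar> \<le> 2 * P * h"
    proof -
      have "\<bar>\<beta> * poly p (T s)\<bar> \<le> h * P" unfolding abs_mult using h Ps by (intro mult_mono) auto
      moreover have "\<bar>Rr s * (poly ?p1 (T s) * \<alpha>)\<bar> \<le> 1 * (P * h)"
        unfolding abs_mult using h Ps Rs P1 by (intro mult_mono) auto
      ultimately show ?thesis unfolding N1_def by (simp add: algebra_simps)
    qed
    have h2: "\<alpha>\<^sup>2 \<le> h\<^sup>2" "\<bar>\<alpha> ^ 3\<bar> \<le> h ^ 3"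
      using power_mono[OF h(1), of 2] power_mono[OF h(1), of 3] by (simp_all add: power_abs)
    have b2: "\<bar>N2 s\<bar> \<le> 3 * P * h\<^sup>2"
    proof -
      have "\<bar>2 * \<beta> * (poly ?p1 (T s) * \<alpha>)\<bar> \<le> (2 * h) * (P * h)"
        unfolding abs_mult using h Ps P1 by (intro mult_mono) auto
      moreover have "\<bar>Rr s * (poly ?p2 (T s) * \<alpha>\<^sup>2)\<bar> \<le> 1 * (P * h\<^sup>2)"
        unfolding abs_mult using h2 Ps Rs P1 by (intro mult_mono) auto
      ultimately show ?thesis unfolding N2_def by (simp add: algebra_simps power2_eq_square)
    qed
    have b3: "\<bar>N3 s\<bar> \<le> 4 * P * h ^ 3"
    proof -
      have "\<bar>\<alpha>\<^sup>2\<bar> \<le> h\<^sup>2" "\<bar>3 * \<beta>\<bar> \<le> 3 * h" using h2(1) h(2) by (simp_all add: abs_mult)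
      hence "\<bar>3 * \<beta> * (poly ?p2 (T s) * \<alpha>\<^sup>2)\<bar> \<le> (3 * h) * (P * h\<^sup>2)"
        unfolding abs_mult[of "3 * \<beta>"] abs_mult[of "poly ?p2 (T s)"]
        by (intro mult_mono[OF _ mult_mono[OF Ps(3)]]) (use P1 h in simp_all)
      moreover have "\<bar>Rr s * (poly ?p3 (T s) * \<alpha> ^ 3)\<bar> \<le> 1 * (P * h ^ 3)"
        unfolding abs_mult[of "Rr s"] abs_mult[of "poly ?p3 (T s)"]
        by (rule mult_mono[OF Rs mult_mono[OF Ps(4) h2(2)]]) (use P1 in simp_all)
      ultimately show ?thesis unfolding N3_def by (simp add: algebra_simps power2_eq_square power3_eq_cube)
    qed
    have Ns: "c \<le> \<bar>N s\<bar>" "c > 0" using Nc[OF s'] c by auto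
    have "\<bar>f3 s\<bar> \<le> C * h ^ 3"
    proof -
      have "\<bar>N3 s / N s\<bar> \<le> 4 * P * h ^ 3 / c"
        unfolding abs_divide using b3 Ns by (intro frac_le) auto
      moreover have "\<bar>3 * N1 s * N2 s / (N s)\<^sup>2\<bar> \<le> 3 * (2 * P * h) * (3 * P * h\<^sup>2) / c\<^sup>2"
        unfolding abs_divide abs_mult power_abs using b1 b2 Ns P1 h by (intro frac_le mult_mono power_mono) auto
      moreover have "\<bar>2 * (N1 s) ^ 3 / (N s) ^ 3\<bar> \<le> 2 * (2 * P * h) ^ 3 / c ^ 3"
        unfolding abs_divide abs_mult power_abs using b1 Ns P1 h by (intro frac_le mult_mono power_mono) auto
      ultimately have "\<bar>f3 s\<bar> \<le> 4 * P * h ^ 3 / c + 3 * (2 * P * h) * (3 * P * h\<^sup>2) / c\<^sup>2 + 2 * (2 * P * h) ^ 3 / c ^ 3"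
        unfolding f3_def by linarith
      also have "\<dots> = C * h ^ 3" unfolding C_def by (simp add: power_mult_distrib power2_eq_square power3_eq_cube algebra_simps)
      finally show ?thesis .
    qed
    moreover have "\<bar>f3 s / 6\<bar> \<le> \<bar>f3 s\<bar>" by simp
    moreover have "f 1 - f 0 - f1 0 - f2 0 / 2 = f3 s / 6" using f by simp
    ultimately have "\<bar>f 1 - f 0 - f1 0 - f2 0 / 2\<bar> \<le> C * h ^ 3" by linarith
    moreover have "f 1 = ln (1 + r * poly p t')" "f 0 = ln (1 + rho * poly p t)"
      by (simp_all add: f_def N_def T_def Rr_def \<alpha>_def \<beta>_def)
    moreover have "f1 0 = (t' - t) * (rho * poly (pderiv p) t / (1 + rho * poly p t)) + (r - rho) * (poly p t / (1 + rho * poly p t))"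
      by (simp add: f1_def N1_def N_def T_def Rr_def \<alpha>_def \<beta>_def add_divide_distrib)
    moreover have "f2 0 = (t' - t)\<^sup>2 * (rho * poly (pderiv (pderiv p)) t / (1 + rho * poly p t) - (rho * poly (pderiv p) t / (1 + rho * poly p t))\<^sup>2)
            + 2 * (t' - t) * (r - rho) * (poly (pderiv p) t / (1 + rho * poly p t)\<^sup>2)
            - (r - rho)\<^sup>2 * (poly p t / (1 + rho * poly p t))\<^sup>2"
    proof -
      have e0: "T 0 = t" "Rr 0 = rho" by (simp_all add: T_def Rr_def)
      have nz: "1 + rho * poly p t \<noteq> 0" using N0[of 0] by (simp add: N_def T_def Rr_def)
      show ?thesis
        unfolding f2_def N_def N1_def N2_def e0 \<alpha>_def[symmetric] \<beta>_def[symmetric] using nz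
        by (simp add: divide_simps power2_eq_square) (simp add: algebra_simps)
    qed
    ultimately show "\<bar>ln (1 + r * poly p t') - ln (1 + rho * poly p t)
         - ((t' - t) * (rho * poly (pderiv p) t / (1 + rho * poly p t)) + (r - rho) * (poly p t / (1 + rho * poly p t)))
         - ((t' - t)\<^sup>2 * (rho * poly (pderiv (pderiv p)) t / (1 + rho * poly p t) - (rho * poly (pderiv p) t / (1 + rho * poly p t))\<^sup>2)
            + 2 * (t' - t) * (r - rho) * (poly (pderiv p) t / (1 + rho * poly p t)\<^sup>2)
            - (r - rho)\<^sup>2 * (poly p t / (1 + rho * poly p t))\<^sup>2) / 2\<bar>
       \<le> C * (\<bar>t' - t\<bar> + \<bar>r - rho\<bar>) ^ 3"
      by (simp only: h_def \<alpha>_def \<beta>_def)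
  qed
qed

text \<open>The linear-quadratic model \<open>s . H - J(H) / 2\<close> is maximal at \<open>G = (s1 / Jm, s2 / Jr)\<close>; comparing the maximiser with
  the point of the constraint set closest to \<open>G\<close> shows that it agrees with \<open>G\<close> to second order.\<close>
lemma argmax_expansion:
  fixes mu :: "'a::real_inner" and rho Jm Jr C :: real
  assumes mu: "norm mu = 1" and J: "Jm > 0" "Jr > 0" and C: "C \<ge> 0"
  defines "S \<equiv> (\<lambda>\<delta>. {q :: 'a \<times> real. norm (fst q) = 1 \<and> dist q (mu, rho) \<le> \<delta>})"
  shows "\<exists>\<delta>0>0. \<forall>\<delta>. 0 < \<delta> \<longrightarrow> \<delta> \<le> \<delta>0 \<longrightarrow> (\<exists>\<eta>>0. \<exists>K>0. \<forall>f T s1 s2 \<epsilon>.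
     0 \<le> \<epsilon> \<longrightarrow> \<epsilon> \<le> \<eta> \<longrightarrow> norm (s1, s2) \<le> \<eta> \<longrightarrow> s1 \<bullet> mu = 0 \<longrightarrow> T \<in> S \<delta> \<longrightarrow> (\<forall>q\<in>S \<delta>. f q \<le> (f T :: real)) \<longrightarrow>
     (\<forall>q\<in>S \<delta>. \<bar>f q - f (mu, rho) - (s1 \<bullet> (fst q - mu) + s2 * (snd q - rho)
         - (Jm * ((norm (fst q - mu))\<^sup>2 - (mu \<bullet> (fst q - mu))\<^sup>2) + Jr * (snd q - rho)\<^sup>2) / 2)\<bar>
         \<le> \<epsilon> * (norm (q - (mu, rho)))\<^sup>2 / 2 + C * norm (q - (mu, rho)) ^ 3) \<longrightarrow>
     dist T (mu, rho) < \<delta> \<and> norm (T - (mu, rho)) \<le> K * norm (s1, s2) \<and>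
     (norm (T - (mu, rho) - (s1 /\<^sub>R Jm, s2 / Jr)))\<^sup>2 \<le> K * (\<epsilon> + norm (s1, s2)) * (norm (s1, s2))\<^sup>2)"
proof -
  \<comment> \<open>\<open>2 * c0\<close> is the smaller of the two information constants, so it
    bounds the quadratic form from below off the direction \<open>mu\<close>.\<close>
  define c0 where "c0 = min Jm Jr / 2"
  define J1 where "J1 = max Jm Jr"
  have c0: "c0 > 0" "2 * c0 \<le> Jm" "2 * c0 \<le> Jr" using J by (auto simp: c0_def)
  have J1: "J1 > 0" "Jm \<le> J1" "Jr \<le> J1" using J by (auto simp: J1_def)
  \<comment> \<open>Makes C |H|^3 at most c0 |H|^2 / 8 on the constraint set.\<close>
  define \<delta>0 where "\<delta>0 = min 1 (c0 / (8 * (C + 1)))"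
  have \<delta>0: "\<delta>0 > 0" "\<delta>0 \<le> 1" "C * \<delta>0 \<le> c0 / 8"
  proof -
    show "\<delta>0 > 0" "\<delta>0 \<le> 1" using c0 C by (auto simp: \<delta>0_def)
    have "C * \<delta>0 \<le> (C + 1) * (c0 / (8 * (C + 1)))"
      using C c0 by (intro mult_mono) (auto simp: \<delta>0_def)
    also have "\<dots> = c0 / 8" using C by (simp add: field_simps)
    finally show "C * \<delta>0 \<le> c0 / 8" .
  qed
  show ?thesis
  proof (rule exI[of _ \<delta>0], intro conjI allI impI \<delta>0(1))
    fix \<delta> :: real assume \<delta>: "0 < \<delta>" "\<delta> \<le> \<delta>0"
    have \<delta>1: "\<delta> \<le> 1" "C * \<delta> \<le> c0 / 8"
    proof -
      show "\<delta> \<le> 1" using \<delta> \<delta>0 by simp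
      have "C * \<delta> \<le> C * \<delta>0" using \<delta> C by (intro mult_left_mono) auto
      thus "C * \<delta> \<le> c0 / 8" using \<delta>0 by simp
    qed
    \<comment> \<open>The bound c0 / 8 absorbs the error \<epsilon> in the quadratic form. The bound
      c0 \<delta> / 8 on the score forces |H| <= 4 \<sigma> / c0 <= \<delta> / 2, which keeps the
      maximiser in the interior.\<close>
    define \<eta> where "\<eta> = min 1 (min (c0 / 8) (c0 * \<delta> / 8))"
    have \<eta>: "\<eta> > 0" "\<eta> \<le> 1" "\<eta> \<le> c0 / 8" "\<eta> \<le> c0 * \<delta> / 8" using c0 \<delta> by (auto simp: \<eta>_def)
    define L where "L = 8 / c0"
    have L: "L > 0" using c0 by (simp add: L_def)
    define K where "K = L + L ^ 4 / 4 + (J1 * L ^ 4 + 2 * L\<^sup>2 + 4 * C * L ^ 3) / (2 * c0)"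
    have K: "K > 0" "L \<le> K" using L c0 C J1 by (auto simp: K_def add_pos_nonneg)
    show "\<exists>\<eta>>0. \<exists>K>0. \<forall>f T s1 s2 \<epsilon>.
     0 \<le> \<epsilon> \<longrightarrow> \<epsilon> \<le> \<eta> \<longrightarrow> norm (s1, s2) \<le> \<eta> \<longrightarrow> s1 \<bullet> mu = 0 \<longrightarrow> T \<in> S \<delta> \<longrightarrow> (\<forall>q\<in>S \<delta>. f q \<le> (f T :: real)) \<longrightarrow>
     (\<forall>q\<in>S \<delta>. \<bar>f q - f (mu, rho) - (s1 \<bullet> (fst q - mu) + s2 * (snd q - rho)
         - (Jm * ((norm (fst q - mu))\<^sup>2 - (mu \<bullet> (fst q - mu))\<^sup>2) + Jr * (snd q - rho)\<^sup>2) / 2)\<bar>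
         \<le> \<epsilon> * (norm (q - (mu, rho)))\<^sup>2 / 2 + C * norm (q - (mu, rho)) ^ 3) \<longrightarrow>
     dist T (mu, rho) < \<delta> \<and> norm (T - (mu, rho)) \<le> K * norm (s1, s2) \<and>
     (norm (T - (mu, rho) - (s1 /\<^sub>R Jm, s2 / Jr)))\<^sup>2 \<le> K * (\<epsilon> + norm (s1, s2)) * (norm (s1, s2))\<^sup>2"
    proof (rule exI[of _ \<eta>], intro conjI \<eta>(1), rule exI[of _ K], intro conjI K(1), intro allI impI)
      fix f :: "'a \<times> real \<Rightarrow> real" and T :: "'a \<times> real" and s1 :: 'a and s2 \<epsilon> :: real
      assume \<epsilon>: "0 \<le> \<epsilon>" "\<epsilon> \<le> \<eta>" and s: "norm (s1, s2) \<le> \<eta>" and s1: "s1 \<bullet> mu = 0"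
        and T: "T \<in> S \<delta>" "\<forall>q\<in>S \<delta>. f q \<le> f T"
        and exp: "\<forall>q\<in>S \<delta>. \<bar>f q - f (mu, rho) - (s1 \<bullet> (fst q - mu) + s2 * (snd q - rho)
         - (Jm * ((norm (fst q - mu))\<^sup>2 - (mu \<bullet> (fst q - mu))\<^sup>2) + Jr * (snd q - rho)\<^sup>2) / 2)\<bar>
         \<le> \<epsilon> * (norm (q - (mu, rho)))\<^sup>2 / 2 + C * norm (q - (mu, rho)) ^ 3"
      define \<sigma> where "\<sigma> = norm (s1, s2)"
      have \<sigma>: "\<sigma> \<ge> 0" "\<sigma> \<le> 1" "\<sigma> \<le> c0 * \<delta> / 8" using s \<eta> by (auto simp: \<sigma>_def)
      define Q where "Q = (\<lambda>H :: 'a \<times> real. Jm * ((norm (fst H))\<^sup>2 - (mu \<bullet> fst H)\<^sup>2) + Jr * (snd H)\<^sup>2)"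
      define R where "R = (\<lambda>H :: 'a \<times> real. \<epsilon> * (norm H)\<^sup>2 / 2 + C * norm H ^ 3)"
      define sH where "sH = (\<lambda>H :: 'a \<times> real. s1 \<bullet> fst H + s2 * snd H)"
      have exp: "\<bar>f q - f (mu, rho) - (sH (q - (mu, rho)) - Q (q - (mu, rho)) / 2)\<bar> \<le> R (q - (mu, rho))" if "q \<in> S \<delta>" for q
        using bspec[OF exp that] by (simp add: sH_def Q_def R_def)
      have n2: "(norm H)\<^sup>2 = (norm (fst H))\<^sup>2 + (snd H)\<^sup>2" for H :: "'a \<times> real"
        by (simp add: norm_prod_def)
      have nle: "norm (fst H) \<le> norm H" for H :: "'a \<times> real"
        using norm_fst_le[of "fst H" "snd H"] by simp
      have cs: "(mu \<bullet> h)\<^sup>2 \<le> (norm h)\<^sup>2" for h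
        using power_mono[OF Cauchy_Schwarz_ineq2[of mu h], of 2] mu by simp
      have Qup: "Q H \<le> J1 * (norm H)\<^sup>2" for H
      proof -
        have "Jm * ((norm (fst H))\<^sup>2 - (mu \<bullet> fst H)\<^sup>2) \<le> J1 * (norm (fst H))\<^sup>2"
          using J1 J cs[of "fst H"] by (intro mult_mono) auto
        moreover have "Jr * (snd H)\<^sup>2 \<le> J1 * (snd H)\<^sup>2" using J1 by (intro mult_right_mono) auto
        ultimately show ?thesis unfolding Q_def n2 by (simp add: algebra_simps)
      qed
      have Qlow: "2 * c0 * ((norm H)\<^sup>2 - (mu \<bullet> fst H)\<^sup>2) \<le> Q H" for H
      proof -
        have "2 * c0 * ((norm (fst H))\<^sup>2 - (mu \<bullet> fst H)\<^sup>2) \<le> Jm * ((norm (fst H))\<^sup>2 - (mu \<bullet> fst H)\<^sup>2)"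
          using c0 cs[of "fst H"] by (intro mult_right_mono) auto
        moreover have "2 * c0 * (snd H)\<^sup>2 \<le> Jr * (snd H)\<^sup>2" using c0 by (intro mult_right_mono) auto
        ultimately show ?thesis unfolding Q_def n2 by (simp add: algebra_simps)
      qed
      \<comment> \<open>Since \<open>fst q\<close> and \<open>mu\<close> are unit vectors, the
        normal component of the increment is quadratic in it; this compensates the degeneracy of Q
        in the direction \<open>mu\<close>.\<close>
      have mu_h: "mu \<bullet> fst (q - (mu, rho)) = - (norm (fst (q - (mu, rho))))\<^sup>2 / 2" if "q \<in> S \<delta>" for q
      proof -
        have "fst q \<bullet> fst q = 1" "mu \<bullet> mu = 1" using that mu by (simp_all add: S_def norm_eq_1)
        thus ?thesis by (simp add: power2_norm_eq_inner inner_diff_left inner_diff_right inner_commute)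
      qed
      have sH_le: "\<bar>sH H\<bar> \<le> \<sigma> * norm H" for H
      proof -
        have "sH H = (s1, s2) \<bullet> H" by (cases H) (simp add: sH_def)
        thus ?thesis unfolding \<sigma>_def using Cauchy_Schwarz_ineq2[of "(s1, s2)" H] by simp
      qed
      have SH: "norm (q - (mu, rho)) \<le> \<delta>" if "q \<in> S \<delta>" for q
        using that by (simp add: S_def dist_norm)
      define H where "H = T - (mu, rho)"
      have H\<delta>: "norm H \<le> \<delta>" "norm H \<le> 1" using SH[OF T(1)] \<delta>1 by (auto simp: H_def)
      have muH: "(mu \<bullet> fst H)\<^sup>2 = (norm (fst H)) ^ 4 / 4"
        using mu_h[OF T(1)] by (simp add: H_def power2_eq_square power4_eq_xxxx)
      have th0: "(mu, rho) \<in> S \<delta>" using mu \<delta> by (simp add: S_def)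
      have fst4: "norm (fst H) ^ 4 \<le> norm H ^ 4" by (intro power_mono nle) auto
      have H4: "norm H ^ 4 \<le> (norm H)\<^sup>2" using H\<delta> by (intro power_decreasing) auto
      \<comment> \<open>Comparison with the value at the true parameter: Q / 2 dominates c0 |H|^2 /
        2, the remainder takes away at most half of that, and the linear term is at most \<sigma>
        |H|.\<close>
      have HL: "norm H \<le> 4 * \<sigma> / c0"
      proof (cases "norm H = 0")
        case True
        thus ?thesis using \<sigma> c0 by simp
      next
        case False
        have "c0 * (norm H)\<^sup>2 \<le> 2 * c0 * ((norm H)\<^sup>2 - (mu \<bullet> fst H)\<^sup>2)"
        proof -
          have "(mu \<bullet> fst H)\<^sup>2 \<le> (norm H)\<^sup>2 / 2" unfolding muH using fst4 H4 zero_le_power2[of "norm H"] by linarith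
          thus ?thesis using c0 by (simp add: algebra_simps)
        qed
        hence q: "c0 * (norm H)\<^sup>2 \<le> Q H" using Qlow[of H] by linarith
        have r: "R H \<le> c0 / 4 * (norm H)\<^sup>2"
        proof -
          have "\<epsilon> * (norm H)\<^sup>2 / 2 \<le> c0 / 8 * (norm H)\<^sup>2"
          proof -
            have "\<epsilon> * (norm H)\<^sup>2 \<le> c0 / 8 * (norm H)\<^sup>2" using \<epsilon> \<eta> by (intro mult_right_mono) auto
            moreover have "0 \<le> c0 / 8 * (norm H)\<^sup>2" using c0 by simp
            ultimately show ?thesis by linarith
          qed
          moreover have "C * norm H ^ 3 \<le> c0 / 8 * (norm H)\<^sup>2"
          proof -
            have "C * norm H ^ 3 = C * norm H * (norm H)\<^sup>2" by (simp add: power2_eq_square power3_eq_cube)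
            also have "\<dots> \<le> (c0 / 8) * (norm H)\<^sup>2"
              using H\<delta> C \<delta>1 by (intro mult_right_mono order_trans[OF mult_left_mono[OF H\<delta>(1) C]]) auto
            finally show ?thesis .
          qed
          ultimately show ?thesis unfolding R_def by linarith
        qed
        have "f (mu, rho) \<le> f T" using T(2) th0 by blast
        hence "0 \<le> sH H - Q H / 2 + R H" using exp[OF T(1)] unfolding H_def[symmetric] by linarith
        hence "c0 / 4 * (norm H)\<^sup>2 \<le> \<sigma> * norm H" using q r sH_le[of H] by linarith
        hence "c0 / 4 * norm H * norm H \<le> \<sigma> * norm H" by (simp add: power2_eq_square mult.assoc)
        hence "c0 / 4 * norm H \<le> \<sigma>" using False by simp
        thus ?thesis using c0 by (simp add: field_simps)
      qed
      have Hhalf: "norm H \<le> \<delta> / 2"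
      proof -
        have "4 * \<sigma> / c0 \<le> \<delta> / 2" using \<sigma> c0 by (simp add: field_simps)
        thus ?thesis using HL by simp
      qed
      have HL\<sigma>: "norm H \<le> L * \<sigma>"
      proof -
        have "4 * \<sigma> / c0 \<le> L * \<sigma>" unfolding L_def using \<sigma> c0 by (simp add: field_simps)
        thus ?thesis using HL by linarith
      qed
      define G where "G = (s1 /\<^sub>R Jm, s2 / Jr)"
      have g_mu: "mu \<bullet> fst G = 0" using s1 by (simp add: G_def inner_commute)
      have Gn: "norm G \<le> \<sigma> / (2 * c0)"
      proof -
        have "(norm G)\<^sup>2 = (norm s1 / Jm)\<^sup>2 + (s2 / Jr)\<^sup>2"
          using J by (simp add: n2 G_def divide_inverse mult.commute)
        also have "\<dots> \<le> (norm s1 / (2 * c0))\<^sup>2 + (s2 / (2 * c0))\<^sup>2"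
        proof (rule add_mono)
          show "(norm s1 / Jm)\<^sup>2 \<le> (norm s1 / (2 * c0))\<^sup>2"
            using c0 by (intro power_mono divide_left_mono) (auto simp: J)
          have "\<bar>s2 / Jr\<bar> \<le> \<bar>s2 / (2 * c0)\<bar>"
            unfolding abs_divide using c0 J by (intro divide_left_mono) auto
          thus "(s2 / Jr)\<^sup>2 \<le> (s2 / (2 * c0))\<^sup>2" by (rule abs_le_square_iff[THEN iffD1])
        qed
        also have "\<dots> = (\<sigma> / (2 * c0))\<^sup>2"
          unfolding power_divide \<sigma>_def n2[of "(s1, s2)"] by (simp add: add_divide_distrib)
        finally show ?thesis by (rule power2_le_imp_le) (use \<sigma> c0 in auto)
      qed
      have G\<delta>: "norm G \<le> \<delta> / 2" "norm G \<le> 1"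
      proof -
        have "\<sigma> / (2 * c0) \<le> \<delta> / 2" using \<sigma> c0 \<delta> by (simp add: field_simps)
        thus "norm G \<le> \<delta> / 2" using Gn by simp
        thus "norm G \<le> 1" using \<delta>1 by simp
      qed
      define g where "g = fst G"
      define N where "N = sqrt (1 + (norm g)\<^sup>2)"
      have N: "N \<ge> 1" "N\<^sup>2 = 1 + (norm g)\<^sup>2" by (simp_all add: N_def)
      have Nle: "N - 1 \<le> (norm g)\<^sup>2"
      proof -
        have "(N - 1) * 1 \<le> (N - 1) * (N + 1)" using N by (intro mult_left_mono) auto
        hence "N - 1 \<le> (N - 1) * (N + 1)" by simp
        also have "\<dots> = (norm g)\<^sup>2" using N(2) by (simp add: algebra_simps power2_eq_square)
        finally show ?thesis .
      qed
      have nmg: "norm (mu + g) = N"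
      proof -
        have "mu \<bullet> mu = 1" "mu \<bullet> g = 0" using mu g_mu by (simp_all add: norm_eq_1 g_def)
        hence "(norm (mu + g))\<^sup>2 = N\<^sup>2"
          unfolding N(2) power2_norm_eq_inner inner_add_left inner_add_right inner_commute[of g mu] by linarith
        thus ?thesis by (rule power2_eq_imp_eq[OF _ norm_ge_zero]) (use N(1) in linarith)
      qed
      \<comment> \<open>The unconstrained optimum mu + g lies in the tangent plane; dividing by its
        length N returns to the sphere at the cost N - 1 <= |g|^2.\<close>
      define q where "q = ((mu + g) /\<^sub>R N, rho + snd G)"
      define Hq where "Hq = q - (mu, rho)"
      have HqG: "norm (Hq - G) \<le> (norm G)\<^sup>2"
      proof -
        have "Hq - G = ((inverse N - 1) *\<^sub>R (mu + g), 0)"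
          by (cases G) (simp add: Hq_def q_def g_def scaleR_diff_left)
        hence "norm (Hq - G) = \<bar>inverse N - 1\<bar> * N"
          using nmg N(1) by (simp add: norm_prod_def abs_mult)
        also have "\<dots> = N - 1" using N by (simp add: abs_if field_simps)
        also have "\<dots> \<le> (norm g)\<^sup>2" by (rule Nle)
        also have "\<dots> \<le> (norm G)\<^sup>2" unfolding g_def by (intro power_mono nle) auto
        finally show ?thesis .
      qed
      have G2: "(norm G)\<^sup>2 \<le> norm G / 2"
      proof -
        have "norm G * norm G \<le> (1 / 2) * norm G" using G\<delta> \<delta>1 by (intro mult_right_mono) auto
        thus ?thesis by (simp add: power2_eq_square)
      qed
      have Hq2: "norm Hq \<le> 2 * norm G"
      proof -
        have "norm Hq \<le> norm (Hq - G) + norm G" using norm_triangle_ineq[of "Hq - G" G] by simp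
        thus ?thesis using HqG G2 norm_ge_zero[of G] by linarith
      qed
      have Hq2': "norm Hq \<le> \<delta>"
      proof -
        have "2 * norm G \<le> \<delta>" using G\<delta> by simp
        thus ?thesis using Hq2 by linarith
      qed
      have qS: "q \<in> S \<delta>"
        using Hq2' nmg N unfolding S_def by (simp add: q_def Hq_def dist_norm)
      \<comment> \<open>Completing the square: up to a constant, the model value at H' is minus half
        of Q (H' - G), so comparing values of f compares distances to G.\<close>
      have ident: "Q (H' - G) = Q G - 2 * sH H' + Q H'" for H'
      proof -
        have a: "(norm (fst H' - fst G))\<^sup>2 = (norm (fst H'))\<^sup>2 - 2 * (fst G \<bullet> fst H') + (norm (fst G))\<^sup>2"
          by (simp add: power2_norm_eq_inner inner_diff_left inner_diff_right inner_commute)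
        have b: "mu \<bullet> (fst H' - fst G) = mu \<bullet> fst H'" using g_mu by (simp add: inner_diff_right)
        have c: "Jm * (fst G \<bullet> fst H') = s1 \<bullet> fst H'" using J by (simp add: G_def)
        have d: "Jr * (snd G * snd H') = s2 * snd H'" using J by (simp add: G_def)
        have "Q (H' - G) = Jm * (norm (fst H'))\<^sup>2 - 2 * (Jm * (fst G \<bullet> fst H')) + Jm * (norm (fst G))\<^sup>2 - Jm * (mu \<bullet> fst H')\<^sup>2
            + Jr * (snd H')\<^sup>2 - 2 * (Jr * (snd G * snd H')) + Jr * (snd G)\<^sup>2"
          unfolding Q_def fst_diff snd_diff a b by (simp add: algebra_simps power2_eq_square)
        moreover have "Q G = Jm * (norm (fst G))\<^sup>2 + Jr * (snd G)\<^sup>2" by (simp add: Q_def g_mu)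
        moreover have "Q H' = Jm * (norm (fst H'))\<^sup>2 - Jm * (mu \<bullet> fst H')\<^sup>2 + Jr * (snd H')\<^sup>2"
          by (simp add: Q_def algebra_simps)
        ultimately show ?thesis unfolding c d sH_def by simp
      qed
      have main: "Q (H - G) \<le> Q (Hq - G) + 2 * R H + 2 * R Hq"
      proof -
        have "f q \<le> f T" using T(2) qS by blast
        thus ?thesis unfolding ident using exp[OF T(1)] exp[OF qS]
          unfolding H_def[symmetric] Hq_def[symmetric] by linarith
      qed
      have GL: "norm G \<le> L * \<sigma>" and HqL: "norm Hq \<le> L * \<sigma>"
      proof -
        have "2 * (\<sigma> / (2 * c0)) \<le> L * \<sigma>" unfolding L_def using \<sigma> c0 by (simp add: field_simps)
        thus "norm Hq \<le> L * \<sigma>" using Hq2 Gn by linarith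
        have "\<sigma> / (2 * c0) \<le> L * \<sigma>" unfolding L_def using \<sigma> c0 by (simp add: field_simps)
        thus "norm G \<le> L * \<sigma>" using Gn by linarith
      qed
      have \<sigma>43: "\<sigma> ^ 4 \<le> \<sigma> ^ 3" using \<sigma> by (intro power_decreasing) auto
      have p4: "x ^ 4 \<le> L ^ 4 * \<sigma> ^ 3" if "0 \<le> x" "x \<le> L * \<sigma>" for x :: real
      proof -
        have "x ^ 4 \<le> (L * \<sigma>) ^ 4" using that by (intro power_mono) auto
        also have "\<dots> = L ^ 4 * \<sigma> ^ 4" by (simp add: power_mult_distrib)
        also have "\<dots> \<le> L ^ 4 * \<sigma> ^ 3" using \<sigma>43 L by (intro mult_left_mono) auto
        finally show ?thesis .
      qed
      have RL: "R H' \<le> \<epsilon> * L\<^sup>2 * \<sigma>\<^sup>2 / 2 + C * L ^ 3 * \<sigma> ^ 3" if "norm H' \<le> L * \<sigma>" for H'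
      proof -
        have "(norm H')\<^sup>2 \<le> (L * \<sigma>)\<^sup>2" "norm H' ^ 3 \<le> (L * \<sigma>) ^ 3" using that by (auto intro!: power_mono)
        hence "\<epsilon> * (norm H')\<^sup>2 \<le> \<epsilon> * (L * \<sigma>)\<^sup>2" "C * norm H' ^ 3 \<le> C * (L * \<sigma>) ^ 3"
          using \<epsilon> C by (auto intro!: mult_left_mono)
        thus ?thesis by (simp add: R_def power_mult_distrib mult_ac)
      qed
      have QG: "Q (Hq - G) \<le> J1 * (L ^ 4 * \<sigma> ^ 3)"
      proof -
        have "(norm (Hq - G))\<^sup>2 \<le> ((norm G)\<^sup>2)\<^sup>2" using HqG by (intro power_mono) auto
        also have "\<dots> = norm G ^ 4" by (simp add: power2_eq_square power4_eq_xxxx)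
        also have "\<dots> \<le> L ^ 4 * \<sigma> ^ 3" by (rule p4) (use GL in auto)
        finally have "J1 * (norm (Hq - G))\<^sup>2 \<le> J1 * (L ^ 4 * \<sigma> ^ 3)" using J1 by (intro mult_left_mono) auto
        thus ?thesis using Qup[of "Hq - G"] by linarith
      qed
      have muHG: "(mu \<bullet> fst (H - G))\<^sup>2 \<le> L ^ 4 * \<sigma> ^ 3 / 4"
      proof -
        have "mu \<bullet> fst (H - G) = mu \<bullet> fst H" using g_mu by (simp add: inner_diff_right)
        thus ?thesis using muH fst4 p4[OF norm_ge_zero HL\<sigma>] by (simp only:)
      qed
      have "2 * c0 * (norm (H - G))\<^sup>2 \<le> 2 * c0 * (L ^ 4 * \<sigma> ^ 3 / 4) + (J1 * (L ^ 4 * \<sigma> ^ 3) + 2 * \<epsilon> * L\<^sup>2 * \<sigma>\<^sup>2 + 4 * C * L ^ 3 * \<sigma> ^ 3)"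
      proof -
        have "2 * c0 * (mu \<bullet> fst (H - G))\<^sup>2 \<le> 2 * c0 * (L ^ 4 * \<sigma> ^ 3 / 4)"
          using muHG c0 by (intro mult_left_mono) auto
        thus ?thesis using Qlow[of "H - G"] main QG RL[OF HL\<sigma>] RL[OF HqL]
          by (simp only: right_diff_distrib)
      qed
      also have "\<dots> \<le> 2 * c0 * (K * (\<epsilon> + \<sigma>) * \<sigma>\<^sup>2)"
      proof -
        have e1: "2 * \<epsilon> * L\<^sup>2 * \<sigma>\<^sup>2 \<le> 2 * L\<^sup>2 * (\<epsilon> + \<sigma>) * \<sigma>\<^sup>2"
          using \<sigma> by (simp add: algebra_simps)
        have e2: "x * \<sigma> ^ 3 \<le> x * (\<epsilon> + \<sigma>) * \<sigma>\<^sup>2" if "x \<ge> 0" for x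
          using that \<epsilon> \<sigma> by (simp add: algebra_simps power2_eq_square power3_eq_cube)
        have "2 * c0 * K = 2 * c0 * L + 2 * c0 * (L ^ 4 / 4) + (J1 * L ^ 4 + 2 * L\<^sup>2 + 4 * C * L ^ 3)"
          unfolding K_def distrib_left using c0(1) by simp
        hence "2 * c0 * (K * (\<epsilon> + \<sigma>) * \<sigma>\<^sup>2) = 2 * c0 * L * (\<epsilon> + \<sigma>) * \<sigma>\<^sup>2 + 2 * c0 * (L ^ 4 / 4) * (\<epsilon> + \<sigma>) * \<sigma>\<^sup>2
           + (J1 * L ^ 4 * (\<epsilon> + \<sigma>) * \<sigma>\<^sup>2 + 2 * L\<^sup>2 * (\<epsilon> + \<sigma>) * \<sigma>\<^sup>2 + 4 * C * L ^ 3 * (\<epsilon> + \<sigma>) * \<sigma>\<^sup>2)"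
          by (simp only: mult.assoc[symmetric]) (simp add: algebra_simps)
        moreover have "2 * c0 * L * (\<epsilon> + \<sigma>) * \<sigma>\<^sup>2 \<ge> 0" using c0 L \<epsilon> \<sigma> by simp
        moreover have "2 * c0 * (L ^ 4 / 4) * \<sigma> ^ 3 \<le> 2 * c0 * (L ^ 4 / 4) * (\<epsilon> + \<sigma>) * \<sigma>\<^sup>2"
          "J1 * L ^ 4 * \<sigma> ^ 3 \<le> J1 * L ^ 4 * (\<epsilon> + \<sigma>) * \<sigma>\<^sup>2" "4 * C * L ^ 3 * \<sigma> ^ 3 \<le> 4 * C * L ^ 3 * (\<epsilon> + \<sigma>) * \<sigma>\<^sup>2"
          using c0 L J1 C by (intro e2; simp)+
        ultimately show ?thesis using e1 by (simp only: mult.assoc[symmetric])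
      qed
      finally have fin: "(norm (H - G))\<^sup>2 \<le> K * (\<epsilon> + \<sigma>) * \<sigma>\<^sup>2" using c0 by simp
      have "norm H \<le> K * \<sigma>" using HL\<sigma> mult_right_mono[OF K(2) \<sigma>(1)] by linarith
      moreover have "dist T (mu, rho) < \<delta>" using Hhalf \<delta> by (simp add: H_def dist_norm)
      ultimately show "dist T (mu, rho) < \<delta> \<and> norm (T - (mu, rho)) \<le> K * norm (s1, s2) \<and>
         (norm (T - (mu, rho) - (s1 /\<^sub>R Jm, s2 / Jr)))\<^sup>2 \<le> K * (\<epsilon> + norm (s1, s2)) * (norm (s1, s2))\<^sup>2"
        using fin unfolding H_def G_def \<sigma>_def by blast
    qed
  qed
qed

section \<open>The Fisher information\<close>

lemma integral_cos_substitution: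
  fixes F :: "real \<Rightarrow> real"
  assumes F: "continuous_on {-1..1} F"
  shows "integral {-1..1} (\<lambda>t. F t * (1 - t\<^sup>2) powr (real m / 2)) = integral {0..pi} (\<lambda>\<theta>. F (cos \<theta>) * sin \<theta> ^ (m + 1))"
proof -
  define G where "G = (\<lambda>t. F t * sqrt (1 - t\<^sup>2) ^ m)"
  have contG: "continuous_on {-1..1} G"
    unfolding G_def by (intro continuous_intros F)
  \<comment> \<open>The exponent may be zero, and \<open>0 powr 0\<close> is 0 whereas
    \<open>sqrt 0 ^ 0\<close> is 1, so the integrands are compared off the endpoints.\<close>
  have "integral {-1..1} (\<lambda>t. F t * (1 - t\<^sup>2) powr (real m / 2)) = integral {-1..1} G"
  proof (rule integral_spike[of "{-1, 1}"])
    fix t :: real assume "t \<in> {-1..1} - {-1, 1}"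
    hence "1 - t\<^sup>2 > 0" by (simp add: abs_square_less_1 abs_less_iff)
    hence "(1 - t\<^sup>2) powr (real m / 2) = sqrt (1 - t\<^sup>2) ^ m"
      by (simp add: powr_realpow[symmetric] powr_powr flip: powr_half_sqrt)
    thus "G t = F t * (1 - t\<^sup>2) powr (real m / 2)" by (simp add: G_def)
  qed simp
  \<comment> \<open>The reflection t -> -t allows the increasing substitution -cos in place of
    cos.\<close>
  also have "\<dots> = integral {-1..1} (\<lambda>t. G (- t))"
    using Henstock_Kurzweil_Integration.integral_reflect_real[of 1 "-1" G] by simp
  also have "\<dots> = integral {0..pi} (\<lambda>\<theta>. F (cos \<theta>) * sin \<theta> ^ (m + 1))"
  proof -
    have "((\<lambda>\<theta>. sin \<theta> *\<^sub>R (\<lambda>t. G (- t)) (- cos \<theta>)) has_integral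
          (integral {- cos 0..- cos pi} (\<lambda>t. G (- t)))) {0..pi}"
    proof (rule has_integral_substitution[where c="-1" and d=1])
      show "continuous_on {-1..1} (\<lambda>t. G (- t))"
        by (intro continuous_on_compose2[OF contG] continuous_intros) auto
      show "((\<lambda>x. - cos x) has_field_derivative sin x) (at x within {0..pi})" for x
        by (auto intro!: derivative_eq_intros)
    qed auto
    hence "integral {-1..1} (\<lambda>t. G (- t)) = integral {0..pi} (\<lambda>\<theta>. sin \<theta> * G (cos \<theta>))"
      by (simp add: integral_unique)
    also have "\<dots> = integral {0..pi} (\<lambda>\<theta>. F (cos \<theta>) * sin \<theta> ^ (m + 1))"
    proof (rule integral_cong)
      fix \<theta> :: real assume "\<theta> \<in> {0..pi}"
      hence "sqrt (1 - (cos \<theta>)\<^sup>2) = sin \<theta>" by (simp add: sin_squared_eq[symmetric] sin_ge_zero)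
      thus "sin \<theta> * G (cos \<theta>) = F (cos \<theta>) * sin \<theta> ^ (m + 1)" by (simp add: G_def)
    qed
    finally show ?thesis .
  qed
  finally show ?thesis .
qed

text \<open>Fisher information for rho, the mean square of p / (1 + rho p), in the polar angle: one
  factor of the denominator cancels against the density.\<close>

definition info_rho :: "nat \<Rightarrow> real poly \<Rightarrow> real \<Rightarrow> real" where
  "info_rho d p rho = omega (d - 1) / omega d *
     integral {0..pi} (\<lambda>\<theta>. (poly p (cos \<theta>))\<^sup>2 / (1 + rho * poly p (cos \<theta>)) * sin \<theta> ^ (d - 1))"

text \<open>Fisher information in one unit tangent direction. Isotropy gives the divisor d, and the
  squared tangential length sin^2 raises the exponent from d - 1 to d + 1.\<close>

definition info_mu :: "nat \<Rightarrow> real poly \<Rightarrow> real \<Rightarrow> real" where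
  "info_mu d p rho = omega (d - 1) / (omega d * real d) *
     integral {0..pi} (\<lambda>\<theta>. rho\<^sup>2 * (poly (pderiv p) (cos \<theta>))\<^sup>2 / (1 + rho * poly p (cos \<theta>)) * sin \<theta> ^ (d + 1))"

text \<open>The substitution t = cos theta turns the reciprocals of the stated variances into Fisher
  information. The factor (d - 1)^2 comes from the derivative of the Gegenbauer polynomial, whose
  index is raised by one.\<close>

lemma sigma2_eq_info_ge_2:
  assumes d: "d \<ge> 2" and rho: "0 < rho" "rho < 1"
    and p1: "\<And>t. t \<in> {-1..1} \<Longrightarrow> \<bar>poly p t\<bar> \<le> 1"
    and p: "\<And>t. poly p t = gegen ((real d - 1) / 2) k t / gegen ((real d - 1) / 2) k 1"
    and dp: "\<And>t. poly (pderiv p) t = (real d - 1) * gegen ((real d + 1) / 2) (k - 1) t / gegen ((real d - 1) / 2) k 1"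
  shows "sigma2_rho d k rho = 1 / info_rho d p rho" "sigma2_mu d k rho = 1 / info_mu d p rho"
proof -
  define c where "c = gegen ((real d - 1) / 2) k 1"
  have c: "c > 0" unfolding c_def using d by (intro gegen_1_pos) simp
  have g: "gegen ((real d - 1) / 2) k t = c * poly p t" for t
    using p[of t] c by (simp add: c_def)
  have g': "(real d - 1) * gegen ((real d + 1) / 2) (k - 1) t = c * poly (pderiv p) t" for t
    using dp[of t] c by (simp add: c_def)
  have pos: "1 + rho * poly p t > 0" if "t \<in> {-1..1}" for t
  proof -
    have "\<bar>rho * poly p t\<bar> \<le> rho * 1" unfolding abs_mult using p1[OF that] rho by (intro mult_mono) auto
    thus ?thesis using rho by linarith
  qed
  have D: "c + rho * (c * x) = c * (1 + rho * x)" for x by (simp add: algebra_simps)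
  have p11: "poly p 1 = 1" using p[of 1] c by (simp add: c_def)
  show "sigma2_rho d k rho = 1 / info_rho d p rho"
  proof -
    have "integral {-1..1} (\<lambda>t. (c * poly p t)\<^sup>2 * (1 - t\<^sup>2) powr (real d / 2 - 1) / (c + rho * (c * poly p t))) =
      integral {-1..1} (\<lambda>t. c * ((poly p t)\<^sup>2 / (1 + rho * poly p t) * (1 - t\<^sup>2) powr (real (d - 2) / 2)))"
      using d c unfolding D
      by (intro integral_cong) (simp add: power_mult_distrib power2_eq_square of_nat_diff diff_divide_distrib mult_ac)
    also have "\<dots> = c * integral {0..pi} (\<lambda>\<theta>. (poly p (cos \<theta>))\<^sup>2 / (1 + rho * poly p (cos \<theta>)) * sin \<theta> ^ (d - 2 + 1))"
      using pos by (subst integral_mult_right, subst integral_cos_substitution) (force intro!: continuous_intros)+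
    also have "d - 2 + 1 = d - 1" using d by simp
    finally show ?thesis
      using d c unfolding sigma2_rho_def info_rho_def g p11 mult_1_right
      by (simp add: field_simps)
  qed
  show "sigma2_mu d k rho = 1 / info_mu d p rho"
  proof -
    have "(real d - 1)\<^sup>2 * integral {-1..1} (\<lambda>t. (gegen ((real d + 1) / 2) (k - 1) t)\<^sup>2 * (1 - t\<^sup>2) powr (real d / 2)
          / (c + rho * (c * poly p t))) =
      integral {-1..1} (\<lambda>t. ((real d - 1) * gegen ((real d + 1) / 2) (k - 1) t)\<^sup>2 * (1 - t\<^sup>2) powr (real d / 2)
          / (c + rho * (c * poly p t)))"
      by (subst integral_mult_right[symmetric]) (simp add: power_mult_distrib mult_ac)
    also have "\<dots> = integral {-1..1} (\<lambda>t. (c / rho\<^sup>2) * (rho\<^sup>2 * (poly (pderiv p) t)\<^sup>2 / (1 + rho * poly p t) * (1 - t\<^sup>2) powr (real d / 2)))"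
      using c rho unfolding D g'
      by (intro integral_cong) (simp add: power_mult_distrib power2_eq_square mult_ac)
    also have "\<dots> = (c / rho\<^sup>2) * integral {0..pi} (\<lambda>\<theta>. rho\<^sup>2 * (poly (pderiv p) (cos \<theta>))\<^sup>2 / (1 + rho * poly p (cos \<theta>)) * sin \<theta> ^ (d + 1))"
      using pos by (subst integral_mult_right, subst integral_cos_substitution) (force intro!: continuous_intros)+
    finally have eq: "(real d - 1)\<^sup>2 * integral {-1..1} (\<lambda>t. (gegen ((real d + 1) / 2) (k - 1) t)\<^sup>2 * (1 - t\<^sup>2) powr (real d / 2)
          / (c + rho * (c * poly p t))) = (c / rho\<^sup>2) * integral {0..pi} (\<lambda>\<theta>. rho\<^sup>2 * (poly (pderiv p) (cos \<theta>))\<^sup>2 / (1 + rho * poly p (cos \<theta>)) * sin \<theta> ^ (d + 1))"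
      (is "_ * ?I = _ * ?J") .
    have "rho\<^sup>2 * (omega (d - 1) / (omega d * c)) * ((real d - 1)\<^sup>2 / real d) * ?I = rho\<^sup>2 * (omega (d - 1) / (omega d * c)) / real d * ((real d - 1)\<^sup>2 * ?I)"
      by simp
    also have "\<dots> = info_mu d p rho"
      unfolding eq info_mu_def using c rho by (simp add: field_simps)
    finally show ?thesis using d unfolding sigma2_mu_def g p11 mult_1_right by simp
  qed
qed

text \<open>With \<open>w = sqrt (1 - rho\<^sup>2)\<close> and \<open>s = rho / (1 + w)\<close> one has \<open>rho = 2 s / (1 + s\<^sup>2)\<close>, and
  \<open>(x - 2 arctan (s sin x / (1 + s cos x))) / w\<close> is an antiderivative of \<open>1 / (1 + rho cos x)\<close> on the whole line.\<close>
lemma integral_inverse_one_plus_cos: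
  assumes rho: "0 < rho" "rho < 1" and k: "k \<ge> 1"
  shows "((\<lambda>\<theta>. 1 / (1 + rho * cos (real k * \<theta>))) has_integral (pi / sqrt (1 - rho\<^sup>2))) {0..pi}"
proof -
  define w where "w = sqrt (1 - rho\<^sup>2)"
  have r2: "rho\<^sup>2 < 1" using rho by (simp add: abs_square_less_1)
  have w: "w > 0" "w\<^sup>2 = 1 - rho\<^sup>2" using r2 by (simp_all add: w_def)
  define s where "s = rho / (1 + w)"
  have s: "0 < s" "s < 1" using rho w by (simp_all add: s_def)
  have s2: "s\<^sup>2 = (1 - w) / (1 + w)"
  proof -
    have "s\<^sup>2 = rho\<^sup>2 / (1 + w)\<^sup>2" by (simp add: s_def power_divide)
    also have "rho\<^sup>2 = (1 - w) * (1 + w)" using w(2) by (simp add: algebra_simps power2_eq_square)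
    finally show ?thesis using w by (simp add: power2_eq_square)
  qed
  have s3: "1 + s\<^sup>2 = 2 / (1 + w)" "1 - s\<^sup>2 = 2 * w / (1 + w)" unfolding s2 using w by (simp_all add: field_simps)
  define A where "A = (\<lambda>x. (x - 2 * arctan (s * sin x / (1 + s * cos x))) / w)"
  have A: "(A has_real_derivative 1 / (1 + rho * cos x)) (at x)" for x
  proof -
    have "\<bar>s * cos x\<bar> \<le> s * 1" "\<bar>rho * cos x\<bar> \<le> rho * 1"
      unfolding abs_mult using s rho by (intro mult_mono; simp)+
    hence d: "1 + s * cos x > 0" "1 + rho * cos x > 0" using s rho by linarith+
    define u where "u = s * sin x / (1 + s * cos x)"
    have q: "(1 + s * cos x)\<^sup>2 + (s * sin x)\<^sup>2 = 1 + 2 * s * cos x + s\<^sup>2"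
    proof -
      have "(s * sin x)\<^sup>2 = s\<^sup>2 - s\<^sup>2 * (cos x)\<^sup>2" by (simp add: power_mult_distrib sin_squared_eq algebra_simps)
      thus ?thesis by (simp add: power2_sum power_mult_distrib algebra_simps)
    qed
    have q2: "1 + 2 * s * cos x + s\<^sup>2 = (1 + s\<^sup>2) * (1 + rho * cos x)"
    proof -
      have "(1 + s\<^sup>2) * rho = 2 * rho / (1 + w)" unfolding s3 by simp
      also have "\<dots> = 2 * s" by (simp add: s_def)
      finally have "(1 + s\<^sup>2) * rho = 2 * s" .
      moreover have "(1 + s\<^sup>2) * (1 + rho * cos x) = 1 + s\<^sup>2 + (1 + s\<^sup>2) * rho * cos x" by (simp add: algebra_simps)
      ultimately show ?thesis by simp
    qed
    have qp: "1 + 2 * s * cos x + s\<^sup>2 > 0" unfolding q2 using d s by (intro mult_pos_pos) (auto intro: add_pos_nonneg)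
    have "((\<lambda>x. s * sin x / (1 + s * cos x)) has_real_derivative
        ((s * cos x) * (1 + s * cos x) - (s * sin x) * (- (s * sin x))) / (1 + s * cos x)\<^sup>2) (at x)"
      using d by (auto intro!: derivative_eq_intros simp: power2_eq_square)
    also have "(s * cos x) * (1 + s * cos x) - (s * sin x) * (- (s * sin x)) = s * cos x + s\<^sup>2"
    proof -
      have "(s * sin x) * (s * sin x) = s\<^sup>2 - s\<^sup>2 * (cos x)\<^sup>2"
      proof -
        have "(s * sin x) * (s * sin x) = s\<^sup>2 * (sin x)\<^sup>2" by (simp add: power2_eq_square)
        thus ?thesis by (simp add: sin_squared_eq algebra_simps)
      qed
      thus ?thesis by (simp add: algebra_simps power2_eq_square)
    qed
    finally have du: "((\<lambda>x. s * sin x / (1 + s * cos x)) has_real_derivative (s * cos x + s\<^sup>2) / (1 + s * cos x)\<^sup>2) (at x)" .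
    have "((\<lambda>x. arctan (s * sin x / (1 + s * cos x))) has_real_derivative
       inverse (1 + (s * sin x / (1 + s * cos x))\<^sup>2) * ((s * cos x + s\<^sup>2) / (1 + s * cos x)\<^sup>2)) (at x)"
      by (rule DERIV_chain2[OF DERIV_arctan du])
    also have "inverse (1 + (s * sin x / (1 + s * cos x))\<^sup>2) * ((s * cos x + s\<^sup>2) / (1 + s * cos x)\<^sup>2) =
        (s * cos x + s\<^sup>2) / (1 + 2 * s * cos x + s\<^sup>2)"
    proof -
      have "1 + (s * sin x / (1 + s * cos x))\<^sup>2 = (1 + 2 * s * cos x + s\<^sup>2) / (1 + s * cos x)\<^sup>2"
        unfolding q[symmetric] using d by (simp add: power_divide add_divide_distrib)
      thus ?thesis using d by simp
    qed
    finally have dA: "((\<lambda>x. arctan (s * sin x / (1 + s * cos x))) has_real_derivative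
       (s * cos x + s\<^sup>2) / (1 + 2 * s * cos x + s\<^sup>2)) (at x)" .
    have "(A has_real_derivative (1 - 2 * ((s * cos x + s\<^sup>2) / (1 + 2 * s * cos x + s\<^sup>2))) / w) (at x)"
      unfolding A_def by (rule DERIV_cdivide[OF DERIV_diff[OF DERIV_ident DERIV_cmult[OF dA]]])
    also have "(1 - 2 * ((s * cos x + s\<^sup>2) / (1 + 2 * s * cos x + s\<^sup>2))) / w = (1 - s\<^sup>2) / (1 + 2 * s * cos x + s\<^sup>2) / w"
      using qp by (simp add: field_simps)
    also have "\<dots> = 1 / (1 + rho * cos x)"
    proof -
      have "w * Y / (Y * X) / w = 1 / X" if "X > 0" "Y > 0" for X Y
        using w(1) that by simp
      from this[of _ "2 / (1 + w)"] have "2 * w / (1 + w) / (2 / (1 + w) * X) / w = 1 / X" if "X > 0" for X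
        using w(1) that by (simp add: mult.commute)
      thus ?thesis unfolding q2 s3 using d(2) by blast
    qed
    finally show ?thesis .
  qed
  have "((\<lambda>\<theta>. 1 / (1 + rho * cos (real k * \<theta>))) has_integral (A (real k * pi) / real k - A (real k * 0) / real k)) {0..pi}"
  proof (rule fundamental_theorem_of_calculus)
    fix \<theta> :: real
    have "((\<lambda>\<theta>. A (real k * \<theta>)) has_real_derivative 1 / (1 + rho * cos (real k * \<theta>)) * real k) (at \<theta> within {0..pi})"
      by (rule DERIV_chain2[OF A]) (auto intro!: derivative_eq_intros)
    from DERIV_cdivide[OF this, of "real k"]
    show "((\<lambda>\<theta>. A (real k * \<theta>) / real k) has_vector_derivative 1 / (1 + rho * cos (real k * \<theta>))) (at \<theta> within {0..pi})"
      unfolding has_real_derivative_iff_has_vector_derivative[symmetric] using k by simp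
  qed simp
  \<comment> \<open>At multiples of pi the sine vanishes and with it the arctan term, so the
    integral does not depend on k.\<close>
  moreover have "A (real k * pi) / real k - A (real k * 0) / real k = pi / w"
    using k by (simp add: A_def sin_npi)
  ultimately show ?thesis by (simp add: w_def)
qed

text \<open>Division with remainder by 1 + rho cos reduces both integrals to that of its reciprocal:
  cos^2 leaves the remainder 1 / rho^2, and rho^2 sin^2 leaves -(1 - rho^2).\<close>

lemma sigma2_eq_info_1:
  assumes rho: "0 < rho" "rho < 1" and k: "k \<ge> 1"
    and p: "\<And>\<theta>. poly p (cos \<theta>) = cos (real k * \<theta>)" "\<And>\<theta>. poly (pderiv p) (cos \<theta>) * sin \<theta> = real k * sin (real k * \<theta>)"
  shows "sigma2_rho 1 k rho = 1 / info_rho 1 p rho" "sigma2_mu 1 k rho = 1 / info_mu 1 p rho"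
proof -
  define w where "w = sqrt (1 - rho\<^sup>2)"
  have r2: "rho\<^sup>2 < 1" using rho by (simp add: abs_square_less_1)
  have w: "w > 0" "w\<^sup>2 = 1 - rho\<^sup>2" using r2 by (simp_all add: w_def)
  have w1: "w < 1" using rho w by (simp add: w_def)
  note I = integral_inverse_one_plus_cos[OF rho k, folded w_def]
  have D: "1 + rho * cos x \<noteq> 0" for x
  proof -
    have "\<bar>rho * cos x\<bar> \<le> rho * 1" unfolding abs_mult using rho by (intro mult_mono) auto
    thus ?thesis using rho by linarith
  qed
  have cosI: "((\<lambda>\<theta>. cos (real k * \<theta>)) has_integral 0) {0..pi}"
  proof -
    have "((\<lambda>\<theta>. cos (real k * \<theta>)) has_integral (sin (real k * pi) / real k - sin (real k * 0) / real k)) {0..pi}"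
      by (rule fundamental_theorem_of_calculus)
         (use k in \<open>auto simp: has_real_derivative_iff_has_vector_derivative[symmetric] intro!: derivative_eq_intros\<close>)
    thus ?thesis by (simp add: sin_npi)
  qed
  have oneI: "((\<lambda>\<theta>. 1 :: real) has_integral pi) {0..pi::real}"
    using has_integral_const_real[of "1::real" 0 pi] by simp
  have "((\<lambda>\<theta>. (1 / rho\<^sup>2) * ((rho * cos (real k * \<theta>) - 1) + 1 / (1 + rho * cos (real k * \<theta>)))) has_integral
      (1 / rho\<^sup>2) * ((rho * 0 - pi) + pi / w)) {0..pi}"
    by (intro has_integral_mult_right has_integral_add has_integral_diff cosI oneI I)
  also have "(\<lambda>\<theta>. (1 / rho\<^sup>2) * ((rho * cos (real k * \<theta>) - 1) + 1 / (1 + rho * cos (real k * \<theta>)))) =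
     (\<lambda>\<theta>. (cos (real k * \<theta>))\<^sup>2 / (1 + rho * cos (real k * \<theta>)))"
    using rho D by (intro ext) (simp add: field_simps power2_eq_square)
  finally have "info_rho 1 p rho = (1 / pi) * ((1 / rho\<^sup>2) * ((rho * 0 - pi) + pi / w))"
    using omega_0 omega_1 by (simp add: info_rho_def p integral_unique)
  also have "(rho * 0 - pi) + pi / w = pi * (1 / w - 1)" by (simp add: algebra_simps)
  also have "(1 / pi) * ((1 / rho\<^sup>2) * (pi * (1 / w - 1))) = (1 / rho\<^sup>2) * (1 / w - 1)" by simp
  also have "\<dots> = (1 - w) / (rho\<^sup>2 * w)" using w by (simp add: field_simps)
  finally show "sigma2_rho 1 k rho = 1 / info_rho 1 p rho"
    by (simp add: sigma2_rho_def w_def[symmetric])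
  have "((\<lambda>\<theta>. (real k)\<^sup>2 * ((1 - rho * cos (real k * \<theta>)) - (1 - rho\<^sup>2) * (1 / (1 + rho * cos (real k * \<theta>))))) has_integral
      (real k)\<^sup>2 * ((pi - rho * 0) - (1 - rho\<^sup>2) * (pi / w))) {0..pi}"
    by (intro has_integral_mult_right has_integral_diff cosI oneI I)
  also have "(\<lambda>\<theta>. (real k)\<^sup>2 * ((1 - rho * cos (real k * \<theta>)) - (1 - rho\<^sup>2) * (1 / (1 + rho * cos (real k * \<theta>))))) =
     (\<lambda>\<theta>. rho\<^sup>2 * (poly (pderiv p) (cos \<theta>))\<^sup>2 / (1 + rho * poly p (cos \<theta>)) * sin \<theta> ^ (1 + 1))"
  proof
    fix \<theta>
    have "rho\<^sup>2 * (poly (pderiv p) (cos \<theta>))\<^sup>2 / (1 + rho * poly p (cos \<theta>)) * sin \<theta> ^ (1 + 1) =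
       rho\<^sup>2 * (poly (pderiv p) (cos \<theta>) * sin \<theta>)\<^sup>2 / (1 + rho * poly p (cos \<theta>))"
      by (simp add: power_mult_distrib power2_eq_square)
    also have "\<dots> = rho\<^sup>2 * ((real k)\<^sup>2 * (1 - (cos (real k * \<theta>))\<^sup>2)) / (1 + rho * cos (real k * \<theta>))"
      unfolding p by (simp add: power_mult_distrib sin_squared_eq)
    also have "\<dots> = (real k)\<^sup>2 * ((1 - rho * cos (real k * \<theta>)) - (1 - rho\<^sup>2) * (1 / (1 + rho * cos (real k * \<theta>))))"
      using D[of "real k * \<theta>"] by (simp add: field_simps) (simp add: algebra_simps power2_eq_square)
    finally show "(real k)\<^sup>2 * ((1 - rho * cos (real k * \<theta>)) - (1 - rho\<^sup>2) * (1 / (1 + rho * cos (real k * \<theta>)))) =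
      rho\<^sup>2 * (poly (pderiv p) (cos \<theta>))\<^sup>2 / (1 + rho * poly p (cos \<theta>)) * sin \<theta> ^ (1 + 1)" by simp
  qed
  finally have "info_mu 1 p rho = (1 / pi) * ((real k)\<^sup>2 * ((pi - rho * 0) - (1 - rho\<^sup>2) * (pi / w)))"
    using omega_0 omega_1 by (simp add: info_mu_def integral_unique)
  also have "\<dots> = (real k)\<^sup>2 * (1 - w)"
    unfolding w(2)[symmetric] using w by (simp add: field_simps power2_eq_square)
  finally show "sigma2_mu 1 k rho = 1 / info_mu 1 p rho"
    by (simp add: sigma2_mu_def w_def[symmetric])
qed

text \<open>On the two-sphere with k = 1 the weight of the first integral is constant and p(t) = t.
  Division by 1 + rho t leaves its reciprocal, whose integral is a difference of logarithms and
  equals 2 artanh (rho) / rho.\<close>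

lemma sigma2_2_1:
  assumes rho: "0 < rho" "rho < 1"
  shows "sigma2_rho 2 1 rho = rho ^ 3 / (artanh rho - rho)"
    and "sigma2_mu 2 1 rho = 2 * rho / (rho - (1 - rho\<^sup>2) * artanh rho)"
proof -
  have g: "gegen lam 1 t = 2 * lam * t" "gegen lam 0 t = 1" for lam t by (simp_all add: gegen_def)
  have g': "gegen lam (Suc 0) t = 2 * lam * t" for lam t using g(1) by simp
  have o: "omega 2 = 4 * pi" using omega_0 omega_add_2[of 0] by (simp add: numeral_2_eq_2)
  have pos: "1 + rho * t > 0" if "t \<in> {-1..1}" for t
  proof -
    have "\<bar>rho * t\<bar> \<le> rho * 1" unfolding abs_mult using that rho by (intro mult_mono) auto
    thus ?thesis using rho by linarith
  qed
  have lnI: "((\<lambda>t. 1 / (1 + rho * t)) has_integral (2 * artanh rho / rho)) {-1..1}"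
  proof -
    have "((\<lambda>t. 1 / (1 + rho * t)) has_integral (ln (1 + rho * 1) / rho - ln (1 + rho * (-1)) / rho)) {-1..1}"
    proof (rule fundamental_theorem_of_calculus)
      fix t :: real assume "t \<in> {-1..1}"
      thus "((\<lambda>t. ln (1 + rho * t) / rho) has_vector_derivative 1 / (1 + rho * t)) (at t within {-1..1})"
        unfolding has_real_derivative_iff_has_vector_derivative[symmetric]
        using pos[of t] rho by (auto intro!: derivative_eq_intros)
    qed simp
    moreover have "ln (1 + rho * 1) / rho - ln (1 + rho * (-1)) / rho = 2 * artanh rho / rho"
      using rho by (simp add: artanh_def ln_div diff_divide_distrib)
    ultimately show ?thesis by simp
  qed
  have tI: "((\<lambda>t. t) has_integral 0) {-1..1::real}"
    using ident_has_integral[of "-1" "1::real"] by simp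
  have oneI: "((\<lambda>t. 1 :: real) has_integral 2) {-1..1::real}"
    using has_integral_const_real[of "1::real" "-1" 1] by simp
  have "((\<lambda>t. (1 / rho\<^sup>2) * ((rho * t - 1) + 1 / (1 + rho * t))) has_integral (1 / rho\<^sup>2) * ((rho * 0 - 2) + 2 * artanh rho / rho)) {-1..1}"
    by (intro has_integral_mult_right has_integral_add has_integral_diff tI oneI lnI)
  hence t2I: "((\<lambda>t. t\<^sup>2 / (1 + rho * t)) has_integral (1 / rho\<^sup>2) * ((rho * 0 - 2) + 2 * artanh rho / rho)) {-1..1}"
  proof (rule has_integral_eq[rotated])
    fix t :: real assume "t \<in> {-1..1}"
    thus "(1 / rho\<^sup>2) * ((rho * t - 1) + 1 / (1 + rho * t)) = t\<^sup>2 / (1 + rho * t)"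
      using pos[of t] rho by (simp add: field_simps power2_eq_square)
  qed
  have "integral {-1..1} (\<lambda>t. t\<^sup>2 * (1 - t\<^sup>2) powr 0 / (1 + rho * t)) = integral {-1..1} (\<lambda>t. t\<^sup>2 / (1 + rho * t))"
  proof (rule integral_spike[of "{-1, 1}"])
    fix t :: real assume "t \<in> {-1..1} - {-1, 1}"
    hence "1 - t\<^sup>2 > 0" by (simp add: abs_square_less_1 abs_less_iff)
    thus "t\<^sup>2 / (1 + rho * t) = t\<^sup>2 * (1 - t\<^sup>2) powr 0 / (1 + rho * t)" by simp
  qed simp
  also have "\<dots> = (1 / rho\<^sup>2) * ((rho * 0 - 2) + 2 * artanh rho / rho)" using t2I by (rule integral_unique)
  finally have "integral {-1..1} (\<lambda>t. t\<^sup>2 * (1 - t\<^sup>2) powr 0 / (1 + rho * t)) = 2 * (artanh rho - rho) / rho ^ 3"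
    using rho by (simp add: field_simps power2_eq_square power3_eq_cube)
  thus "sigma2_rho 2 1 rho = rho ^ 3 / (artanh rho - rho)"
    unfolding sigma2_rho_def g using o omega_1 by (simp add: g del: right_diff_distrib_numeral)
  have "((\<lambda>t. 1 / (1 + rho * t) - t\<^sup>2 / (1 + rho * t)) has_integral
       2 * artanh rho / rho - (1 / rho\<^sup>2) * ((rho * 0 - 2) + 2 * artanh rho / rho)) {-1..1}"
    by (intro has_integral_diff lnI t2I)
  hence "((\<lambda>t. (1 - t\<^sup>2) powr 1 / (1 + rho * t)) has_integral
       2 * artanh rho / rho - (1 / rho\<^sup>2) * ((rho * 0 - 2) + 2 * artanh rho / rho)) {-1..1}"
  proof (rule has_integral_eq[rotated])
    fix t :: real assume "t \<in> {-1..1}"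
    hence "1 - t\<^sup>2 \<ge> 0" by (simp add: abs_square_le_1 abs_le_iff)
    thus "1 / (1 + rho * t) - t\<^sup>2 / (1 + rho * t) = (1 - t\<^sup>2) powr 1 / (1 + rho * t)"
      by (simp add: diff_divide_distrib)
  qed
  hence "integral {-1..1} (\<lambda>t. (1 - t\<^sup>2) powr 1 / (1 + rho * t)) = 2 * artanh rho / rho - (1 / rho\<^sup>2) * ((rho * 0 - 2) + 2 * artanh rho / rho)"
    by (rule integral_unique)
  also have "\<dots> = 2 * (rho - (1 - rho\<^sup>2) * artanh rho) / rho ^ 3"
    using rho by (simp add: field_simps power2_eq_square power3_eq_cube)
  finally have "integral {-1..1} (\<lambda>t. (1 - t\<^sup>2) powr 1 / (1 + rho * t)) = 2 * (rho - (1 - rho\<^sup>2) * artanh rho) / rho ^ 3" .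
  thus "sigma2_mu 2 1 rho = 2 * rho / (rho - (1 - rho\<^sup>2) * artanh rho)"
    unfolding sigma2_mu_def using o omega_1 rho by (simp add: g g' power2_eq_square power3_eq_cube del: right_diff_distrib_numeral)
qed

section \<open>The parameter space\<close>

lemma UNIV_card_2_idx:
  assumes "CARD('n::{finite,wellorder}) = 2"
  shows "(UNIV :: 'n set) = {idx1, idx2}" "(idx1 :: 'n) \<noteq> idx2"
proof -
  obtain a b :: 'n where ab: "a \<noteq> b" "(UNIV :: 'n set) = {a, b}" using assms by (metis card_2_iff)
  hence "\<exists>i :: 'n. i \<noteq> idx1" by (metis)
  hence "(idx2 :: 'n) \<noteq> idx1" unfolding idx2_def by (rule LeastI_ex)
  thus ne: "(idx1 :: 'n) \<noteq> idx2" by simp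
  have "idx1 \<in> {a, b}" "idx2 \<in> {a, b}" using ab(2) by blast+
  thus "(UNIV :: 'n set) = {idx1, idx2}"
  proof -
    have "idx1 = a \<and> idx2 = b \<or> idx1 = b \<and> idx2 = a"
      using ne \<open>idx1 \<in> {a, b}\<close> \<open>idx2 \<in> {a, b}\<close> by auto
    thus ?thesis unfolding ab(2) by auto
  qed
qed

lemma theta_star_sphere:
  fixes v :: "real ^ 'n::{finite,wellorder}"
  assumes "(v, r) \<in> theta_star k rs" and n: "CARD('n) \<ge> 2"
  shows "norm v = 1" "0 < r" "r < rs"
proof -
  have "norm (cos \<theta> *\<^sub>R axis idx1 1 + sin \<theta> *\<^sub>R axis idx2 1 :: (real, 'n) vec) = 1" if c: "CARD('n) = 2" for \<theta>
  proof -
    have "(axis idx1 1 :: (real, 'n) vec) \<bullet> axis idx2 1 = 0" using UNIV_card_2_idx(2)[OF c] by (simp add: inner_axis_axis)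
    hence "(cos \<theta> *\<^sub>R axis idx1 1 + sin \<theta> *\<^sub>R axis idx2 1 :: (real, 'n) vec) \<bullet> (cos \<theta> *\<^sub>R axis idx1 1 + sin \<theta> *\<^sub>R axis idx2 1) = 1"
      by (simp add: inner_add_left inner_add_right inner_axis_axis inner_commute power2_eq_square[symmetric])
    thus ?thesis by (simp add: norm_eq_1)
  qed
  thus "norm v = 1" "0 < r" "r < rs"
    using assms(1) by (auto simp: theta_star_def split: if_splits)
qed

text \<open>Only the arc (\<open>d = 1\<close>) needs an argument: a unit vector at angle \<open>\<plusminus>arccos (v . v0)\<close> from \<open>v0\<close> stays on the arc
  when \<open>v . v0\<close> is close to 1.\<close>
lemma theta_star_relatively_open:
  fixes mu :: "real ^ 'n::{finite,wellorder}"
  assumes mem: "(mu, rho) \<in> theta_star k rs" and n: "CARD('n) \<ge> 2"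
  shows "\<exists>\<delta>>0. \<forall>q. norm (fst q) = 1 \<longrightarrow> dist q (mu, rho) \<le> \<delta> \<longrightarrow> q \<in> theta_star k rs"
proof -
  note base = theta_star_sphere[OF mem n]
  define \<epsilon> where "\<epsilon> = min rho (rs - rho) / 2"
  have \<epsilon>: "\<epsilon> > 0" using base by (simp add: \<epsilon>_def)
  have r: "0 < r \<and> r < rs" if "dist r rho \<le> \<epsilon>" for r
  proof -
    have "\<epsilon> \<le> rho / 2" "2 * \<epsilon> \<le> rs - rho" by (auto simp: \<epsilon>_def)
    note e = this that[unfolded dist_real_def]
    have "0 < r" using e base(2) by linarith
    moreover have "r < rs" using e base(3) by linarith
    ultimately show ?thesis ..
  qed
  have ds: "dist (fst q) mu \<le> dist q (mu, rho)" "dist (snd q) rho \<le> dist q (mu, rho)" for q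
    using dist_fst_le[of q "(mu, rho)"] dist_snd_le[of q "(mu, rho)"] by auto
  show ?thesis
  proof (cases "CARD('n) = 2")
    case True
    note idx = UNIV_card_2_idx[OF True]
    let ?c = "\<lambda>\<theta>. cos \<theta> *\<^sub>R axis idx1 1 + sin \<theta> *\<^sub>R axis idx2 1 :: (real, 'n) vec"
    have comp: "?c \<theta> $ idx1 = cos \<theta>" "?c \<theta> $ idx2 = sin \<theta>" for \<theta>
      using idx(2) by (simp_all add: axis_def)
    obtain \<theta>0 where \<theta>0: "0 < \<theta>0" "\<theta>0 < 2 * pi / real k" "mu = ?c \<theta>0"
      using mem True by (auto simp: theta_star_def)
    define \<eta> where "\<eta> = min \<theta>0 (2 * pi / real k - \<theta>0)"
    have \<eta>: "\<eta> > 0" using \<theta>0 by (simp add: \<eta>_def)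
    have "continuous_on {-1..1} arccos" by (rule continuous_on_arccos')
    then obtain d1 where d1: "d1 > 0" "\<And>x. x \<in> {-1..1} \<Longrightarrow> dist x 1 < d1 \<Longrightarrow> dist (arccos x) (arccos 1) < \<eta>"
      unfolding continuous_on_iff using \<eta> by (metis atLeastAtMost_iff le_numeral_extra(4) neg_le_iff_le zero_le_one le_minus_one_simps(2))
    define \<delta> where "\<delta> = min \<epsilon> (d1 / 2)"
    show ?thesis
    proof (rule exI[of _ \<delta>], intro conjI allI impI)
      show "\<delta> > 0" using \<epsilon> d1 by (simp add: \<delta>_def)
      fix q :: "(real, 'n) vec \<times> real" assume q: "norm (fst q) = 1" "dist q (mu, rho) \<le> \<delta>"
      define v where "v = fst q"
      have inner2: "x \<bullet> y = x $ idx1 * y $ idx1 + x $ idx2 * y $ idx2" for x y :: "(real, 'n) vec"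
        unfolding inner_vec_def idx(1) using idx(2) by simp
      have "(v $ idx1)\<^sup>2 + (v $ idx2)\<^sup>2 = 1"
        using q(1) inner2[of v v] by (simp add: v_def norm_eq_1 power2_eq_square)
      then obtain \<psi> where \<psi>: "v $ idx1 = cos \<psi>" "v $ idx2 = sin \<psi>"
        using sincos_total_2pi by metis
      have vi: "v \<bullet> mu = cos (\<psi> - \<theta>0)" unfolding inner2 \<psi> \<theta>0(3) comp cos_diff ..
      define \<phi> where "\<phi> = arccos (v \<bullet> mu)"
      have c\<phi>: "cos \<phi> = cos (\<psi> - \<theta>0)" unfolding \<phi>_def vi by (rule cos_arccos) auto
      have "\<phi> < \<eta>"
      proof -
        have "dist (v \<bullet> mu) 1 = \<bar>(v - mu) \<bullet> mu\<bar>" using base(1) by (simp add: dist_real_def inner_diff_left norm_eq_1)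
        also have "\<dots> \<le> norm (v - mu)" using Cauchy_Schwarz_ineq2[of "v - mu" mu] base(1) by simp
        also have "\<dots> < d1" using ds(1)[of q] q(2) d1(1) by (simp add: v_def dist_norm \<delta>_def)
        finally have "dist (arccos (v \<bullet> mu)) (arccos 1) < \<eta>" by (intro d1(2)) (auto simp: vi)
        thus ?thesis by (simp add: \<phi>_def dist_real_def)
      qed
      have \<phi>0: "\<phi> \<ge> 0" unfolding \<phi>_def vi by (rule arccos_lbound) auto
      obtain m where m: "m \<in> \<int>" "\<psi> - \<theta>0 = \<phi> + 2 * m * pi \<or> \<psi> - \<theta>0 = - \<phi> + 2 * m * pi"
        using c\<phi>[symmetric] unfolding cos_eq by blast
      \<comment> \<open>Removing full turns brings the angle of v within \<phi> < \<eta> of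
        \<open>\<theta>0\<close>, hence inside the arc.\<close>
      define \<theta>1 where "\<theta>1 = \<psi> - 2 * m * pi"
      have \<theta>1: "\<theta>1 = \<theta>0 + \<phi> \<or> \<theta>1 = \<theta>0 - \<phi>" using m(2) by (auto simp: \<theta>1_def)
      have "0 < \<theta>1" "\<theta>1 < 2 * pi / real k" using \<theta>1 \<open>\<phi> < \<eta>\<close> \<phi>0 by (auto simp: \<eta>_def)
      moreover have "cos \<theta>1 = cos \<psi>" "sin \<theta>1 = sin \<psi>"
      proof -
        obtain j where j: "m = of_int j" using m(1) by (elim Ints_cases)
        have "sin (2 * m * pi) = 0" "cos (2 * m * pi) = 1"
          using sin_int_2pin[of j] cos_int_2pin[of j] by (simp_all add: j mult.commute mult.left_commute)
        thus "cos \<theta>1 = cos \<psi>" "sin \<theta>1 = sin \<psi>"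
          unfolding \<theta>1_def by (simp_all add: cos_diff sin_diff)
      qed
      moreover have "v = ?c \<theta>1" if "cos \<theta>1 = cos \<psi>" "sin \<theta>1 = sin \<psi>"
      proof (rule vec_eq_iff[THEN iffD2], rule allI)
        fix i :: 'n
        have "i = idx1 \<or> i = idx2" using idx(1) by blast
        thus "v $ i = ?c \<theta>1 $ i" using comp[of \<theta>1] \<psi> that by auto
      qed
      ultimately have "\<exists>\<theta>. 0 < \<theta> \<and> \<theta> < 2 * pi / real k \<and> v = ?c \<theta>" by blast
      moreover have "0 < snd q \<and> snd q < rs" using r[of "snd q"] ds(2)[of q] q(2) by (simp add: \<delta>_def)
      ultimately show "q \<in> theta_star k rs" using True by (cases q) (auto simp: theta_star_def v_def)
    qed
  next
    case False
    show ?thesis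
    proof (cases "odd k")
      case True
      show ?thesis
      proof (rule exI[of _ \<epsilon>], intro conjI allI impI \<epsilon>)
        fix q :: "(real, 'n) vec \<times> real" assume q: "norm (fst q) = 1" "dist q (mu, rho) \<le> \<epsilon>"
        have "0 < snd q \<and> snd q < rs" using r[of "snd q"] ds(2)[of q] q(2) by simp
        thus "q \<in> theta_star k rs" using True False q(1) by (cases q) (auto simp: theta_star_def)
      qed
    next
      case ev: False
      have m1: "mu $ idx1 > 0" using mem False ev by (auto simp: theta_star_def)
      show ?thesis
      proof (rule exI[of _ "min \<epsilon> (mu $ idx1 / 2)"], intro conjI allI impI)
        show "min \<epsilon> (mu $ idx1 / 2) > 0" using \<epsilon> m1 by simp
        fix q :: "(real, 'n) vec \<times> real" assume q: "norm (fst q) = 1" "dist q (mu, rho) \<le> min \<epsilon> (mu $ idx1 / 2)"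
        have "\<bar>(fst q - mu) $ idx1\<bar> \<le> norm (fst q - mu)" by (rule component_le_norm_cart)
        moreover have "2 * norm (fst q - mu) \<le> mu $ idx1" using ds(1)[of q] q(2) by (simp add: dist_norm)
        ultimately have "fst q $ idx1 > 0" using m1 unfolding vector_minus_component by linarith
        moreover have "0 < snd q \<and> snd q < rs" using r[of "snd q"] ds(2)[of q] q(2) by simp
        ultimately show "q \<in> theta_star k rs" using ev False q(1) by (cases q) (auto simp: theta_star_def)
      qed
    qed
  qed
qed

section \<open>Zonal models on the sphere\<close>

text \<open>What the asymptotic theory uses of the density: a bounded zonal polynomial of mean zero
  that satisfies the differential equation. The values at 1 give the positivity of the Fisher
  information.\<close>

locale zonal_model =
  fixes p :: "real poly" and rho rs :: real and mu :: "real ^ 'n::{finite,wellorder}" and d k :: nat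
  assumes card: "CARD('n) \<ge> 2" and d_eq: "d = CARD('n) - 1"
    and mu: "norm mu = 1" and rho: "0 < rho" "rho < rs" "rs < 1"
    and p_le: "\<And>t. t \<in> {-1..1} \<Longrightarrow> \<bar>poly p t\<bar> \<le> 1"
    and p_1: "poly p 1 = 1" and dp_1: "poly (pderiv p) 1 \<noteq> 0"
    and ode: "\<And>t. t \<in> {-1..1} \<Longrightarrow> (1 - t\<^sup>2) * poly (pderiv (pderiv p)) t =
         real d * t * poly (pderiv p) t - real k * (real k + real d - 1) * poly p t"
    and mean_p: "(\<integral>x. poly p (x \<bullet> mu) \<partial>sphere_surface) = 0"
begin

text \<open>In terms of the function ln (1 + r p(t)) at r = rho: \<open>sa\<close> and
  \<open>sb\<close> are its derivatives in r and t, \<open>hA\<close> is the second derivative in t,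
  \<open>hB\<close> the mixed one, and the negative square of \<open>sa\<close> is the second
  derivative in r.\<close>

definition den :: "real \<Rightarrow> real" where "den t = 1 + rho * poly p t"
definition sa :: "real \<Rightarrow> real" where "sa t = poly p t / den t"
definition sb :: "real \<Rightarrow> real" where "sb t = rho * poly (pderiv p) t / den t"
definition hA :: "real \<Rightarrow> real" where "hA t = rho * poly (pderiv (pderiv p)) t / den t - (sb t)\<^sup>2"
definition hB :: "real \<Rightarrow> real" where "hB t = poly (pderiv p) t / (den t)\<^sup>2"
definition tang :: "(real, 'n) vec \<Rightarrow> (real, 'n) vec" where "tang h = h - (mu \<bullet> h) *\<^sub>R mu"
text \<open>The normal part of the gradient is projected away; its contribution reappears as the
  curvature term of \<open>hess\<close>.\<close>

definition score :: "(real, 'n) vec \<Rightarrow> (real, 'n) vec \<times> real" where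
  "score x = (sb (x \<bullet> mu) *\<^sub>R tang x, sa (x \<bullet> mu))"

text \<open>The Hessian of the log-likelihood on the tangent space; the last term is the curvature of the sphere.\<close>
definition hess :: "(real, 'n) vec \<Rightarrow> (real, 'n) vec \<times> real \<Rightarrow> (real, 'n) vec \<times> real \<Rightarrow> real" where
  "hess x H H' = hA (x \<bullet> mu) * (tang x \<bullet> fst H) * (tang x \<bullet> fst H')
     + hB (x \<bullet> mu) * ((tang x \<bullet> fst H) * snd H' + (tang x \<bullet> fst H') * snd H)
     - (sa (x \<bullet> mu))\<^sup>2 * snd H * snd H'
     - sb (x \<bullet> mu) * (x \<bullet> mu) * (tang (fst H) \<bullet> tang (fst H'))"

abbreviation Jm :: real where "Jm \<equiv> info_mu d p rho"
abbreviation Jr :: real where "Jr \<equiv> info_rho d p rho"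

definition model_mean :: "((real, 'n) vec \<Rightarrow> real) \<Rightarrow> real" where
  "model_mean f = (\<integral>x. f x * den (x \<bullet> mu) \<partial>sphere_surface) / omega d"

section \<open>Bounds, measurability and integrability in the zonal model\<close>

lemma mu_mu: "mu \<bullet> mu = 1" using mu by (simp add: norm_eq_1)

lemma d1: "d \<ge> 1" "CARD('n) - 1 = d" using card d_eq by auto

lemma den_ge: "t \<in> {-1..1} \<Longrightarrow> den t \<ge> 1 - rs"
  unfolding den_def using density_poly_lower[OF p_le, of t rho rs] rho by auto

lemma den_pos: "t \<in> {-1..1} \<Longrightarrow> den t > 0"
  using den_ge[of t] rho by linarith

lemma borel_measurable_poly [measurable]: "poly (q :: real poly) \<in> borel_measurable borel"
  by (intro borel_measurable_continuous_onI continuous_intros)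

lemma measurable_coeffs [measurable]:
  "den \<in> borel_measurable borel" "sa \<in> borel_measurable borel" "sb \<in> borel_measurable borel"
  "hA \<in> borel_measurable borel" "hB \<in> borel_measurable borel"
  unfolding den_def[abs_def] sa_def[abs_def] sb_def[abs_def] hA_def[abs_def] hB_def[abs_def] by measurable

lemma continuous_coeffs [continuous_intros]:
  "continuous_on {-1..1} den" "continuous_on {-1..1} sa" "continuous_on {-1..1} sb"
  "continuous_on {-1..1} hA" "continuous_on {-1..1} hB"
proof -
  have nz: "den t \<noteq> 0" if "t \<in> {-1..1}" for t using den_pos[OF that] by simp
  show 1: "continuous_on {-1..1} den" unfolding den_def[abs_def] by (intro continuous_intros)
  show "continuous_on {-1..1} sa" unfolding sa_def[abs_def] by (intro continuous_intros 1) (use nz in auto)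
  show 2: "continuous_on {-1..1} sb" unfolding sb_def[abs_def] by (intro continuous_intros 1) (use nz in auto)
  show "continuous_on {-1..1} hA" unfolding hA_def[abs_def] by (intro continuous_intros 1 2) (use nz in auto)
  show "continuous_on {-1..1} hB" unfolding hB_def[abs_def] by (intro continuous_intros 1) (use nz in auto)
qed

lemma continuous_bounded_Icc:
  assumes "continuous_on {-1..1::real} F"
  obtains B :: real where "\<And>t. t \<in> {-1..1} \<Longrightarrow> \<bar>F t\<bar> \<le> B"
proof -
  have "bounded (F ` {-1..1})" using assms by (intro compact_imp_bounded compact_continuous_image) auto
  then obtain B where "\<forall>y\<in>F ` {-1..1}. norm y \<le> B" unfolding bounded_iff by blast
  thus ?thesis using that[of B] by auto
qed

lemma coeffs_bounded:
  obtains B where "B \<ge> 1" "\<And>t. t \<in> {-1..1} \<Longrightarrow> \<bar>den t\<bar> \<le> B \<and> \<bar>sa t\<bar> \<le> B \<and> \<bar>sb t\<bar> \<le> B \<and> \<bar>hA t\<bar> \<le> B \<and> \<bar>hB t\<bar> \<le> B"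
proof -
  obtain B1 B2 B3 B4 B5 where B: "\<And>t. t \<in> {-1..1} \<Longrightarrow> \<bar>den t\<bar> \<le> B1" "\<And>t. t \<in> {-1..1} \<Longrightarrow> \<bar>sa t\<bar> \<le> B2"
    "\<And>t. t \<in> {-1..1} \<Longrightarrow> \<bar>sb t\<bar> \<le> B3" "\<And>t. t \<in> {-1..1} \<Longrightarrow> \<bar>hA t\<bar> \<le> B4" "\<And>t. t \<in> {-1..1} \<Longrightarrow> \<bar>hB t\<bar> \<le> B5"
    using continuous_coeffs continuous_bounded_Icc by metis
  define B where "B = Max {1, B1, B2, B3, B4, B5}"
  have le: "y \<le> B" if "y \<in> {1, B1, B2, B3, B4, B5}" for y
    unfolding B_def using that by (intro Max_ge) auto
  show ?thesis
  proof (rule that[of B])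
    show "1 \<le> B" by (rule le) simp
    fix t :: real assume t: "t \<in> {-1..1}"
    show "\<bar>den t\<bar> \<le> B \<and> \<bar>sa t\<bar> \<le> B \<and> \<bar>sb t\<bar> \<le> B \<and> \<bar>hA t\<bar> \<le> B \<and> \<bar>hB t\<bar> \<le> B"
      by (intro conjI; rule order_trans[OF _ le]; (rule B[OF t])?; simp)
  qed
qed

lemma inner_mu_Icc: "norm x = 1 \<Longrightarrow> x \<bullet> mu \<in> {-1..1}"
  using abs_inner_le_1[OF _ mu, of x] by auto

lemma tang_inner: "tang x \<bullet> h = x \<bullet> tang h" "tang x \<bullet> mu = 0" "mu \<bullet> tang x = 0" "tang x \<bullet> tang h = x \<bullet> tang h"
  using mu_mu by (simp_all add: tang_def inner_diff_left inner_diff_right inner_commute)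

lemma norm_tang_sq: "(norm (tang h))\<^sup>2 = (norm h)\<^sup>2 - (mu \<bullet> h)\<^sup>2"
  unfolding power2_norm_eq_inner tang_inner(4) by (simp add: tang_def inner_diff_right inner_commute power2_eq_square)

lemma norm_tang_le: "norm (tang h) \<le> norm h"
proof -
  have "(norm (tang h))\<^sup>2 \<le> (norm h)\<^sup>2" unfolding norm_tang_sq by simp
  thus ?thesis by (rule power2_le_imp_le) simp
qed

lemma tang_linear: "tang (x + y) = tang x + tang y" "tang (c *\<^sub>R x) = c *\<^sub>R tang x"
  by (simp_all add: tang_def inner_add_right algebra_simps)

lemma borel_measurable_tang [measurable]: "tang \<in> borel_measurable borel"
  unfolding tang_def[abs_def] by measurable

lemma measurable_score [measurable]: "score \<in> borel_measurable borel"
  unfolding score_def[abs_def] by measurable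

lemma measurable_hess [measurable]: "(\<lambda>x. hess x H H') \<in> borel_measurable borel"
  unfolding hess_def by measurable

lemma integrable_zonal_times:
  fixes F :: "real \<Rightarrow> real" and G :: "(real, 'n) vec \<Rightarrow> real"
  assumes "continuous_on {-1..1} F" and [measurable]: "F \<in> borel_measurable borel" "G \<in> borel_measurable borel"
    and "\<And>x. norm x = 1 \<Longrightarrow> \<bar>G x\<bar> \<le> B"
  shows "integrable sphere_surface (\<lambda>x :: (real, 'n) vec. F (x \<bullet> mu) * G x)"
proof -
  obtain C where C: "\<And>t. t \<in> {-1..1} \<Longrightarrow> \<bar>F t\<bar> \<le> C" using continuous_bounded_Icc[OF assms(1)] by blast
  show ?thesis
  proof (rule integrable_sphere_surface[of _ "C * B"])
    fix x :: "(real, 'n) vec" assume x: "norm x = 1"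
    show "\<bar>F (x \<bullet> mu) * G x\<bar> \<le> C * B"
      unfolding abs_mult using C[OF inner_mu_Icc[OF x]] assms(4)[OF x] by (intro mult_mono) auto
  qed measurable
qed

lemma abs_inner_unit: "norm x = 1 \<Longrightarrow> \<bar>x \<bullet> u\<bar> \<le> norm u"
  using Cauchy_Schwarz_ineq2[of x u] by simp

lemma power2_inner_unit: "norm x = 1 \<Longrightarrow> (x \<bullet> u)\<^sup>2 \<le> (norm u)\<^sup>2"
  using power_mono[OF abs_inner_unit abs_ge_zero, of x u 2] by simp

lemma integral_zonal_tang:
  fixes F :: "real \<Rightarrow> real"
  assumes F: "continuous_on {-1..1} F" "F \<in> borel_measurable borel"
  shows "(\<integral>x. F (x \<bullet> mu) * (x \<bullet> tang h)\<^sup>2 \<partial>sphere_surface) =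
     (norm (tang h))\<^sup>2 / real d * (\<integral>x. F (x \<bullet> mu) * (1 - (x \<bullet> mu)\<^sup>2) \<partial>sphere_surface)"
proof -
  obtain C where C: "\<And>t. t \<in> {-1..1} \<Longrightarrow> \<bar>F t\<bar> \<le> C" using continuous_bounded_Icc[OF F(1)] by blast
  have "tang h \<bullet> mu = 0" by (rule tang_inner(2))
  from sphere_isotropic[OF mu this F(2) C] show ?thesis
    unfolding d1(2) using d1(1) by (simp add: field_simps)
qed

lemma info_mu_integral:
  "Jm = (\<integral>x. (sb (x \<bullet> mu))\<^sup>2 * den (x \<bullet> mu) * (1 - (x \<bullet> mu)\<^sup>2) \<partial>sphere_surface) / (real d * omega d)"
proof -
  have "(\<integral>x. (sb (x \<bullet> mu))\<^sup>2 * den (x \<bullet> mu) * (1 - (x \<bullet> mu)\<^sup>2) \<partial>sphere_surface) =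
     omega (d - 1) * integral {0..pi} (\<lambda>\<theta>. (sb (cos \<theta>))\<^sup>2 * den (cos \<theta>) * (1 - (cos \<theta>)\<^sup>2) * sin \<theta> ^ (d - 1))"
    by (rule integral_sphere_zonal[OF mu card, where F="\<lambda>t. (sb t)\<^sup>2 * den t * (1 - t\<^sup>2)", unfolded d1(2)])
       (measurable, intro continuous_intros)
  also have "(\<lambda>\<theta>. (sb (cos \<theta>))\<^sup>2 * den (cos \<theta>) * (1 - (cos \<theta>)\<^sup>2) * sin \<theta> ^ (d - 1)) =
     (\<lambda>\<theta>. rho\<^sup>2 * (poly (pderiv p) (cos \<theta>))\<^sup>2 / (1 + rho * poly p (cos \<theta>)) * sin \<theta> ^ (d + 1))"
  proof
    fix \<theta> :: real
    have "den (cos \<theta>) > 0" by (rule den_pos) auto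
    hence "(sb (cos \<theta>))\<^sup>2 * den (cos \<theta>) = rho\<^sup>2 * (poly (pderiv p) (cos \<theta>))\<^sup>2 / (1 + rho * poly p (cos \<theta>))"
      by (simp add: sb_def den_def[symmetric] power_divide power_mult_distrib power2_eq_square)
    moreover have "(1 - (cos \<theta>)\<^sup>2) * sin \<theta> ^ (d - 1) = sin \<theta> ^ (d + 1)"
    proof -
      have "d + 1 = 2 + (d - 1)" using d1 by simp
      thus ?thesis by (simp only: power_add sin_squared_eq)
    qed
    ultimately show "(sb (cos \<theta>))\<^sup>2 * den (cos \<theta>) * (1 - (cos \<theta>)\<^sup>2) * sin \<theta> ^ (d - 1) =
      rho\<^sup>2 * (poly (pderiv p) (cos \<theta>))\<^sup>2 / (1 + rho * poly p (cos \<theta>)) * sin \<theta> ^ (d + 1)"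
      by (metis mult.assoc)
  qed
  finally show ?thesis unfolding info_mu_def by (simp add: mult.commute)
qed

lemma info_rho_integral: "Jr = (\<integral>x. (sa (x \<bullet> mu))\<^sup>2 * den (x \<bullet> mu) \<partial>sphere_surface) / omega d"
proof -
  have "(\<integral>x. (sa (x \<bullet> mu))\<^sup>2 * den (x \<bullet> mu) \<partial>sphere_surface) =
     omega (d - 1) * integral {0..pi} (\<lambda>\<theta>. (sa (cos \<theta>))\<^sup>2 * den (cos \<theta>) * sin \<theta> ^ (d - 1))"
    by (rule integral_sphere_zonal[OF mu card, where F="\<lambda>t. (sa t)\<^sup>2 * den t", unfolded d1(2)])
       (measurable, intro continuous_intros)
  also have "(\<lambda>\<theta>. (sa (cos \<theta>))\<^sup>2 * den (cos \<theta>) * sin \<theta> ^ (d - 1)) =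
     (\<lambda>\<theta>. (poly p (cos \<theta>))\<^sup>2 / (1 + rho * poly p (cos \<theta>)) * sin \<theta> ^ (d - 1))"
  proof
    fix \<theta> :: real
    have "den (cos \<theta>) > 0" by (rule den_pos) auto
    thus "(sa (cos \<theta>))\<^sup>2 * den (cos \<theta>) * sin \<theta> ^ (d - 1) =
       (poly p (cos \<theta>))\<^sup>2 / (1 + rho * poly p (cos \<theta>)) * sin \<theta> ^ (d - 1)"
      by (simp add: sa_def den_def[symmetric] power_divide power2_eq_square)
  qed
  finally show ?thesis unfolding info_rho_def by simp
qed

text \<open>A vanishing integral would make the nonnegative continuous integrand zero. As sin > 0
  inside the interval, q would then vanish on all of (-1, 1) and be the zero polynomial.\<close>

lemma integral_zonal_pos:
  assumes q: "poly q (1::real) \<noteq> 0"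
  shows "integral {0..pi} (\<lambda>\<theta>. (poly q (cos \<theta>))\<^sup>2 / (1 + rho * poly p (cos \<theta>)) * sin \<theta> ^ m) > 0"
proof -
  let ?f = "\<lambda>\<theta>. (poly q (cos \<theta>))\<^sup>2 / (1 + rho * poly p (cos \<theta>)) * sin \<theta> ^ m"
  have dp: "1 + rho * poly p (cos \<theta>) > 0" for \<theta> using den_pos[of "cos \<theta>"] by (simp add: den_def)
  have cont: "continuous_on {0..pi} ?f" by (intro continuous_intros) (use dp in \<open>auto simp: less_imp_neq[symmetric]\<close>)
  have nn: "?f \<theta> \<ge> 0" if "\<theta> \<in> {0..pi}" for \<theta> using that dp[of \<theta>] by (auto simp: sin_ge_zero)
  have "integral {0..pi} ?f \<noteq> 0"
  proof
    assume "integral {0..pi} ?f = 0"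
    hence z: "\<forall>\<theta>\<in>{0..pi}. ?f \<theta> = 0" using integral_eq_0_iff[OF cont] nn by auto
    have "{-1<..<1} \<subseteq> {t. poly q t = 0}"
    proof
      fix t :: real assume t: "t \<in> {-1<..<1}"
      define \<theta> where "\<theta> = arccos t"
      have "0 < \<theta>" "\<theta> < pi" using t by (auto simp: \<theta>_def arccos_lt_bounded)
      hence "sin \<theta> > 0" by (rule sin_gt_zero)
      moreover have "?f \<theta> = 0" using z \<open>0 < \<theta>\<close> \<open>\<theta> < pi\<close> by auto
      ultimately have "poly q (cos \<theta>) = 0" using dp[of \<theta>] by (simp split: if_splits)
      thus "t \<in> {t. poly q t = 0}" using t by (simp add: \<theta>_def)
    qed
    moreover have "infinite {-1<..<1::real}" by (rule infinite_Ioo) simp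
    ultimately have "infinite {t. poly q t = 0}" by (rule infinite_super)
    hence "q = 0" using poly_roots_finite by blast
    thus False using q by simp
  qed
  moreover have "integral {0..pi} ?f \<ge> 0" by (rule integral_nonneg[OF integrable_continuous_real[OF cont]]) (use nn in blast)
  ultimately show ?thesis by simp
qed

lemma info_pos: "Jm > 0" "Jr > 0"
proof -
  have "integral {0..pi} (\<lambda>\<theta>. rho\<^sup>2 * (poly (pderiv p) (cos \<theta>))\<^sup>2 / (1 + rho * poly p (cos \<theta>)) * sin \<theta> ^ (d + 1)) =
     integral {0..pi} (\<lambda>\<theta>. (poly (smult rho (pderiv p)) (cos \<theta>))\<^sup>2 / (1 + rho * poly p (cos \<theta>)) * sin \<theta> ^ (d + 1))"
    by (simp add: power_mult_distrib)
  also have "\<dots> > 0" by (rule integral_zonal_pos) (use dp_1 rho in simp)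
  finally show "Jm > 0"
    unfolding info_mu_def using omega_pos[of d] omega_pos[of "d - 1"] d1 by simp
  show "Jr > 0"
    unfolding info_rho_def using omega_pos[of d] omega_pos[of "d - 1"] integral_zonal_pos[of p "d - 1"] p_1 by simp
qed

section \<open>Moments of the score and of the Hessian\<close>

lemma sa_den: "t \<in> {-1..1} \<Longrightarrow> sa t * den t = poly p t"
  and sb_den: "t \<in> {-1..1} \<Longrightarrow> sb t * den t = rho * poly (pderiv p) t"
  and hA_den: "t \<in> {-1..1} \<Longrightarrow> hA t * den t = rho * poly (pderiv (pderiv p)) t - (sb t)\<^sup>2 * den t"
  using den_pos[of t] by (auto simp: sa_def sb_def hA_def field_simps)

lemma integral_sphere_cong:
  fixes f g :: "(real, 'n) vec \<Rightarrow> real"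
  assumes "\<And>x. norm x = 1 \<Longrightarrow> f x = g x" and [measurable]: "f \<in> borel_measurable borel" "g \<in> borel_measurable borel"
  shows "(\<integral>x. f x \<partial>sphere_surface) = (\<integral>x. g x \<partial>sphere_surface)"
proof (rule integral_cong_AE)
  show "AE x in sphere_surface. f x = g x"
    using AE_sphere_surface_norm by eventually_elim (use assms(1) in blast)
qed auto

lemma integral_odd_zero:
  assumes [measurable]: "F \<in> borel_measurable borel"
  shows "(\<integral>x. F (x \<bullet> mu) * (x \<bullet> tang h) \<partial>sphere_surface) = 0"
  by (rule sphere_odd_moment_orthogonal[OF tang_inner(2)]) measurable

text \<open>The tangential part is odd under a reflection fixing \<open>mu\<close>. The component
  for rho becomes p itself after multiplication by the density, hence is centred by
  \<open>mean_p\<close>.\<close>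

lemma model_mean_score: "model_mean (\<lambda>x. score x \<bullet> H) = 0"
proof -
  have i1: "integrable sphere_surface (\<lambda>x. sb (x \<bullet> mu) * den (x \<bullet> mu) * (x \<bullet> tang (fst H)))"
    by (rule integrable_zonal_times[where F="\<lambda>t. sb t * den t"]) (auto intro!: continuous_intros abs_inner_unit)
  have i2: "integrable sphere_surface (\<lambda>x. poly p (x \<bullet> mu) * snd H)"
    by (rule integrable_zonal_times[where F="\<lambda>t. poly p t" and G="\<lambda>_. snd H"]) (auto intro!: continuous_intros)
  have "(\<integral>x. (score x \<bullet> H) * den (x \<bullet> mu) \<partial>sphere_surface) =
     (\<integral>x. sb (x \<bullet> mu) * den (x \<bullet> mu) * (x \<bullet> tang (fst H)) + poly p (x \<bullet> mu) * snd H \<partial>sphere_surface)"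
  proof (rule integral_sphere_cong)
    fix x :: "(real, 'n) vec" assume x: "norm x = 1"
    show "(score x \<bullet> H) * den (x \<bullet> mu) = sb (x \<bullet> mu) * den (x \<bullet> mu) * (x \<bullet> tang (fst H)) + poly p (x \<bullet> mu) * snd H"
      unfolding sa_den[OF inner_mu_Icc[OF x], symmetric]
      by (cases H) (simp add: score_def tang_inner(1) algebra_simps)
  qed auto
  also have "\<dots> = 0" using i1 i2 integral_odd_zero[of "\<lambda>t. sb t * den t"] mean_p by simp
  finally show ?thesis by (simp add: model_mean_def)
qed

lemma model_mean_score_sq: "model_mean (\<lambda>x. (score x \<bullet> H)\<^sup>2) = Jm * (norm (tang (fst H)))\<^sup>2 + Jr * (snd H)\<^sup>2"
proof -
  let ?F = "\<lambda>t. (sb t)\<^sup>2 * den t" and ?G = "\<lambda>t. sb t * sa t * den t" and ?K = "\<lambda>t. (sa t)\<^sup>2 * den t"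
  have i1: "integrable sphere_surface (\<lambda>x. ?F (x \<bullet> mu) * (x \<bullet> tang (fst H))\<^sup>2)"
    by (rule integrable_zonal_times[where F="?F"]) (auto intro!: continuous_intros power2_inner_unit)
  have i2: "integrable sphere_surface (\<lambda>x. ?G (x \<bullet> mu) * (x \<bullet> tang (fst H)))"
    by (rule integrable_zonal_times[where F="?G"]) (auto intro!: continuous_intros abs_inner_unit)
  have i3: "integrable sphere_surface (\<lambda>x. ?K (x \<bullet> mu) * 1)"
    by (rule integrable_zonal_times[where F="?K"]) (auto intro!: continuous_intros)
  have "(\<integral>x. (score x \<bullet> H)\<^sup>2 * den (x \<bullet> mu) \<partial>sphere_surface) =
     (\<integral>x. ?F (x \<bullet> mu) * (x \<bullet> tang (fst H))\<^sup>2 + 2 * snd H * (?G (x \<bullet> mu) * (x \<bullet> tang (fst H))) + (snd H)\<^sup>2 * (?K (x \<bullet> mu) * 1) \<partial>sphere_surface)"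
    by (rule Bochner_Integration.integral_cong[OF refl], cases H)
       (simp add: score_def tang_inner(1) algebra_simps power2_eq_square)
  also have "\<dots> = (\<integral>x. ?F (x \<bullet> mu) * (x \<bullet> tang (fst H))\<^sup>2 \<partial>sphere_surface) + (snd H)\<^sup>2 * (\<integral>x. ?K (x \<bullet> mu) \<partial>sphere_surface)"
    using i1 i2 i3 integral_odd_zero[of ?G] by simp
  also have "(\<integral>x. ?F (x \<bullet> mu) * (x \<bullet> tang (fst H))\<^sup>2 \<partial>sphere_surface) = (norm (tang (fst H)))\<^sup>2 * (Jm * omega d)"
    unfolding info_mu_integral using omega_pos[of d]
    by (subst integral_zonal_tang[where F="?F"]) (auto intro!: continuous_intros)
  also have "(\<integral>x. ?K (x \<bullet> mu) \<partial>sphere_surface) = Jr * omega d"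
    unfolding info_rho_integral using omega_pos[of d] by simp
  finally show ?thesis using omega_pos[of d] by (simp add: model_mean_def field_simps)
qed

text \<open>The information identity: the differential equation of \<open>p\<close> turns the second-derivative term into
  the curvature term.\<close>
lemma model_mean_hess: "model_mean (\<lambda>x. hess x H H) = - (Jm * (norm (tang (fst H)))\<^sup>2 + Jr * (snd H)\<^sup>2)"
proof -
  let ?h = "tang (fst H)"
  let ?P2 = "\<lambda>t. rho * poly (pderiv (pderiv p)) t" and ?F = "\<lambda>t. (sb t)\<^sup>2 * den t"
  let ?G = "\<lambda>t. hB t * den t" and ?K = "\<lambda>t. (sa t)\<^sup>2 * den t" and ?T = "\<lambda>t. rho * t * poly (pderiv p) t"
  have i0: "integrable sphere_surface (\<lambda>x. ?P2 (x \<bullet> mu) * (x \<bullet> ?h)\<^sup>2)"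
    by (rule integrable_zonal_times[where F="?P2"]) (auto intro!: continuous_intros power2_inner_unit)
  have i1: "integrable sphere_surface (\<lambda>x. ?F (x \<bullet> mu) * (x \<bullet> ?h)\<^sup>2)"
    by (rule integrable_zonal_times[where F="?F"]) (auto intro!: continuous_intros power2_inner_unit)
  have i2: "integrable sphere_surface (\<lambda>x. ?G (x \<bullet> mu) * (x \<bullet> ?h))"
    by (rule integrable_zonal_times[where F="?G"]) (auto intro!: continuous_intros abs_inner_unit)
  have i3: "integrable sphere_surface (\<lambda>x. ?K (x \<bullet> mu) * 1)"
    by (rule integrable_zonal_times[where F="?K"]) (auto intro!: continuous_intros)
  have i4: "integrable sphere_surface (\<lambda>x. ?T (x \<bullet> mu) * 1)"
    by (rule integrable_zonal_times[where F="?T"]) (auto intro!: continuous_intros)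
  have i5: "integrable sphere_surface (\<lambda>x. poly p (x \<bullet> mu) * 1)"
    by (rule integrable_zonal_times[where F="poly p"]) (auto intro!: continuous_intros)
  have "(\<integral>x. hess x H H * den (x \<bullet> mu) \<partial>sphere_surface) =
     (\<integral>x. ?P2 (x \<bullet> mu) * (x \<bullet> ?h)\<^sup>2 - ?F (x \<bullet> mu) * (x \<bullet> ?h)\<^sup>2 + 2 * snd H * (?G (x \<bullet> mu) * (x \<bullet> ?h))
        - (snd H)\<^sup>2 * (?K (x \<bullet> mu) * 1) - (norm ?h)\<^sup>2 * (?T (x \<bullet> mu) * 1) \<partial>sphere_surface)"
  proof (rule integral_sphere_cong)
    fix x :: "(real, 'n) vec" assume x: "norm x = 1"
    note t = inner_mu_Icc[OF x]
    have "hess x H H * den (x \<bullet> mu) = (hA (x \<bullet> mu) * den (x \<bullet> mu)) * (x \<bullet> ?h)\<^sup>2 + 2 * snd H * (?G (x \<bullet> mu) * (x \<bullet> ?h))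
        - (snd H)\<^sup>2 * (?K (x \<bullet> mu) * 1) - (norm ?h)\<^sup>2 * ((sb (x \<bullet> mu) * den (x \<bullet> mu)) * (x \<bullet> mu))"
      unfolding hess_def power2_norm_eq_inner
      by (simp add: tang_inner(1) algebra_simps power2_eq_square)
    thus "hess x H H * den (x \<bullet> mu) = ?P2 (x \<bullet> mu) * (x \<bullet> ?h)\<^sup>2 - ?F (x \<bullet> mu) * (x \<bullet> ?h)\<^sup>2 + 2 * snd H * (?G (x \<bullet> mu) * (x \<bullet> ?h))
        - (snd H)\<^sup>2 * (?K (x \<bullet> mu) * 1) - (norm ?h)\<^sup>2 * (?T (x \<bullet> mu) * 1)"
      unfolding hA_den[OF t] sb_den[OF t] by (simp add: algebra_simps)
  qed auto
  also have "\<dots> = (\<integral>x. ?P2 (x \<bullet> mu) * (x \<bullet> ?h)\<^sup>2 \<partial>sphere_surface) - (\<integral>x. ?F (x \<bullet> mu) * (x \<bullet> ?h)\<^sup>2 \<partial>sphere_surface)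
      - (snd H)\<^sup>2 * (\<integral>x. ?K (x \<bullet> mu) \<partial>sphere_surface) - (norm ?h)\<^sup>2 * (\<integral>x. ?T (x \<bullet> mu) \<partial>sphere_surface)"
    using i0 i1 i2 i3 i4 integral_odd_zero[of ?G] by simp
  \<comment> \<open>Isotropy brings in the factor 1 - t^2, exactly the leading coefficient of the
    differential equation, and the eigenvalue term integrates to zero by \<open>mean_p\<close>. What
    remains cancels the curvature integral.\<close>
  also have "(\<integral>x. ?P2 (x \<bullet> mu) * (x \<bullet> ?h)\<^sup>2 \<partial>sphere_surface) = (norm ?h)\<^sup>2 * (\<integral>x. ?T (x \<bullet> mu) \<partial>sphere_surface)"
  proof -
    have "(\<integral>x. ?P2 (x \<bullet> mu) * (1 - (x \<bullet> mu)\<^sup>2) \<partial>sphere_surface) =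
       (\<integral>x. real d * (?T (x \<bullet> mu) * 1) - rho * (real k * (real k + real d - 1)) * (poly p (x \<bullet> mu) * 1) \<partial>sphere_surface)"
    proof (rule integral_sphere_cong)
      fix x :: "(real, 'n) vec" assume x: "norm x = 1"
      have "?P2 (x \<bullet> mu) * (1 - (x \<bullet> mu)\<^sup>2) = rho * ((1 - (x \<bullet> mu)\<^sup>2) * poly (pderiv (pderiv p)) (x \<bullet> mu))" by simp
      also have "\<dots> = real d * (?T (x \<bullet> mu) * 1) - rho * (real k * (real k + real d - 1)) * (poly p (x \<bullet> mu) * 1)"
        unfolding ode[OF inner_mu_Icc[OF x]] by (simp add: algebra_simps)
      finally show "?P2 (x \<bullet> mu) * (1 - (x \<bullet> mu)\<^sup>2) =
        real d * (?T (x \<bullet> mu) * 1) - rho * (real k * (real k + real d - 1)) * (poly p (x \<bullet> mu) * 1)" .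
    qed auto
    also have "\<dots> = real d * (\<integral>x. ?T (x \<bullet> mu) \<partial>sphere_surface)"
      using i4 i5 mean_p by simp
    finally show ?thesis
      using d1 by (subst integral_zonal_tang[where F="?P2"]) (auto intro!: continuous_intros)
  qed
  also have "(\<integral>x. ?F (x \<bullet> mu) * (x \<bullet> ?h)\<^sup>2 \<partial>sphere_surface) = (norm ?h)\<^sup>2 * (Jm * omega d)"
    unfolding info_mu_integral using omega_pos[of d]
    by (subst integral_zonal_tang[where F="?F"]) (auto intro!: continuous_intros)
  also have "(\<integral>x. ?K (x \<bullet> mu) \<partial>sphere_surface) = Jr * omega d"
    unfolding info_rho_integral using omega_pos[of d] by simp
  finally show ?thesis using omega_pos[of d] by (simp add: model_mean_def field_simps)
qed

lemma bilinear_hess: "bilinear (hess x)"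
  unfolding bilinear_def linear_iff
  by (auto simp: hess_def tang_linear inner_add_left inner_add_right algebra_simps)

end

text \<open>Slutsky's lemma for characteristic functions: the difference of \<open>iexp a\<close>
  and \<open>iexp b\<close> is at most |a - b|, which is used where Z and Z' are close, and at most
  2, which is used on the exceptional event.\<close>

lemma (in prob_space) char_tendsto_perturb:
  fixes Z Z' :: "nat \<Rightarrow> 'a \<Rightarrow> 'b::euclidean_space"
  assumes [measurable]: "\<And>n. Z n \<in> borel_measurable M" "\<And>n. Z' n \<in> borel_measurable M"
    and close: "\<And>e. e > 0 \<Longrightarrow> (\<lambda>n. prob {w \<in> space M. norm (Z n w - Z' n w) > e}) \<longlonglongrightarrow> 0"
    and lim: "(\<lambda>n. \<integral>w. iexp (t \<bullet> Z n w) \<partial>M) \<longlonglongrightarrow> L"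
  shows "(\<lambda>n. \<integral>w. iexp (t \<bullet> Z' n w) \<partial>M) \<longlonglongrightarrow> L"
proof -
  have int: "integrable M (\<lambda>w. iexp (t \<bullet> V w))" if [measurable]: "V \<in> borel_measurable M" for V :: "'a \<Rightarrow> 'b"
    by (rule integrable_const_bound[of _ 1]) auto
  have bound: "norm ((\<integral>w. iexp (t \<bullet> Z' n w) \<partial>M) - (\<integral>w. iexp (t \<bullet> Z n w) \<partial>M)) \<le>
      norm t * e + 2 * prob {w \<in> space M. norm (Z n w - Z' n w) > e}" if e: "e > 0" for n e
  proof -
    let ?E = "{w \<in> space M. norm (Z n w - Z' n w) > e}"
    have E: "?E \<in> sets M" by measurable
    have iE: "integrable M (indicator ?E :: 'a \<Rightarrow> real)"
      using E by (auto intro!: integrable_real_indicator simp: less_top[symmetric])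
    have "norm ((\<integral>w. iexp (t \<bullet> Z' n w) \<partial>M) - (\<integral>w. iexp (t \<bullet> Z n w) \<partial>M)) =
        norm (\<integral>w. iexp (t \<bullet> Z' n w) - iexp (t \<bullet> Z n w) \<partial>M)"
      using int by simp
    also have "\<dots> \<le> (\<integral>w. norm (iexp (t \<bullet> Z' n w) - iexp (t \<bullet> Z n w)) \<partial>M)" by (rule integral_norm_bound)
    also have "\<dots> \<le> (\<integral>w. norm t * e + 2 * indicator ?E w \<partial>M)"
    proof (rule integral_mono)
      show "integrable M (\<lambda>w. norm (iexp (t \<bullet> Z' n w) - iexp (t \<bullet> Z n w)))" using int by auto
      show "integrable M (\<lambda>w. norm t * e + 2 * indicator ?E w)" using iE by simp
      fix w assume w: "w \<in> space M"
      show "norm (iexp (t \<bullet> Z' n w) - iexp (t \<bullet> Z n w)) \<le> norm t * e + 2 * indicator ?E w"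
      proof (cases "w \<in> ?E")
        case True
        have "norm (iexp (t \<bullet> Z' n w) - iexp (t \<bullet> Z n w)) \<le> norm (iexp (t \<bullet> Z' n w)) + norm (iexp (t \<bullet> Z n w))"
          by (rule norm_triangle_ineq4)
        moreover have "norm t * e \<ge> 0" using e by simp
        ultimately show ?thesis using True by simp
      next
        case False
        have "iexp (t \<bullet> Z' n w) - iexp (t \<bullet> Z n w) = iexp (t \<bullet> Z n w) * (iexp (t \<bullet> Z' n w - t \<bullet> Z n w) - 1)"
          by (simp add: exp_diff right_diff_distrib)
        hence "norm (iexp (t \<bullet> Z' n w) - iexp (t \<bullet> Z n w)) = norm (iexp (t \<bullet> Z' n w - t \<bullet> Z n w) - 1)"
          by (simp add: norm_mult)
        also have "\<dots> \<le> \<bar>t \<bullet> Z' n w - t \<bullet> Z n w\<bar>"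
          using iexp_approx1[of "t \<bullet> Z' n w - t \<bullet> Z n w" 0] by simp
        also have "\<dots> \<le> norm t * norm (Z n w - Z' n w)"
          using Cauchy_Schwarz_ineq2[of t "Z' n w - Z n w"] by (simp add: inner_diff_right norm_minus_commute)
        also have "\<dots> \<le> norm t * e" using False w by (intro mult_left_mono) auto
        finally show ?thesis using False by simp
      qed
    qed
    also have "\<dots> = norm t * e + 2 * prob ?E"
      using iE E by (subst Bochner_Integration.integral_add) (auto simp: prob_space)
    finally show ?thesis .
  qed
  have "(\<lambda>n. (\<integral>w. iexp (t \<bullet> Z' n w) \<partial>M) - (\<integral>w. iexp (t \<bullet> Z n w) \<partial>M)) \<longlonglongrightarrow> 0"
  proof (rule LIMSEQ_I)
    fix r :: real assume r: "r > 0"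
    \<comment> \<open>Makes |t| e at most r / 2, leaving r / 2 for twice the probability; the
      summand 1 covers t = 0.\<close>
    define e where "e = r / (2 * (norm t + 1))"
    have nt: "norm t + 1 > 0" using norm_ge_zero[of t] by linarith
    have e: "e > 0" using r nt by (simp add: e_def)
    have te: "norm t * e \<le> r / 2"
    proof -
      have "norm t * e \<le> (norm t + 1) * e" using e by (intro mult_right_mono) auto
      also have "\<dots> = r / 2"
      proof -
        have "x * (r / (2 * x)) = r / 2" if "x > 0" for x :: real using that by simp
        from this[OF nt] show ?thesis by (simp only: e_def)
      qed
      finally show ?thesis .
    qed
    have "eventually (\<lambda>n. prob {w \<in> space M. norm (Z n w - Z' n w) > e} < r / 4) sequentially"
      using r by (intro order_tendstoD(2)[OF close[OF e]]) auto
    then obtain N where N: "\<And>n. n \<ge> N \<Longrightarrow> prob {w \<in> space M. norm (Z n w - Z' n w) > e} < r / 4"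
      by (auto simp: eventually_sequentially)
    show "\<exists>N. \<forall>n\<ge>N. norm ((\<integral>w. iexp (t \<bullet> Z' n w) \<partial>M) - (\<integral>w. iexp (t \<bullet> Z n w) \<partial>M) - 0) < r"
    proof (intro exI[of _ N] allI impI)
      fix n assume "n \<ge> N"
      from N[OF this] bound[OF e, of n] te
      show "norm ((\<integral>w. iexp (t \<bullet> Z' n w) \<partial>M) - (\<integral>w. iexp (t \<bullet> Z n w) \<partial>M) - 0) < r" by simp
    qed
  qed
  from tendsto_add[OF this lim] show ?thesis by simp
qed

context zonal_model
begin

text \<open>The expansion in t = x . mu and r is rewritten in the ambient increment. Here x . h
  differs from its tangential part by -t |h|^2 / 2: in the linear term this is the curvature term of
  \<open>hess\<close> up to fourth order, and in the quadratic terms it is of third order. For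
  increments of norm at most 1 the fourth order is absorbed by the third.\<close>

lemma log_likelihood_expansion:
  obtains C where "C \<ge> 0"
    "\<And>x q. norm x = 1 \<Longrightarrow> norm (fst q) = 1 \<Longrightarrow> snd q \<in> {0..rs} \<Longrightarrow> norm (q - (mu, rho)) \<le> 1 \<Longrightarrow>
       \<bar>ln (1 + snd q * poly p (x \<bullet> fst q)) - ln (1 + rho * poly p (x \<bullet> mu)) - score x \<bullet> (q - (mu, rho))
          - hess x (q - (mu, rho)) (q - (mu, rho)) / 2\<bar> \<le> C * norm (q - (mu, rho)) ^ 3"
proof -
  obtain C0 where C0: "C0 \<ge> 0" and T: "\<And>t t' rho r. t \<in> {-1..1} \<Longrightarrow> t' \<in> {-1..1} \<Longrightarrow> rho \<in> {0..rs} \<Longrightarrow> r \<in> {0..rs} \<Longrightarrow>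
       \<bar>ln (1 + r * poly p t') - ln (1 + rho * poly p t)
         - ((t' - t) * (rho * poly (pderiv p) t / (1 + rho * poly p t)) + (r - rho) * (poly p t / (1 + rho * poly p t)))
         - ((t' - t)\<^sup>2 * (rho * poly (pderiv (pderiv p)) t / (1 + rho * poly p t) - (rho * poly (pderiv p) t / (1 + rho * poly p t))\<^sup>2)
            + 2 * (t' - t) * (r - rho) * (poly (pderiv p) t / (1 + rho * poly p t)\<^sup>2)
            - (r - rho)\<^sup>2 * (poly p t / (1 + rho * poly p t))\<^sup>2) / 2\<bar>
       \<le> C0 * (\<bar>t' - t\<bar> + \<bar>r - rho\<bar>) ^ 3"
    by (rule log_density_taylor[OF p_le order.strict_trans[OF rho(1,2)] rho(3)]) (assumption, rule that)
  obtain B where B: "B \<ge> 1" "\<And>t. t \<in> {-1..1} \<Longrightarrow> \<bar>den t\<bar> \<le> B \<and> \<bar>sa t\<bar> \<le> B \<and> \<bar>sb t\<bar> \<le> B \<and> \<bar>hA t\<bar> \<le> B \<and> \<bar>hB t\<bar> \<le> B"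
    by (rule coeffs_bounded) (rule that)
  show ?thesis
  proof (rule that[of "8 * C0 + 2 * B"])
    show "8 * C0 + 2 * B \<ge> 0" using C0 B(1) by simp
    fix x :: "(real, 'n) vec" and q :: "(real, 'n) vec \<times> real"
    assume x: "norm x = 1" and q: "norm (fst q) = 1" "snd q \<in> {0..rs}" "norm (q - (mu, rho)) \<le> 1"
    define h where "h = fst q - mu"
    define \<beta> where "\<beta> = snd q - rho"
    define N where "N = norm (q - (mu, rho))"
    have H: "q - (mu, rho) = (h, \<beta>)" by (cases q) (simp add: h_def \<beta>_def)
    have N: "0 \<le> N" "N \<le> 1" "norm h \<le> N" "\<bar>\<beta>\<bar> \<le> N"
      using q(3) norm_fst_le[of h \<beta>] norm_snd_le[of \<beta> h] by (auto simp: N_def H)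
    define t where "t = x \<bullet> mu"
    define \<alpha> where "\<alpha> = x \<bullet> h"
    define \<xi> where "\<xi> = tang x \<bullet> h"
    have tI: "t \<in> {-1..1}" unfolding t_def by (rule inner_mu_Icc[OF x])
    have t'I: "x \<bullet> fst q \<in> {-1..1}" using abs_inner_le_1[OF x q(1)] by auto
    have t': "x \<bullet> fst q - t = \<alpha>" by (simp add: \<alpha>_def t_def h_def inner_diff_right)
    have muh: "mu \<bullet> h = - (norm h)\<^sup>2 / 2"
    proof -
      have "fst q \<bullet> fst q = 1" using q(1) by (simp add: norm_eq_1)
      thus ?thesis using mu_mu by (simp add: h_def power2_norm_eq_inner inner_diff_left inner_diff_right inner_commute)
    qed
    have \<alpha>\<xi>: "\<alpha> - \<xi> = - t * (norm h)\<^sup>2 / 2"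
      unfolding \<alpha>_def \<xi>_def tang_def t_def inner_diff_left inner_scaleR_left muh by (simp add: inner_commute)
    have \<alpha>N: "\<bar>\<alpha>\<bar> \<le> N" using abs_inner_unit[OF x, of h] N(3) by (simp add: \<alpha>_def)
    have \<xi>N: "\<bar>\<xi>\<bar> \<le> N" unfolding \<xi>_def tang_inner(1) using abs_inner_unit[OF x, of "tang h"] norm_tang_le[of h] N(3) by linarith
    have hN: "(norm h)\<^sup>2 \<le> N\<^sup>2" using N by (intro power_mono) auto
    have th: "tang h \<bullet> tang h = (norm h)\<^sup>2 - (norm h) ^ 4 / 4"
      using norm_tang_sq[of h] unfolding muh by (simp add: power2_norm_eq_inner[symmetric] power_divide power4_eq_xxxx power2_eq_square)
    let ?lin = "\<alpha> * sb t + \<beta> * sa t" and ?quad = "\<alpha>\<^sup>2 * hA t + 2 * \<alpha> * \<beta> * hB t - \<beta>\<^sup>2 * (sa t)\<^sup>2"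
    have 1: "\<bar>ln (1 + snd q * poly p (x \<bullet> fst q)) - ln (1 + rho * poly p t) - ?lin - ?quad / 2\<bar> \<le> C0 * (\<bar>\<alpha>\<bar> + \<bar>\<beta>\<bar>) ^ 3"
      using T[OF tI t'I _ q(2), of rho] rho unfolding t' \<beta>_def[symmetric]
      by (simp add: sa_def sb_def hA_def hB_def den_def)
    have sc: "score x \<bullet> (h, \<beta>) = \<xi> * sb t + \<beta> * sa t"
      by (simp add: score_def t_def \<xi>_def)
    have he: "hess x (h, \<beta>) (h, \<beta>) = hA t * \<xi>\<^sup>2 + 2 * hB t * \<xi> * \<beta> - (sa t)\<^sup>2 * \<beta>\<^sup>2 - sb t * t * ((norm h)\<^sup>2 - (norm h) ^ 4 / 4)"
      unfolding hess_def fst_conv snd_conv th t_def[symmetric] \<xi>_def[symmetric] by (simp add: power2_eq_square algebra_simps)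
    have diff: "?lin + ?quad / 2 - (score x \<bullet> (h, \<beta>) + hess x (h, \<beta>) (h, \<beta>) / 2) =
       hA t * ((\<alpha> - \<xi>) * (\<alpha> + \<xi>)) / 2 + hB t * ((\<alpha> - \<xi>) * \<beta>) - sb t * t * (norm h) ^ 4 / 8"
    proof -
      have "sb t * (\<alpha> - \<xi>) = - sb t * t * (norm h)\<^sup>2 / 2" unfolding \<alpha>\<xi> by simp
      moreover have "?lin + ?quad / 2 - (score x \<bullet> (h, \<beta>) + hess x (h, \<beta>) (h, \<beta>) / 2) =
         sb t * (\<alpha> - \<xi>) + sb t * t * (norm h)\<^sup>2 / 2 + hA t * ((\<alpha> - \<xi>) * (\<alpha> + \<xi>)) / 2 + hB t * ((\<alpha> - \<xi>) * \<beta>) - sb t * t * (norm h) ^ 4 / 8"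
        unfolding sc he by (simp add: algebra_simps power2_eq_square add_divide_distrib diff_divide_distrib)
      ultimately show ?thesis by simp
    qed
    have Bt: "\<bar>hA t\<bar> \<le> B" "\<bar>hB t\<bar> \<le> B" "\<bar>sb t\<bar> \<le> B" "\<bar>t\<bar> \<le> 1" using B(2)[OF tI] tI by auto
    have \<alpha>\<xi>N: "\<bar>\<alpha> - \<xi>\<bar> \<le> N\<^sup>2 / 2"
    proof -
      have "\<bar>\<alpha> - \<xi>\<bar> = \<bar>t\<bar> * (norm h)\<^sup>2 / 2" unfolding \<alpha>\<xi> by (simp add: abs_mult)
      also have "\<dots> \<le> 1 * N\<^sup>2 / 2" using Bt(4) hN by (intro divide_right_mono mult_mono) auto
      finally show ?thesis by simp
    qed
    have b1: "\<bar>hA t * ((\<alpha> - \<xi>) * (\<alpha> + \<xi>)) / 2\<bar> \<le> B * N ^ 3 / 2"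
    proof -
      have "\<bar>\<alpha> + \<xi>\<bar> \<le> 2 * N" using \<alpha>N \<xi>N by linarith
      hence q: "\<bar>\<alpha> - \<xi>\<bar> * \<bar>\<alpha> + \<xi>\<bar> \<le> N\<^sup>2 / 2 * (2 * N)" using \<alpha>\<xi>N by (intro mult_mono) auto
      have "\<bar>hA t\<bar> * (\<bar>\<alpha> - \<xi>\<bar> * \<bar>\<alpha> + \<xi>\<bar>) \<le> B * (N\<^sup>2 / 2 * (2 * N))"
        by (rule mult_mono[OF Bt(1) q]) (use B(1) in auto)
      thus ?thesis by (simp add: abs_mult power2_eq_square power3_eq_cube)
    qed
    have b2: "\<bar>hB t * ((\<alpha> - \<xi>) * \<beta>)\<bar> \<le> B * N ^ 3 / 2"
    proof -
      have q: "\<bar>\<alpha> - \<xi>\<bar> * \<bar>\<beta>\<bar> \<le> N\<^sup>2 / 2 * N" using \<alpha>\<xi>N N by (intro mult_mono) auto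
      have "\<bar>hB t\<bar> * (\<bar>\<alpha> - \<xi>\<bar> * \<bar>\<beta>\<bar>) \<le> B * (N\<^sup>2 / 2 * N)"
        by (rule mult_mono[OF Bt(2) q]) (use B(1) in auto)
      thus ?thesis by (simp add: abs_mult power2_eq_square power3_eq_cube)
    qed
    have b3: "\<bar>sb t * t * (norm h) ^ 4 / 8\<bar> \<le> B * N ^ 3 / 8"
    proof -
      have "norm h ^ 4 \<le> N ^ 4" using N by (intro power_mono) auto
      also have "\<dots> \<le> N ^ 3" using N by (intro power_decreasing) auto
      finally have h4: "norm h ^ 4 \<le> N ^ 3" .
      have "\<bar>sb t\<bar> * \<bar>t\<bar> \<le> B * 1" using Bt B(1) by (intro mult_mono) auto
      hence "\<bar>sb t\<bar> * \<bar>t\<bar> * norm h ^ 4 \<le> B * N ^ 3" using h4 B(1) by (intro mult_mono) auto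
      thus ?thesis by (simp add: abs_mult)
    qed
    have "C0 * (\<bar>\<alpha>\<bar> + \<bar>\<beta>\<bar>) ^ 3 \<le> C0 * (2 * N) ^ 3"
      using \<alpha>N N C0 by (intro mult_left_mono power_mono) auto
    also have "\<dots> = 8 * C0 * N ^ 3" by (simp add: power_mult_distrib)
    finally have 2: "C0 * (\<bar>\<alpha>\<bar> + \<bar>\<beta>\<bar>) ^ 3 \<le> 8 * C0 * N ^ 3" .
    have BN: "B * N ^ 3 \<ge> 0" using B(1) N by simp
    have "\<bar>ln (1 + snd q * poly p (x \<bullet> fst q)) - ln (1 + rho * poly p t) - (score x \<bullet> (h, \<beta>) + hess x (h, \<beta>) (h, \<beta>) / 2)\<bar>
       \<le> 8 * C0 * N ^ 3 + 2 * (B * N ^ 3)"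
      using 1 2 b1 b2 b3 diff BN by linarith
    thus "\<bar>ln (1 + snd q * poly p (x \<bullet> fst q)) - ln (1 + rho * poly p (x \<bullet> mu)) - score x \<bullet> (q - (mu, rho))
          - hess x (q - (mu, rho)) (q - (mu, rho)) / 2\<bar> \<le> (8 * C0 + 2 * B) * norm (q - (mu, rho)) ^ 3"
      unfolding H t_def[symmetric] N_def[symmetric, unfolded H] by (simp add: algebra_simps)
  qed
qed

lemma score_bounded:
  obtains B where "B > 0" "\<And>x. norm x = 1 \<Longrightarrow> norm (score x) \<le> B"
proof -
  obtain B where B: "B \<ge> 1" "\<And>t. t \<in> {-1..1} \<Longrightarrow> \<bar>den t\<bar> \<le> B \<and> \<bar>sa t\<bar> \<le> B \<and> \<bar>sb t\<bar> \<le> B \<and> \<bar>hA t\<bar> \<le> B \<and> \<bar>hB t\<bar> \<le> B"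
    by (rule coeffs_bounded) (rule that)
  show ?thesis
  proof (rule that[of "2 * B"])
    show "2 * B > 0" using B by simp
    fix x :: "(real, 'n) vec" assume x: "norm x = 1"
    note b = B(2)[OF inner_mu_Icc[OF x]]
    have "norm (score x) \<le> norm (sb (x \<bullet> mu) *\<^sub>R tang x) + norm (sa (x \<bullet> mu))"
      unfolding score_def by (rule norm_Pair_le)
    also have "\<bar>sb (x \<bullet> mu)\<bar> * norm (tang x) \<le> B * 1"
      using b norm_tang_le[of x] x B(1) by (intro mult_mono) auto
    hence "norm (sb (x \<bullet> mu) *\<^sub>R tang x) + norm (sa (x \<bullet> mu)) \<le> 2 * B" using b by simp
    finally show "norm (score x) \<le> 2 * B" .
  qed
qed

lemma hess_bounded:
  obtains B where "\<And>x H H'. norm x = 1 \<Longrightarrow> norm H \<le> 1 \<Longrightarrow> norm H' \<le> 1 \<Longrightarrow> \<bar>hess x H H'\<bar> \<le> B"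
proof -
  obtain B where B: "B \<ge> 1" "\<And>t. t \<in> {-1..1} \<Longrightarrow> \<bar>den t\<bar> \<le> B \<and> \<bar>sa t\<bar> \<le> B \<and> \<bar>sb t\<bar> \<le> B \<and> \<bar>hA t\<bar> \<le> B \<and> \<bar>hB t\<bar> \<le> B"
    by (rule coeffs_bounded) (rule that)
  show ?thesis
  proof (rule that[of "4 * B + B\<^sup>2"])
    fix x :: "(real, 'n) vec" and H H' :: "(real, 'n) vec \<times> real"
    assume x: "norm x = 1" and H: "norm H \<le> 1" "norm H' \<le> 1"
    note b = B(2)[OF inner_mu_Icc[OF x]]
    have f: "norm (fst V) \<le> norm V" "\<bar>snd V\<bar> \<le> norm V" for V :: "(real, 'n) vec \<times> real"
      using norm_fst_le[of "fst V" "snd V"] norm_snd_le[of "snd V" "fst V"] by auto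
    have u: "\<bar>tang x \<bullet> fst V\<bar> \<le> 1" "\<bar>snd V\<bar> \<le> 1" if "norm V \<le> 1" for V :: "(real, 'n) vec \<times> real"
      using Cauchy_Schwarz_ineq2[of "tang x" "fst V"] norm_tang_le[of x] x f[of V] that
        mult_mono[of "norm (tang x)" 1 "norm (fst V)" 1] by auto
    have t: "\<bar>tang (fst H) \<bullet> tang (fst H')\<bar> \<le> 1"
    proof -
      have "norm (tang (fst H)) \<le> 1" "norm (tang (fst H')) \<le> 1"
        using norm_tang_le[of "fst H"] norm_tang_le[of "fst H'"] f[of H] f[of H'] H by linarith+
      thus ?thesis using Cauchy_Schwarz_ineq2[of "tang (fst H)" "tang (fst H')"]
          mult_mono[of "norm (tang (fst H))" 1 "norm (tang (fst H'))" 1] by auto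
    qed
    have p: "\<bar>a * c\<bar> \<le> r" if "\<bar>a\<bar> \<le> r" "\<bar>c\<bar> \<le> 1" for a c r :: real
      using mult_mono[of "\<bar>a\<bar>" r "\<bar>c\<bar>" 1] that by (auto simp: abs_mult)
    note uH = u[OF H(1)] u[OF H(2)]
    have "\<bar>hA (x \<bullet> mu) * (tang x \<bullet> fst H) * (tang x \<bullet> fst H')\<bar> \<le> B" using b uH by (intro p) auto
    moreover have "\<bar>hB (x \<bullet> mu) * ((tang x \<bullet> fst H) * snd H')\<bar> \<le> B" "\<bar>hB (x \<bullet> mu) * ((tang x \<bullet> fst H') * snd H)\<bar> \<le> B"
      using b uH by (intro p; auto)+
    moreover have "\<bar>(sa (x \<bullet> mu))\<^sup>2 * snd H * snd H'\<bar> \<le> B\<^sup>2"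
    proof -
      have "\<bar>(sa (x \<bullet> mu))\<^sup>2\<bar> \<le> B\<^sup>2" using power_mono[of "\<bar>sa (x \<bullet> mu)\<bar>" B 2] b by simp
      thus ?thesis using uH by (intro p) auto
    qed
    moreover have "\<bar>sb (x \<bullet> mu) * (x \<bullet> mu) * (tang (fst H) \<bullet> tang (fst H'))\<bar> \<le> B"
      using b t inner_mu_Icc[OF x] by (intro p) auto
    ultimately show "\<bar>hess x H H'\<bar> \<le> 4 * B + B\<^sup>2" unfolding hess_def distrib_left by linarith
  qed
qed

end

section \<open>Limits of the score and the Hessian\<close>

text \<open>The sample lies on the sphere everywhere, not just almost surely, so that the pointwise
  bounds hold on the whole space; the null set is dealt with when the locale is interpreted.
  \<open>D\<close> records the common law, as the central limit theorem demands.\<close>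

locale zonal_sample = zonal_model p rho rs mu d k + prob_space M
  for p rho rs and mu :: "real ^ 'n::{finite,wellorder}" and d k and M :: "'w measure" +
  fixes X :: "nat \<Rightarrow> 'w \<Rightarrow> (real, 'n) vec" and D :: "(real, 'n) vec measure"
  assumes X_sphere: "\<And>i w. w \<in> space M \<Longrightarrow> norm (X i w) = 1"
    and X_indep: "indep_vars (\<lambda>_. borel) X UNIV"
    and X_distr: "\<And>i. distr M borel (X i) = D"
    and X_mean: "\<And>i f. f \<in> borel_measurable borel \<Longrightarrow> expectation (\<lambda>w. f (X i w)) = model_mean f"
begin

lemma X_measurable [measurable]: "X i \<in> borel_measurable M"
  using X_indep by (auto simp: indep_vars_def)

definition mean_score :: "nat \<Rightarrow> 'w \<Rightarrow> (real, 'n) vec \<times> real" where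
  "mean_score n w = (1 / real n) *\<^sub>R (\<Sum>i<n. score (X i w))"

definition mean_hess :: "nat \<Rightarrow> 'w \<Rightarrow> (real, 'n) vec \<times> real \<Rightarrow> (real, 'n) vec \<times> real \<Rightarrow> real" where
  "mean_hess n w H H' = (\<Sum>i<n. hess (X i w) H H') / real n"

text \<open>A single random variable that dominates the deviation of the Hessian form, relative to
  |H|^2, in all directions H at once.\<close>

definition hess_error :: "nat \<Rightarrow> 'w \<Rightarrow> real" where
  "hess_error n w = (\<Sum>b\<in>Basis. \<Sum>b'\<in>Basis. \<bar>mean_hess n w b b' - model_mean (\<lambda>x. hess x b b')\<bar>)"

definition loglik :: "nat \<Rightarrow> 'w \<Rightarrow> (real, 'n) vec \<times> real \<Rightarrow> real" where
  "loglik n w q = (\<Sum>i<n. ln (1 + snd q * poly p (X i w \<bullet> fst q)))"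

lemma measurable_mean_score [measurable]: "mean_score n \<in> borel_measurable M"
  unfolding mean_score_def[abs_def] by measurable

lemma measurable_hess_error [measurable]: "hess_error n \<in> borel_measurable M"
  unfolding hess_error_def[abs_def] mean_hess_def by measurable

lemma indep_compose: "f \<in> borel_measurable borel \<Longrightarrow> indep_vars (\<lambda>_. borel) (\<lambda>i w. f (X i w)) UNIV"
  by (rule indep_vars_compose2[OF X_indep])

lemma hess_expand:
  "hess x H H = (\<Sum>b\<in>Basis. \<Sum>b'\<in>Basis. (H \<bullet> b) * (H \<bullet> b') * hess x b b')"
proof -
  note bl = bilinear_hess[of x]
  have "hess x H H = hess x (\<Sum>b\<in>Basis. (H \<bullet> b) *\<^sub>R b) (\<Sum>b\<in>Basis. (H \<bullet> b) *\<^sub>R b)"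
    by (simp only: euclidean_representation)
  also have "\<dots> = (\<Sum>(b, b')\<in>Basis \<times> Basis. hess x ((H \<bullet> b) *\<^sub>R b) ((H \<bullet> b') *\<^sub>R b'))"
    by (rule bilinear_sum[OF bl])
  also have "\<dots> = (\<Sum>b\<in>Basis. \<Sum>b'\<in>Basis. (H \<bullet> b) * (H \<bullet> b') * hess x b b')"
    unfolding sum.cartesian_product[symmetric]
    by (simp add: bilinear_lmul[OF bl] bilinear_rmul[OF bl] mult_ac)
  finally show ?thesis .
qed

lemma model_mean_sum:
  assumes "\<And>i. i \<in> I \<Longrightarrow> integrable sphere_surface (\<lambda>x. f i x * den (x \<bullet> mu))"
  shows "model_mean (\<lambda>x. \<Sum>i\<in>I. c i * f i x) = (\<Sum>i\<in>I. c i * model_mean (f i))"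
proof -
  have "(\<integral>x. (\<Sum>i\<in>I. c i * f i x) * den (x \<bullet> mu) \<partial>sphere_surface) = (\<integral>x. (\<Sum>i\<in>I. c i * (f i x * den (x \<bullet> mu))) \<partial>sphere_surface)"
    by (simp add: sum_distrib_right mult.assoc)
  also have "\<dots> = (\<Sum>i\<in>I. c i * (\<integral>x. f i x * den (x \<bullet> mu) \<partial>sphere_surface))"
    using assms by (subst Bochner_Integration.integral_sum) auto
  finally show ?thesis by (simp add: model_mean_def sum_divide_distrib)
qed

lemma integrable_hess: "integrable sphere_surface (\<lambda>x. hess x H H' * den (x \<bullet> mu))"
proof -
  obtain B where B: "\<And>x H H'. norm x = 1 \<Longrightarrow> norm H \<le> 1 \<Longrightarrow> norm H' \<le> 1 \<Longrightarrow> \<bar>hess x H H'\<bar> \<le> B"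
    by (rule hess_bounded) (rule that)
  \<comment> \<open>Rescaling by c brings both arguments into the unit ball, where
    \<open>hess_bounded\<close> applies; the summand 1 keeps c positive for zero vectors.\<close>
  define c where "c = 1 + norm H + norm H'"
  have c: "c > 0" using norm_ge_zero[of H] norm_ge_zero[of H'] unfolding c_def by linarith
  have "\<bar>hess x H H'\<bar> \<le> c * (c * B)" if x: "norm x = 1" for x
  proof -
    have "hess x (c *\<^sub>R U) (c *\<^sub>R V) = c * (c * hess x U V)" for U V
      by (simp add: bilinear_lmul[OF bilinear_hess] bilinear_rmul[OF bilinear_hess])
    from this[of "H /\<^sub>R c" "H' /\<^sub>R c"] have "hess x H H' = c * (c * hess x (H /\<^sub>R c) (H' /\<^sub>R c))"
      using c by simp
    hence "\<bar>hess x H H'\<bar> = c * (c * \<bar>hess x (H /\<^sub>R c) (H' /\<^sub>R c)\<bar>)" using c by (simp add: abs_mult)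
    moreover have "norm H \<le> c" "norm H' \<le> c" by (simp_all add: c_def)
    hence "norm (H /\<^sub>R c) \<le> 1" "norm (H' /\<^sub>R c) \<le> 1" using c by (simp_all add: field_simps)
    hence "\<bar>hess x (H /\<^sub>R c) (H' /\<^sub>R c)\<bar> \<le> B" by (rule B[OF x])
    ultimately show ?thesis using c by simp
  qed
  hence "integrable sphere_surface (\<lambda>x. den (x \<bullet> mu) * hess x H H')"
    by (intro integrable_zonal_times continuous_coeffs) auto
  thus ?thesis by (simp add: mult.commute)
qed

text \<open>In the expansion of both forms over the basis each entry carries a product of two
  coordinates of H, bounded by |H|^2. The limit form is identified by
  \<open>model_mean_hess\<close>.\<close>

lemma mean_hess_close:
  "\<bar>mean_hess n w H H + (Jm * ((norm (fst H))\<^sup>2 - (mu \<bullet> fst H)\<^sup>2) + Jr * (snd H)\<^sup>2)\<bar> \<le> hess_error n w * (norm H)\<^sup>2"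
proof -
  have m: "mean_hess n w H H = (\<Sum>b\<in>Basis. \<Sum>b'\<in>Basis. (H \<bullet> b) * (H \<bullet> b') * mean_hess n w b b')"
  proof -
    have eq: "(\<Sum>i<n. hess (X i w) H H) = (\<Sum>b\<in>Basis. \<Sum>b'\<in>Basis. (H \<bullet> b) * (H \<bullet> b') * (\<Sum>i<n. hess (X i w) b b'))"
      unfolding hess_expand sum_distrib_left by (subst sum.swap, rule sum.cong[OF refl], subst sum.swap, rule refl)
    show ?thesis
      unfolding mean_hess_def eq by (simp only: sum_divide_distrib[where A=Basis] times_divide_eq_right)
  qed
  have "model_mean (\<lambda>x. hess x H H) = (\<Sum>(b, b')\<in>Basis \<times> Basis. (H \<bullet> b) * (H \<bullet> b') * model_mean (\<lambda>x. hess x b b'))"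
  proof -
    have "model_mean (\<lambda>x. hess x H H) = model_mean (\<lambda>x. \<Sum>i\<in>Basis \<times> Basis. (H \<bullet> fst i) * (H \<bullet> snd i) * hess x (fst i) (snd i))"
      unfolding hess_expand sum.cartesian_product by (simp add: case_prod_unfold)
    also have "\<dots> = (\<Sum>i\<in>Basis \<times> Basis. (H \<bullet> fst i) * (H \<bullet> snd i) * model_mean (\<lambda>x. hess x (fst i) (snd i)))"
      by (rule model_mean_sum[where f="\<lambda>i x. hess x (fst i) (snd i)"]) (rule integrable_hess)
    finally show ?thesis by (simp add: case_prod_unfold)
  qed
  hence e: "- (Jm * ((norm (fst H))\<^sup>2 - (mu \<bullet> fst H)\<^sup>2) + Jr * (snd H)\<^sup>2) =
      (\<Sum>b\<in>Basis. \<Sum>b'\<in>Basis. (H \<bullet> b) * (H \<bullet> b') * model_mean (\<lambda>x. hess x b b'))"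
    unfolding model_mean_hess norm_tang_sq sum.cartesian_product .
  have "mean_hess n w H H + (Jm * ((norm (fst H))\<^sup>2 - (mu \<bullet> fst H)\<^sup>2) + Jr * (snd H)\<^sup>2) =
     mean_hess n w H H - (- (Jm * ((norm (fst H))\<^sup>2 - (mu \<bullet> fst H)\<^sup>2) + Jr * (snd H)\<^sup>2))" by simp
  also have "\<dots> = (\<Sum>b\<in>Basis. \<Sum>b'\<in>Basis. (H \<bullet> b) * (H \<bullet> b') * (mean_hess n w b b' - model_mean (\<lambda>x. hess x b b')))"
    unfolding e m by (simp add: sum_subtractf[symmetric] right_diff_distrib)
  also have "\<bar>\<dots>\<bar> \<le> (\<Sum>b\<in>Basis. \<Sum>b'\<in>Basis. (norm H)\<^sup>2 * \<bar>mean_hess n w b b' - model_mean (\<lambda>x. hess x b b')\<bar>)"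
  proof (intro order_trans[OF sum_abs] sum_mono)
    fix b b' :: "(real, 'n) vec \<times> real" assume b: "b \<in> Basis" "b' \<in> Basis"
    have "\<bar>H \<bullet> b\<bar> * \<bar>H \<bullet> b'\<bar> \<le> norm H * norm H"
      using b by (intro mult_mono Basis_le_norm) auto
    thus "\<bar>(H \<bullet> b) * (H \<bullet> b') * (mean_hess n w b b' - model_mean (\<lambda>x. hess x b b'))\<bar> \<le>
       (norm H)\<^sup>2 * \<bar>mean_hess n w b b' - model_mean (\<lambda>x. hess x b b')\<bar>"
      unfolding abs_mult power2_eq_square by (intro mult_right_mono) auto
  qed
  also have "\<dots> = hess_error n w * (norm H)\<^sup>2"
    by (simp add: hess_error_def sum_distrib_left[symmetric] mult.commute)
  finally show ?thesis .
qed

lemma mean_score_tangential: "fst (mean_score n w) \<bullet> mu = 0"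
  by (simp add: mean_score_def score_def fst_sum inner_sum_left tang_inner(2))

lemma loglik_expansion:
  obtains C where "C \<ge> 0"
    "\<And>n w q. n > 0 \<Longrightarrow> w \<in> space M \<Longrightarrow> norm (fst q) = 1 \<Longrightarrow> snd q \<in> {0..rs} \<Longrightarrow> norm (q - (mu, rho)) \<le> 1 \<Longrightarrow>
       \<bar>loglik n w q / real n - loglik n w (mu, rho) / real n
          - (fst (mean_score n w) \<bullet> (fst q - mu) + snd (mean_score n w) * (snd q - rho)
            - (Jm * ((norm (fst q - mu))\<^sup>2 - (mu \<bullet> (fst q - mu))\<^sup>2) + Jr * (snd q - rho)\<^sup>2) / 2)\<bar>
       \<le> hess_error n w * (norm (q - (mu, rho)))\<^sup>2 / 2 + C * norm (q - (mu, rho)) ^ 3"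
proof -
  obtain C where C: "C \<ge> 0"
    "\<And>x q. norm x = 1 \<Longrightarrow> norm (fst q) = 1 \<Longrightarrow> snd q \<in> {0..rs} \<Longrightarrow> norm (q - (mu, rho)) \<le> 1 \<Longrightarrow>
       \<bar>ln (1 + snd q * poly p (x \<bullet> fst q)) - ln (1 + rho * poly p (x \<bullet> mu)) - score x \<bullet> (q - (mu, rho))
          - hess x (q - (mu, rho)) (q - (mu, rho)) / 2\<bar> \<le> C * norm (q - (mu, rho)) ^ 3"
    by (rule log_likelihood_expansion) (rule that)
  show ?thesis
  proof (rule that[OF C(1)])
    fix n :: nat and w and q :: "(real, 'n) vec \<times> real"
    assume n: "n > 0" and w: "w \<in> space M" and q: "norm (fst q) = 1" "snd q \<in> {0..rs}" "norm (q - (mu, rho)) \<le> 1"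
    define H where "H = q - (mu, rho)"
    define Q where "Q = Jm * ((norm (fst H))\<^sup>2 - (mu \<bullet> fst H)\<^sup>2) + Jr * (snd H)\<^sup>2"
    have "\<bar>\<Sum>i<n. ln (1 + snd q * poly p (X i w \<bullet> fst q)) - ln (1 + rho * poly p (X i w \<bullet> mu)) - score (X i w) \<bullet> H - hess (X i w) H H / 2\<bar>
        \<le> (\<Sum>i<n. C * norm H ^ 3)"
      unfolding H_def by (rule order_trans[OF sum_abs], rule sum_mono, rule C(2)[OF X_sphere[OF w] q])
    also have "\<dots> = real n * (C * norm H ^ 3)" by simp
    also have "(\<Sum>i<n. ln (1 + snd q * poly p (X i w \<bullet> fst q)) - ln (1 + rho * poly p (X i w \<bullet> mu)) - score (X i w) \<bullet> H - hess (X i w) H H / 2) =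
       real n * (loglik n w q / real n - loglik n w (mu, rho) / real n - mean_score n w \<bullet> H - mean_hess n w H H / 2)"
    proof -
      have "(\<Sum>i<n. ln (1 + snd q * poly p (X i w \<bullet> fst q)) - ln (1 + rho * poly p (X i w \<bullet> mu)) - score (X i w) \<bullet> H - hess (X i w) H H / 2) =
          loglik n w q - loglik n w (mu, rho) - (\<Sum>i<n. score (X i w)) \<bullet> H - (\<Sum>i<n. hess (X i w) H H) / 2"
        by (simp add: sum_subtractf loglik_def inner_sum_left sum_divide_distrib)
      moreover have "real n * (loglik n w q / real n - loglik n w (mu, rho) / real n - mean_score n w \<bullet> H - mean_hess n w H H / 2) =
          loglik n w q - loglik n w (mu, rho) - (\<Sum>i<n. score (X i w)) \<bullet> H - (\<Sum>i<n. hess (X i w) H H) / 2"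
        unfolding mean_score_def mean_hess_def inner_scaleR_left using n by (simp add: right_diff_distrib)
      ultimately show ?thesis by simp
    qed
    finally have "real n * \<bar>loglik n w q / real n - loglik n w (mu, rho) / real n - mean_score n w \<bullet> H - mean_hess n w H H / 2\<bar>
       \<le> real n * (C * norm H ^ 3)" using n by (simp only: abs_mult abs_of_nat)
    hence 1: "\<bar>loglik n w q / real n - loglik n w (mu, rho) / real n - mean_score n w \<bullet> H - mean_hess n w H H / 2\<bar> \<le> C * norm H ^ 3"
      using n by simp
    have 2: "\<bar>mean_hess n w H H + Q\<bar> \<le> hess_error n w * (norm H)\<^sup>2"
      unfolding Q_def by (rule mean_hess_close)
    have 3: "mean_score n w \<bullet> H = fst (mean_score n w) \<bullet> fst H + snd (mean_score n w) * snd H"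
      by (cases H, cases "mean_score n w") simp
    have "\<bar>loglik n w q / real n - loglik n w (mu, rho) / real n - (fst (mean_score n w) \<bullet> fst H + snd (mean_score n w) * snd H - Q / 2)\<bar>
       \<le> hess_error n w * (norm H)\<^sup>2 / 2 + C * norm H ^ 3"
      using 1 2 unfolding 3 by linarith
    thus "\<bar>loglik n w q / real n - loglik n w (mu, rho) / real n
          - (fst (mean_score n w) \<bullet> (fst q - mu) + snd (mean_score n w) * (snd q - rho)
            - (Jm * ((norm (fst q - mu))\<^sup>2 - (mu \<bullet> (fst q - mu))\<^sup>2) + Jr * (snd q - rho)\<^sup>2) / 2)\<bar>
       \<le> hess_error n w * (norm (q - (mu, rho)))\<^sup>2 / 2 + C * norm (q - (mu, rho)) ^ 3"
      by (simp add: H_def Q_def)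
  qed
qed

text \<open>If the sum reaches e, one of its c entries reaches e / c, and each entry obeys the weak
  law.\<close>

lemma hess_error_tendsto:
  assumes e: "e > 0"
  shows "(\<lambda>n. prob {w \<in> space M. hess_error n w \<ge> e}) \<longlonglongrightarrow> 0"
proof -
  let ?S = "(Basis :: ((real, 'n) vec \<times> real) set) \<times> (Basis :: ((real, 'n) vec \<times> real) set)"
  define c where "c = real (card ?S)"
  have c: "c > 0" unfolding c_def of_nat_0_less_iff by (subst card_gt_0_iff) auto
  define E where "E = (\<lambda>i n. {w \<in> space M. \<bar>mean_hess n w (fst i) (snd i) - model_mean (\<lambda>x. hess x (fst i) (snd i))\<bar> \<ge> e / c})"
  have Em: "E i n \<in> sets M" for i n
    unfolding E_def mean_hess_def by measurable
  obtain B where B: "\<And>x H H'. norm x = 1 \<Longrightarrow> norm H \<le> 1 \<Longrightarrow> norm H' \<le> 1 \<Longrightarrow> \<bar>hess x H H'\<bar> \<le> B"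
    by (rule hess_bounded) (rule that)
  have lim: "(\<lambda>n. prob (E i n)) \<longlonglongrightarrow> 0" if "i \<in> ?S" for i
    unfolding E_def mean_hess_def
  proof (rule weak_law_bounded)
    show "indep_vars (\<lambda>_. borel) (\<lambda>j w. hess (X j w) (fst i) (snd i)) UNIV" by (rule indep_compose) simp
    show "\<bar>hess (X j w) (fst i) (snd i)\<bar> \<le> B" if "w \<in> space M" for j w
      using \<open>i \<in> ?S\<close> by (intro B X_sphere that) (auto simp: norm_Basis)
    show "expectation (\<lambda>w. hess (X j w) (fst i) (snd i)) = model_mean (\<lambda>x. hess x (fst i) (snd i))" for j
      by (rule X_mean) simp
  qed (use e c in simp)
  have "(\<lambda>n. \<Sum>i\<in>?S. prob (E i n)) \<longlonglongrightarrow> (\<Sum>i\<in>?S. 0)" by (intro tendsto_sum lim)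
  hence lim': "(\<lambda>n. \<Sum>i\<in>?S. prob (E i n)) \<longlonglongrightarrow> 0" by simp
  show ?thesis
  proof (rule tendsto_sandwich[OF _ _ tendsto_const lim'])
    show "\<forall>\<^sub>F n in sequentially. prob {w \<in> space M. hess_error n w \<ge> e} \<le> (\<Sum>i\<in>?S. prob (E i n))"
    proof (rule always_eventually, rule allI)
      fix n
      have "{w \<in> space M. hess_error n w \<ge> e} \<subseteq> (\<Union>i\<in>?S. E i n)"
      proof
        fix w assume w: "w \<in> {w \<in> space M. hess_error n w \<ge> e}"
        show "w \<in> (\<Union>i\<in>?S. E i n)"
        proof (rule ccontr)
          assume "w \<notin> (\<Union>i\<in>?S. E i n)"
          hence lt: "\<bar>mean_hess n w (fst i) (snd i) - model_mean (\<lambda>x. hess x (fst i) (snd i))\<bar> < e / c" if "i \<in> ?S" for i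
            using w that by (force simp: E_def)
          have "hess_error n w = (\<Sum>i\<in>?S. \<bar>mean_hess n w (fst i) (snd i) - model_mean (\<lambda>x. hess x (fst i) (snd i))\<bar>)"
            by (simp add: hess_error_def sum.cartesian_product case_prod_unfold)
          also have "\<dots> < (\<Sum>i\<in>?S. e / c)"
            by (rule sum_strict_mono) (use lt in auto)
          also have "\<dots> = e" using c by (simp add: c_def)
          finally show False using w by simp
        qed
      qed
      hence "prob {w \<in> space M. hess_error n w \<ge> e} \<le> prob (\<Union>i\<in>?S. E i n)"
        using Em by (intro finite_measure_mono sets.finite_UN) auto
      also have "\<dots> \<le> (\<Sum>i\<in>?S. prob (E i n))"
        using Em by (intro finite_measure_subadditive_finite) auto
      finally show "prob {w \<in> space M. hess_error n w \<ge> e} \<le> (\<Sum>i\<in>?S. prob (E i n))" .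
    qed
  qed simp
qed

text \<open>Hoeffding's inequality is applied to each coordinate sum at level sqrt n R / c. The
  resulting bound is free of n, so R can be fixed beforehand.\<close>

lemma mean_score_tight:
  assumes e: "e > 0"
  obtains R where "R > 0" "\<And>n. n > 0 \<Longrightarrow> prob {w \<in> space M. sqrt (real n) * norm (mean_score n w) \<ge> R} \<le> e"
proof -
  let ?S = "Basis :: ((real, 'n) vec \<times> real) set"
  define c where "c = real (card ?S)"
  have c: "c > 0" unfolding c_def of_nat_0_less_iff by (subst card_gt_0_iff) auto
  obtain B where B: "B > 0" "\<And>x. norm x = 1 \<Longrightarrow> norm (score x) \<le> B" by (rule score_bounded) (rule that)
  \<comment> \<open>Larger than -ln (e / (2 c)), so that the c coordinate bounds 2 exp (-y) sum to
    less than e.\<close>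
  define y where "y = \<bar>ln (e / (2 * c))\<bar> + 1"
  define R where "R = sqrt (2 * c\<^sup>2 * B\<^sup>2 * y)"
  have y: "y > 0" unfolding y_def by linarith
  have R: "R > 0" "c * (2 * exp (- (R\<^sup>2 / (2 * c\<^sup>2 * B\<^sup>2)))) < e"
  proof -
    show "R > 0" using y c B(1) by (simp add: R_def)
    have "R\<^sup>2 / (2 * c\<^sup>2 * B\<^sup>2) = y" using y c B(1) by (simp add: R_def)
    moreover have "exp (- y) < exp (ln (e / (2 * c)))" unfolding exp_less_cancel_iff y_def by linarith
    hence "exp (- y) < e / (2 * c)" using e c by simp
    ultimately show "c * (2 * exp (- (R\<^sup>2 / (2 * c\<^sup>2 * B\<^sup>2)))) < e" using c by (simp add: field_simps)
  qed
  show ?thesis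
  proof (rule that[OF R(1)])
    fix n :: nat assume n: "n > 0"
    define E where "E = (\<lambda>b. {w \<in> space M. \<bar>(\<Sum>i<n. score (X i w) \<bullet> b) - real n * 0\<bar> \<ge> sqrt (real n) * R / c})"
    have Em: "E b \<in> sets M" for b unfolding E_def by measurable
    have Eb: "prob (E b) \<le> 2 * exp (- (R\<^sup>2 / (2 * c\<^sup>2 * B\<^sup>2)))" if b: "b \<in> ?S" for b
    proof -
      have "prob (E b) \<le> 2 * exp (- (sqrt (real n) * R / c)\<^sup>2 / (2 * real n * B\<^sup>2))"
        unfolding E_def
      proof (rule hoeffding_sum[OF _ _ B(1)])
        show "indep_vars (\<lambda>_. borel) (\<lambda>j w. score (X j w) \<bullet> b) UNIV" by (rule indep_compose) simp
        show "\<bar>score (X j w) \<bullet> b\<bar> \<le> B" if "w \<in> space M" for j w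
          using Basis_le_norm[OF b, of "score (X j w)"] B(2)[OF X_sphere[OF that, of j]] by linarith
        show "expectation (\<lambda>w. score (X j w) \<bullet> b) = 0" for j
          using X_mean[of "\<lambda>x. score x \<bullet> b" j] model_mean_score[of b] by simp
      qed (use n R c in auto)
      also have "- (sqrt (real n) * R / c)\<^sup>2 / (2 * real n * B\<^sup>2) = - (R\<^sup>2 / (2 * c\<^sup>2 * B\<^sup>2))"
        using n by (simp add: power_mult_distrib power_divide field_simps)
      finally show ?thesis .
    qed
    have "{w \<in> space M. sqrt (real n) * norm (mean_score n w) \<ge> R} \<subseteq> (\<Union>b\<in>?S. E b)"
    proof
      fix w assume w: "w \<in> {w \<in> space M. sqrt (real n) * norm (mean_score n w) \<ge> R}"
      show "w \<in> (\<Union>b\<in>?S. E b)"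
      proof (rule ccontr)
        assume "w \<notin> (\<Union>b\<in>?S. E b)"
        hence lt: "\<bar>\<Sum>i<n. score (X i w) \<bullet> b\<bar> < sqrt (real n) * R / c" if "b \<in> ?S" for b
          using w that by (force simp: E_def)
        have "norm (\<Sum>i<n. score (X i w)) \<le> (\<Sum>b\<in>?S. \<bar>(\<Sum>i<n. score (X i w)) \<bullet> b\<bar>)" by (rule norm_le_l1)
        also have "\<dots> < (\<Sum>b\<in>?S. sqrt (real n) * R / c)"
          by (rule sum_strict_mono) (use lt in \<open>auto simp: inner_sum_left\<close>)
        also have "\<dots> = sqrt (real n) * R" using c by (simp add: c_def)
        finally have "norm (\<Sum>i<n. score (X i w)) / sqrt (real n) < R"
          using n by (simp add: pos_divide_less_eq mult.commute)
        moreover have "sqrt (real n) * norm (mean_score n w) = norm (\<Sum>i<n. score (X i w)) / sqrt (real n)"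
          using n by (simp add: mean_score_def real_div_sqrt field_simps)
        ultimately have "sqrt (real n) * norm (mean_score n w) < R" by simp
        thus False using w by simp
      qed
    qed
    hence "prob {w \<in> space M. sqrt (real n) * norm (mean_score n w) \<ge> R} \<le> prob (\<Union>b\<in>?S. E b)"
      using Em by (intro finite_measure_mono sets.finite_UN) auto
    also have "\<dots> \<le> (\<Sum>b\<in>?S. prob (E b))"
      using Em by (intro finite_measure_subadditive_finite) auto
    also have "\<dots> \<le> (\<Sum>b\<in>?S. 2 * exp (- (R\<^sup>2 / (2 * c\<^sup>2 * B\<^sup>2))))" by (intro sum_mono Eb)
    also have "\<dots> = c * (2 * exp (- (R\<^sup>2 / (2 * c\<^sup>2 * B\<^sup>2))))" by (simp add: c_def)
    also have "\<dots> \<le> e" using R by simp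
    finally show "prob {w \<in> space M. sqrt (real n) * norm (mean_score n w) \<ge> R} \<le> e" .
  qed
qed

text \<open>Tightness suffices: for n >= (R / \<eta>)^2 the event lies in the tail event at level
  R.\<close>

lemma mean_score_tendsto:
  assumes \<eta>: "\<eta> > 0"
  shows "(\<lambda>n. prob {w \<in> space M. norm (mean_score n w) \<ge> \<eta>}) \<longlonglongrightarrow> 0"
proof (rule LIMSEQ_I)
  fix r :: real assume r: "r > 0"
  obtain R where R: "R > 0" "\<And>n. n > 0 \<Longrightarrow> prob {w \<in> space M. sqrt (real n) * norm (mean_score n w) \<ge> R} \<le> r / 2"
    using mean_score_tight[of "r / 2"] r by auto
  obtain N :: nat where N: "(R / \<eta>)\<^sup>2 \<le> real N" using real_arch_simple by blast
  show "\<exists>N. \<forall>n\<ge>N. norm (prob {w \<in> space M. norm (mean_score n w) \<ge> \<eta>} - 0) < r"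
  proof (intro exI[of _ "Suc N"] allI impI)
    fix n assume n: "n \<ge> Suc N"
    have "(R / \<eta>)\<^sup>2 \<le> real n" using N n by simp
    hence "R / \<eta> \<le> sqrt (real n)" by (rule real_le_rsqrt)
    hence Rn: "R \<le> sqrt (real n) * \<eta>" using \<eta> by (simp add: field_simps)
    have "{w \<in> space M. norm (mean_score n w) \<ge> \<eta>} \<subseteq> {w \<in> space M. sqrt (real n) * norm (mean_score n w) \<ge> R}"
    proof (intro Collect_mono impI conjI; elim conjE)
      fix w assume "\<eta> \<le> norm (mean_score n w)"
      hence "sqrt (real n) * \<eta> \<le> sqrt (real n) * norm (mean_score n w)" by (intro mult_left_mono) auto
      thus "R \<le> sqrt (real n) * norm (mean_score n w)" using Rn by linarith
    qed
    hence "prob {w \<in> space M. norm (mean_score n w) \<ge> \<eta>} \<le> prob {w \<in> space M. sqrt (real n) * norm (mean_score n w) \<ge> R}"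
      by (intro finite_measure_mono) auto
    also have "\<dots> \<le> r / 2" using R(2)[of n] n by simp
    finally show "norm (prob {w \<in> space M. norm (mean_score n w) \<ge> \<eta>} - 0) < r" using r by simp
  qed
qed

end

context zonal_sample
begin

text \<open>\<open>T n\<close> maximises over the cap for every outcome, but is claimed to be
  interior only on \<open>A n\<close>. The radius \<delta> does not depend on n and can be forced
  below any \<delta>o, so that the cap can later be placed inside the parameter set.\<close>

lemma mle_asymptotics:
  assumes \<delta>o: "\<delta>o > 0"
  obtains \<delta> T A where "0 < \<delta>" "\<delta> \<le> \<delta>o" "\<And>n. T n \<in> borel_measurable M"
    "\<And>n. A n \<in> sets M" "(\<lambda>n. prob (A n)) \<longlonglongrightarrow> 1"
    "\<And>n w. w \<in> space M \<Longrightarrow> norm (fst (T n w)) = 1 \<and>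
        (\<forall>q. norm (fst q) = 1 \<longrightarrow> dist q (mu, rho) \<le> \<delta> \<longrightarrow> loglik n w q \<le> loglik n w (T n w))"
    "\<And>n w. w \<in> A n \<Longrightarrow> dist (T n w) (mu, rho) < \<delta>"
    "\<And>e. e > 0 \<Longrightarrow> (\<lambda>n. prob {w \<in> space M. dist (T n w) (mu, rho) > e}) \<longlonglongrightarrow> 0"
    "\<And>t. (\<lambda>n. \<integral>w. iexp (t \<bullet> (sqrt (real n) *\<^sub>R (T n w - (mu, rho)))) \<partial>M) \<longlonglongrightarrow>
        complex_of_real (exp (- ((norm (tang (fst t)))\<^sup>2 / Jm + (snd t)\<^sup>2 / Jr) / 2))"
proof -
  obtain C where C: "C \<ge> 0"
    "\<And>n w q. n > 0 \<Longrightarrow> w \<in> space M \<Longrightarrow> norm (fst q) = 1 \<Longrightarrow> snd q \<in> {0..rs} \<Longrightarrow> norm (q - (mu, rho)) \<le> 1 \<Longrightarrow>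
       \<bar>loglik n w q / real n - loglik n w (mu, rho) / real n
          - (fst (mean_score n w) \<bullet> (fst q - mu) + snd (mean_score n w) * (snd q - rho)
            - (Jm * ((norm (fst q - mu))\<^sup>2 - (mu \<bullet> (fst q - mu))\<^sup>2) + Jr * (snd q - rho)\<^sup>2) / 2)\<bar>
       \<le> hess_error n w * (norm (q - (mu, rho)))\<^sup>2 / 2 + C * norm (q - (mu, rho)) ^ 3"
    by (rule loglik_expansion) (rule that)
  define S where "S = (\<lambda>\<delta>. {q :: (real, 'n) vec \<times> real. norm (fst q) = 1 \<and> dist q (mu, rho) \<le> \<delta>})"
  obtain \<delta>0 where \<delta>0: "\<delta>0 > 0" and argmax: "\<forall>\<delta>. 0 < \<delta> \<longrightarrow> \<delta> \<le> \<delta>0 \<longrightarrow> (\<exists>\<eta>>0. \<exists>K>0. \<forall>f T s1 s2 \<epsilon>.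
     0 \<le> \<epsilon> \<longrightarrow> \<epsilon> \<le> \<eta> \<longrightarrow> norm (s1, s2) \<le> \<eta> \<longrightarrow> s1 \<bullet> mu = 0 \<longrightarrow> T \<in> S \<delta> \<longrightarrow> (\<forall>q\<in>S \<delta>. f q \<le> (f T :: real)) \<longrightarrow>
     (\<forall>q\<in>S \<delta>. \<bar>f q - f (mu, rho) - (s1 \<bullet> (fst q - mu) + s2 * (snd q - rho)
         - (Jm * ((norm (fst q - mu))\<^sup>2 - (mu \<bullet> (fst q - mu))\<^sup>2) + Jr * (snd q - rho)\<^sup>2) / 2)\<bar>
         \<le> \<epsilon> * (norm (q - (mu, rho)))\<^sup>2 / 2 + C * norm (q - (mu, rho)) ^ 3) \<longrightarrow>
     dist T (mu, rho) < \<delta> \<and> norm (T - (mu, rho)) \<le> K * norm (s1, s2) \<and>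
     (norm (T - (mu, rho) - (s1 /\<^sub>R Jm, s2 / Jr)))\<^sup>2 \<le> K * (\<epsilon> + norm (s1, s2)) * (norm (s1, s2))\<^sup>2)"
    using argmax_expansion[OF mu info_pos C(1), of rho] unfolding S_def by blast
  \<comment> \<open>Besides the radius from \<open>argmax_expansion\<close>, the cap must stay in
    the range 0 <= r <= rs and in the unit ball around the true parameter, as the likelihood
    expansion requires.\<close>
  define \<delta> where "\<delta> = min (min \<delta>0 \<delta>o) (min 1 (min rho (rs - rho)))"
  have \<delta>: "0 < \<delta>" "\<delta> \<le> \<delta>0" "\<delta> \<le> \<delta>o" "\<delta> \<le> 1" "\<delta> \<le> rho" "\<delta> \<le> rs - rho"
    using \<delta>0 \<delta>o rho by (auto simp: \<delta>_def)
  obtain \<eta> K where \<eta>: "\<eta> > 0" and K: "K > 0" and am: "\<And>f T s1 s2 \<epsilon>.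
     0 \<le> \<epsilon> \<Longrightarrow> \<epsilon> \<le> \<eta> \<Longrightarrow> norm (s1, s2) \<le> \<eta> \<Longrightarrow> s1 \<bullet> mu = 0 \<Longrightarrow> T \<in> S \<delta> \<Longrightarrow> (\<forall>q\<in>S \<delta>. f q \<le> (f T :: real)) \<Longrightarrow>
     (\<forall>q\<in>S \<delta>. \<bar>f q - f (mu, rho) - (s1 \<bullet> (fst q - mu) + s2 * (snd q - rho)
         - (Jm * ((norm (fst q - mu))\<^sup>2 - (mu \<bullet> (fst q - mu))\<^sup>2) + Jr * (snd q - rho)\<^sup>2) / 2)\<bar>
         \<le> \<epsilon> * (norm (q - (mu, rho)))\<^sup>2 / 2 + C * norm (q - (mu, rho)) ^ 3) \<Longrightarrow>
     dist T (mu, rho) < \<delta> \<and> norm (T - (mu, rho)) \<le> K * norm (s1, s2) \<and>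
     (norm (T - (mu, rho) - (s1 /\<^sub>R Jm, s2 / Jr)))\<^sup>2 \<le> K * (\<epsilon> + norm (s1, s2)) * (norm (s1, s2))\<^sup>2"
    using argmax[rule_format, OF \<delta>(1,2)] by blast
  have Ssnd: "snd q \<in> {0..rs}" and Snorm: "norm (q - (mu, rho)) \<le> 1" if "q \<in> S \<delta>" for q
  proof -
    have d: "dist q (mu, rho) \<le> \<delta>" using that by (simp add: S_def)
    hence "\<bar>snd q - rho\<bar> \<le> \<delta>" using dist_snd_le[of q "(mu, rho)"] by (simp add: dist_real_def)
    thus "snd q \<in> {0..rs}" using \<delta>(5,6) by auto
    show "norm (q - (mu, rho)) \<le> 1" using d \<delta>(4) by (simp add: dist_norm)
  qed
  have th0: "(mu, rho) \<in> S \<delta>" using mu \<delta>(1) by (simp add: S_def)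
  have Scomp: "compact (S \<delta>)"
  proof -
    have "S \<delta> = cball (mu, rho) \<delta> \<inter> {q. norm (fst q) = 1}" by (auto simp: S_def dist_commute)
    moreover have "closed {q :: (real, 'n) vec \<times> real. norm (fst q) = 1}"
      by (intro closed_Collect_eq continuous_intros)
    ultimately show ?thesis by (simp add: compact_Int_closed)
  qed
  have ex: "\<exists>T. T \<in> borel_measurable M \<and> (\<forall>w\<in>space M. T w \<in> S \<delta> \<and> (\<forall>q\<in>S \<delta>. loglik n w q \<le> loglik n w (T w)))" for n
  proof -
    have "continuous_on (S \<delta>) (loglik n w)" if w: "w \<in> space M" for w
      unfolding loglik_def
    proof (intro continuous_on_sum continuous_on_ln continuous_intros)
      show "\<forall>q\<in>S \<delta>. 1 + snd q * poly p (X i w \<bullet> fst q) \<noteq> 0" for i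
      proof
        fix q assume q: "q \<in> S \<delta>"
        have "norm (fst q) = 1" using q by (simp add: S_def)
        hence "X i w \<bullet> fst q \<in> {-1..1}" using abs_inner_le_1[OF X_sphere[OF w, of i]] by (auto simp: abs_le_iff minus_le_iff)
        hence "1 - rs \<le> 1 + snd q * poly p (X i w \<bullet> fst q)"
          using density_poly_lower[OF p_le, of "X i w \<bullet> fst q" "snd q" rs] Ssnd[OF q] by auto
        thus "1 + snd q * poly p (X i w \<bullet> fst q) \<noteq> 0" using rho by linarith
      qed
    qed
    moreover have "(\<lambda>w. loglik n w q) \<in> borel_measurable M" for q unfolding loglik_def by measurable
    moreover have "S \<delta> \<noteq> {}" using th0 by blast
    ultimately show ?thesis using measurable_argmax[OF Scomp, of M "loglik n"] by metis
  qed
  obtain T where T: "\<And>n. T n \<in> borel_measurable M" "\<And>n w. w \<in> space M \<Longrightarrow> T n w \<in> S \<delta>"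
      "\<And>n w q. w \<in> space M \<Longrightarrow> q \<in> S \<delta> \<Longrightarrow> loglik n w q \<le> loglik n w (T n w)"
  proof -
    have "\<forall>n. \<exists>T. T \<in> borel_measurable M \<and> (\<forall>w\<in>space M. T w \<in> S \<delta> \<and> (\<forall>q\<in>S \<delta>. loglik n w q \<le> loglik n w (T w)))"
      using ex by blast
    from choice[OF this] show ?thesis using that by blast
  qed
  note [measurable] = T(1)
  \<comment> \<open>The expansion of the averages holds for n > 0, so the empty event stands in for
    n = 0.\<close>
  define A where "A = (\<lambda>n. if n = 0 then {} else {w \<in> space M. hess_error n w \<le> \<eta> \<and> norm (mean_score n w) \<le> \<eta>})"
  have Am: "A n \<in> sets M" for n unfolding A_def by simp
  define G where "G = (\<lambda>n w. (fst (mean_score n w) /\<^sub>R Jm, snd (mean_score n w) / Jr))"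
  have G_meas [measurable]: "G n \<in> borel_measurable M" for n
  proof -
    have "(\<lambda>s :: (real, 'n) vec \<times> real. (fst s /\<^sub>R Jm, snd s / Jr)) \<in> borel_measurable borel"
      using info_pos by (intro borel_measurable_continuous_onI continuous_intros) auto
    from measurable_compose[OF measurable_mean_score this] show ?thesis unfolding G_def .
  qed
  have key: "dist (T n w) (mu, rho) < \<delta> \<and> norm (T n w - (mu, rho)) \<le> K * norm (mean_score n w) \<and>
      (norm (T n w - (mu, rho) - G n w))\<^sup>2 \<le> K * (hess_error n w + norm (mean_score n w)) * (norm (mean_score n w))\<^sup>2"
    if w: "w \<in> A n" for n w
  proof -
    have n: "n > 0" and w': "w \<in> space M" "hess_error n w \<le> \<eta>" "norm (mean_score n w) \<le> \<eta>"
      using w by (auto simp: A_def split: if_splits)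
    let ?m = "mean_score n w"
    have he: "hess_error n w \<ge> 0" by (simp add: hess_error_def sum_nonneg)
    have nm: "norm (fst ?m, snd ?m) \<le> \<eta>" using w'(3) by simp
    have c: "\<forall>q\<in>S \<delta>. loglik n w q / real n \<le> loglik n w (T n w) / real n"
      using T(3)[OF w'(1)] by (simp add: divide_right_mono)
    have e: "\<forall>q\<in>S \<delta>. \<bar>loglik n w q / real n - loglik n w (mu, rho) / real n
          - (fst ?m \<bullet> (fst q - mu) + snd ?m * (snd q - rho)
            - (Jm * ((norm (fst q - mu))\<^sup>2 - (mu \<bullet> (fst q - mu))\<^sup>2) + Jr * (snd q - rho)\<^sup>2) / 2)\<bar>
       \<le> hess_error n w * (norm (q - (mu, rho)))\<^sup>2 / 2 + C * norm (q - (mu, rho)) ^ 3"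
    proof
      fix q assume q: "q \<in> S \<delta>"
      show "\<bar>loglik n w q / real n - loglik n w (mu, rho) / real n
          - (fst ?m \<bullet> (fst q - mu) + snd ?m * (snd q - rho)
            - (Jm * ((norm (fst q - mu))\<^sup>2 - (mu \<bullet> (fst q - mu))\<^sup>2) + Jr * (snd q - rho)\<^sup>2) / 2)\<bar>
       \<le> hess_error n w * (norm (q - (mu, rho)))\<^sup>2 / 2 + C * norm (q - (mu, rho)) ^ 3"
        by (rule C(2)[OF n w'(1) _ Ssnd[OF q] Snorm[OF q]]) (use q in \<open>simp add: S_def\<close>)
    qed
    show ?thesis
      using am[OF he w'(2) nm mean_score_tangential T(2)[OF w'(1)] c e] unfolding G_def prod.collapse .
  qed
  have Acompl: "(\<lambda>n. prob (space M - A n)) \<longlonglongrightarrow> 0"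
  proof -
    have "(\<lambda>n. prob {w \<in> space M. hess_error n w \<ge> \<eta>} + prob {w \<in> space M. norm (mean_score n w) \<ge> \<eta>}) \<longlonglongrightarrow> 0"
      using tendsto_add[OF hess_error_tendsto[OF \<eta>] mean_score_tendsto[OF \<eta>]] by simp
    thus ?thesis
    proof (rule tendsto_sandwich[OF _ _ tendsto_const, rotated 2])
      show "\<forall>\<^sub>F n in sequentially. prob (space M - A n) \<le>
          prob {w \<in> space M. hess_error n w \<ge> \<eta>} + prob {w \<in> space M. norm (mean_score n w) \<ge> \<eta>}"
        using eventually_gt_at_top[of 0]
      proof eventually_elim
        case (elim n)
        have "prob (space M - A n) \<le> prob ({w \<in> space M. hess_error n w \<ge> \<eta>} \<union> {w \<in> space M. norm (mean_score n w) \<ge> \<eta>})"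
          by (intro finite_measure_mono) (use elim in \<open>auto simp: A_def\<close>)
        also have "\<dots> \<le> prob {w \<in> space M. hess_error n w \<ge> \<eta>} + prob {w \<in> space M. norm (mean_score n w) \<ge> \<eta>}"
          by (intro measure_Un_le) auto
        finally show ?case .
      qed
    qed simp
  qed
  have Aprob: "(\<lambda>n. prob (A n)) \<longlonglongrightarrow> 1"
  proof -
    have "prob (A n) = 1 - prob (space M - A n)" for n
      using prob_compl[OF Am[of n]] by simp
    thus ?thesis using tendsto_diff[OF tendsto_const[of 1] Acompl] by simp
  qed
  have cons: "(\<lambda>n. prob {w \<in> space M. dist (T n w) (mu, rho) > e}) \<longlonglongrightarrow> 0" if e: "e > 0" for e
  proof -
    have eK: "e / K > 0" using e K by simp
    have "(\<lambda>n. prob (space M - A n) + prob {w \<in> space M. norm (mean_score n w) \<ge> e / K}) \<longlonglongrightarrow> 0"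
      using tendsto_add[OF Acompl mean_score_tendsto[OF eK]] by simp
    thus ?thesis
    proof (rule tendsto_sandwich[OF _ _ tendsto_const, rotated 2])
      show "\<forall>\<^sub>F n in sequentially. prob {w \<in> space M. dist (T n w) (mu, rho) > e} \<le>
          prob (space M - A n) + prob {w \<in> space M. norm (mean_score n w) \<ge> e / K}"
      proof (rule always_eventually, rule allI)
        fix n
        have "{w \<in> space M. dist (T n w) (mu, rho) > e} \<subseteq> (space M - A n) \<union> {w \<in> space M. norm (mean_score n w) \<ge> e / K}"
        proof
          fix w assume w: "w \<in> {w \<in> space M. dist (T n w) (mu, rho) > e}"
          show "w \<in> (space M - A n) \<union> {w \<in> space M. norm (mean_score n w) \<ge> e / K}"
          proof (cases "w \<in> A n")
            case True
            have "e < K * norm (mean_score n w)" using key[OF True] w by (simp add: dist_norm)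
            thus ?thesis using w K by (simp add: field_simps)
          qed (use w in auto)
        qed
        hence "prob {w \<in> space M. dist (T n w) (mu, rho) > e} \<le> prob ((space M - A n) \<union> {w \<in> space M. norm (mean_score n w) \<ge> e / K})"
          using Am by (intro finite_measure_mono) auto
        also have "\<dots> \<le> prob (space M - A n) + prob {w \<in> space M. norm (mean_score n w) \<ge> e / K}"
          using Am by (intro measure_Un_le) auto
        finally show "prob {w \<in> space M. dist (T n w) (mu, rho) > e} \<le>
          prob (space M - A n) + prob {w \<in> space M. norm (mean_score n w) \<ge> e / K}" .
      qed
    qed simp
  qed
  have close: "(\<lambda>n. prob {w \<in> space M. norm (sqrt (real n) *\<^sub>R G n w - sqrt (real n) *\<^sub>R (T n w - (mu, rho))) > e}) \<longlonglongrightarrow> 0"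
    if e: "e > 0" for e
  proof (rule LIMSEQ_I)
    fix r :: real assume r: "r > 0"
    obtain R where R: "R > 0" "\<And>n. n > 0 \<Longrightarrow> prob {w \<in> space M. sqrt (real n) * norm (mean_score n w) \<ge> R} \<le> r / 4"
      using mean_score_tight[of "r / 4"] r by auto
    \<comment> \<open>With Hessian error and score below \<kappa>, and sqrt n times the score below
      R, the squared distance is at most K (2 \<kappa>) R^2 = e^2.\<close>
    define \<kappa> where "\<kappa> = e\<^sup>2 / (2 * K * R\<^sup>2)"
    have \<kappa>: "\<kappa> > 0" using e K R by (simp add: \<kappa>_def)
    have "(\<lambda>n. prob (space M - A n) + (prob {w \<in> space M. hess_error n w \<ge> \<kappa>} + prob {w \<in> space M. norm (mean_score n w) \<ge> \<kappa>})) \<longlonglongrightarrow> 0"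
      using tendsto_add[OF Acompl tendsto_add[OF hess_error_tendsto[OF \<kappa>] mean_score_tendsto[OF \<kappa>]]] by simp
    hence "eventually (\<lambda>n. prob (space M - A n) + (prob {w \<in> space M. hess_error n w \<ge> \<kappa>} + prob {w \<in> space M. norm (mean_score n w) \<ge> \<kappa>}) < r / 2) sequentially"
      using r by (intro order_tendstoD(2)) auto
    hence "eventually (\<lambda>n. norm (prob {w \<in> space M. norm (sqrt (real n) *\<^sub>R G n w - sqrt (real n) *\<^sub>R (T n w - (mu, rho))) > e} - 0) < r) sequentially"
      using eventually_gt_at_top[of 0]
    proof eventually_elim
      case (elim n)
      let ?E = "{w \<in> space M. norm (sqrt (real n) *\<^sub>R G n w - sqrt (real n) *\<^sub>R (T n w - (mu, rho))) > e}"
      let ?E1 = "{w \<in> space M. sqrt (real n) * norm (mean_score n w) \<ge> R}"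
      let ?E2 = "{w \<in> space M. hess_error n w \<ge> \<kappa>}" and ?E3 = "{w \<in> space M. norm (mean_score n w) \<ge> \<kappa>}"
      have "?E \<subseteq> (space M - A n) \<union> (?E1 \<union> (?E2 \<union> ?E3))"
      proof
        fix w assume w: "w \<in> ?E"
        show "w \<in> (space M - A n) \<union> (?E1 \<union> (?E2 \<union> ?E3))"
        proof (rule ccontr)
          assume "w \<notin> (space M - A n) \<union> (?E1 \<union> (?E2 \<union> ?E3))"
          hence w': "w \<in> A n" "sqrt (real n) * norm (mean_score n w) < R" "hess_error n w < \<kappa>" "norm (mean_score n w) < \<kappa>"
            using w by auto
          let ?s = "norm (mean_score n w)"
          have he: "hess_error n w \<ge> 0" by (simp add: hess_error_def sum_nonneg)
          have "sqrt (real n) *\<^sub>R G n w - sqrt (real n) *\<^sub>R (T n w - (mu, rho)) = - (sqrt (real n) *\<^sub>R (T n w - (mu, rho) - G n w))"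
            by (simp add: scaleR_diff_right)
          hence "e < sqrt (real n) * norm (T n w - (mu, rho) - G n w)" using w by simp
          hence "e\<^sup>2 < (sqrt (real n) * norm (T n w - (mu, rho) - G n w))\<^sup>2" using e by (intro power_strict_mono) auto
          also have "\<dots> = real n * (norm (T n w - (mu, rho) - G n w))\<^sup>2" by (simp add: power_mult_distrib)
          also have "\<dots> \<le> real n * (K * (hess_error n w + ?s) * ?s\<^sup>2)" using key[OF w'(1)] by (intro mult_left_mono) auto
          also have "\<dots> = K * (hess_error n w + ?s) * (sqrt (real n) * ?s)\<^sup>2" by (simp add: power_mult_distrib)
          also have "\<dots> \<le> K * (2 * \<kappa>) * R\<^sup>2"
            using w' he K R \<kappa> by (intro mult_mono power_mono) auto
          also have "\<dots> = e\<^sup>2" using K R by (simp add: \<kappa>_def)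
          finally show False by simp
        qed
      qed
      hence "prob ?E \<le> prob ((space M - A n) \<union> (?E1 \<union> (?E2 \<union> ?E3)))"
        using Am by (intro finite_measure_mono) auto
      also have "\<dots> \<le> prob (space M - A n) + prob (?E1 \<union> (?E2 \<union> ?E3))"
        using Am by (intro measure_Un_le) auto
      also have "prob (?E1 \<union> (?E2 \<union> ?E3)) \<le> prob ?E1 + prob (?E2 \<union> ?E3)"
        by (intro measure_Un_le) auto
      also have "prob (?E2 \<union> ?E3) \<le> prob ?E2 + prob ?E3"
        by (intro measure_Un_le) auto
      finally have "prob ?E \<le> prob (space M - A n) + (prob ?E1 + (prob ?E2 + prob ?E3))" by simp
      thus ?case using elim(1) R(2)[OF elim(2)] r by simp
    qed
    thus "\<exists>N. \<forall>n\<ge>N. norm (prob {w \<in> space M. norm (sqrt (real n) *\<^sub>R G n w - sqrt (real n) *\<^sub>R (T n w - (mu, rho))) > e} - 0) < r"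
      by (simp add: eventually_sequentially)
  qed
  have clt: "(\<lambda>n. \<integral>w. iexp (t \<bullet> (sqrt (real n) *\<^sub>R G n w)) \<partial>M) \<longlonglongrightarrow>
      complex_of_real (exp (- ((norm (tang (fst t)))\<^sup>2 / Jm + (snd t)\<^sup>2 / Jr) / 2))" for t
  proof -
    define V where "V = (\<lambda>s :: (real, 'n) vec \<times> real. (fst s /\<^sub>R Jm, snd s / Jr))"
    have Vm [measurable]: "V \<in> borel_measurable borel"
      unfolding V_def using info_pos by (intro borel_measurable_continuous_onI continuous_intros) auto
    \<comment> \<open>\<open>V\<close> is linear, so sqrt n times G is a normalised sum of
      independent, identically distributed vectors.\<close>
    have VG: "sqrt (real n) *\<^sub>R G n w = (1 / sqrt (real n)) *\<^sub>R (\<Sum>i<n. V (score (X i w)))" for n w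
    proof -
      have "sqrt (real n) * (1 / real n) = 1 / sqrt (real n)"
        by (cases "n = 0") (simp_all add: field_simps)
      moreover have "(\<Sum>i<n. V (score (X i w))) = V (\<Sum>i<n. score (X i w))"
        by (rule prod_eqI) (simp_all add: V_def fst_sum snd_sum scaleR_sum_right sum_divide_distrib)
      moreover have "G n w = (1 / real n) *\<^sub>R V (\<Sum>i<n. score (X i w))"
        by (simp add: G_def V_def mean_score_def)
      ultimately show ?thesis by simp
    qed
    obtain B where B: "B > 0" "\<And>x. norm x = 1 \<Longrightarrow> norm (score x) \<le> B" by (rule score_bounded) (rule that)
    define t' where "t' = (fst t /\<^sub>R Jm, snd t / Jr)"
    have tV: "t \<bullet> V s = s \<bullet> t'" for s
      by (cases s, cases t) (simp add: V_def t'_def inner_commute)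
    have var: "Jm * (norm (tang (fst t')))\<^sup>2 + Jr * (snd t')\<^sup>2 = (norm (tang (fst t)))\<^sup>2 / Jm + (snd t)\<^sup>2 / Jr"
      using info_pos by (simp add: t'_def tang_linear power_mult_distrib power_divide power2_eq_square field_simps)
    show ?thesis
      unfolding VG
    proof (rule char_clt[where B="B / Jm + B / Jr" and D="distr D borel (\<lambda>x. V (score x))"])
      show "indep_vars (\<lambda>_. borel) (\<lambda>i w. V (score (X i w))) UNIV" by (rule indep_compose) measurable
      show "distr M borel (\<lambda>w. V (score (X i w))) = distr D borel (\<lambda>x. V (score x))" for i
        unfolding X_distr[of i, symmetric] by (subst distr_distr) (auto simp: comp_def)
      show "norm (V (score (X i w))) \<le> B / Jm + B / Jr" if "w \<in> space M" for i w
      proof -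
        let ?s = "score (X i w)"
        have "norm ?s \<le> B" by (rule B(2)[OF X_sphere[OF that]])
        hence "norm (fst ?s) \<le> B" "norm (snd ?s) \<le> B"
          using norm_fst_le[of "fst ?s" "snd ?s"] norm_snd_le[of "snd ?s" "fst ?s"] by auto
        hence "norm (fst ?s) / Jm \<le> B / Jm" "norm (snd ?s) / Jr \<le> B / Jr"
          using info_pos by (auto intro!: divide_right_mono)
        moreover have "norm (V ?s) \<le> norm (fst ?s /\<^sub>R Jm) + norm (snd ?s / Jr)"
          unfolding V_def by (rule norm_Pair_le)
        moreover have "norm (fst ?s /\<^sub>R Jm) = norm (fst ?s) / Jm" "norm (snd ?s / Jr) = norm (snd ?s) / Jr"
          using info_pos by (simp_all add: divide_inverse mult.commute abs_mult)
        ultimately show ?thesis by linarith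
      qed
      show "expectation (\<lambda>w. t \<bullet> V (score (X i w))) = 0" for i
        unfolding tV using X_mean[of "\<lambda>x. score x \<bullet> t'" i] model_mean_score[of t'] by simp
      show "expectation (\<lambda>w. (t \<bullet> V (score (X i w)))\<^sup>2) = (norm (tang (fst t)))\<^sup>2 / Jm + (snd t)\<^sup>2 / Jr" for i
        unfolding tV var[symmetric] using X_mean[of "\<lambda>x. (score x \<bullet> t')\<^sup>2" i] model_mean_score_sq[of t'] by simp
    qed
  qed
  show ?thesis
  proof (rule that[of \<delta> T A])
    show "norm (fst (T n w)) = 1 \<and> (\<forall>q. norm (fst q) = 1 \<longrightarrow> dist q (mu, rho) \<le> \<delta> \<longrightarrow> loglik n w q \<le> loglik n w (T n w))"
      if "w \<in> space M" for n w
      using T(2,3)[OF that] by (auto simp: S_def)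
    show "(\<lambda>n. \<integral>w. iexp (t \<bullet> (sqrt (real n) *\<^sub>R (T n w - (mu, rho)))) \<partial>M) \<longlonglongrightarrow>
        complex_of_real (exp (- ((norm (tang (fst t)))\<^sup>2 / Jm + (snd t)\<^sup>2 / Jr) / 2))" for t
      by (rule char_tendsto_perturb[OF _ _ close clt]) measurable
  qed (use \<delta> T(1) Am Aprob key cons in auto)
qed

end

section \<open>Maximum likelihood estimation\<close>

text \<open>Outside \<open>[-1, 1]\<close>, \<open>arccos\<close> is a \<open>THE\<close> over the empty predicate, hence constant.\<close>
lemma borel_measurable_arccos [measurable]: "arccos \<in> borel_measurable borel"
proof -
  have out: "arccos x = (THE y. False)" if "x \<notin> {-1..1}" for x
  proof -
    have "(0 \<le> y \<and> y \<le> pi \<and> cos y = x) = False" for y using that by auto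
    thus ?thesis unfolding arccos_def by (simp only:)
  qed
  have "continuous_on UNIV (\<lambda>x. arccos (max (-1) (min 1 x)))"
    by (rule continuous_on_compose2[OF continuous_on_arccos']) (auto intro!: continuous_intros)
  hence [measurable]: "(\<lambda>x. arccos (max (-1) (min 1 x))) \<in> borel_measurable borel"
    by (rule borel_measurable_continuous_onI)
  have "arccos = (\<lambda>x. if x \<in> {-1..1} then arccos (max (-1) (min 1 x)) else (THE y. False))"
    using out by (intro ext) auto
  also have "\<dots> \<in> borel_measurable borel" by measurable
  finally show ?thesis .
qed

lemma borel_measurable_gegen_tilde [measurable]: "gegen_tilde d k \<in> borel_measurable borel"
  unfolding gegen_tilde_def[abs_def] gegen_def[abs_def] by (cases "d = 1") (simp_all, measurable)

lemma borel_measurable_fC [measurable]: "fC d k (mu :: 'a::euclidean_space) rho \<in> borel_measurable borel"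
  unfolding fC_def[abs_def] by measurable

lemma AE_Ck_distr_sphere: "AE x in Ck_distr d k mu rho. norm x = 1"
  unfolding Ck_distr_def by (subst AE_density) (use AE_sphere_surface_norm in auto)

text \<open>Transfers the asymptotics from the polynomial model to \<open>fC\<close> and the given
  sample. Two gaps are bridged: the sample lies on the sphere only almost surely, and
  \<open>fC\<close> is expressed by the polynomial only for arguments in [-1, 1].\<close>

lemma mle_of_Ck:
  fixes M :: "'w measure"
    and X :: "nat \<Rightarrow> 'w \<Rightarrow> real ^ 'n::{finite,wellorder}"
    and k :: nat and rs rho :: real and mu :: "real ^ 'n::{finite,wellorder}"
  assumes d: "d = CARD('n) - 1"
    and pM: "prob_space M"
    and card: "CARD('n) \<ge> 2" and k: "k \<ge> 1" and rs: "0 < rs" "rs < 1"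
    and mem: "(mu, rho) \<in> theta_star k rs"
    and Xm: "\<And>i. X i \<in> borel_measurable M"
    and indep: "prob_space.indep_vars M (\<lambda>_. borel) X UNIV"
    and distr: "\<And>i. distr M borel (X i) = Ck_distr d k mu rho"
  obtains T A where "\<And>n. T n \<in> borel_measurable M" "\<And>n. A n \<in> sets M" "(\<lambda>n. measure M (A n)) \<longlonglongrightarrow> 1"
    "\<And>n w. w \<in> A n \<Longrightarrow> w \<in> space M \<and>
       is_local_max_on (theta_star k rs) (\<lambda>p. \<Sum>i<n. ln (fC d k (fst p) (snd p) (X i w))) (T n w)"
    "\<And>e. e > 0 \<Longrightarrow> (\<lambda>n. measure M {w \<in> space M. dist (T n w) (mu, rho) > e}) \<longlonglongrightarrow> 0"
    "conv_distr M
          (\<lambda>n w. (sqrt (real n) *\<^sub>R (fst (T n w) - mu), sqrt (real n) * (snd (T n w) - rho)))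
          (gaussian (\<lambda>(v, r). (sigma2_mu d k rho *\<^sub>R (v - (mu \<bullet> v) *\<^sub>R mu), sigma2_rho d k rho * r)))"
proof -
  interpret M: prob_space M by (rule pM)
  note [measurable] = Xm
  have d1: "d \<ge> 1" using d card by simp
  note th = theta_star_sphere[OF mem card]
  obtain p where p: "\<And>t. t \<in> {-1..1} \<Longrightarrow> gegen_tilde d k t = poly p t"
    "\<And>t. t \<in> {-1..1} \<Longrightarrow> \<bar>poly p t\<bar> \<le> 1" "poly p 1 = 1" "poly (pderiv p) 1 \<noteq> 0"
    "\<And>t. t \<in> {-1..1} \<Longrightarrow> (1 - t\<^sup>2) * poly (pderiv (pderiv p)) t =
         real d * t * poly (pderiv p) t - real k * (real k + real d - 1) * poly p t"
    "d = 1 \<Longrightarrow> (\<forall>\<theta>. poly p (cos \<theta>) = cos (real k * \<theta>) \<and> poly (pderiv p) (cos \<theta>) * sin \<theta> = real k * sin (real k * \<theta>))"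
    "d \<ge> 2 \<Longrightarrow> (\<forall>t. poly p t = gegen ((real d - 1) / 2) k t / gegen ((real d - 1) / 2) k 1 \<and>
       poly (pderiv p) t = (real d - 1) * gegen ((real d + 1) / 2) (k - 1) t / gegen ((real d - 1) / 2) k 1)"
    by (rule gegen_tilde_poly[OF d1 k]) (rule that)
  have I: "x \<bullet> v \<in> {-1..1}" if "norm x = 1" "norm v = 1" for x v :: "(real, 'n) vec"
    using abs_inner_le_1[OF that] by auto
  have fC: "fC d k v r x = (1 + r * poly p (x \<bullet> v)) / omega d" if "norm x = 1" "norm v = 1" for x v :: "(real, 'n) vec" and r
    using p(1)[OF I[OF that]] by (simp add: fC_def)
  have pos: "1 + r * poly p (x \<bullet> v) > 0" if "norm x = 1" "norm v = 1" "r \<in> {0..rs}" for x v :: "(real, 'n) vec" and r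
    using density_poly_lower[OF p(2)[OF I[OF that(1,2)]], of r rs] that(3) rs by auto
  have rho_I: "rho \<in> {0..rs}" using th by auto
  have f0: "0 \<le> fC d k mu rho x" "fC d k mu rho x \<le> 2 / omega d" if x: "norm x = 1" for x :: "(real, 'n) vec"
  proof -
    have "\<bar>rho\<bar> \<le> 1" using th rs by auto
    hence "\<bar>rho * poly p (x \<bullet> mu)\<bar> \<le> 1 * 1"
      unfolding abs_mult by (rule mult_mono[OF _ p(2)[OF I[OF x th(1)]]]) auto
    hence "rho * poly p (x \<bullet> mu) \<le> 1" by linarith
    thus "0 \<le> fC d k mu rho x" "fC d k mu rho x \<le> 2 / omega d"
      unfolding fC[OF x th(1)] using pos[OF x th(1) rho_I] omega_pos[of d] by (auto intro!: divide_right_mono)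
  qed
  have AEf0: "AE x in sphere_surface. 0 \<le> fC d k mu rho (x :: (real, 'n) vec)"
    using AE_sphere_surface_norm by eventually_elim (rule f0)
  have intf: "integrable sphere_surface (fC d k mu rho :: (real, 'n) vec \<Rightarrow> real)"
    by (rule integrable_sphere_surface[of _ "2 / omega d"]) (use f0 in auto)
  have polym [measurable]: "poly (q :: real poly) \<in> borel_measurable borel" for q
    by (intro borel_measurable_continuous_onI continuous_intros)
  \<comment> \<open>By \<open>distr\<close> the density has total mass one. The constant part
    already accounts for all of it, and rho > 0, so the integral of p must vanish.\<close>
  have mean_p: "(\<integral>x. poly p (x \<bullet> mu) \<partial>sphere_surface) = 0"
  proof -
    have "1 = emeasure (distr M borel (X 0)) UNIV"
      using M.emeasure_space_1 by (simp add: emeasure_distr)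
    also have "\<dots> = (\<integral>\<^sup>+x. ennreal (fC d k mu rho x) \<partial>sphere_surface)"
      unfolding distr Ck_distr_def by (subst emeasure_density) auto
    also have "\<dots> = ennreal (\<integral>x. fC d k mu rho x \<partial>sphere_surface)"
      by (rule nn_integral_eq_integral[OF intf AEf0])
    finally have "(\<integral>x. fC d k mu rho x \<partial>(sphere_surface :: (real, 'n) vec measure)) = 1" by simp
    also have "(\<integral>x. fC d k mu rho x \<partial>(sphere_surface :: (real, 'n) vec measure)) =
       (\<integral>x. (1 + rho * poly p (x \<bullet> mu)) / omega d \<partial>sphere_surface)"
    proof (rule integral_cong_AE)
      show "AE x in sphere_surface. fC d k mu rho x = (1 + rho * poly p (x \<bullet> mu)) / omega d"
        using AE_sphere_surface_norm by eventually_elim (rule fC[OF _ th(1)])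
    qed measurable
    also have "\<dots> = (omega d + rho * (\<integral>x. poly p (x \<bullet> mu) \<partial>sphere_surface)) / omega d"
    proof -
      have "integrable sphere_surface (\<lambda>x. poly p (x \<bullet> mu))"
        by (rule integrable_sphere_surface[of _ 1]) (use p(2) I th(1) in auto)
      moreover have "integrable (sphere_surface :: (real, 'n) vec measure) (\<lambda>x. 1 :: real)" by (rule integrable_sphere_surface) auto
      moreover have "(\<integral>x. 1 \<partial>(sphere_surface :: (real, 'n) vec measure)) = omega d"
        unfolding integral_sphere_surface_const d by simp
      ultimately show ?thesis by simp
    qed
    finally show ?thesis using omega_pos[of d] th(2) by (simp add: field_simps)
  qed
  \<comment> \<open>Moves the sample to \<open>mu\<close> on the null event that it leaves the
    sphere.\<close>
  define g where "g = (\<lambda>x :: (real, 'n) vec. if norm x = 1 then x else mu)"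
  have gm [measurable]: "g \<in> borel_measurable borel" unfolding g_def by measurable
  have AEX: "AE w in M. norm (X i w) = 1" for i
  proof (rule AE_distrD[OF Xm[of i]])
    show "AE x in distr M borel (X i). norm x = 1" unfolding distr by (rule AE_Ck_distr_sphere)
  qed
  interpret zonal_sample p rho rs mu d k M "\<lambda>i w. g (X i w)" "distr (Ck_distr d k mu rho) borel g"
  proof unfold_locales
    show "CARD('n) \<ge> 2" "d = CARD('n) - 1" by fact+
    show "norm mu = 1" "0 < rho" "rho < rs" "rs < 1" using th rs by auto
    show "norm (g (X i w)) = 1" for i w using th(1) by (simp add: g_def)
    show "M.indep_vars (\<lambda>_. borel) (\<lambda>i w. g (X i w)) UNIV"
      by (rule M.indep_vars_compose2[OF indep]) simp
    show "distr M borel (\<lambda>w. g (X i w)) = distr (Ck_distr d k mu rho) borel g" for i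
      unfolding distr[of i, symmetric] by (subst distr_distr) (auto simp: comp_def)
    show "M.expectation (\<lambda>w. f (g (X i w))) = zonal_model.model_mean p rho mu d f"
      if [measurable]: "f \<in> borel_measurable borel" for i and f :: "(real, 'n) vec \<Rightarrow> real"
    proof -
      have zm: "zonal_model p rho rs mu d k"
        by unfold_locales (use card d th rs p mean_p in auto)
      have "M.expectation (\<lambda>w. f (g (X i w))) = M.expectation (\<lambda>w. f (X i w))"
        by (rule integral_cong_AE) (measurable, use AEX[of i] in \<open>auto simp: g_def\<close>)
      also have "\<dots> = (\<integral>x. f x \<partial>Ck_distr d k mu rho)"
        unfolding distr[of i, symmetric] by (subst integral_distr) auto
      also have "\<dots> = (\<integral>x. fC d k mu rho x *\<^sub>R f x \<partial>sphere_surface)"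
        unfolding Ck_distr_def using AEf0 by (subst integral_density) auto
      also have "\<dots> = (\<integral>x. f x * (1 + rho * poly p (x \<bullet> mu)) / omega d \<partial>sphere_surface)"
      proof (rule integral_cong_AE)
        show "AE x in sphere_surface. fC d k mu rho x *\<^sub>R f x = f x * (1 + rho * poly p (x \<bullet> mu)) / omega d"
          using AE_sphere_surface_norm by eventually_elim (simp add: fC[OF _ th(1)])
      qed measurable
      also have "\<dots> = zonal_model.model_mean p rho mu d f"
        unfolding zonal_model.model_mean_def[OF zm] zonal_model.den_def[OF zm] by simp
      finally show ?thesis .
    qed
  qed (use p mean_p in auto)
  obtain \<delta>o where \<delta>o: "\<delta>o > 0" "\<And>q. norm (fst q) = 1 \<Longrightarrow> dist q (mu, rho) \<le> \<delta>o \<Longrightarrow> q \<in> theta_star k rs"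
    using theta_star_relatively_open[OF mem card] by blast
  obtain \<delta> T A where \<delta>: "0 < \<delta>" "\<delta> \<le> \<delta>o" and T: "\<And>n. T n \<in> borel_measurable M"
    and A: "\<And>n. A n \<in> sets M" "(\<lambda>n. M.prob (A n)) \<longlonglongrightarrow> 1"
    and max: "\<And>n w. w \<in> space M \<Longrightarrow> norm (fst (T n w)) = 1 \<and>
        (\<forall>q. norm (fst q) = 1 \<longrightarrow> dist q (mu, rho) \<le> \<delta> \<longrightarrow> loglik n w q \<le> loglik n w (T n w))"
    and near: "\<And>n w. w \<in> A n \<Longrightarrow> dist (T n w) (mu, rho) < \<delta>"
    and cons: "\<And>e. e > 0 \<Longrightarrow> (\<lambda>n. M.prob {w \<in> space M. dist (T n w) (mu, rho) > e}) \<longlonglongrightarrow> 0"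
    and char: "\<And>t. (\<lambda>n. \<integral>w. iexp (t \<bullet> (sqrt (real n) *\<^sub>R (T n w - (mu, rho)))) \<partial>M) \<longlonglongrightarrow>
        complex_of_real (exp (- ((norm (tang (fst t)))\<^sup>2 / Jm + (snd t)\<^sup>2 / Jr) / 2))"
    by (rule mle_asymptotics[OF \<delta>o(1)]) (rule that)
  note [measurable] = T
  \<comment> \<open>On this event the first n modified variables coincide with the given ones, so a
    maximiser for \<open>loglik\<close> maximises the actual likelihood. Only a null event is
    removed.\<close>
  define A' where "A' = (\<lambda>n. A n \<inter> {w \<in> space M. \<forall>i\<in>{..<n}. norm (X i w) = 1})"
  have A'm: "A' n \<in> sets M" for n
  proof -
    have "{w \<in> space M. \<forall>i\<in>{..<n}. norm (X i w) = 1} \<in> sets M" by measurable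
    thus ?thesis using A(1) by (auto simp: A'_def)
  qed
  have A'p: "M.prob (A' n) = M.prob (A n)" for n
  proof (rule M.finite_measure_eq_AE)
    have "AE w in M. \<forall>i\<in>{..<n}. norm (X i w) = 1" using AEX by (simp add: AE_ball_countable)
    thus "AE w in M. (w \<in> A' n) = (w \<in> A n)"
      by (rule AE_mp) (rule AE_I2, auto simp: A'_def)
  qed (use A(1) A'm in auto)
  have sig: "sigma2_rho d k rho = 1 / Jr" "sigma2_mu d k rho = 1 / Jm"
  proof -
    have r: "0 < rho" "rho < 1" using th rs by auto
    have "sigma2_rho d k rho = 1 / Jr \<and> sigma2_mu d k rho = 1 / Jm"
    proof (cases "d = 1")
      case True
      show ?thesis unfolding True using sigma2_eq_info_1[OF r k, of p] p(6)[OF True] by simp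
    next
      case False
      hence d2: "d \<ge> 2" using d1 by simp
      show ?thesis using sigma2_eq_info_ge_2[OF d2 r p(2), where k=k] p(7)[OF d2] by simp
    qed
    thus "sigma2_rho d k rho = 1 / Jr" "sigma2_mu d k rho = 1 / Jm" by auto
  qed
  show ?thesis
  proof (rule that[of T A'])
    show "T n \<in> borel_measurable M" for n by (rule T)
    show "A' n \<in> sets M" for n by (rule A'm)
    show "(\<lambda>n. M.prob (A' n)) \<longlonglongrightarrow> 1" unfolding A'p by (rule A(2))
    show "(\<lambda>n. M.prob {w \<in> space M. dist (T n w) (mu, rho) > e}) \<longlonglongrightarrow> 0" if "e > 0" for e
      by (rule cons[OF that])
    show "w \<in> space M \<and> is_local_max_on (theta_star k rs) (\<lambda>p. \<Sum>i<n. ln (fC d k (fst p) (snd p) (X i w))) (T n w)"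
      if w: "w \<in> A' n" for n w
    proof
      show ws: "w \<in> space M" using w by (simp add: A'_def)
      have X1: "norm (X i w) = 1" if "i < n" for i using w that by (simp add: A'_def)
      have ell: "(\<Sum>i<n. ln (fC d k (fst q) (snd q) (X i w))) = loglik n w q - real n * ln (omega d)"
        if q: "q \<in> theta_star k rs" for q
      proof -
        have q1: "norm (fst q) = 1" "snd q \<in> {0..rs}"
          using theta_star_sphere[of "fst q" "snd q" k rs] q card by auto
        have "(\<Sum>i<n. ln (fC d k (fst q) (snd q) (X i w))) =
           (\<Sum>i<n. ln (1 + snd q * poly p (g (X i w) \<bullet> fst q)) - ln (omega d))"
        proof (rule sum.cong[OF refl])
          fix i assume "i \<in> {..<n}"
          hence x: "norm (X i w) = 1" by (simp add: X1)
          hence gx: "g (X i w) = X i w" by (simp add: g_def)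
          show "ln (fC d k (fst q) (snd q) (X i w)) = ln (1 + snd q * poly p (g (X i w) \<bullet> fst q)) - ln (omega d)"
            unfolding fC[OF x q1(1)] gx using pos[OF x q1] omega_pos[of d] by (simp add: ln_div)
        qed
        thus ?thesis by (simp add: sum_subtractf loglik_def)
      qed
      have dT: "dist (T n w) (mu, rho) < \<delta>" using near w by (simp add: A'_def)
      have Tt: "T n w \<in> theta_star k rs"
        using max[OF ws, of n] dT \<delta> by (intro \<delta>o(2)) auto
      show "is_local_max_on (theta_star k rs) (\<lambda>p. \<Sum>i<n. ln (fC d k (fst p) (snd p) (X i w))) (T n w)"
        unfolding is_local_max_on_def
      \<comment> \<open>By the triangle inequality a ball of this radius around \<open>T n w\<close>
        stays inside the cap.\<close>
      proof (intro conjI Tt exI[of _ "\<delta> - dist (T n w) (mu, rho)"] ballI impI)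
        show "\<delta> - dist (T n w) (mu, rho) > 0" using dT by simp
        fix q assume q: "q \<in> theta_star k rs" "dist q (T n w) < \<delta> - dist (T n w) (mu, rho)"
        have "norm (fst q) = 1" using theta_star_sphere[of "fst q" "snd q" k rs] q card by auto
        moreover have "dist q (mu, rho) \<le> \<delta>"
          using q(2) dist_triangle[of q "(mu, rho)" "T n w"] by simp
        ultimately have "loglik n w q \<le> loglik n w (T n w)" using max[OF ws, of n] by blast
        thus "(\<Sum>i<n. ln (fC d k (fst q) (snd q) (X i w))) \<le> (\<Sum>i<n. ln (fC d k (fst (T n w)) (snd (T n w)) (X i w)))"
          unfolding ell[OF q(1)] ell[OF Tt] by simp
      qed
    qed
    define Cov where "Cov = (\<lambda>(v, r). (sigma2_mu d k rho *\<^sub>R (v - (mu \<bullet> v) *\<^sub>R mu), sigma2_rho d k rho * r))"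
    have Cov: "Cov (v, r) = ((1 / Jm) *\<^sub>R tang v, (1 / Jr) * r)" for v r
      by (simp add: Cov_def sig tang_def)
    \<comment> \<open>An orthogonal projection is self-adjoint and idempotent, so scaling the two
      blocks by the square roots of the variances gives a square root of the covariance.\<close>
    define L where "L = (\<lambda>q :: (real, 'n) vec \<times> real. (sqrt (1 / Jm) *\<^sub>R tang (fst q), sqrt (1 / Jr) * snd q))"
    have linL: "linear L"
      unfolding L_def linear_iff by (auto simp: tang_linear algebra_simps)
    have adjL: "adjoint L = L"
      by (rule adjoint_unique) (auto simp: L_def tang_inner(1))
    have "tang (tang v) = tang v" for v by (simp add: tang_def inner_diff_right mu_mu)
    moreover have "sqrt (1 / Jr) * (sqrt (1 / Jr) * b) = b / Jr" for b
      unfolding mult.assoc[symmetric] real_sqrt_mult_self using info_pos(2) by simp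
    ultimately have LL: "L \<circ> adjoint L = Cov"
      unfolding adjL using info_pos(1) by (simp add: L_def Cov fun_eq_iff tang_linear)
    have "conv_distr M (\<lambda>n w. sqrt (real n) *\<^sub>R (T n w - (mu, rho))) (gaussian Cov)"
    proof (rule conv_distr_charI[OF pM prob_space_gaussian[OF linL LL] sets_gaussian])
      show "(\<lambda>w. sqrt (real n) *\<^sub>R (T n w - (mu, rho))) \<in> borel_measurable M" for n by measurable
      show "(\<lambda>n. \<integral>w. iexp (t \<bullet> (sqrt (real n) *\<^sub>R (T n w - (mu, rho)))) \<partial>M) \<longlonglongrightarrow> (\<integral>x. iexp (t \<bullet> x) \<partial>gaussian Cov)" for t
      proof -
        have "v \<bullet> tang v = (norm (tang v))\<^sup>2" for v
          unfolding power2_norm_eq_inner tang_inner(4) ..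
        hence "t \<bullet> Cov t = (norm (tang (fst t)))\<^sup>2 / Jm + (snd t)\<^sup>2 / Jr"
        proof (cases t)
          case (Pair a b)
          have "t \<bullet> Cov t = (a \<bullet> tang a) / Jm + b * b / Jr" unfolding Pair Cov by simp
          thus ?thesis unfolding \<open>\<And>v. v \<bullet> tang v = (norm (tang v))\<^sup>2\<close> Pair by (simp add: power2_eq_square)
        qed
        thus ?thesis using char[of t] unfolding char_gaussian[OF linL LL] by simp
      qed
    qed
    moreover have "(\<lambda>n w. sqrt (real n) *\<^sub>R (T n w - (mu, rho))) =
       (\<lambda>n w. (sqrt (real n) *\<^sub>R (fst (T n w) - mu), sqrt (real n) * (snd (T n w) - rho)))"
      by (intro ext prod_eqI) auto
    ultimately show "conv_distr M
          (\<lambda>n w. (sqrt (real n) *\<^sub>R (fst (T n w) - mu), sqrt (real n) * (snd (T n w) - rho)))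
          (gaussian (\<lambda>(v, r). (sigma2_mu d k rho *\<^sub>R (v - (mu \<bullet> v) *\<^sub>R mu), sigma2_rho d k rho * r)))"
      unfolding Cov_def by simp
  qed
qed

text \<open>Measurability of the set of outcomes with a local maximum is not asserted; probability
  tending to one is expressed by measurable subsets of it. The same subsets serve for existence and
  for the estimator.\<close>

theorem theorem5:
  fixes M :: "'w measure"
    and X :: "nat \<Rightarrow> 'w \<Rightarrow> real ^ 'n::{finite,wellorder}"
    and k :: nat and rs rho :: real and mu :: "real ^ 'n::{finite,wellorder}"
  defines "d \<equiv> CARD('n) - 1"
  defines "ell \<equiv> (\<lambda>n w (p :: (real ^ 'n::{finite,wellorder}) \<times> real).
              \<Sum>i<n. ln (fC d k (fst p) (snd p) (X i w)))"
  assumes "prob_space M"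
    and "CARD('n) \<ge> 2" and "k \<ge> 1" and "0 < rs" and "rs < 1"
    and "(mu, rho) \<in> theta_star k rs"
    and "\<And>i. X i \<in> borel_measurable M"
    and "prob_space.indep_vars M (\<lambda>_. borel) X UNIV"
    and "\<And>i. distr M borel (X i) = Ck_distr d k mu rho"
  shows
    "(\<exists>A. (\<forall>n. A n \<in> sets M \<and>
             A n \<subseteq> {w \<in> space M. \<exists>p. is_local_max_on (theta_star k rs) (ell n w) p})
          \<and> (\<lambda>n. measure M (A n)) \<longlonglongrightarrow> 1)
   \<and> (\<exists>T :: nat \<Rightarrow> 'w \<Rightarrow> (real ^ 'n::{finite,wellorder}) \<times> real.
        (\<forall>n. T n \<in> borel_measurable M)
      \<and> (\<exists>A. (\<forall>n. A n \<in> sets M \<and>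
               A n \<subseteq> {w \<in> space M. is_local_max_on (theta_star k rs) (ell n w) (T n w)})
            \<and> (\<lambda>n. measure M (A n)) \<longlonglongrightarrow> 1)
      \<and> (\<forall>e>0. (\<lambda>n. measure M {w \<in> space M. dist (T n w) (mu, rho) > e}) \<longlonglongrightarrow> 0)
      \<and> conv_distr M
          (\<lambda>n w. (sqrt (real n) *\<^sub>R (fst (T n w) - mu), sqrt (real n) * (snd (T n w) - rho)))
          (gaussian (\<lambda>(v, r). (sigma2_mu d k rho *\<^sub>R (v - (mu \<bullet> v) *\<^sub>R mu),
                                sigma2_rho d k rho * r))))
   \<and> (d = 2 \<and> k = 1 \<longrightarrow>
        sigma2_rho d k rho = rho ^ 3 / (artanh rho - rho) \<and>
        sigma2_mu d k rho = 2 * rho / (rho - (1 - rho\<^sup>2) * artanh rho))"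
proof -
  note d = d_def[THEN meta_eq_to_obj_eq]
  from mle_of_Ck[OF d assms(3-11)] obtain T A where T: "\<And>n. T n \<in> borel_measurable M"
    and A: "\<And>n. A n \<in> sets M" "(\<lambda>n. measure M (A n)) \<longlonglongrightarrow> 1"
    and max: "\<And>n w. w \<in> A n \<Longrightarrow> w \<in> space M \<and>
       is_local_max_on (theta_star k rs) (\<lambda>p. \<Sum>i<n. ln (fC d k (fst p) (snd p) (X i w))) (T n w)"
    and cons: "\<And>e. e > 0 \<Longrightarrow> (\<lambda>n. measure M {w \<in> space M. dist (T n w) (mu, rho) > e}) \<longlonglongrightarrow> 0"
    and clt: "conv_distr M
          (\<lambda>n w. (sqrt (real n) *\<^sub>R (fst (T n w) - mu), sqrt (real n) * (snd (T n w) - rho)))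
          (gaussian (\<lambda>(v, r). (sigma2_mu d k rho *\<^sub>R (v - (mu \<bullet> v) *\<^sub>R mu), sigma2_rho d k rho * r)))"
    by blast
  have max: "is_local_max_on (theta_star k rs) (ell n w) (T n w)" "w \<in> space M" if "w \<in> A n" for n w
    using max[OF that] unfolding ell_def by auto
  have rho: "0 < rho" "rho < 1"
    using theta_star_sphere[OF \<open>(mu, rho) \<in> theta_star k rs\<close> \<open>CARD('n) \<ge> 2\<close>] \<open>rs < 1\<close> by auto
  have "\<exists>A. (\<forall>n. A n \<in> sets M \<and> A n \<subseteq> {w \<in> space M. \<exists>p. is_local_max_on (theta_star k rs) (ell n w) p})
      \<and> (\<lambda>n. measure M (A n)) \<longlonglongrightarrow> 1"
    using A max by blast
  moreover have "\<exists>A. (\<forall>n. A n \<in> sets M \<and> A n \<subseteq> {w \<in> space M. is_local_max_on (theta_star k rs) (ell n w) (T n w)})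
      \<and> (\<lambda>n. measure M (A n)) \<longlonglongrightarrow> 1"
    using A max by blast
  moreover have "d = 2 \<and> k = 1 \<longrightarrow>
        sigma2_rho d k rho = rho ^ 3 / (artanh rho - rho) \<and>
        sigma2_mu d k rho = 2 * rho / (rho - (1 - rho\<^sup>2) * artanh rho)"
    using sigma2_2_1[OF rho] by simp
  ultimately show ?thesis using T cons clt by blast
qed

end
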